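(* Let $D=[0,1]^d$ and let $u_1,\dots,u_N$ be independent copies of a real-valued, centered, square-integrable Gaussian process $u\sim\mathrm{GP}(0,\mathcal{C})$ on $D$ with covariance function $k$ and trace-class covariance operator $\mathcal{C}$. Suppose: (1) $\sup_{x\in D}k(x,x)\lesssim\mathrm{Tr}(\mathcal{C})$, and there is a positive decreasing sequence $\{\nu_m\}_{m\ge1}$ with $\nu_1=1$ such that $\sup_{x\in D}\int_{\{y\in D:\|x-y\|>m\,r(\mathcal{C})^{-1/d}\}}|k(x,y)|\,dy\lesssim\|\mathcal{C}\|\nu_m$ for all $m\in\mathbb{N}$. (2) $k=k_\lambda$ depends on a correlation lengthscale parameter $\lambda>0$ so that $k_\lambda(x,y)=\mathsf{K}(\|x-y\|/\lambda)$ for an isotropic base kernel $\mathsf{k}:\mathbb{R}^d\times\mathbb{R}^d\to\mathbb{R}$, $\mathsf{k}(x,y)=\mathsf{K}(\|x-y\|)$; moreover $\mathsf{k}$ is positive, i.e. $\mathsf{k}(x,y)=\mathsf{K}(\|x-y\|)>0$, and $\mathsf{K}(r)$ is differentiable, strictly decreasing on $[0,\infty)$, with $\lim_{r\to\infty}\mathsf{K}(r)=0$. Then there exists a universal constant $\lambda_0>0$ such that, for any $\lambda<\lambda_0$, the covariance operator satisfies $r(\mathcal{C})\asymp\lambda^{-d}$. Consequently, the sample covariance estimator $\widehat{\mathcal{C}}$ and the tapering estimator $\widehat{\mathcal{C}}_\kappa$ with $\kappa=m_*\lambda$ satisfy $$\frac{\mathbb{E}\|\widehat{\mathcal{C}}-\mathcal{C}\|}{\|\mathcal{C}\|}\asymp\sqrt{\frac{\lambda^{-d}}{N}}\vee\frac{\lambda^{-d}}{N},$$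 $$\frac{\mathbb{E}\|\widehat{\mathcal{C}}_\kappa-\mathcal{C}\|}{\|\mathcal{C}\|}\lesssim\varepsilon_*+\left(\sqrt{\frac{\log(\lambda^{-d})}{N}}\vee\frac{\log(\lambda^{-d})}{N}\right).$$ In particular, if $\nu_m=m^{-\alpha}$ then $\varepsilon_*\asymp N^{-\frac{\alpha}{2\alpha+d}}$, and if $\nu_m\asymp e^{-m^t}$ then $\varepsilon_*\asymp\sqrt{(\log N)^{d/t}/N}$.
   Context: $\|\cdot\|$ is the operator norm for operators on $L^2(D)$ and the Euclidean norm for vectors; $a\vee b=\max\{a,b\}$, $a\wedge b=\min\{a,b\}$, $(t)_+=\max\{t,0\}$, $\mathbb{N}=\{1,2,\dots\}$. $k(x,y)=\mathbb{E}[u(x)u(y)]$, $(\mathcal{C}\psi)(\cdot)=\int_Dk(\cdot,y)\psi(y)\,dy$, and $r(\mathcal{C})=\mathrm{Tr}(\mathcal{C})/\|\mathcal{C}\|$ is the effective dimension. Point-wise evaluations of $u$ are assumed almost surely well defined Lebesgue almost everywhere. Estimators: $\hat k(x,y)=\frac1N\sum_{n=1}^Nu_n(x)u_n(y)$, $(\widehat{\mathcal{C}}\psi)(\cdot)=\int_D\hat k(\cdot,y)\psi(y)\,dy$; for $\kappa>0$, $f_\kappa(x,y)=\prod_{i=1}^d\min\{(2\kappa-|x_i-y_i|)_+/\kappa,\,1\}$ and $(\widehat{\mathcal{C}}_\kappa\psi)(\cdot)=\int_D\hat k(\cdot,y)f_\kappa(\cdot,y)\psi(y)\,dy$. The quantities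 $m_*$ and $\varepsilon_*$, depending on $\{\nu_m\},N,d$, are $$m_*=\min\Big\{m\in\mathbb{N}:\nu_m\le\sqrt{m^d/N}\Big\},\qquad\varepsilon_*=\max_{m\in\mathbb{N}}\Big\{\nu_m\wedge\sqrt{m^d/N}\Big\}.$$ Standing assumption: $m_*\ge2$ (equivalently $N\ge2$). In the last sentence $\alpha>0$ and $t>0$ are fixed. $a\lesssim b$ means $a\le c\,b$ for some constant $c>0$, and $a\asymp b$ means $a\lesssim b$ and $b\lesssim a$. The constants (including $\lambda_0$) do not depend on $\lambda$ or $N$; the dimension $d$, the base kernel profile $\mathsf{K}$, the constants in hypothesis (1), the sequence $\{\nu_m\}$, and (for the last sentence) $\alpha,t$ are regarded as fixed.
   Formalization: Assumes in addition that ν_m → 0 (else r(C) ≍ λ^{-d} can fail), and takes κ = s·m_*·λ with s fixed: any s for which the tail bound in (1) also holds in units of sλ (s = 1 is κ = m_*λ), or any s ≥ s_0; κ = m_*λ alone can fail for rapidly decaying ν. *)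

theory Defs
  imports "HOL-Probability.Probability"
begin

section \<open>The Hilbert space \<open>L\<^sup>2(D)\<close> for \<open>D = [0,1]\<^sup>d\<close>, with \<open>d = CARD('n)\<close>\<close>

definition unit_cube :: "(real ^ 'n::finite) set" where
  "unit_cube = {x. \<forall>i. 0 \<le> x $ i \<and> x $ i \<le> 1}"

definition L2 :: "(real ^ 'n::finite \<Rightarrow> real) set" where
  "L2 = {f. f \<in> borel_measurable (lebesgue_on unit_cube) \<and>
            integrable (lebesgue_on unit_cube) (\<lambda>x. (f x)\<^sup>2)}"

definition inner_L2 :: "(real ^ 'n::finite \<Rightarrow> real) \<Rightarrow> (real ^ 'n \<Rightarrow> real) \<Rightarrow> real" where
  "inner_L2 f g = (LINT x|lebesgue_on unit_cube. f x * g x)"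

definition norm_L2 :: "(real ^ 'n::finite \<Rightarrow> real) \<Rightarrow> real" where
  "norm_L2 f = sqrt (inner_L2 f f)"

definition op_norm :: "((real ^ 'n::finite \<Rightarrow> real) \<Rightarrow> (real ^ 'n \<Rightarrow> real)) \<Rightarrow> real" where
  "op_norm T = (SUP f\<in>{f \<in> L2. norm_L2 f \<le> 1}. norm_L2 (T f))"

text \<open>Elements of \<open>L\<^sup>2(D)\<close> are represented by functions, so totality says that a function
  orthogonal to the basis has norm zero (not that it is the zero function).\<close>

definition orthonormal_basis_L2 :: "(real ^ 'n::finite \<Rightarrow> real) set \<Rightarrow> bool" where
  "orthonormal_basis_L2 E \<longleftrightarrow>
     E \<subseteq> L2 \<and>
     (\<forall>e\<in>E. inner_L2 e e = 1) \<and>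
     (\<forall>e\<in>E. \<forall>e'\<in>E. e \<noteq> e' \<longrightarrow> inner_L2 e e' = 0) \<and>
     (\<forall>f\<in>L2. (\<forall>e\<in>E. inner_L2 f e = 0) \<longrightarrow> norm_L2 f = 0)"

text \<open>The trace is the sum of the diagonal entries in any orthonormal basis. For bounded
  self-adjoint operators, such as covariance operators, being trace class means
  exactly that these sums exist; \<open>has_sum\<close> is unordered, hence absolute, convergence.\<close>

definition has_trace :: "((real ^ 'n::finite \<Rightarrow> real) \<Rightarrow> (real ^ 'n \<Rightarrow> real)) \<Rightarrow> real \<Rightarrow> bool" where
  "has_trace T t \<longleftrightarrow>
     (\<forall>E. orthonormal_basis_L2 E \<longrightarrow> ((\<lambda>e. inner_L2 (T e) e) has_sum t) E)"

definition trace_class :: "((real ^ 'n::finite \<Rightarrow> real) \<Rightarrow> (real ^ 'n \<Rightarrow> real)) \<Rightarrow> bool" where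
  "trace_class T \<longleftrightarrow> (\<exists>t. has_trace T t)"

definition op_trace :: "((real ^ 'n::finite \<Rightarrow> real) \<Rightarrow> (real ^ 'n \<Rightarrow> real)) \<Rightarrow> real" where
  "op_trace T = (THE t. has_trace T t)"

definition eff_dim :: "((real ^ 'n::finite \<Rightarrow> real) \<Rightarrow> (real ^ 'n \<Rightarrow> real)) \<Rightarrow> real" where
  "eff_dim T = op_trace T / op_norm T"


section \<open>Kernels and integral operators\<close>

definition integral_op ::
  "(real ^ 'n::finite \<Rightarrow> real ^ 'n \<Rightarrow> real) \<Rightarrow> (real ^ 'n \<Rightarrow> real) \<Rightarrow> (real ^ 'n \<Rightarrow> real)" where
  "integral_op k f = (\<lambda>x. LINT y|lebesgue_on unit_cube. k x y * f y)"

definition positive_semidefinite_kernel :: "('a \<Rightarrow> 'a \<Rightarrow> real) \<Rightarrow> bool" where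
  "positive_semidefinite_kernel k \<longleftrightarrow>
     (\<forall>x y. k x y = k y x) \<and>
     (\<forall>S c. finite S \<longrightarrow> 0 \<le> (\<Sum>x\<in>S. \<Sum>y\<in>S. c x * c y * k x y))"

text \<open>Off-diagonal decay of a kernel in multiples of the length \<open>h\<close>; \<open>B\<close> is the implied constant.\<close>

definition tail_bound ::
  "(real ^ 'n::finite \<Rightarrow> real ^ 'n \<Rightarrow> real) \<Rightarrow> real \<Rightarrow> (nat \<Rightarrow> real) \<Rightarrow> real \<Rightarrow> bool" where
  "tail_bound k h \<nu> B \<longleftrightarrow>
     (\<forall>m\<ge>1. \<forall>x\<in>unit_cube.
        (LINT y:{y \<in> unit_cube. norm (x - y) > real m * h}|lebesgue. \<bar>k x y\<bar>)
          \<le> B * (op_norm (integral_op k) * \<nu> m))"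


section \<open>Samples of a centered Gaussian process\<close>

text \<open>Point masses at zero count as (degenerate) centered Gaussians.\<close>

definition centered_gaussian :: "'w measure \<Rightarrow> ('w \<Rightarrow> real) \<Rightarrow> bool" where
  "centered_gaussian M X \<longleftrightarrow>
     X \<in> borel_measurable M \<and>
     ((\<exists>\<sigma>>0. distributed M lborel X (normal_density 0 \<sigma>)) \<or> (AE \<omega> in M. X \<omega> = 0))"

text \<open>Joint measurability and square-integrable paths make the integral operators built from
  the sample paths meaningful almost surely.\<close>

definition centered_gaussian_process ::
  "'w measure \<Rightarrow> (real ^ 'n::finite \<Rightarrow> 'w \<Rightarrow> real) \<Rightarrow> (real ^ 'n \<Rightarrow> real ^ 'n \<Rightarrow> real) \<Rightarrow> bool" where
  "centered_gaussian_process M u k \<longleftrightarrow>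
     (\<lambda>(x, \<omega>). u x \<omega>) \<in> borel_measurable (lebesgue_on unit_cube \<Otimes>\<^sub>M M) \<and>
     (\<forall>S c. finite S \<longrightarrow> S \<subseteq> unit_cube \<longrightarrow> centered_gaussian M (\<lambda>\<omega>. \<Sum>x\<in>S. c x * u x \<omega>)) \<and>
     (\<forall>x\<in>unit_cube. \<forall>y\<in>unit_cube. (LINT \<omega>|M. u x \<omega> * u y \<omega>) = k x y) \<and>
     (AE \<omega> in M. (\<lambda>x. u x \<omega>) \<in> L2)"

text \<open>The law of a centered Gaussian process is determined by its covariance function, so
  independent processes with the same covariance function are independent copies.
  Independence is that of the processes as random elements of the product space
  \<open>\<real>\<^sup>D\<close>.\<close>

definition gaussian_sample ::
  "'w measure \<Rightarrow> nat \<Rightarrow> (nat \<Rightarrow> real ^ 'n::finite \<Rightarrow> 'w \<Rightarrow> real) \<Rightarrow>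
   (real ^ 'n \<Rightarrow> real ^ 'n \<Rightarrow> real) \<Rightarrow> bool" where
  "gaussian_sample M N u k \<longleftrightarrow>
     prob_space M \<and>
     (\<forall>n\<in>{1..N}. centered_gaussian_process M (u n) k) \<and>
     prob_space.indep_vars M (\<lambda>_. \<Pi>\<^sub>M x\<in>unit_cube. borel)
       (\<lambda>n \<omega>. \<lambda>x\<in>unit_cube. u n x \<omega>) {1..N}"


section \<open>Estimators\<close>

definition sample_kernel ::
  "nat \<Rightarrow> (nat \<Rightarrow> real ^ 'n::finite \<Rightarrow> 'w \<Rightarrow> real) \<Rightarrow> 'w \<Rightarrow> real ^ 'n \<Rightarrow> real ^ 'n \<Rightarrow> real" where
  "sample_kernel N u \<omega> x y = (\<Sum>n = 1..N. u n x \<omega> * u n y \<omega>) / real N"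

definition taper :: "real \<Rightarrow> real ^ 'n::finite \<Rightarrow> real ^ 'n \<Rightarrow> real" where
  "taper \<kappa> x y = (\<Prod>i\<in>UNIV. min (max (2 * \<kappa> - \<bar>x $ i - y $ i\<bar>) 0 / \<kappa>) 1)"

definition sample_cov ::
  "nat \<Rightarrow> (nat \<Rightarrow> real ^ 'n::finite \<Rightarrow> 'w \<Rightarrow> real) \<Rightarrow> 'w \<Rightarrow>
   (real ^ 'n \<Rightarrow> real) \<Rightarrow> (real ^ 'n \<Rightarrow> real)" where
  "sample_cov N u \<omega> = integral_op (sample_kernel N u \<omega>)"

definition tapered_cov ::
  "real \<Rightarrow> nat \<Rightarrow> (nat \<Rightarrow> real ^ 'n::finite \<Rightarrow> 'w \<Rightarrow> real) \<Rightarrow> 'w \<Rightarrow>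
   (real ^ 'n \<Rightarrow> real) \<Rightarrow> (real ^ 'n \<Rightarrow> real)" where
  "tapered_cov \<kappa> N u \<omega> = integral_op (\<lambda>x y. sample_kernel N u \<omega> x y * taper \<kappa> x y)"

text \<open>The expectation is a nonnegative integral with values in the extended reals, so an upper
  bound on it includes finiteness, and null sets of paths outside \<open>L\<^sup>2(D)\<close> do not matter.\<close>

definition relative_error ::
  "'w measure \<Rightarrow> ('w \<Rightarrow> (real ^ 'n::finite \<Rightarrow> real) \<Rightarrow> (real ^ 'n \<Rightarrow> real)) \<Rightarrow>
   ((real ^ 'n \<Rightarrow> real) \<Rightarrow> (real ^ 'n \<Rightarrow> real)) \<Rightarrow> ennreal" where
  "relative_error M T C =
     (\<integral>\<^sup>+ \<omega>. ennreal (op_norm (\<lambda>f x. T \<omega> f x - C f x)) \<partial>M) / ennreal (op_norm C)"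


section \<open>The threshold \<open>m\<^sub>*\<close> and the rate \<open>\<epsilon>\<^sub>*\<close>\<close>

definition m_star :: "(nat \<Rightarrow> real) \<Rightarrow> nat \<Rightarrow> nat \<Rightarrow> nat" where
  "m_star \<nu> d N = (LEAST m. 1 \<le> m \<and> \<nu> m \<le> sqrt (real m ^ d / real N))"

text \<open>For \<open>N \<ge> 1\<close> and \<open>\<nu>\<close> decreasing the supremum is attained, so it is a maximum.\<close>

definition eps_star :: "(nat \<Rightarrow> real) \<Rightarrow> nat \<Rightarrow> nat \<Rightarrow> real" where
  "eps_star \<nu> d N = (SUP m\<in>{1..}. min (\<nu> m) (sqrt (real m ^ d / real N)))"

end

theory Submission
  imports Defs
begin

text \<open>Testing \<open>\<C>\<close> on the indicator of the corner cube \<open>[0,\<lambda>]\<^sup>d\<close> gives \<open>\<parallel>\<C>\<parallel> \<ge> c \<lambda>\<^sup>d\<close>. In the other direction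
  \<open>\<parallel>\<C>\<parallel>\<close> is at most the largest row integral of \<open>k\<close>; the hypothesis on the tails leaves a ball of radius
  \<open>m r(\<C>)\<^sup>-\<^sup>1\<^sup>/\<^sup>d\<close>, which has volume at most a multiple of \<open>\<parallel>\<C>\<parallel>\<close> and on which \<open>k\<close> is small except within distance of order
  \<open>\<lambda>\<close>. As the trace stays between \<open>K(0)/A\<close> and \<open>K(0)\<close>, this settles \<open>r(\<C>)\<close>.

  For the upper bounds the kernel and the paths are replaced by their values on a fine grid, which turns operator norms
  into suprema of finite quadratic forms in Gaussian vectors. These are controlled
  by a PAC-Bayes argument, with no chaining and no dependence on the mesh. Tapering decomposes a form
  into forms localized to boxes of side \<open>2\<kappa>\<close>; the effective dimension of a box is of order
  \<open>(\<kappa>/\<lambda>)\<^sup>d = m\<^sub>*\<^sup>d\<close>, and the number of boxes enters only through its logarithm.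

  For the lower bounds, \<open>(\<C>\<^sub>N - \<C>) v\<close> for the normalized indicator \<open>v\<close> of the corner cube, where \<open>\<C>\<^sub>N\<close> is the sample
  covariance, gives the square root rate by second and fourth moments, and \<open>\<parallel>\<C>\<^sub>N\<parallel> \<ge> \<parallel>u\<^sub>1\<parallel>\<^sup>2 / N\<close> gives the linear rate.\<close>

text \<open>The tail hypothesis measures distances in units of \<open>r(C)^(-1/d)\<close>, the very
  quantity to be determined. The upper bound on the norm is therefore self-bounding: the far part of
  a row contributes at most one half and the middle part at most one quarter of the norm itself, and
  both are absorbed on the left. The same mismatch of units returns for the tapering estimator:
  \<open>r(C)^(-1/d)\<close> is comparable to \<lambda> only up to a constant, and no doubling
  property of \<nu> is assumed, which is why the tapering radius carries a scale \<open>s\<close>.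
  The operator norm of the error is a supremum over uncountably many functions, and its
  measurability in the sample is never established. Each upper bound passes through a measurable
  majorant whose integral is computed, each lower bound through an integrable minorant. The mesh may
  depend on \<open>N\<close> and on the kernel, since it only has to push an approximation error
  below the target; grid points are never counted.\<close>

section \<open>Cauchy-Schwarz and Gram factorization\<close>

text \<open>The integral of \<open>(s f - t g)^2\<close> is a nonnegative quadratic form in
  \<open>(s, t)\<close>. Kept homogeneous, it gives the inequality by evaluation at
  \<open>(c, b)\<close>, without division; if \<open>c\<close> vanishes, a suitable multiple of
  \<open>g\<close> would make it equal to -1 unless \<open>b = 0\<close>.\<close>

lemma Cauchy_Schwarz_integral:
  fixes f g :: "'a \<Rightarrow> real"
  assumes [measurable]: "f \<in> borel_measurable M" "g \<in> borel_measurable M"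
    and f: "integrable M (\<lambda>x. (f x)\<^sup>2)" and g: "integrable M (\<lambda>x. (g x)\<^sup>2)"
  shows integrable_mult_L2: "integrable M (\<lambda>x. f x * g x)"
    and "(LINT x|M. f x * g x)\<^sup>2 \<le> (LINT x|M. (f x)\<^sup>2) * (LINT x|M. (g x)\<^sup>2)"
proof -
  show fg: "integrable M (\<lambda>x. f x * g x)"
  proof (rule Bochner_Integration.integrable_bound[where f = "\<lambda>x. (f x)\<^sup>2 + (g x)\<^sup>2"])
    show "AE x in M. norm (f x * g x) \<le> norm ((f x)\<^sup>2 + (g x)\<^sup>2)"
    proof (rule AE_I2)
      fix x
      have "2 * \<bar>f x\<bar> * \<bar>g x\<bar> \<le> (f x)\<^sup>2 + (g x)\<^sup>2"
        using sum_squares_bound[of "\<bar>f x\<bar>" "\<bar>g x\<bar>"] by simp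
      moreover have "0 \<le> \<bar>f x\<bar> * \<bar>g x\<bar>" by simp
      ultimately have "\<bar>f x * g x\<bar> \<le> (f x)\<^sup>2 + (g x)\<^sup>2"
        unfolding abs_mult by linarith
      then show "norm (f x * g x) \<le> norm ((f x)\<^sup>2 + (g x)\<^sup>2)" by simp
    qed
  qed (use f g in auto)
  define a b c where "a = (LINT x|M. (f x)\<^sup>2)" and "b = (LINT x|M. f x * g x)"
    and "c = (LINT x|M. (g x)\<^sup>2)"
  have quad: "0 \<le> a * s\<^sup>2 - 2 * b * s * t + c * t\<^sup>2" for s t :: real
  proof -
    have "0 \<le> (LINT x|M. (s * f x - t * g x)\<^sup>2)" by simp
    also have "\<dots> = (LINT x|M. s\<^sup>2 * (f x)\<^sup>2 - 2 * s * t * (f x * g x) + t\<^sup>2 * (g x)\<^sup>2)"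
      by (intro Bochner_Integration.integral_cong) (auto simp: power2_eq_square algebra_simps)
    also have "\<dots> = s\<^sup>2 * a - 2 * s * t * b + t\<^sup>2 * c"
      unfolding a_def b_def c_def using f g fg by simp
    finally show ?thesis by (simp add: algebra_simps)
  qed
  have "b\<^sup>2 \<le> a * c"
  proof (cases "c = 0")
    case False
    have "c \<ge> 0" unfolding c_def by simp
    with False have "c > 0" by simp
    have "0 \<le> c * (a * c - b\<^sup>2)"
      using quad[of c b] by (simp add: power2_eq_square algebra_simps)
    with \<open>c > 0\<close> show ?thesis by (simp add: zero_le_mult_iff)
  next
    case True
    have "b = 0"
    proof (rule ccontr)
      assume "b \<noteq> 0"
      then have "2 * b * ((a + 1) / (2 * b)) = a + 1" by simp
      then show False using quad[of 1 "(a + 1) / (2 * b)"] True by simp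
    qed
    then show ?thesis using True by simp
  qed
  then show "(LINT x|M. f x * g x)\<^sup>2 \<le> (LINT x|M. (f x)\<^sup>2) * (LINT x|M. (g x)\<^sup>2)"
    unfolding a_def b_def c_def .
qed

text \<open>Cholesky elimination, one index at a time: \<open>k'\<close> is the Schur complement of
  the pivot \<open>k a a\<close> and is again positive semidefinite. A vanishing pivot forces its
  row to vanish, and division by zero then makes the correction term 0, so that both cases share one
  formula.\<close>

lemma psd_gram_factorization:
  fixes k :: "'a \<Rightarrow> 'a \<Rightarrow> real"
  assumes "finite I"
    and "\<And>x y. x \<in> I \<Longrightarrow> y \<in> I \<Longrightarrow> k x y = k y x"
    and "\<And>c. 0 \<le> (\<Sum>x\<in>I. \<Sum>y\<in>I. c x * c y * k x y)"
  shows "\<exists>b :: 'a \<Rightarrow> 'a \<Rightarrow> real. \<forall>x\<in>I. \<forall>y\<in>I. k x y = (\<Sum>i\<in>I. b i x * b i y)"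
  using assms
proof (induction I arbitrary: k rule: finite_induct)
  case (insert a I)
  note sym = insert.prems(1) and psd = insert.prems(2)
  have a: "a \<notin> I" "finite I" using insert by auto
  have expand: "0 \<le> t\<^sup>2 * k a a + 2 * t * (\<Sum>x\<in>I. c x * k a x) + (\<Sum>x\<in>I. \<Sum>y\<in>I. c x * c y * k x y)"
    for t c
  proof -
    define c' where "c' = c(a := t)"
    have c': "c' a = t" "\<And>x. x \<in> I \<Longrightarrow> c' x = c x" using a by (auto simp: c'_def)
    have 1: "(\<Sum>x\<in>insert a I. \<Sum>y\<in>insert a I. c' x * c' y * k x y) =
       t * t * k a a + (\<Sum>y\<in>I. t * c y * k a y) + ((\<Sum>x\<in>I. c x * t * k x a) + (\<Sum>x\<in>I. \<Sum>y\<in>I. c x * c y * k x y))"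
      using a c' by (simp add: sum.distrib)
    have 2: "(\<Sum>x\<in>I. c x * t * k x a) = (\<Sum>y\<in>I. t * c y * k a y)"
      using sym by (intro sum.cong) (auto simp: mult_ac)
    have 3: "(\<Sum>y\<in>I. t * c y * k a y) = t * (\<Sum>x\<in>I. c x * k a x)"
      by (simp add: sum_distrib_left mult_ac)
    show ?thesis using psd[of c'] unfolding 1 2 3 by (simp add: power2_eq_square)
  qed
  have kaa: "0 \<le> k a a" using expand[of 1 "\<lambda>_. 0"] by simp
  define k' where "k' x y = k x y - k a x * k a y / k a a" for x y
  \<comment> \<open>With a zero pivot, the form with weight \<open>t\<close> on \<open>a\<close> and
    1 on \<open>x\<close> is affine in \<open>t\<close>; a nonzero slope would make it negative
    somewhere.\<close>
  have row0: "k a x = 0" if "k a a = 0" "x \<in> I" for x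
  proof (rule ccontr)
    assume nz: "k a x \<noteq> 0"
    define r where "r = k x x"
    have *: "0 \<le> 2 * t * k a x + r" for t
    proof -
      define c where "c y = (if y = x then 1 else 0 :: real)" for y
      have "(\<Sum>y\<in>I. c y * k a y) = (\<Sum>y\<in>I. if y = x then k a y else 0)"
        by (intro sum.cong) (auto simp: c_def)
      then have 1: "(\<Sum>y\<in>I. c y * k a y) = k a x" using that a by simp
      have "(\<Sum>y\<in>I. \<Sum>z\<in>I. c y * c z * k y z) = (\<Sum>y\<in>I. if y = x then (\<Sum>z\<in>I. if z = x then k y z else 0) else 0)"
        by (intro sum.cong) (auto simp: c_def intro!: sum.cong)
      then have 2: "(\<Sum>y\<in>I. \<Sum>z\<in>I. c y * c z * k y z) = r" using that a by (simp add: r_def)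
      show ?thesis using expand[of t c] 1 2 that by simp
    qed
    have "2 * (-(r + 1) / (2 * k a x)) * k a x = -(r + 1)" using nz by (simp add: field_simps)
    then show False using *[of "-(r + 1) / (2 * k a x)"] by simp
  qed
  have psd': "0 \<le> (\<Sum>x\<in>I. \<Sum>y\<in>I. c x * c y * k' x y)" for c
  proof -
    define s where "s = (\<Sum>x\<in>I. c x * k a x)"
    have "(\<Sum>x\<in>I. \<Sum>y\<in>I. c x * c y * k' x y) =
      (\<Sum>x\<in>I. \<Sum>y\<in>I. c x * c y * k x y) - (\<Sum>x\<in>I. \<Sum>y\<in>I. (c x * k a x) * (c y * k a y)) / k a a"
      unfolding sum_divide_distrib sum_subtractf[symmetric]
      by (intro sum.cong refl) (simp add: k'_def field_simps diff_divide_distrib)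
    also have "(\<Sum>x\<in>I. \<Sum>y\<in>I. (c x * k a x) * (c y * k a y)) = s * s"
      unfolding s_def sum_product ..
    finally have eq: "(\<Sum>x\<in>I. \<Sum>y\<in>I. c x * c y * k' x y) = (\<Sum>x\<in>I. \<Sum>y\<in>I. c x * c y * k x y) - s * s / k a a" .
    show ?thesis
    proof (cases "k a a = 0")
      case True
      then show ?thesis using eq expand[of 0 c] by simp
    next
      case False
      then show ?thesis using eq expand[of "- s / k a a" c]
        by (simp add: s_def[symmetric] power2_eq_square)
    qed
  qed
  obtain b where b: "\<And>x y. x \<in> I \<Longrightarrow> y \<in> I \<Longrightarrow> k' x y = (\<Sum>i\<in>I. b i x * b i y)"
    using insert.IH[of k'] psd' sym by (auto simp: k'_def mult.commute)
  \<comment> \<open>The new row is the pivot row divided by the root of the pivot; the older rows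
    receive a zero in column \<open>a\<close>.\<close>
  define b' where "b' i x = (if i = a then k a x / sqrt (k a a) else if x = a then 0 else b i x)" for i x
  have aa: "k a x * k a y / k a a = b' a x * b' a y" for x y
    using kaa by (simp add: b'_def)
  have "k x y = (\<Sum>i\<in>insert a I. b' i x * b' i y)" if x: "x \<in> insert a I" and y: "y \<in> insert a I" for x y
  proof -
    have *: "(\<Sum>i\<in>I. b' i x * b' i y) = (if x = a \<or> y = a then 0 else k' x y)"
    proof (cases "x = a \<or> y = a")
      case True
      then have "(\<Sum>i\<in>I. b' i x * b' i y) = (\<Sum>i\<in>I. 0)"
        using a by (intro sum.cong) (auto simp: b'_def)
      then show ?thesis using True by simp
    next
      case False
      then have "(\<Sum>i\<in>I. b' i x * b' i y) = (\<Sum>i\<in>I. b i x * b i y)"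
        using a by (intro sum.cong) (auto simp: b'_def)
      then show ?thesis using False x y b by simp
    qed
    have **: "k x y = k a x * k a y / k a a" if "x = a \<or> y = a"
      using that row0 x y sym[of x a] sym[of a a] by (cases "k a a = 0") (auto simp: mult.commute)
    show ?thesis using a * ** aa by (auto simp: k'_def)
  qed
  then show ?case by blast
qed simp

section \<open>Gaussian moments and exponential moments\<close>

definition std_gauss :: "real measure" where
  "std_gauss = density lborel (\<lambda>x. ennreal (std_normal_density x))"

lemma prob_space_std_gauss: "prob_space std_gauss"
  unfolding std_gauss_def using prob_space_normal_density[of 1 0] by simp

lemma sets_std_gauss [measurable_cong, simp]: "sets std_gauss = sets borel"
  by (simp add: std_gauss_def)

lemma space_std_gauss [simp]: "space std_gauss = UNIV"
  by (simp add: std_gauss_def)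

lemma std_gauss_moments:
  shows "integrable std_gauss (\<lambda>x. x ^ k)"
    and "(LINT x|std_gauss. x) = 0" "(LINT x|std_gauss. x\<^sup>2) = 1"
    and "(LINT x|std_gauss. x ^ 3) = 0" "(LINT x|std_gauss. x ^ 4) = 3"
proof -
  have eq: "(LINT x|std_gauss. x ^ k) = (LINT x|lborel. std_normal_density x * x ^ k)" for k
    unfolding std_gauss_def by (subst integral_density) auto
  show "integrable std_gauss (\<lambda>x. x ^ k)"
    unfolding std_gauss_def by (subst integrable_density) (auto simp: integrable_std_normal_moment)
  show "(LINT x|std_gauss. x) = 0" using eq[of 1] integral_std_normal_moment_odd[of 0] by simp
  show "(LINT x|std_gauss. x\<^sup>2) = 1" using eq[of 2] integral_std_normal_moment_even[of 1] by (simp add: fact_numeral)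
  show "(LINT x|std_gauss. x ^ 3) = 0" using eq[of 3] integral_std_normal_moment_odd[of 1] by (simp add: numeral_3_eq_3)
  show "(LINT x|std_gauss. x ^ 4) = 3" using eq[of 4] integral_std_normal_moment_even[of 2] by (simp add: fact_numeral)
qed

text \<open>The two families of polynomials are closed under integrating out one Gaussian
  coordinate: the shift \<open>m\<close> becomes a partial sum over the other coordinates, and only
  \<open>c\<close> and \<open>e\<close> change. This is the step of the inductions over
  coordinates.\<close>

lemma std_gauss_affine_moments:
  fixes a c e m :: real
  assumes "0 \<le> c" "0 \<le> e"
  shows "(\<integral>\<^sup>+x. ennreal (c + e * (m + a * x)\<^sup>2) \<partial>std_gauss) = ennreal (c + e * (m\<^sup>2 + a\<^sup>2))"
    and "(\<integral>\<^sup>+x. ennreal ((m + a * x) ^ 4 + e * (m + a * x)\<^sup>2 + c) \<partial>std_gauss) =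
      ennreal (m ^ 4 + 6 * m\<^sup>2 * a\<^sup>2 + 3 * a ^ 4 + e * (m\<^sup>2 + a\<^sup>2) + c)"
proof -
  interpret prob_space std_gauss by (rule prob_space_std_gauss)
  have i [simp]: "integrable std_gauss (\<lambda>x. x ^ k)" "integrable std_gauss (\<lambda>x. x)" for k
    using std_gauss_moments(1)[of k] std_gauss_moments(1)[of 1] by auto
  note p = prob_space[simplified]
  { have "(\<lambda>x. c + e * (m + a * x)\<^sup>2) = (\<lambda>x. (c + e * m\<^sup>2) + (2 * e * m * a) * x + (e * a\<^sup>2) * x\<^sup>2)"
      by (auto simp: power2_eq_square algebra_simps)
    then have "has_bochner_integral std_gauss (\<lambda>x. c + e * (m + a * x)\<^sup>2) (c + e * (m\<^sup>2 + a\<^sup>2))"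
      unfolding has_bochner_integral_iff by (simp add: std_gauss_moments(2-) p algebra_simps)
    then show "(\<integral>\<^sup>+x. ennreal (c + e * (m + a * x)\<^sup>2) \<partial>std_gauss) = ennreal (c + e * (m\<^sup>2 + a\<^sup>2))"
      using assms by (subst nn_integral_eq_integral) (auto simp: has_bochner_integral_iff)
    have "(\<lambda>x. (m + a * x) ^ 4 + e * (m + a * x)\<^sup>2 + c) =
      (\<lambda>x. (m ^ 4 + e * m\<^sup>2 + c) + (4 * m ^ 3 * a + 2 * e * m * a) * x + (6 * m\<^sup>2 * a\<^sup>2 + e * a\<^sup>2) * x\<^sup>2
        + (4 * m * a ^ 3) * x ^ 3 + a ^ 4 * x ^ 4)"
      by (rule ext) algebra
    then have "has_bochner_integral std_gauss (\<lambda>x. (m + a * x) ^ 4 + e * (m + a * x)\<^sup>2 + c)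
       (m ^ 4 + 6 * m\<^sup>2 * a\<^sup>2 + 3 * a ^ 4 + e * (m\<^sup>2 + a\<^sup>2) + c)"
      unfolding has_bochner_integral_iff by (simp add: std_gauss_moments(2-) p algebra_simps)
    then show "(\<integral>\<^sup>+x. ennreal ((m + a * x) ^ 4 + e * (m + a * x)\<^sup>2 + c) \<partial>std_gauss) =
      ennreal (m ^ 4 + 6 * m\<^sup>2 * a\<^sup>2 + 3 * a ^ 4 + e * (m\<^sup>2 + a\<^sup>2) + c)"
      using assms by (subst nn_integral_eq_integral) (auto simp: has_bochner_integral_iff)
  }
qed

text \<open>One-dimensional Cameron-Martin formula: the exponential is the density of the law
  translated by \<open>-v\<close>, under which \<open>v + x\<close> is standard again.\<close>

lemma std_gauss_shift:
  assumes [measurable]: "f \<in> borel_measurable borel"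
  shows "(\<integral>\<^sup>+x. f (v + x) * ennreal (exp (- v * x - v\<^sup>2 / 2)) \<partial>std_gauss) = (\<integral>\<^sup>+x. f x \<partial>std_gauss)"
proof -
  have "(\<integral>\<^sup>+x. f x \<partial>std_gauss) = (\<integral>\<^sup>+x. ennreal (std_normal_density x) * f x \<partial>lborel)"
    unfolding std_gauss_def by (subst nn_integral_density) auto
  also have "\<dots> = (\<integral>\<^sup>+x. ennreal (std_normal_density (v + x)) * f (v + x) \<partial>lborel)"
    by (subst nn_integral_real_affine[where c = 1 and t = v]) auto
  also have "\<dots> = (\<integral>\<^sup>+x. ennreal (std_normal_density x) * (f (v + x) * ennreal (exp (- v * x - v\<^sup>2 / 2))) \<partial>lborel)"
  proof (intro nn_integral_cong)
    fix x :: real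
    have "std_normal_density (v + x) = std_normal_density x * exp (- v * x - v\<^sup>2 / 2)"
      unfolding std_normal_density_def mult.assoc exp_add[symmetric]
      by (simp add: power2_eq_square field_simps)
    then show "ennreal (std_normal_density (v + x)) * f (v + x) =
       ennreal (std_normal_density x) * (f (v + x) * ennreal (exp (- v * x - v\<^sup>2 / 2)))"
      by (simp add: ennreal_mult mult_ac)
  qed
  also have "\<dots> = (\<integral>\<^sup>+x. f (v + x) * ennreal (exp (- v * x - v\<^sup>2 / 2)) \<partial>std_gauss)"
    unfolding std_gauss_def by (subst nn_integral_density) auto
  finally show ?thesis ..
qed

section \<open>Gaussian vectors: moments, shifts and the variational inequality\<close>

abbreviation gauss_vec :: "'p set \<Rightarrow> ('p \<Rightarrow> real) measure" where
  "gauss_vec I \<equiv> Pi\<^sub>M I (\<lambda>_. std_gauss)"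

lemma prob_space_gauss_vec: "prob_space (gauss_vec I)"
  by (intro prob_space_PiM prob_space_std_gauss)

lemma product_sigma_finite_std_gauss: "product_sigma_finite (\<lambda>_. std_gauss)"
  by (intro product_sigma_finite.intro prob_space_imp_sigma_finite prob_space_std_gauss)

lemma gauss_vec_quadratic:
  fixes a :: "'p \<Rightarrow> real"
  assumes "finite I" "0 \<le> c" "0 \<le> e"
  shows "(\<integral>\<^sup>+g. ennreal (c + e * (m + (\<Sum>p\<in>I. a p * g p))\<^sup>2) \<partial>gauss_vec I) =
    ennreal (c + e * (m\<^sup>2 + (\<Sum>p\<in>I. (a p)\<^sup>2)))"
  using assms
proof (induction I arbitrary: c rule: finite_induct)
  case empty
  interpret prob_space "gauss_vec ({} :: 'p set)" by (rule prob_space_gauss_vec)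
  show ?case using emeasure_space_1 by simp
next
  case (insert i I)
  interpret product_sigma_finite "\<lambda>_. std_gauss" by (rule product_sigma_finite_std_gauss)
  have "(\<integral>\<^sup>+g. ennreal (c + e * (m + (\<Sum>p\<in>insert i I. a p * g p))\<^sup>2) \<partial>gauss_vec (insert i I)) =
    (\<integral>\<^sup>+g. \<integral>\<^sup>+y. ennreal (c + e * (m + (\<Sum>p\<in>insert i I. a p * (g(i := y)) p))\<^sup>2) \<partial>std_gauss \<partial>gauss_vec I)"
    using insert by (intro product_nn_integral_insert) auto
  also have "\<dots> = (\<integral>\<^sup>+g. \<integral>\<^sup>+y. ennreal (c + e * ((m + (\<Sum>p\<in>I. a p * g p)) + a i * y)\<^sup>2) \<partial>std_gauss \<partial>gauss_vec I)"
  proof (intro nn_integral_cong)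
    fix g :: "'p \<Rightarrow> real" and y :: real
    have "(\<Sum>p\<in>I. a p * (g(i := y)) p) = (\<Sum>p\<in>I. a p * g p)"
      using insert by (intro sum.cong) auto
    then show "ennreal (c + e * (m + (\<Sum>p\<in>insert i I. a p * (g(i := y)) p))\<^sup>2) =
       ennreal (c + e * ((m + (\<Sum>p\<in>I. a p * g p)) + a i * y)\<^sup>2)"
      using insert by (simp add: algebra_simps)
  qed
  also have "\<dots> = (\<integral>\<^sup>+g. ennreal ((c + e * (a i)\<^sup>2) + e * (m + (\<Sum>p\<in>I. a p * g p))\<^sup>2) \<partial>gauss_vec I)"
  proof (intro nn_integral_cong)
    fix g :: "'p \<Rightarrow> real"
    have eq: "c + e * (M\<^sup>2 + (a i)\<^sup>2) = (c + e * (a i)\<^sup>2) + e * M\<^sup>2" for M by algebra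
    show "(\<integral>\<^sup>+y. ennreal (c + e * ((m + (\<Sum>p\<in>I. a p * g p)) + a i * y)\<^sup>2) \<partial>std_gauss) =
        ennreal ((c + e * (a i)\<^sup>2) + e * (m + (\<Sum>p\<in>I. a p * g p))\<^sup>2)"
      unfolding std_gauss_affine_moments(1)[OF insert.prems] eq ..
  qed
  also have "\<dots> = ennreal ((c + e * (a i)\<^sup>2) + e * (m\<^sup>2 + (\<Sum>p\<in>I. (a p)\<^sup>2)))"
    using insert by (intro insert.IH) auto
  finally show ?case using insert by (simp add: algebra_simps)
qed

text \<open>The lower order coefficients are carried along because integrating out coordinate
  \<open>i\<close> turns \<open>(e, c)\<close> into
  \<open>(6 a_i^2 + e, 3 a_i^4 + e a_i^2 + c)\<close>; the pure fourth power by itself is not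
  inductive.\<close>

lemma gauss_vec_quartic:
  fixes a :: "'p \<Rightarrow> real"
  assumes "finite I" "0 \<le> c" "0 \<le> e"
  shows "(\<integral>\<^sup>+g. ennreal ((m + (\<Sum>p\<in>I. a p * g p)) ^ 4 + e * (m + (\<Sum>p\<in>I. a p * g p))\<^sup>2 + c) \<partial>gauss_vec I) =
    ennreal (m ^ 4 + 6 * m\<^sup>2 * (\<Sum>p\<in>I. (a p)\<^sup>2) + 3 * (\<Sum>p\<in>I. (a p)\<^sup>2)\<^sup>2 + e * (m\<^sup>2 + (\<Sum>p\<in>I. (a p)\<^sup>2)) + c)"
  using assms
proof (induction I arbitrary: c e rule: finite_induct)
  case empty
  interpret prob_space "gauss_vec ({} :: 'p set)" by (rule prob_space_gauss_vec)
  show ?case using emeasure_space_1 by simp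
next
  case (insert i I)
  interpret product_sigma_finite "\<lambda>_. std_gauss" by (rule product_sigma_finite_std_gauss)
  define A where "A = (\<Sum>p\<in>I. (a p)\<^sup>2)"
  have "(\<integral>\<^sup>+g. ennreal ((m + (\<Sum>p\<in>insert i I. a p * g p)) ^ 4 + e * (m + (\<Sum>p\<in>insert i I. a p * g p))\<^sup>2 + c) \<partial>gauss_vec (insert i I)) =
    (\<integral>\<^sup>+g. \<integral>\<^sup>+y. ennreal ((m + (\<Sum>p\<in>insert i I. a p * (g(i := y)) p)) ^ 4 + e * (m + (\<Sum>p\<in>insert i I. a p * (g(i := y)) p))\<^sup>2 + c) \<partial>std_gauss \<partial>gauss_vec I)"
    using insert by (intro product_nn_integral_insert) auto
  also have "\<dots> = (\<integral>\<^sup>+g. \<integral>\<^sup>+y. ennreal (((m + (\<Sum>p\<in>I. a p * g p)) + a i * y) ^ 4 + e * ((m + (\<Sum>p\<in>I. a p * g p)) + a i * y)\<^sup>2 + c) \<partial>std_gauss \<partial>gauss_vec I)"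
  proof (intro nn_integral_cong)
    fix g :: "'p \<Rightarrow> real" and y :: real
    have "(\<Sum>p\<in>I. a p * (g(i := y)) p) = (\<Sum>p\<in>I. a p * g p)"
      using insert by (intro sum.cong) auto
    then have eq: "m + (\<Sum>p\<in>insert i I. a p * (g(i := y)) p) = (m + (\<Sum>p\<in>I. a p * g p)) + a i * y"
      using insert by simp
    show "ennreal ((m + (\<Sum>p\<in>insert i I. a p * (g(i := y)) p)) ^ 4 + e * (m + (\<Sum>p\<in>insert i I. a p * (g(i := y)) p))\<^sup>2 + c) =
      ennreal (((m + (\<Sum>p\<in>I. a p * g p)) + a i * y) ^ 4 + e * ((m + (\<Sum>p\<in>I. a p * g p)) + a i * y)\<^sup>2 + c)"
      unfolding eq ..
  qed
  also have "\<dots> = (\<integral>\<^sup>+g. ennreal ((m + (\<Sum>p\<in>I. a p * g p)) ^ 4 + (6 * (a i)\<^sup>2 + e) * (m + (\<Sum>p\<in>I. a p * g p))\<^sup>2 + (3 * (a i) ^ 4 + e * (a i)\<^sup>2 + c)) \<partial>gauss_vec I)"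
  proof (intro nn_integral_cong)
    fix g :: "'p \<Rightarrow> real"
    have eq: "M ^ 4 + 6 * M\<^sup>2 * (a i)\<^sup>2 + 3 * a i ^ 4 + e * (M\<^sup>2 + (a i)\<^sup>2) + c =
        M ^ 4 + (6 * (a i)\<^sup>2 + e) * M\<^sup>2 + (3 * (a i) ^ 4 + e * (a i)\<^sup>2 + c)" for M by algebra
    show "(\<integral>\<^sup>+y. ennreal (((m + (\<Sum>p\<in>I. a p * g p)) + a i * y) ^ 4 + e * ((m + (\<Sum>p\<in>I. a p * g p)) + a i * y)\<^sup>2 + c) \<partial>std_gauss) =
        ennreal ((m + (\<Sum>p\<in>I. a p * g p)) ^ 4 + (6 * (a i)\<^sup>2 + e) * (m + (\<Sum>p\<in>I. a p * g p))\<^sup>2 + (3 * (a i) ^ 4 + e * (a i)\<^sup>2 + c))"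
      unfolding std_gauss_affine_moments(2)[OF insert.prems] eq ..
  qed
  also have "\<dots> = ennreal (m ^ 4 + 6 * m\<^sup>2 * A + 3 * A\<^sup>2 + (6 * (a i)\<^sup>2 + e) * (m\<^sup>2 + A) + (3 * (a i) ^ 4 + e * (a i)\<^sup>2 + c))"
    unfolding A_def using insert by (intro insert.IH) auto
  also have "m ^ 4 + 6 * m\<^sup>2 * A + 3 * A\<^sup>2 + (6 * (a i)\<^sup>2 + e) * (m\<^sup>2 + A) + (3 * (a i) ^ 4 + e * (a i)\<^sup>2 + c) =
    m ^ 4 + 6 * m\<^sup>2 * ((a i)\<^sup>2 + A) + 3 * ((a i)\<^sup>2 + A)\<^sup>2 + e * (m\<^sup>2 + ((a i)\<^sup>2 + A)) + c"
    by algebra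
  finally show ?case using insert by (simp add: A_def)
qed

text \<open>The fourth moment is kept below three times the squared second moment, with a nonzero
  mean allowed. In this shape the bound passes through Cauchy-Schwarz to products of squared linear
  forms.\<close>

lemma gauss_vec_moments:
  fixes a :: "'p \<Rightarrow> real"
  assumes "finite I"
  defines "A \<equiv> (\<Sum>p\<in>I. (a p)\<^sup>2)"
  shows "integrable (gauss_vec I) (\<lambda>g. (m + (\<Sum>p\<in>I. a p * g p))\<^sup>2)"
    and "(LINT g|gauss_vec I. (m + (\<Sum>p\<in>I. a p * g p))\<^sup>2) = m\<^sup>2 + A"
    and "integrable (gauss_vec I) (\<lambda>g. (m + (\<Sum>p\<in>I. a p * g p)) ^ 4)"
    and "(LINT g|gauss_vec I. (m + (\<Sum>p\<in>I. a p * g p)) ^ 4) \<le> 3 * (m\<^sup>2 + A)\<^sup>2"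
proof -
  have 2: "(\<integral>\<^sup>+g. ennreal ((m + (\<Sum>p\<in>I. a p * g p))\<^sup>2) \<partial>gauss_vec I) = ennreal (m\<^sup>2 + A)"
    using gauss_vec_quadratic[OF assms(1), of 0 1 m a] by (simp add: A_def)
  have 4: "(\<integral>\<^sup>+g. ennreal ((m + (\<Sum>p\<in>I. a p * g p)) ^ 4) \<partial>gauss_vec I) = ennreal (m ^ 4 + 6 * m\<^sup>2 * A + 3 * A\<^sup>2)"
    using gauss_vec_quartic[OF assms(1), of 0 0 m a] by (simp add: A_def)
  have A: "A \<ge> 0" by (auto simp: A_def intro: sum_nonneg)
  have pos: "0 \<le> m ^ 4 + 6 * m\<^sup>2 * A + 3 * A\<^sup>2" using A by simp
  have "has_bochner_integral (gauss_vec I) (\<lambda>g. (m + (\<Sum>p\<in>I. a p * g p))\<^sup>2) (m\<^sup>2 + A)"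
    by (rule has_bochner_integral_nn_integral) (use 2 A in auto)
  then show "integrable (gauss_vec I) (\<lambda>g. (m + (\<Sum>p\<in>I. a p * g p))\<^sup>2)"
    and "(LINT g|gauss_vec I. (m + (\<Sum>p\<in>I. a p * g p))\<^sup>2) = m\<^sup>2 + A"
    by (auto simp: has_bochner_integral_iff)
  have "has_bochner_integral (gauss_vec I) (\<lambda>g. (m + (\<Sum>p\<in>I. a p * g p)) ^ 4) (m ^ 4 + 6 * m\<^sup>2 * A + 3 * A\<^sup>2)"
    by (rule has_bochner_integral_nn_integral) (use 4 pos in auto)
  moreover have "m ^ 4 + 6 * m\<^sup>2 * A + 3 * A\<^sup>2 \<le> 3 * (m\<^sup>2 + A)\<^sup>2"
  proof -
    have "3 * (m\<^sup>2 + A)\<^sup>2 - (m ^ 4 + 6 * m\<^sup>2 * A + 3 * A\<^sup>2) = 2 * (m\<^sup>2)\<^sup>2" by algebra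
    then show ?thesis using zero_le_power2[of "m\<^sup>2"] by linarith
  qed
  ultimately show "integrable (gauss_vec I) (\<lambda>g. (m + (\<Sum>p\<in>I. a p * g p)) ^ 4)"
    and "(LINT g|gauss_vec I. (m + (\<Sum>p\<in>I. a p * g p)) ^ 4) \<le> 3 * (m\<^sup>2 + A)\<^sup>2"
    by (auto simp: has_bochner_integral_iff)
qed

text \<open>Linear moments are extracted from quadratic ones by
  \<open>2 l = (1 + l)^2 - l^2 - 1\<close>.\<close>

lemma gauss_vec_linear:
  fixes a :: "'p \<Rightarrow> real"
  assumes "finite I"
  shows "integrable (gauss_vec I) (\<lambda>g. \<Sum>p\<in>I. a p * g p)"
    and "(LINT g|gauss_vec I. (\<Sum>p\<in>I. a p * g p)) = 0"
proof -
  interpret prob_space "gauss_vec I" by (rule prob_space_gauss_vec)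
  define l where "l g = (\<Sum>p\<in>I. a p * g p)" for g :: "'p \<Rightarrow> real"
  note 1 = gauss_vec_moments[OF assms, of 1 a, folded l_def]
  note 0 = gauss_vec_moments[OF assms, of 0 a, folded l_def]
  have eq: "l = (\<lambda>g. ((1 + l g)\<^sup>2 - (0 + l g)\<^sup>2 - 1) / 2)"
    by (auto simp: power2_eq_square algebra_simps)
  have int: "integrable (gauss_vec I) (\<lambda>g. (1 + l g)\<^sup>2 - (0 + l g)\<^sup>2 - 1)"
    using 1(1) 0(1) by (intro Bochner_Integration.integrable_diff) auto
  have "integrable (gauss_vec I) l"
    by (subst eq) (use int in \<open>intro Bochner_Integration.integrable_divide\<close>)
  then show "integrable (gauss_vec I) (\<lambda>g. \<Sum>p\<in>I. a p * g p)"
    by (simp add: l_def[abs_def])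
  have "(LINT g|gauss_vec I. l g) = (LINT g|gauss_vec I. (1 + l g)\<^sup>2 - (0 + l g)\<^sup>2 - 1) / 2"
    by (subst eq) simp
  also have "(LINT g|gauss_vec I. (1 + l g)\<^sup>2 - (0 + l g)\<^sup>2 - 1) = 0"
    using 1(1,2) 0(1,2) by (simp add: prob_space[simplified])
  finally show "(LINT g|gauss_vec I. (\<Sum>p\<in>I. a p * g p)) = 0" by (simp add: l_def)
qed

text \<open>Cameron-Martin, coordinate by coordinate. The translated vector is restricted to
  \<open>I\<close> because the points of a product space are undefined outside the index set; the
  unrestricted translate would leave the space.\<close>

lemma gauss_vec_shift:
  fixes f :: "('p \<Rightarrow> real) \<Rightarrow> ennreal"
  assumes "finite I" "f \<in> borel_measurable (gauss_vec I)"
  shows "(\<integral>\<^sup>+g. f (\<lambda>p\<in>I. v p + g p) * ennreal (exp (- (\<Sum>p\<in>I. v p * g p) - (\<Sum>p\<in>I. (v p)\<^sup>2) / 2)) \<partial>gauss_vec I)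
    = (\<integral>\<^sup>+g. f g \<partial>gauss_vec I)"
  using assms
proof (induction I arbitrary: f rule: finite_induct)
  case empty
  show ?case
  proof (intro nn_integral_cong)
    fix g assume "g \<in> space (gauss_vec {} :: ('p \<Rightarrow> real) measure)"
    then have "g = (\<lambda>_. undefined)" by (auto simp: space_PiM)
    then show "f (\<lambda>p\<in>{}. v p + g p) * ennreal (exp (- (\<Sum>p\<in>{}. v p * g p) - (\<Sum>p\<in>{}. (v p)\<^sup>2) / 2)) = f g"
      by (simp add: restrict_def)
  qed
next
  case (insert i I)
  interpret product_sigma_finite "\<lambda>_. std_gauss" by (rule product_sigma_finite_std_gauss)
  note [measurable] = insert.prems
  define E where "E g = exp (- (\<Sum>p\<in>I. v p * g p) - (\<Sum>p\<in>I. (v p)\<^sup>2) / 2)" for g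
  define f' where "f' g = (\<integral>\<^sup>+y. f (g(i := y)) \<partial>std_gauss)" for g
  interpret sg: prob_space std_gauss by (rule prob_space_std_gauss)
  have upd [measurable]: "(\<lambda>x. (fst x)(i := snd x)) \<in> measurable (gauss_vec I \<Otimes>\<^sub>M std_gauss) (gauss_vec (insert i I))"
    by (rule measurable_fun_upd[where J = I]) auto
  have [measurable]: "(\<lambda>(g, y). f (g(i := y))) \<in> borel_measurable (gauss_vec I \<Otimes>\<^sub>M std_gauss)"
    using measurable_compose[OF upd insert.prems] by (simp add: split_beta')
  have sh: "(\<lambda>g. \<lambda>p\<in>J. v p + g p) \<in> measurable (gauss_vec J) (gauss_vec J)" for J
    by (intro measurable_restrict) measurable
  have "(\<integral>\<^sup>+g. f (\<lambda>p\<in>insert i I. v p + g p) * ennreal (exp (- (\<Sum>p\<in>insert i I. v p * g p) - (\<Sum>p\<in>insert i I. (v p)\<^sup>2) / 2)) \<partial>gauss_vec (insert i I)) =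
    (\<integral>\<^sup>+g. \<integral>\<^sup>+y. f (\<lambda>p\<in>insert i I. v p + (g(i := y)) p) * ennreal (exp (- (\<Sum>p\<in>insert i I. v p * (g(i := y)) p) - (\<Sum>p\<in>insert i I. (v p)\<^sup>2) / 2)) \<partial>std_gauss \<partial>gauss_vec I)"
    using insert sh[of "insert i I"] by (intro product_nn_integral_insert borel_measurable_times_ennreal) (auto intro: measurable_compose)
  also have "\<dots> = (\<integral>\<^sup>+g. \<integral>\<^sup>+y. ennreal (E g) * (f ((\<lambda>p\<in>I. v p + g p)(i := v i + y)) * ennreal (exp (- v i * y - (v i)\<^sup>2 / 2))) \<partial>std_gauss \<partial>gauss_vec I)"
  proof (intro nn_integral_cong)
    fix g :: "'p \<Rightarrow> real" and y :: real
    have 1: "(\<Sum>p\<in>I. v p * (g(i := y)) p) = (\<Sum>p\<in>I. v p * g p)"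
      using insert by (intro sum.cong) auto
    have 2: "(\<lambda>p\<in>insert i I. v p + (g(i := y)) p) = (\<lambda>p\<in>I. v p + g p)(i := v i + y)"
      using insert by (auto simp: restrict_def fun_eq_iff)
    have 3: "exp (- (\<Sum>p\<in>insert i I. v p * (g(i := y)) p) - (\<Sum>p\<in>insert i I. (v p)\<^sup>2) / 2) = E g * exp (- v i * y - (v i)\<^sup>2 / 2)"
      using insert 1 by (simp add: E_def exp_add[symmetric] field_simps)
    show "f (\<lambda>p\<in>insert i I. v p + (g(i := y)) p) * ennreal (exp (- (\<Sum>p\<in>insert i I. v p * (g(i := y)) p) - (\<Sum>p\<in>insert i I. (v p)\<^sup>2) / 2)) =
      ennreal (E g) * (f ((\<lambda>p\<in>I. v p + g p)(i := v i + y)) * ennreal (exp (- v i * y - (v i)\<^sup>2 / 2)))"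
      unfolding 2 3 by (simp add: ennreal_mult E_def mult_ac)
  qed
  also have "\<dots> = (\<integral>\<^sup>+g. ennreal (E g) * f' (\<lambda>p\<in>I. v p + g p) \<partial>gauss_vec I)"
  proof (intro nn_integral_cong)
    fix g assume g: "g \<in> space (gauss_vec I :: ('p \<Rightarrow> real) measure)"
    define G where "G = (\<lambda>p\<in>I. v p + g p)"
    have G: "G \<in> space (gauss_vec I)" by (auto simp: G_def space_PiM)
    have [measurable]: "(\<lambda>y. f (G(i := y))) \<in> borel_measurable borel"
      using measurable_compose[OF measurable_Pair1'[OF G, of std_gauss], of "\<lambda>(g, y). f (g(i := y))" borel]
      by simp
    show "(\<integral>\<^sup>+y. ennreal (E g) * (f (G(i := v i + y)) * ennreal (exp (- v i * y - (v i)\<^sup>2 / 2))) \<partial>std_gauss) = ennreal (E g) * f' G"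
      unfolding f'_def using std_gauss_shift[of "\<lambda>y. f (G(i := y))" "v i"]
      by (subst nn_integral_cmult) auto
  qed
  also have "\<dots> = (\<integral>\<^sup>+g. f' g \<partial>gauss_vec I)"
  proof -
    have "f' \<in> borel_measurable (gauss_vec I)" unfolding f'_def by measurable
    from insert.IH[OF this] show ?thesis
      unfolding E_def by (subst mult.commute)
  qed
  also have "\<dots> = (\<integral>\<^sup>+g. f g \<partial>gauss_vec (insert i I))"
    unfolding f'_def using insert by (intro product_nn_integral_insert[symmetric]) auto
  finally show ?case .
qed

text \<open>Jensen for the exponential, by the tangent at the mean. The nonnegative integral on the
  right admits the case in which the exponential of \<open>H\<close> is not integrable.\<close>

lemma (in prob_space) exp_expectation_le:
  assumes H: "integrable M H"
  shows "ennreal (exp (LINT x|M. H x)) \<le> (\<integral>\<^sup>+x. ennreal (exp (H x)) \<partial>M)"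
proof (cases "(\<integral>\<^sup>+x. ennreal (exp (H x)) \<partial>M) = \<infinity>")
  case False
  have [measurable]: "H \<in> borel_measurable M" using H by auto
  have ie: "integrable M (\<lambda>x. exp (H x))"
    using False by (intro integrableI_nonneg) (auto simp: less_top)
  define m where "m = (LINT x|M. H x)"
  have "exp m = (LINT x|M. exp m * (1 + H x - m))"
    using H by (simp add: prob_space m_def)
  also have "\<dots> \<le> (LINT x|M. exp (H x))"
  proof (intro integral_mono)
    show "integrable M (\<lambda>x. exp m * (1 + H x - m))" using H by simp
    fix x
    have "exp m * (1 + (H x - m)) \<le> exp m * exp (H x - m)"
      by (intro mult_left_mono exp_ge_add_one_self) auto
    then show "exp m * (1 + H x - m) \<le> exp (H x)"
      by (simp add: exp_add[symmetric] algebra_simps)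
  qed (rule ie)
  finally show ?thesis unfolding m_def
    by (subst nn_integral_eq_integral[OF ie]) (auto intro: ennreal_leI)
qed simp

text \<open>Gibbs variational principle with a Gaussian prior: the logarithm of the right side
  dominates the mean of \<open>h\<close> under the prior translated by \<open>v\<close>, minus the
  relative entropy \<open>|v|^2 / (2 b^2)\<close>. Translate by Cameron-Martin and apply Jensen; the
  linear term of the density has mean zero. The minorant \<open>hl\<close> stands in for
  \<open>h\<close> because its mean under the translated prior is accessible.\<close>

lemma gauss_vec_variational:
  fixes h hl :: "('p \<Rightarrow> real) \<Rightarrow> real"
  assumes I: "finite I" and b: "b > 0"
    and meas: "(\<lambda>g. h (\<lambda>p\<in>I. b * g p)) \<in> borel_measurable (gauss_vec I)"
    and le: "\<And>\<theta>. hl \<theta> \<le> h \<theta>"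
    and hl: "\<And>\<theta>. hl (restrict \<theta> I) = hl \<theta>"
    and int: "integrable (gauss_vec I) (\<lambda>g. hl (\<lambda>p. v p + b * g p))"
  shows "ennreal (exp ((LINT g|gauss_vec I. hl (\<lambda>p. v p + b * g p)) - (\<Sum>p\<in>I. (v p)\<^sup>2) / (2 * b\<^sup>2)))
    \<le> (\<integral>\<^sup>+g. ennreal (exp (h (\<lambda>p\<in>I. b * g p))) \<partial>gauss_vec I)"
proof -
  interpret prob_space "gauss_vec I" by (rule prob_space_gauss_vec)
  define w where "w p = v p / b" for p
  define W where "W = (\<Sum>p\<in>I. (v p)\<^sup>2) / (2 * b\<^sup>2)"
  have W: "(\<Sum>p\<in>I. (w p)\<^sup>2) / 2 = W"
    by (simp add: w_def W_def power_divide sum_divide_distrib[symmetric] field_simps)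
  note lin = gauss_vec_linear[OF I, of w]
  let ?H = "\<lambda>g. hl (\<lambda>p. v p + b * g p) - (\<Sum>p\<in>I. w p * g p) - W"
  have iH: "integrable (gauss_vec I) ?H" using int lin(1) by simp
  have "(LINT g|gauss_vec I. ?H g) = (LINT g|gauss_vec I. hl (\<lambda>p. v p + b * g p)) - W"
    using int lin prob_space[simplified] by simp
  then have "ennreal (exp ((LINT g|gauss_vec I. hl (\<lambda>p. v p + b * g p)) - W)) \<le> (\<integral>\<^sup>+g. ennreal (exp (?H g)) \<partial>gauss_vec I)"
    using exp_expectation_le[OF iH] by simp
  also have "\<dots> \<le> (\<integral>\<^sup>+g. ennreal (exp (h (\<lambda>p\<in>I. b * (\<lambda>p\<in>I. w p + g p) p))) * ennreal (exp (- (\<Sum>p\<in>I. w p * g p) - (\<Sum>p\<in>I. (w p)\<^sup>2) / 2)) \<partial>gauss_vec I)"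
  proof (intro nn_integral_mono)
    fix g :: "'p \<Rightarrow> real"
    have "(\<lambda>p\<in>I. b * (\<lambda>p\<in>I. w p + g p) p) = restrict (\<lambda>p. v p + b * g p) I"
      using b by (auto simp: w_def restrict_def field_simps)
    then have "hl (\<lambda>p. v p + b * g p) \<le> h (\<lambda>p\<in>I. b * (\<lambda>p\<in>I. w p + g p) p)"
      using le hl by metis
    then have "exp (?H g) \<le> exp (h (\<lambda>p\<in>I. b * (\<lambda>p\<in>I. w p + g p) p)) * exp (- (\<Sum>p\<in>I. w p * g p) - (\<Sum>p\<in>I. (w p)\<^sup>2) / 2)"
      unfolding exp_add[symmetric] W by simp
    then show "ennreal (exp (?H g)) \<le> ennreal (exp (h (\<lambda>p\<in>I. b * (\<lambda>p\<in>I. w p + g p) p))) * ennreal (exp (- (\<Sum>p\<in>I. w p * g p) - (\<Sum>p\<in>I. (w p)\<^sup>2) / 2))"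
      by (subst ennreal_mult[symmetric]) (auto intro: ennreal_leI)
  qed
  also have "\<dots> = (\<integral>\<^sup>+g. ennreal (exp (h (\<lambda>p\<in>I. b * g p))) \<partial>gauss_vec I)"
    by (intro gauss_vec_shift[OF I, of "\<lambda>g. ennreal (exp (h (\<lambda>p\<in>I. b * g p)))" w]
        measurable_compose[OF meas]) auto
  finally show ?thesis unfolding W_def .
qed

section \<open>PAC-Bayes inequalities for sums of squared linear forms\<close>

text \<open>The rows \<open>c i\<close> form a factor of the quadratic form. The covariance, through
  a Gram factorization, and the sample covariance, with one row per observation, are both of this
  kind, so the same Gaussian averages apply to each.\<close>

definition sqform :: "'i set \<Rightarrow> 'p set \<Rightarrow> ('i \<Rightarrow> 'p \<Rightarrow> real) \<Rightarrow> ('p \<Rightarrow> real) \<Rightarrow> real" where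
  "sqform A I c \<theta> = (\<Sum>i\<in>A. (\<Sum>p\<in>I. c i p * \<theta> p)\<^sup>2)"

text \<open>The trace of the matrix of \<open>sqform\<close>, which is the mean of the form under a
  standard Gaussian vector.\<close>

definition sqtrace :: "'i set \<Rightarrow> 'p set \<Rightarrow> ('i \<Rightarrow> 'p \<Rightarrow> real) \<Rightarrow> real" where
  "sqtrace A I c = (\<Sum>i\<in>A. \<Sum>p\<in>I. (c i p)\<^sup>2)"

lemma sqform_nonneg: "0 \<le> sqform A I c \<theta>" and sqtrace_nonneg: "0 \<le> sqtrace A I c"
  by (auto simp: sqform_def sqtrace_def intro!: sum_nonneg)

lemma sqform_restrict: "sqform A I c (restrict \<theta> I) = sqform A I c \<theta>"
  unfolding sqform_def by (intro sum.cong arg_cong[where f = "\<lambda>x. x\<^sup>2"]) auto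

lemma sqform_measurable [measurable]:
  "(\<lambda>g. sqform A I c (\<lambda>p. v p + b * g p)) \<in> borel_measurable (gauss_vec I)"
  unfolding sqform_def by measurable

text \<open>Averages over a Gaussian vector with mean \<open>v\<close> and covariance
  \<open>b^2\<close>: smoothing adds \<open>b^2\<close> times the trace. For the product, the
  squared linear forms are paired by Cauchy-Schwarz and their fourth moments supply the factor
  3.\<close>

lemma gauss_vec_sqform:
  fixes c :: "'i \<Rightarrow> 'p \<Rightarrow> real" and e :: "'j \<Rightarrow> 'p \<Rightarrow> real" and v :: "'p \<Rightarrow> real" and b :: real
  assumes I: "finite I"
  defines "\<theta> \<equiv> \<lambda>g p. v p + b * g p"
  shows "integrable (gauss_vec I) (\<lambda>g. sqform A I c (\<theta> g))"
    and "(LINT g|gauss_vec I. sqform A I c (\<theta> g)) = sqform A I c v + b\<^sup>2 * sqtrace A I c"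
    and "integrable (gauss_vec I) (\<lambda>g. sqform A I c (\<theta> g) * sqform B I e (\<theta> g))"
    and "(LINT g|gauss_vec I. sqform A I c (\<theta> g) * sqform B I e (\<theta> g)) \<le>
      3 * (sqform A I c v + b\<^sup>2 * sqtrace A I c) * (sqform B I e v + b\<^sup>2 * sqtrace B I e)"
proof -
  define m where "m f = (\<Sum>p\<in>I. f p * v p)" for f :: "'p \<Rightarrow> real"
  define S where "S f = (\<Sum>p\<in>I. (f p)\<^sup>2)" for f :: "'p \<Rightarrow> real"
  define l where "l f g = (\<Sum>p\<in>I. f p * \<theta> g p)" for f g :: "'p \<Rightarrow> real"
  have l: "l f g = m f + (\<Sum>p\<in>I. (b * f p) * g p)" for f g
    by (simp add: l_def m_def \<theta>_def sum.distrib algebra_simps)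
  have Sb: "(\<Sum>p\<in>I. (b * f p)\<^sup>2) = b\<^sup>2 * S f" for f
    by (simp add: S_def power_mult_distrib sum_distrib_left)
  note mo = gauss_vec_moments[OF I, of "m f" "\<lambda>p. b * f p" for f, folded l, unfolded Sb]
  have lm [measurable]: "l f \<in> borel_measurable (gauss_vec I)" for f
    unfolding l by measurable
  have Q: "sqform A I c (\<theta> g) = (\<Sum>i\<in>A. (l (c i) g)\<^sup>2)" for A g and c :: "'k \<Rightarrow> 'p \<Rightarrow> real"
    by (simp add: sqform_def l_def)
  have Qv: "sqform A I c v + b\<^sup>2 * sqtrace A I c = (\<Sum>i\<in>A. (m (c i))\<^sup>2 + b\<^sup>2 * S (c i))"
    for A and c :: "'k \<Rightarrow> 'p \<Rightarrow> real"
    by (simp add: sqform_def sqtrace_def m_def S_def sum.distrib sum_distrib_left)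
  show "integrable (gauss_vec I) (\<lambda>g. sqform A I c (\<theta> g))"
    unfolding Q by (intro Bochner_Integration.integrable_sum mo(1))
  show "(LINT g|gauss_vec I. sqform A I c (\<theta> g)) = sqform A I c v + b\<^sup>2 * sqtrace A I c"
    unfolding Q Qv by (subst Bochner_Integration.integral_sum) (auto simp: mo(1,2))
  have p4: "((l f g)\<^sup>2)\<^sup>2 = l f g ^ 4" for f g by simp
  have i2: "integrable (gauss_vec I) (\<lambda>g. (l f g)\<^sup>2 * (l f' g)\<^sup>2)" for f f'
    by (rule integrable_mult_L2) (auto simp: mo(3))
  have prod: "(LINT g|gauss_vec I. (l f g)\<^sup>2 * (l f' g)\<^sup>2) \<le> 3 * ((m f)\<^sup>2 + b\<^sup>2 * S f) * ((m f')\<^sup>2 + b\<^sup>2 * S f')"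
    for f f'
  proof (rule power2_le_imp_le)
    have S: "0 \<le> S f" for f by (auto simp: S_def intro: sum_nonneg)
    show "0 \<le> 3 * ((m f)\<^sup>2 + b\<^sup>2 * S f) * ((m f')\<^sup>2 + b\<^sup>2 * S f')"
      using S[of f] S[of f'] by simp
    have "(LINT g|gauss_vec I. (l f g)\<^sup>2 * (l f' g)\<^sup>2)\<^sup>2 \<le> (LINT g|gauss_vec I. l f g ^ 4) * (LINT g|gauss_vec I. l f' g ^ 4)"
      using Cauchy_Schwarz_integral(2)[of "\<lambda>g. (l f g)\<^sup>2" "gauss_vec I" "\<lambda>g. (l f' g)\<^sup>2"] by (simp add: mo(3))
    also have "\<dots> \<le> (3 * ((m f)\<^sup>2 + b\<^sup>2 * S f)\<^sup>2) * (3 * ((m f')\<^sup>2 + b\<^sup>2 * S f')\<^sup>2)"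
      by (intro mult_mono mo(4)) (auto intro: Bochner_Integration.integral_nonneg)
    finally show "(LINT g|gauss_vec I. (l f g)\<^sup>2 * (l f' g)\<^sup>2)\<^sup>2 \<le> (3 * ((m f)\<^sup>2 + b\<^sup>2 * S f) * ((m f')\<^sup>2 + b\<^sup>2 * S f'))\<^sup>2"
      by (simp only: power_mult_distrib power2_eq_square[of "3::real"] mult_ac)
  qed
  have Q2: "sqform A I c (\<theta> g) * sqform B I e (\<theta> g) = (\<Sum>i\<in>A. \<Sum>j\<in>B. (l (c i) g)\<^sup>2 * (l (e j) g)\<^sup>2)" for g
    unfolding Q by (simp add: sum_product)
  show "integrable (gauss_vec I) (\<lambda>g. sqform A I c (\<theta> g) * sqform B I e (\<theta> g))"
    unfolding Q2 by (intro Bochner_Integration.integrable_sum i2)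
  have "(LINT g|gauss_vec I. sqform A I c (\<theta> g) * sqform B I e (\<theta> g)) =
    (\<Sum>i\<in>A. \<Sum>j\<in>B. (LINT g|gauss_vec I. (l (c i) g)\<^sup>2 * (l (e j) g)\<^sup>2))"
    unfolding Q2 by (simp add: i2)
  also have "\<dots> \<le> (\<Sum>i\<in>A. \<Sum>j\<in>B. 3 * ((m (c i))\<^sup>2 + b\<^sup>2 * S (c i)) * ((m (e j))\<^sup>2 + b\<^sup>2 * S (e j)))"
    by (intro sum_mono prod)
  also have "\<dots> = 3 * (sqform A I c v + b\<^sup>2 * sqtrace A I c) * (sqform B I e v + b\<^sup>2 * sqtrace B I e)"
    unfolding Qv mult.assoc by (subst sum_product) (simp only: sum_distrib_left)
  finally show "(LINT g|gauss_vec I. sqform A I c (\<theta> g) * sqform B I e (\<theta> g)) \<le>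
      3 * (sqform A I c v + b\<^sup>2 * sqtrace A I c) * (sqform B I e v + b\<^sup>2 * sqtrace B I e)" .
qed

text \<open>When \<open>C\<close> is the form of a Gaussian sample with covariance form
  \<open>Q\<close>, it is at each \<theta> equal to \<open>Q\<close> times a chi-square average, and
  the integrand on the right has mean one over the sample. Using \<open>s / (1 + 2 s Q / N)\<close>
  instead of \<open>s\<close> is essential: \<open>Q\<close> is unbounded under a Gaussian prior,
  and the damping keeps the exponential moment finite at every \<theta>. The constant 6 is a 2 from
  expanding the damping factor times the 3 from the fourth moments.\<close>

lemma pac_bayes_upper:
  fixes c :: "'i \<Rightarrow> 'p \<Rightarrow> real" and e :: "'j \<Rightarrow> 'p \<Rightarrow> real" and v :: "'p \<Rightarrow> real" and b s N :: real
    and A :: "'i set" and B :: "'j set" and I :: "'p set"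
  assumes I: "finite I" and pos: "b > 0" "s > 0" "N > 0"
  defines "Q \<equiv> sqform A I c" and "C \<equiv> sqform B I e"
  defines "Qb \<equiv> Q v + b\<^sup>2 * sqtrace A I c" and "Cb \<equiv> C v + b\<^sup>2 * sqtrace B I e"
  shows "ennreal (exp (s * (Cb - Qb) - 6 * s\<^sup>2 / N * (Qb * Cb) - (\<Sum>p\<in>I. (v p)\<^sup>2) / (2 * b\<^sup>2))) \<le>
    (\<integral>\<^sup>+g. ennreal (exp (s / (1 + 2 * s * Q (\<lambda>p\<in>I. b * g p) / N) * C (\<lambda>p\<in>I. b * g p)
       - N / 2 * ln (1 + 2 * s * Q (\<lambda>p\<in>I. b * g p) / N))) \<partial>gauss_vec I)"
proof -
  define h where "h \<theta> = s / (1 + 2 * s * Q \<theta> / N) * C \<theta> - N / 2 * ln (1 + 2 * s * Q \<theta> / N)" for \<theta>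
  \<comment> \<open>A polynomial below \<open>h\<close>, from \<open>1 / (1 + x) \<ge> 1 - x\<close>
    and \<open>ln (1 + x) \<le> x\<close>, whose Gaussian average can be bounded.\<close>
  define hl where "hl \<theta> = s * (C \<theta> - Q \<theta>) - 2 * s\<^sup>2 / N * (Q \<theta> * C \<theta>)" for \<theta>
  have nn: "0 \<le> Q \<theta>" "0 \<le> C \<theta>" for \<theta> by (auto simp: Q_def C_def sqform_nonneg)
  have res: "Q (restrict \<theta> I) = Q \<theta>" "C (restrict \<theta> I) = C \<theta>" for \<theta>
    by (auto simp: Q_def C_def sqform_restrict)
  have le: "hl \<theta> \<le> h \<theta>" for \<theta>
  proof -
    define x where "x = 2 * s * Q \<theta> / N"
    have x: "0 \<le> x" using nn pos by (simp add: x_def)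
    have "1 - x \<le> 1 / (1 + x)" using x by (simp add: field_simps)
    then have "(s * C \<theta>) * (1 - x) \<le> (s * C \<theta>) * (1 / (1 + x))"
      using nn pos by (intro mult_left_mono) auto
    moreover have "N / 2 * ln (1 + x) \<le> N / 2 * x"
      using x pos by (intro mult_left_mono ln_add_one_self_le_self) auto
    moreover have "N / 2 * x = s * Q \<theta>" using pos by (simp add: x_def)
    moreover have "s * C \<theta> * x = 2 * s\<^sup>2 / N * (Q \<theta> * C \<theta>)" by (simp add: x_def power2_eq_square)
    ultimately show ?thesis unfolding h_def hl_def x_def[symmetric] by (simp add: algebra_simps)
  qed
  have "(\<lambda>g. sqform A I c (\<lambda>p\<in>I. b * g p)) \<in> borel_measurable (gauss_vec I)" for A and c :: "'k \<Rightarrow> 'p \<Rightarrow> real"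
    unfolding sqform_restrict using sqform_measurable[of A I c "\<lambda>_. 0" b] by simp
  then have [measurable]: "(\<lambda>g. Q (\<lambda>p\<in>I. b * g p)) \<in> borel_measurable (gauss_vec I)"
    "(\<lambda>g. C (\<lambda>p\<in>I. b * g p)) \<in> borel_measurable (gauss_vec I)"
    unfolding Q_def C_def by blast+
  note q = gauss_vec_sqform(1,2)[OF I, where A = A and c = c and v = v and b = b, folded Q_def C_def, folded Qb_def Cb_def]
    gauss_vec_sqform(3,4)[OF I, where A = A and c = c and v = v and b = b and B = B and e = e, folded Q_def C_def, folded Qb_def Cb_def]
  note c = gauss_vec_sqform(1,2)[OF I, where A = B and c = e and v = v and b = b, folded Q_def C_def, folded Qb_def Cb_def]
  have meas: "(\<lambda>g. h (\<lambda>p\<in>I. b * g p)) \<in> borel_measurable (gauss_vec I)"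
    unfolding h_def by measurable
  have hlr: "hl (restrict \<theta> I) = hl \<theta>" for \<theta> unfolding hl_def res ..
  have int: "integrable (gauss_vec I) (\<lambda>g. hl (\<lambda>p. v p + b * g p))"
    unfolding hl_def using q(1,3) c(1) by simp
  have "(LINT g|gauss_vec I. hl (\<lambda>p. v p + b * g p)) = s * (Cb - Qb) -
     2 * s\<^sup>2 / N * (LINT g|gauss_vec I. Q (\<lambda>p. v p + b * g p) * C (\<lambda>p. v p + b * g p))"
    unfolding hl_def using q(1,2,3) c by simp
  moreover have "2 * s\<^sup>2 / N * (LINT g|gauss_vec I. Q (\<lambda>p. v p + b * g p) * C (\<lambda>p. v p + b * g p)) \<le> 2 * s\<^sup>2 / N * (3 * Qb * Cb)"
    using pos q(4) by (intro mult_left_mono) auto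
  ultimately have "s * (Cb - Qb) - 6 * s\<^sup>2 / N * (Qb * Cb) \<le> (LINT g|gauss_vec I. hl (\<lambda>p. v p + b * g p))"
    by simp
  then have "ennreal (exp (s * (Cb - Qb) - 6 * s\<^sup>2 / N * (Qb * Cb) - (\<Sum>p\<in>I. (v p)\<^sup>2) / (2 * b\<^sup>2))) \<le>
    ennreal (exp ((LINT g|gauss_vec I. hl (\<lambda>p. v p + b * g p)) - (\<Sum>p\<in>I. (v p)\<^sup>2) / (2 * b\<^sup>2)))"
    by (intro ennreal_leI) simp
  also have "\<dots> \<le> (\<integral>\<^sup>+g. ennreal (exp (h (\<lambda>p\<in>I. b * g p))) \<partial>gauss_vec I)"
    by (rule gauss_vec_variational[OF I pos(1) meas le hlr int])
  finally show ?thesis unfolding h_def .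
qed

lemma ln_one_plus_ge: "x - x\<^sup>2 \<le> ln (1 + x)" if "0 \<le> x" for x :: real
proof (cases "x \<le> 1")
  case True then show ?thesis using ln_one_plus_pos_lower_bound[OF that] by simp
next
  case False
  then have "x * 1 \<le> x * x" by (intro mult_left_mono) auto
  then have "x - x\<^sup>2 \<le> 0" by (simp add: power2_eq_square)
  also have "0 \<le> ln (1 + x)" using that by simp
  finally show ?thesis .
qed

text \<open>Here the exponent is \<open>- s C\<close> without damping, since its exponential is
  bounded. The logarithm now has to be estimated from below, by \<open>x - x^2\<close>, which is the
  source of the term in \<open>Qb * Qb\<close>.\<close>

lemma pac_bayes_lower:
  fixes c :: "'i \<Rightarrow> 'p \<Rightarrow> real" and e :: "'j \<Rightarrow> 'p \<Rightarrow> real" and v :: "'p \<Rightarrow> real" and b s N :: real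
    and A :: "'i set" and B :: "'j set" and I :: "'p set"
  assumes I: "finite I" and pos: "b > 0" "s > 0" "N > 0"
  defines "Q \<equiv> sqform A I c" and "C \<equiv> sqform B I e"
  defines "Qb \<equiv> Q v + b\<^sup>2 * sqtrace A I c" and "Cb \<equiv> C v + b\<^sup>2 * sqtrace B I e"
  shows "ennreal (exp (s * (Qb - Cb) - 6 * s\<^sup>2 / N * (Qb * Qb) - (\<Sum>p\<in>I. (v p)\<^sup>2) / (2 * b\<^sup>2))) \<le>
    (\<integral>\<^sup>+g. ennreal (exp (N / 2 * ln (1 + 2 * s * Q (\<lambda>p\<in>I. b * g p) / N) - s * C (\<lambda>p\<in>I. b * g p))) \<partial>gauss_vec I)"
proof -
  define h where "h \<theta> = N / 2 * ln (1 + 2 * s * Q \<theta> / N) - s * C \<theta>" for \<theta>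
  define hl where "hl \<theta> = s * (Q \<theta> - C \<theta>) - 2 * s\<^sup>2 / N * (Q \<theta> * Q \<theta>)" for \<theta>
  have nn: "0 \<le> Q \<theta>" "0 \<le> C \<theta>" for \<theta> by (auto simp: Q_def C_def sqform_nonneg)
  have res: "Q (restrict \<theta> I) = Q \<theta>" "C (restrict \<theta> I) = C \<theta>" for \<theta>
    by (auto simp: Q_def C_def sqform_restrict)
  have le: "hl \<theta> \<le> h \<theta>" for \<theta>
  proof -
    define x where "x = 2 * s * Q \<theta> / N"
    have x: "0 \<le> x" using nn pos by (simp add: x_def)
    have "N / 2 * (x - x\<^sup>2) \<le> N / 2 * ln (1 + x)"
      using x pos by (intro mult_left_mono ln_one_plus_ge) auto
    moreover have "N / 2 * x = s * Q \<theta>" using pos by (simp add: x_def)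
    moreover have "N / 2 * x\<^sup>2 = 2 * s\<^sup>2 / N * (Q \<theta> * Q \<theta>)" using pos by (simp add: x_def power2_eq_square)
    ultimately show ?thesis unfolding h_def hl_def x_def[symmetric] by (simp add: algebra_simps)
  qed
  have "(\<lambda>g. sqform A I c (\<lambda>p\<in>I. b * g p)) \<in> borel_measurable (gauss_vec I)" for A and c :: "'k \<Rightarrow> 'p \<Rightarrow> real"
    unfolding sqform_restrict using sqform_measurable[of A I c "\<lambda>_. 0" b] by simp
  then have [measurable]: "(\<lambda>g. Q (\<lambda>p\<in>I. b * g p)) \<in> borel_measurable (gauss_vec I)"
    "(\<lambda>g. C (\<lambda>p\<in>I. b * g p)) \<in> borel_measurable (gauss_vec I)"
    unfolding Q_def C_def by blast+
  note q = gauss_vec_sqform(1,2)[OF I, where A = A and c = c and v = v and b = b, folded Q_def C_def, folded Qb_def Cb_def]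
    gauss_vec_sqform(3,4)[OF I, where A = A and c = c and v = v and b = b and B = A and e = c, folded Q_def C_def, folded Qb_def Cb_def]
  note c = gauss_vec_sqform(1,2)[OF I, where A = B and c = e and v = v and b = b, folded Q_def C_def, folded Qb_def Cb_def]
  have meas: "(\<lambda>g. h (\<lambda>p\<in>I. b * g p)) \<in> borel_measurable (gauss_vec I)"
    unfolding h_def by measurable
  have hlr: "hl (restrict \<theta> I) = hl \<theta>" for \<theta> unfolding hl_def res ..
  have int: "integrable (gauss_vec I) (\<lambda>g. hl (\<lambda>p. v p + b * g p))"
    unfolding hl_def using q(1,3) c(1) by simp
  have "(LINT g|gauss_vec I. hl (\<lambda>p. v p + b * g p)) = s * (Qb - Cb) -
     2 * s\<^sup>2 / N * (LINT g|gauss_vec I. Q (\<lambda>p. v p + b * g p) * Q (\<lambda>p. v p + b * g p))"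
    unfolding hl_def using q(1,2,3) c by simp
  moreover have "2 * s\<^sup>2 / N * (LINT g|gauss_vec I. Q (\<lambda>p. v p + b * g p) * Q (\<lambda>p. v p + b * g p)) \<le> 2 * s\<^sup>2 / N * (3 * Qb * Qb)"
    using pos q(4) by (intro mult_left_mono) auto
  ultimately have "s * (Qb - Cb) - 6 * s\<^sup>2 / N * (Qb * Qb) \<le> (LINT g|gauss_vec I. hl (\<lambda>p. v p + b * g p))"
    by simp
  then have "ennreal (exp (s * (Qb - Cb) - 6 * s\<^sup>2 / N * (Qb * Qb) - (\<Sum>p\<in>I. (v p)\<^sup>2) / (2 * b\<^sup>2))) \<le>
    ennreal (exp ((LINT g|gauss_vec I. hl (\<lambda>p. v p + b * g p)) - (\<Sum>p\<in>I. (v p)\<^sup>2) / (2 * b\<^sup>2)))"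
    by (intro ennreal_leI) simp
  also have "\<dots> \<le> (\<integral>\<^sup>+g. ennreal (exp (h (\<lambda>p\<in>I. b * g p))) \<partial>gauss_vec I)"
    by (rule gauss_vec_variational[OF I pos(1) meas le hlr int])
  finally show ?thesis unfolding h_def .
qed

section \<open>Moments and exponential moments of Gaussian variables\<close>

lemma std_gauss_even_moment: "has_bochner_integral std_gauss (\<lambda>x. x ^ (2 * k)) (fact (2 * k) / (2 ^ k * fact k))"
proof -
  have "(LINT x|std_gauss. x ^ (2 * k)) = (LINT x|lborel. std_normal_density x * x ^ (2 * k))"
    unfolding std_gauss_def by (subst integral_density) auto
  then show ?thesis using std_gauss_moments(1)[of "2 * k"] integral_std_normal_moment_even[of k]
    by (simp add: has_bochner_integral_iff)
qed

text \<open>Integrals over any centered Gaussian, degenerate or not, become integrals over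
  \<open>std_gauss\<close>: the point mass at zero is the case \<open>\<sigma> = 0\<close>.\<close>

lemma (in prob_space) centered_gaussian_distr:
  assumes "centered_gaussian M X"
  obtains \<sigma> where "\<sigma> \<ge> 0"
    "\<And>f :: real \<Rightarrow> ennreal. f \<in> borel_measurable borel \<Longrightarrow> (\<integral>\<^sup>+\<omega>. f (X \<omega>) \<partial>M) = (\<integral>\<^sup>+x. f (\<sigma> * x) \<partial>std_gauss)"
proof -
  have [measurable]: "X \<in> borel_measurable M" using assms by (simp add: centered_gaussian_def)
  interpret sg: prob_space std_gauss by (rule prob_space_std_gauss)
  from assms consider \<sigma> where "\<sigma> > 0" "distributed M lborel X (normal_density 0 \<sigma>)" | "AE \<omega> in M. X \<omega> = 0"
    unfolding centered_gaussian_def by auto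
  then show thesis
  proof cases
    case (1 \<sigma>)
    have "(\<integral>\<^sup>+\<omega>. f (X \<omega>) \<partial>M) = (\<integral>\<^sup>+x. f (\<sigma> * x) \<partial>std_gauss)" if [measurable]: "f \<in> borel_measurable borel"
      for f :: "real \<Rightarrow> ennreal"
    proof -
      have "(\<integral>\<^sup>+\<omega>. f (X \<omega>) \<partial>M) = (\<integral>\<^sup>+x. normal_density 0 \<sigma> x * f x \<partial>lborel)"
        by (subst distributed_nn_integral[OF 1(2)]) auto
      also have "\<dots> = (\<integral>\<^sup>+x. ennreal \<sigma> * (normal_density 0 \<sigma> (\<sigma> * x) * f (\<sigma> * x)) \<partial>lborel)"
        using 1(1) by (subst nn_integral_real_affine[where c = \<sigma> and t = 0]) (auto simp: nn_integral_cmult)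
      also have "\<dots> = (\<integral>\<^sup>+x. std_normal_density x * f (\<sigma> * x) \<partial>lborel)"
      proof (intro nn_integral_cong)
        fix x
        have "\<sigma> * normal_density 0 \<sigma> (\<sigma> * x) = std_normal_density x"
          using 1(1) by (simp add: normal_density_def power_mult_distrib real_sqrt_mult)
        then show "ennreal \<sigma> * (normal_density 0 \<sigma> (\<sigma> * x) * f (\<sigma> * x)) = std_normal_density x * f (\<sigma> * x)"
          using 1(1) by (simp add: mult.assoc[symmetric] ennreal_mult[symmetric])
      qed
      also have "\<dots> = (\<integral>\<^sup>+x. f (\<sigma> * x) \<partial>std_gauss)"
        unfolding std_gauss_def by (subst nn_integral_density) auto
      finally show ?thesis .
    qed
    with 1 show thesis by (intro that[of \<sigma>]) auto
  next
    case 2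
    have "(\<integral>\<^sup>+\<omega>. f (X \<omega>) \<partial>M) = (\<integral>\<^sup>+x. f (0 * x) \<partial>std_gauss)" for f :: "real \<Rightarrow> ennreal"
    proof -
      have "(\<integral>\<^sup>+\<omega>. f (X \<omega>) \<partial>M) = (\<integral>\<^sup>+\<omega>. f 0 \<partial>M)"
        using 2 by (intro nn_integral_cong_AE) auto
      then show ?thesis by (simp add: emeasure_space_1 sg.emeasure_space_1[simplified])
    qed
    then show thesis by (intro that[of 0]) auto
  qed
qed

lemma (in prob_space) centered_gaussian_even_moment:
  assumes "centered_gaussian M X"
  shows "integrable M (\<lambda>\<omega>. X \<omega> ^ (2 * k))"
    and "(LINT \<omega>|M. X \<omega> ^ (2 * k)) = fact (2 * k) / (2 ^ k * fact k) * (LINT \<omega>|M. (X \<omega>)\<^sup>2) ^ k"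
proof -
  have [measurable]: "X \<in> borel_measurable M" using assms by (simp add: centered_gaussian_def)
  obtain \<sigma> where s: "\<sigma> \<ge> 0"
    "\<And>f :: real \<Rightarrow> ennreal. f \<in> borel_measurable borel \<Longrightarrow> (\<integral>\<^sup>+\<omega>. f (X \<omega>) \<partial>M) = (\<integral>\<^sup>+x. f (\<sigma> * x) \<partial>std_gauss)"
    using centered_gaussian_distr[OF assms] by blast
  have *: "has_bochner_integral M (\<lambda>\<omega>. X \<omega> ^ (2 * k)) (\<sigma> ^ (2 * k) * (fact (2 * k) / (2 ^ k * fact k)))" for k
  proof (rule has_bochner_integral_nn_integral)
    have "(\<integral>\<^sup>+\<omega>. ennreal (X \<omega> ^ (2 * k)) \<partial>M) = (\<integral>\<^sup>+x. ennreal ((\<sigma> * x) ^ (2 * k)) \<partial>std_gauss)"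
      by (rule s(2)) measurable
    also have "\<dots> = ennreal (\<sigma> ^ (2 * k) * (fact (2 * k) / (2 ^ k * fact k)))"
      using has_bochner_integral_mult_right[OF std_gauss_even_moment[of k], of "\<sigma> ^ (2 * k)"]
      by (subst nn_integral_eq_integral) (auto simp: has_bochner_integral_iff power_mult_distrib)
    finally show "(\<integral>\<^sup>+\<omega>. ennreal (X \<omega> ^ (2 * k)) \<partial>M) = ennreal (\<sigma> ^ (2 * k) * (fact (2 * k) / (2 ^ k * fact k)))" .
  qed (use s(1) in auto)
  have 1: "(LINT \<omega>|M. (X \<omega>)\<^sup>2) = \<sigma>\<^sup>2"
    using *[of 1] by (simp add: has_bochner_integral_iff)
  show "integrable M (\<lambda>\<omega>. X \<omega> ^ (2 * k))"
    and "(LINT \<omega>|M. X \<omega> ^ (2 * k)) = fact (2 * k) / (2 ^ k * fact k) * (LINT \<omega>|M. (X \<omega>)\<^sup>2) ^ k"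
    unfolding 1 using *[of k] by (auto simp: has_bochner_integral_iff power_mult)
qed

text \<open>Tilting the density by \<open>exp (a * x^2)\<close> gives \<open>r\<close> times the
  normal density of variance \<open>r^2 = 1 / (1 - 2 * a)\<close>, so the integral is
  \<open>r\<close>.\<close>

lemma std_gauss_exp_square:
  assumes "2 * a < 1"
  shows "(\<integral>\<^sup>+x. ennreal (exp (a * x\<^sup>2)) \<partial>std_gauss) = ennreal (1 / sqrt (1 - 2 * a))"
proof -
  define r where "r = 1 / sqrt (1 - 2 * a)"
  have r: "r > 0" using assms by (simp add: r_def)
  have "exp (a * x\<^sup>2) * std_normal_density x = r * normal_density 0 r x" for x
  proof -
    have r2: "1 / r\<^sup>2 = 1 - 2 * a" using assms by (simp add: r_def power_divide)
    have "- (x\<^sup>2 / (2 * r\<^sup>2)) = - (x\<^sup>2 / 2) * (1 / r\<^sup>2)" by simp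
    then have "- (x\<^sup>2 / (2 * r\<^sup>2)) = a * x\<^sup>2 - x\<^sup>2 / 2"
      unfolding r2 by (simp add: algebra_simps)
    then show ?thesis using r
      by (simp add: normal_density_def real_sqrt_mult exp_add[symmetric] field_simps)
  qed
  then have eq: "std_normal_density x * exp (a * x\<^sup>2) = r * normal_density 0 r x" for x
    by (simp add: mult.commute)
  have "(\<integral>\<^sup>+x. ennreal (exp (a * x\<^sup>2)) \<partial>std_gauss) = (\<integral>\<^sup>+x. ennreal (r * normal_density 0 r x) \<partial>lborel)"
    unfolding std_gauss_def by (subst nn_integral_density) (auto simp: ennreal_mult[symmetric] eq)
  also have "\<dots> = ennreal r"
    using r by (subst nn_integral_eq_integral) auto
  finally show ?thesis unfolding r_def .
qed

lemma (in prob_space) centered_gaussian_exp_square: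
  assumes X: "centered_gaussian M X" and a: "2 * a * (LINT \<omega>|M. (X \<omega>)\<^sup>2) < 1"
  shows "(\<integral>\<^sup>+\<omega>. ennreal (exp (a * (X \<omega>)\<^sup>2)) \<partial>M) = ennreal (1 / sqrt (1 - 2 * a * (LINT \<omega>|M. (X \<omega>)\<^sup>2)))"
proof -
  have [measurable]: "X \<in> borel_measurable M" using X by (simp add: centered_gaussian_def)
  obtain \<sigma> where s: "\<sigma> \<ge> 0"
    "\<And>f :: real \<Rightarrow> ennreal. f \<in> borel_measurable borel \<Longrightarrow> (\<integral>\<^sup>+\<omega>. f (X \<omega>) \<partial>M) = (\<integral>\<^sup>+x. f (\<sigma> * x) \<partial>std_gauss)"
    using centered_gaussian_distr[OF X] by blast
  have "(\<integral>\<^sup>+\<omega>. ennreal ((X \<omega>)\<^sup>2) \<partial>M) = (\<integral>\<^sup>+x. ennreal (0 + \<sigma>\<^sup>2 * (0 + 1 * x)\<^sup>2) \<partial>std_gauss)"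
    using s(2)[of "\<lambda>x. ennreal (x\<^sup>2)"] by (simp add: power_mult_distrib)
  also have "\<dots> = ennreal (\<sigma>\<^sup>2)"
    by (subst std_gauss_affine_moments(1)) auto
  finally have v: "(LINT \<omega>|M. (X \<omega>)\<^sup>2) = \<sigma>\<^sup>2"
    by (intro has_bochner_integral_integral_eq has_bochner_integral_nn_integral) auto
  have "(\<integral>\<^sup>+\<omega>. ennreal (exp (a * (X \<omega>)\<^sup>2)) \<partial>M) = (\<integral>\<^sup>+x. ennreal (exp ((a * \<sigma>\<^sup>2) * x\<^sup>2)) \<partial>std_gauss)"
    using s(2)[of "\<lambda>x. ennreal (exp (a * x\<^sup>2))"] by (simp add: power_mult_distrib mult_ac)
  also have "\<dots> = ennreal (1 / sqrt (1 - 2 * (a * \<sigma>\<^sup>2)))"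
    using a v by (intro std_gauss_exp_square) simp
  finally show ?thesis by (simp add: v mult.assoc)
qed

text \<open>Exponential moment of a scaled chi-square variable. The power is written through a
  logarithm because the normalizing terms of the PAC-Bayes exponents have that form and cancel
  it.\<close>

lemma (in prob_space) indep_gaussian_exp_sum:
  assumes J: "finite J" and ind: "indep_vars (\<lambda>_. borel) Z J"
    and Z: "\<And>n. n \<in> J \<Longrightarrow> centered_gaussian M (Z n)"
    and q: "\<And>n. n \<in> J \<Longrightarrow> (LINT \<omega>|M. (Z n \<omega>)\<^sup>2) = q" and a: "2 * a * q < 1"
  shows "(\<integral>\<^sup>+\<omega>. ennreal (exp (a * (\<Sum>n\<in>J. (Z n \<omega>)\<^sup>2))) \<partial>M) = ennreal (exp (- (real (card J) / 2 * ln (1 - 2 * a * q))))"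
proof -
  have ind': "indep_vars (\<lambda>_. borel) (\<lambda>n \<omega>. exp (a * (Z n \<omega>)\<^sup>2)) J"
    by (rule indep_vars_compose2[OF ind]) measurable
  define r where "r = 1 / sqrt (1 - 2 * a * q)"
  have r: "r > 0" using a by (simp add: r_def)
  have "(\<integral>\<^sup>+\<omega>. ennreal (exp (a * (\<Sum>n\<in>J. (Z n \<omega>)\<^sup>2))) \<partial>M) = (\<integral>\<^sup>+\<omega>. ennreal (\<Prod>n\<in>J. exp (a * (Z n \<omega>)\<^sup>2)) \<partial>M)"
    using J by (simp add: sum_distrib_left exp_sum)
  also have "\<dots> = (\<integral>\<^sup>+\<omega>. (\<Prod>n\<in>J. ennreal (exp (a * (Z n \<omega>)\<^sup>2))) \<partial>M)"
    by (intro nn_integral_cong prod_ennreal[symmetric]) auto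
  also have "\<dots> = (\<Prod>n\<in>J. \<integral>\<^sup>+\<omega>. ennreal (exp (a * (Z n \<omega>)\<^sup>2)) \<partial>M)"
  proof -
    have "(\<integral>\<^sup>+\<omega>. (\<Prod>n\<in>J. ennreal (exp (a * (Z n \<omega>)\<^sup>2))) \<partial>M) = (\<Prod>n\<in>J. \<integral>\<^sup>+\<omega>. ennreal (exp (a * (Z n \<omega>)\<^sup>2)) \<partial>M)"
      by (rule indep_vars_nn_integral[OF J]) (auto intro!: indep_vars_compose2[OF ind])
    then show ?thesis .
  qed
  also have "\<dots> = (\<Prod>n\<in>J. ennreal r)"
  proof (intro prod.cong refl)
    fix n assume n: "n \<in> J"
    show "(\<integral>\<^sup>+\<omega>. ennreal (exp (a * (Z n \<omega>)\<^sup>2)) \<partial>M) = ennreal r"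
      using centered_gaussian_exp_square[OF Z[OF n], of a] q[OF n] a by (simp add: r_def)
  qed
  also have "\<dots> = ennreal (r ^ card J)" using r by (simp add: ennreal_power)
  also have "r ^ card J = exp (real (card J) * ln r)"
    using r by (simp add: exp_of_nat_mult)
  also have "ln r = - (ln (1 - 2 * a * q) / 2)"
    using a by (simp add: r_def ln_div ln_sqrt)
  finally show ?thesis by simp
qed

text \<open>The upper inequality still contains \<open>D\<close> in its quadratic term. As
  \<open>Qb \<le> 2 * \<sigma>\<close>, that part is at most \<open>s * D\<close> times
  \<open>12 * s * \<sigma> / N\<close>, and the restriction
  \<open>s \<le> N / (24 * \<sigma>)\<close> makes it at most half of \<open>s * D\<close>, which is
  absorbed. The lower inequality has no such term.\<close>

lemma deviation_from_exponent:
  fixes D L s \<sigma> Qb N :: real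
  assumes pos: "s > 0" "\<sigma> > 0" "N > 0" and s: "s \<le> N / (24 * \<sigma>)"
    and Qb: "0 \<le> Qb" "Qb \<le> 2 * \<sigma>" and L: "0 \<le> L"
    and up: "s * D - 6 * s\<^sup>2 / N * (Qb * (D + Qb)) \<le> L"
    and low: "s * (- D) - 6 * s\<^sup>2 / N * (Qb * Qb) \<le> L"
  shows "\<bar>D\<bar> \<le> 48 * s * \<sigma>\<^sup>2 / N + 2 * L / s"
proof -
  have QQ: "Qb * Qb \<le> 4 * \<sigma>\<^sup>2" using mult_mono[OF Qb(2) Qb(2)] Qb pos by (simp add: power2_eq_square)
  have c: "0 \<le> 6 * s\<^sup>2 / N" using pos by simp
  have r0: "6 * s\<^sup>2 / N * (Qb * Qb) \<le> 6 * s\<^sup>2 / N * (4 * \<sigma>\<^sup>2)"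
    using QQ c by (rule mult_left_mono)
  have sd: "s * (24 * s * \<sigma>\<^sup>2 / N + L / s) = 6 * s\<^sup>2 / N * (4 * \<sigma>\<^sup>2) + L"
    using pos by (simp add: distrib_left power2_eq_square)
  have "s * (- D) \<le> s * (24 * s * \<sigma>\<^sup>2 / N + L / s)"
    using low r0 unfolding sd by linarith
  then have 1: "- D \<le> 24 * s * \<sigma>\<^sup>2 / N + L / s" by (rule mult_left_le_imp_le[OF _ pos(1)])
  have n1: "0 \<le> 24 * s * \<sigma>\<^sup>2 / N" "0 \<le> L / s" using pos L by auto
  have 2: "D \<le> 48 * s * \<sigma>\<^sup>2 / N + 2 * (L / s)"
  proof (cases "D \<le> 0")
    case False
    have "s * (24 * \<sigma>) \<le> N" using s pos by (simp add: field_simps)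
    then have "12 * s * \<sigma> / N \<le> 1 / 2" using pos by (simp add: field_simps)
    then have h: "s * D * (12 * s * \<sigma> / N) \<le> s * D * (1 / 2)"
      using False pos by (intro mult_left_mono) auto
    have "6 * s\<^sup>2 / N * (Qb * D) \<le> 6 * s\<^sup>2 / N * (2 * \<sigma> * D)"
      using Qb False by (intro mult_left_mono[OF _ c] mult_right_mono) auto
    also have "\<dots> = s * D * (12 * s * \<sigma> / N)" by (simp add: power2_eq_square)
    finally have "s * D / 2 \<le> 6 * s\<^sup>2 / N * (Qb * Qb) + L"
      using up h by (simp add: distrib_left)
    also have "\<dots> \<le> s * (24 * s * \<sigma>\<^sup>2 / N + L / s)"
      using r0 unfolding sd by linarith
    finally have "s * (D / 2) \<le> s * (24 * s * \<sigma>\<^sup>2 / N + L / s)" by simp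
    then have "D / 2 \<le> 24 * s * \<sigma>\<^sup>2 / N + L / s" by (rule mult_left_le_imp_le[OF _ pos(1)])
    moreover have "48 * s * \<sigma>\<^sup>2 / N = 2 * (24 * s * \<sigma>\<^sup>2 / N)" by simp
    ultimately show ?thesis by linarith
  qed (use n1 in linarith)
  have "2 * L / s = 2 * (L / s)" by simp
  moreover have "48 * s * \<sigma>\<^sup>2 / N = 2 * (24 * s * \<sigma>\<^sup>2 / N)" by simp
  ultimately show ?thesis using 1 2 n1 by linarith
qed

text \<open>PAC-Bayes: the exponential moment of the quadratic form at a fixed \<open>\<theta>\<close> is averaged over a
  Gaussian prior of covariance \<open>\<sigma>/\<tau>\<close>; shifting the prior to each \<open>v\<close> in the unit ball costs
  relative entropy at most \<open>\<tau>/(2\<sigma>)\<close>, uniformly in \<open>v\<close>. The trace part of the shifted average is removed by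
  comparing with \<open>v = 0\<close>.\<close>

lemma (in prob_space) gaussian_forms_deviation:
  fixes X :: "nat \<Rightarrow> 'p \<Rightarrow> 'a \<Rightarrow> real" and S :: "'p \<Rightarrow> 'p \<Rightarrow> real"
  assumes I: "finite I" and N: "1 \<le> N"
    and meas: "\<And>n p. n \<in> {1..N} \<Longrightarrow> p \<in> I \<Longrightarrow> X n p \<in> borel_measurable M"
    and gauss: "\<And>n \<theta>. n \<in> {1..N} \<Longrightarrow> centered_gaussian M (\<lambda>\<omega>. \<Sum>p\<in>I. \<theta> p * X n p \<omega>)"
    and cov: "\<And>n \<theta>. n \<in> {1..N} \<Longrightarrow> (LINT \<omega>|M. (\<Sum>p\<in>I. \<theta> p * X n p \<omega>)\<^sup>2) = (\<Sum>p\<in>I. \<Sum>p'\<in>I. \<theta> p * \<theta> p' * S p p')"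
    and indep: "\<And>\<theta>. indep_vars (\<lambda>_. borel) (\<lambda>n \<omega>. \<Sum>p\<in>I. \<theta> p * X n p \<omega>) {1..N}"
    and sym: "\<And>p p'. p \<in> I \<Longrightarrow> p' \<in> I \<Longrightarrow> S p p' = S p' p"
    and norm: "\<And>\<theta>. (\<Sum>p\<in>I. \<Sum>p'\<in>I. \<theta> p * \<theta> p' * S p p') \<le> \<sigma> * (\<Sum>p\<in>I. (\<theta> p)\<^sup>2)"
    and trace: "(\<Sum>p\<in>I. S p p) \<le> \<tau>"
    and pos: "\<sigma> > 0" "\<tau> > 0" "s > 0" and s: "s \<le> real N / (24 * \<sigma>)"
  shows "\<exists>Y \<in> borel_measurable M. (\<integral>\<^sup>+\<omega>. Y \<omega> \<partial>M) \<le> 2 \<and>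
    (\<forall>\<omega>. Y \<omega> < \<infinity> \<longrightarrow> (\<forall>v. (\<Sum>p\<in>I. (v p)\<^sup>2) \<le> 1 \<longrightarrow>
      \<bar>(\<Sum>n=1..N. (\<Sum>p\<in>I. v p * X n p \<omega>)\<^sup>2) / real N - (\<Sum>p\<in>I. \<Sum>p'\<in>I. v p * v p' * S p p')\<bar>
        \<le> 96 * s * \<sigma>\<^sup>2 / real N + 2 * (\<tau> / \<sigma> + 2 * ln (1 + enn2real (Y \<omega>))) / s))"
proof -
  have N0: "real N > 0" using N by simp
  obtain c where c: "\<And>x y. x \<in> I \<Longrightarrow> y \<in> I \<Longrightarrow> S x y = (\<Sum>i\<in>I. c i x * c i y)"
  proof -
    \<comment> \<open>Positive semidefiniteness is read off from the sample: the form is the second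
      moment of a linear combination.\<close>
    have "0 \<le> (\<Sum>x\<in>I. \<Sum>y\<in>I. \<theta> x * \<theta> y * S x y)" for \<theta>
    proof -
      have "(\<Sum>x\<in>I. \<Sum>y\<in>I. \<theta> x * \<theta> y * S x y) = (LINT \<omega>|M. (\<Sum>p\<in>I. \<theta> p * X 1 p \<omega>)\<^sup>2)"
        using cov[of 1 \<theta>] N by simp
      then show ?thesis by simp
    qed
    then show thesis using psd_gram_factorization[OF I, of S] sym that by blast
  qed
  \<comment> \<open>The prior scale balances two costs: smoothing raises the covariance form by at
    most \<open>b^2 * \<tau> = \<sigma>\<close>, no more than its own norm bound, and a shift by a
    unit vector costs \<open>1 / (2 * b^2) = \<tau> / (2 * \<sigma>)\<close>.\<close>
  define b where "b = sqrt (\<sigma> / \<tau>)"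
  have b: "b > 0" and b2: "b\<^sup>2 = \<sigma> / \<tau>" using pos by (auto simp: b_def)
  define Q where "Q = sqform I I c"
  have Q: "Q \<theta> = (\<Sum>p\<in>I. \<Sum>p'\<in>I. \<theta> p * \<theta> p' * S p p')" for \<theta>
  proof -
    have "(\<Sum>p\<in>I. \<Sum>p'\<in>I. \<theta> p * \<theta> p' * S p p') = (\<Sum>p\<in>I. \<Sum>p'\<in>I. \<Sum>i\<in>I. (c i p * \<theta> p) * (c i p' * \<theta> p'))"
      by (intro sum.cong refl) (auto simp: c sum_distrib_left mult_ac)
    also have "\<dots> = (\<Sum>p\<in>I. \<Sum>i\<in>I. \<Sum>p'\<in>I. (c i p * \<theta> p) * (c i p' * \<theta> p'))"
      by (intro sum.cong refl sum.swap)
    also have "\<dots> = (\<Sum>i\<in>I. \<Sum>p\<in>I. \<Sum>p'\<in>I. (c i p * \<theta> p) * (c i p' * \<theta> p'))"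
      by (rule sum.swap)
    also have "\<dots> = Q \<theta>" by (simp add: Q_def sqform_def power2_eq_square sum_product)
    finally show ?thesis ..
  qed
  have trQ: "sqtrace I I c \<le> \<tau>"
  proof -
    have "sqtrace I I c = (\<Sum>p\<in>I. \<Sum>i\<in>I. c i p * c i p)"
      unfolding sqtrace_def power2_eq_square by (rule sum.swap)
    also have "\<dots> = (\<Sum>p\<in>I. S p p)" by (intro sum.cong refl) (simp add: c)
    finally show ?thesis using trace by simp
  qed
  define e where "e \<omega> n p = X n p \<omega> / sqrt (real N)" for \<omega> n p
  define C where "C \<omega> = sqform {1..N} I (e \<omega>)" for \<omega>
  have C: "C \<omega> \<theta> = (\<Sum>n=1..N. (\<Sum>p\<in>I. \<theta> p * X n p \<omega>)\<^sup>2) / real N" for \<omega> \<theta>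
  proof -
    have eq: "(\<Sum>p\<in>I. e \<omega> n p * \<theta> p) = (\<Sum>p\<in>I. \<theta> p * X n p \<omega>) / sqrt (real N)" for n
      by (simp add: e_def sum_divide_distrib mult.commute)
    show ?thesis unfolding C_def sqform_def eq power_divide sum_divide_distrib[symmetric] by simp
  qed
  define x where "x \<theta> = 2 * s * Q \<theta> / real N" for \<theta>
  have x0: "0 \<le> x \<theta>" for \<theta> using pos by (simp add: x_def Q_def sqform_nonneg)
  \<comment> \<open>Both exponents are normalized so that, at each fixed \<theta>, their
    exponentials have mean exactly one over the sample.\<close>
  define h1 where "h1 \<omega> \<theta> = s / (1 + x \<theta>) * C \<omega> \<theta> - real N / 2 * ln (1 + x \<theta>)" for \<omega> \<theta>
  define h2 where "h2 \<omega> \<theta> = real N / 2 * ln (1 + x \<theta>) - s * C \<omega> \<theta>" for \<omega> \<theta>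
  have res: "Q (restrict \<theta> I) = Q \<theta>" "C \<omega> (restrict \<theta> I) = C \<omega> \<theta>" "x (restrict \<theta> I) = x \<theta>"
    "h1 \<omega> (restrict \<theta> I) = h1 \<omega> \<theta>" "h2 \<omega> (restrict \<theta> I) = h2 \<omega> \<theta>" for \<theta> \<omega>
    by (simp_all only: Q_def C_def x_def h1_def h2_def sqform_restrict)
  have mom: "(\<integral>\<^sup>+\<omega>. ennreal (exp (a * C \<omega> \<theta>)) \<partial>M) = ennreal (exp (- (real N / 2 * ln (1 - 2 * (a / real N) * Q \<theta>))))"
    if "2 * (a / real N) * Q \<theta> < 1" for a \<theta>
  proof -
    have "a * C \<omega> \<theta> = a / real N * (\<Sum>n=1..N. (\<Sum>p\<in>I. \<theta> p * X n p \<omega>)\<^sup>2)" for \<omega>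
      by (simp add: C)
    then show ?thesis
      using indep_gaussian_exp_sum[OF _ indep[of \<theta>] gauss[of _ \<theta>] _ that] cov by (simp add: Q)
  qed
  have 1: "(\<integral>\<^sup>+\<omega>. ennreal (exp (h1 \<omega> \<theta>)) \<partial>M) = 1" for \<theta>
  proof -
    have eq: "1 - 2 * (s / (1 + x \<theta>) / real N) * Q \<theta> = 1 / (1 + x \<theta>)"
    proof -
      have "2 * (s / (1 + x \<theta>) / real N) * Q \<theta> = x \<theta> / (1 + x \<theta>)" by (simp add: x_def)
      then show ?thesis using x0[of \<theta>] by (simp add: field_simps)
    qed
    have lt: "2 * (s / (1 + x \<theta>) / real N) * Q \<theta> < 1"
    proof -
      have "0 < 1 / (1 + x \<theta>)" using x0[of \<theta>] by simp
      then show ?thesis using eq by linarith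
    qed
    have "(\<integral>\<^sup>+\<omega>. ennreal (exp (h1 \<omega> \<theta>)) \<partial>M) =
        (\<integral>\<^sup>+\<omega>. ennreal (exp (- (real N / 2 * ln (1 + x \<theta>)))) * ennreal (exp (s / (1 + x \<theta>) * C \<omega> \<theta>)) \<partial>M)"
      by (intro nn_integral_cong) (simp add: h1_def ennreal_mult[symmetric] exp_add[symmetric])
    also have "\<dots> = ennreal (exp (- (real N / 2 * ln (1 + x \<theta>)))) * (\<integral>\<^sup>+\<omega>. ennreal (exp (s / (1 + x \<theta>) * C \<omega> \<theta>)) \<partial>M)"
      using meas by (intro nn_integral_cmult) (simp add: C)
    also have "\<dots> = ennreal (exp (- (real N / 2 * ln (1 + x \<theta>)))) * ennreal (exp (real N / 2 * ln (1 + x \<theta>)))"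
      unfolding mom[OF lt] eq using x0[of \<theta>] by (simp add: ln_div)
    finally show ?thesis by (simp add: ennreal_mult[symmetric] exp_add[symmetric])
  qed
  have 2: "(\<integral>\<^sup>+\<omega>. ennreal (exp (h2 \<omega> \<theta>)) \<partial>M) = 1" for \<theta>
  proof -
    have eq: "1 - 2 * (- s / real N) * Q \<theta> = 1 + x \<theta>" by (simp add: x_def)
    have lt: "2 * (- s / real N) * Q \<theta> < 1" using x0[of \<theta>] eq by linarith
    have "(\<integral>\<^sup>+\<omega>. ennreal (exp (h2 \<omega> \<theta>)) \<partial>M) =
        (\<integral>\<^sup>+\<omega>. ennreal (exp (real N / 2 * ln (1 + x \<theta>))) * ennreal (exp (- s * C \<omega> \<theta>)) \<partial>M)"
      by (intro nn_integral_cong) (simp add: h2_def ennreal_mult[symmetric] exp_add[symmetric])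
    also have "\<dots> = ennreal (exp (real N / 2 * ln (1 + x \<theta>))) * (\<integral>\<^sup>+\<omega>. ennreal (exp (- s * C \<omega> \<theta>)) \<partial>M)"
      using meas by (intro nn_integral_cmult) (simp add: C)
    also have "\<dots> = ennreal (exp (real N / 2 * ln (1 + x \<theta>))) * ennreal (exp (- (real N / 2 * ln (1 + x \<theta>))))"
      unfolding mom[OF lt] eq ..
    finally show ?thesis by (simp add: ennreal_mult[symmetric] exp_add[symmetric])
  qed
  interpret G: prob_space "gauss_vec I" by (rule prob_space_gauss_vec)
  interpret P: pair_sigma_finite M "gauss_vec I" ..
  have mX [measurable]: "(\<lambda>z. X n p (fst z)) \<in> borel_measurable (M \<Otimes>\<^sub>M gauss_vec I)" if "n \<in> {1..N}" "p \<in> I" for n p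
    using meas[OF that] by measurable
  have mg [measurable]: "(\<lambda>z. snd z p) \<in> borel_measurable (M \<Otimes>\<^sub>M gauss_vec I)" if "p \<in> I" for p
    using that by measurable
  have mC [measurable]: "(\<lambda>z. C (fst z) (\<lambda>p. b * snd z p)) \<in> borel_measurable (M \<Otimes>\<^sub>M gauss_vec I)"
    unfolding C by (intro borel_measurable_divide borel_measurable_sum borel_measurable_power
        borel_measurable_times mX mg borel_measurable_const)
  have mQ [measurable]: "(\<lambda>z. x (\<lambda>p. b * snd z p)) \<in> borel_measurable (M \<Otimes>\<^sub>M gauss_vec I)"
    unfolding x_def Q by (intro borel_measurable_divide borel_measurable_sum
        borel_measurable_times mg borel_measurable_const)
  have m1: "(\<lambda>z. ennreal (exp (h1 (fst z) (\<lambda>p. b * snd z p)))) \<in> borel_measurable (M \<Otimes>\<^sub>M gauss_vec I)"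
    unfolding h1_def by measurable
  have m2: "(\<lambda>z. ennreal (exp (h2 (fst z) (\<lambda>p. b * snd z p)))) \<in> borel_measurable (M \<Otimes>\<^sub>M gauss_vec I)"
    unfolding h2_def by measurable
  \<comment> \<open>One random variable for all directions: the prior average. Fubini exchanges it
    with the mean over the sample, which is one at every \<theta>.\<close>
  define Y1 where "Y1 \<omega> = (\<integral>\<^sup>+g. ennreal (exp (h1 \<omega> (\<lambda>p. b * g p))) \<partial>gauss_vec I)" for \<omega>
  define Y2 where "Y2 \<omega> = (\<integral>\<^sup>+g. ennreal (exp (h2 \<omega> (\<lambda>p. b * g p))) \<partial>gauss_vec I)" for \<omega>
  have mY [measurable]: "Y1 \<in> borel_measurable M" "Y2 \<in> borel_measurable M"
    using G.borel_measurable_nn_integral_fst[OF m1] G.borel_measurable_nn_integral_fst[OF m2]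
    by (simp_all add: Y1_def[abs_def] Y2_def[abs_def])
  have iY1: "(\<integral>\<^sup>+\<omega>. Y1 \<omega> \<partial>M) = 1"
    using P.Fubini'[of "\<lambda>\<omega> g. ennreal (exp (h1 \<omega> (\<lambda>p. b * g p)))"] m1
    by (simp add: Y1_def split_beta' 1 G.emeasure_space_1)
  have iY2: "(\<integral>\<^sup>+\<omega>. Y2 \<omega> \<partial>M) = 1"
    using P.Fubini'[of "\<lambda>\<omega> g. ennreal (exp (h2 \<omega> (\<lambda>p. b * g p)))"] m2
    by (simp add: Y2_def split_beta' 2 G.emeasure_space_1)
  define Y where "Y \<omega> = Y1 \<omega> + Y2 \<omega>" for \<omega>
  have mYY: "Y \<in> borel_measurable M" unfolding Y_def[abs_def] by measurable
  have iY: "(\<integral>\<^sup>+\<omega>. Y \<omega> \<partial>M) \<le> 2"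
    unfolding Y_def by (subst nn_integral_add) (auto simp: iY1 iY2)
  have main: "\<bar>(C \<omega> v + b\<^sup>2 * sqtrace {1..N} I (e \<omega>)) - (Q v + b\<^sup>2 * sqtrace I I c)\<bar>
      \<le> 48 * s * \<sigma>\<^sup>2 / real N + (\<tau> / \<sigma> + 2 * ln (1 + enn2real (Y \<omega>))) / s"
    if fin: "Y \<omega> < \<infinity>" and v: "(\<Sum>p\<in>I. (v p)\<^sup>2) \<le> 1" for \<omega> v
  proof -
    define Qb where "Qb = Q v + b\<^sup>2 * sqtrace I I c"
    define Cb where "Cb = C \<omega> v + b\<^sup>2 * sqtrace {1..N} I (e \<omega>)"
    define L where "L = \<tau> / (2 * \<sigma>) + ln (1 + enn2real (Y \<omega>))"
    have Qb: "0 \<le> Qb" "Qb \<le> 2 * \<sigma>"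
    proof -
      show "0 \<le> Qb" by (simp add: Qb_def Q_def sqform_nonneg sqtrace_nonneg)
      have "\<sigma> * (\<Sum>p\<in>I. (v p)\<^sup>2) \<le> \<sigma> * 1" using v pos by (intro mult_left_mono) auto
      then have "Q v \<le> \<sigma> * 1" using norm[of v] unfolding Q by linarith
      moreover have "b\<^sup>2 * sqtrace I I c \<le> b\<^sup>2 * \<tau>" using trQ by (intro mult_left_mono) auto
      ultimately show "Qb \<le> 2 * \<sigma>" using pos by (simp add: Qb_def b2)
    qed
    have V: "(\<Sum>p\<in>I. (v p)\<^sup>2) / (2 * b\<^sup>2) \<le> \<tau> / (2 * \<sigma>)"
    proof -
      have "(\<Sum>p\<in>I. (v p)\<^sup>2) / (2 * b\<^sup>2) \<le> 1 / (2 * b\<^sup>2)" using v b by (intro divide_right_mono) auto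
      then show ?thesis by (simp add: b2)
    qed
    \<comment> \<open>Adding 1 inside the logarithm keeps it nonnegative when \<open>Y\<close> is
      small.\<close>
    have ln_bound: "y \<le> L" if "ennreal (exp (y - (\<Sum>p\<in>I. (v p)\<^sup>2) / (2 * b\<^sup>2))) \<le> Y \<omega>" for y
    proof -
      have "ennreal (exp (y - (\<Sum>p\<in>I. (v p)\<^sup>2) / (2 * b\<^sup>2))) \<le> ennreal (enn2real (Y \<omega>))"
        using that fin by simp
      then have "exp (y - (\<Sum>p\<in>I. (v p)\<^sup>2) / (2 * b\<^sup>2)) \<le> 1 + enn2real (Y \<omega>)"
        by (simp add: ennreal_le_iff)
      then have "y - (\<Sum>p\<in>I. (v p)\<^sup>2) / (2 * b\<^sup>2) \<le> ln (1 + enn2real (Y \<omega>))"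
        by (subst ln_ge_iff) (auto simp: add_pos_nonneg)
      then show ?thesis using V by (simp add: L_def)
    qed
    have up: "s * (Cb - Qb) - 6 * s\<^sup>2 / real N * (Qb * ((Cb - Qb) + Qb)) \<le> L"
    proof (rule ln_bound)
      have "ennreal (exp (s * (Cb - Qb) - 6 * s\<^sup>2 / real N * (Qb * Cb) - (\<Sum>p\<in>I. (v p)\<^sup>2) / (2 * b\<^sup>2))) \<le> Y1 \<omega>"
        using pac_bayes_upper[OF I b pos(3) N0, where A = I and c = c and B = "{1..N}" and e = "e \<omega>" and v = v]
        unfolding Q_def[symmetric] C_def[symmetric] x_def[symmetric] Qb_def[symmetric] Cb_def[symmetric] h1_def[symmetric] res
        by (simp add: Y1_def)
      also have "\<dots> \<le> Y \<omega>" by (simp add: Y_def)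
      finally show "ennreal (exp (s * (Cb - Qb) - 6 * s\<^sup>2 / real N * (Qb * ((Cb - Qb) + Qb)) - (\<Sum>p\<in>I. (v p)\<^sup>2) / (2 * b\<^sup>2))) \<le> Y \<omega>"
        by simp
    qed
    have low: "s * (- (Cb - Qb)) - 6 * s\<^sup>2 / real N * (Qb * Qb) \<le> L"
    proof (rule ln_bound)
      have "ennreal (exp (s * (Qb - Cb) - 6 * s\<^sup>2 / real N * (Qb * Qb) - (\<Sum>p\<in>I. (v p)\<^sup>2) / (2 * b\<^sup>2))) \<le> Y2 \<omega>"
        using pac_bayes_lower[OF I b pos(3) N0, where A = I and c = c and B = "{1..N}" and e = "e \<omega>" and v = v]
        unfolding Q_def[symmetric] C_def[symmetric] x_def[symmetric] Qb_def[symmetric] Cb_def[symmetric] h2_def[symmetric] res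
        by (simp add: Y2_def)
      also have "\<dots> \<le> Y \<omega>" by (simp add: Y_def)
      finally show "ennreal (exp (s * (- (Cb - Qb)) - 6 * s\<^sup>2 / real N * (Qb * Qb) - (\<Sum>p\<in>I. (v p)\<^sup>2) / (2 * b\<^sup>2))) \<le> Y \<omega>"
        by simp
    qed
    have L: "0 \<le> L" using pos by (simp add: L_def add_nonneg_nonneg)
    have "\<bar>Cb - Qb\<bar> \<le> 48 * s * \<sigma>\<^sup>2 / real N + 2 * L / s"
      by (rule deviation_from_exponent[OF pos(3) pos(1) N0 s Qb L up low])
    also have "2 * L = \<tau> / \<sigma> + 2 * ln (1 + enn2real (Y \<omega>))" by (simp add: L_def)
    finally show ?thesis unfolding Cb_def Qb_def .
  qed
  show ?thesis
  proof (intro bexI[of _ Y] conjI allI impI iY mYY)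
    fix \<omega> and v :: "'p \<Rightarrow> real" assume fin: "Y \<omega> < \<infinity>" and v: "(\<Sum>p\<in>I. (v p)\<^sup>2) \<le> 1"
    have 0: "C \<omega> (\<lambda>_. 0) = 0" "Q (\<lambda>_. 0) = 0" by (auto simp: C Q)
    define B where "B = \<tau> / \<sigma> + 2 * ln (1 + enn2real (Y \<omega>))"
    have m0: "\<bar>(0 + b\<^sup>2 * sqtrace {1..N} I (e \<omega>)) - (0 + b\<^sup>2 * sqtrace I I c)\<bar> \<le> 48 * s * \<sigma>\<^sup>2 / real N + B / s"
      using main[OF fin, of "\<lambda>_. 0"] unfolding 0 B_def by simp
    have "\<bar>C \<omega> v - Q v\<bar> \<le> 2 * (48 * s * \<sigma>\<^sup>2 / real N + B / s)"
    proof -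
      have "\<bar>x - y\<bar> \<le> 2 * R" if "\<bar>(x + t) - (y + u)\<bar> \<le> R" "\<bar>(0 + t) - (0 + u)\<bar> \<le> R" for x y t u R :: real
        using that by arith
      from this[OF main[OF fin v, folded B_def] m0] show ?thesis .
    qed
    also have "\<dots> = 96 * s * \<sigma>\<^sup>2 / real N + 2 * B / s" by (simp add: distrib_left)
    finally show "\<bar>(\<Sum>n=1..N. (\<Sum>p\<in>I. v p * X n p \<omega>)\<^sup>2) / real N - (\<Sum>p\<in>I. \<Sum>p'\<in>I. v p * v p' * S p p')\<bar>
        \<le> 96 * s * \<sigma>\<^sup>2 / real N + 2 * (\<tau> / \<sigma> + 2 * ln (1 + enn2real (Y \<omega>))) / s"
      unfolding C Q B_def .
  qed
qed

section \<open>Quadratic forms of integral operators on the unit cube\<close>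

abbreviation cube :: "(real ^ 'n::finite) measure" where
  "cube \<equiv> lebesgue_on unit_cube"

abbreviation cube_sq :: "((real ^ 'n::finite) \<times> (real ^ 'n)) measure" where
  "cube_sq \<equiv> cube \<Otimes>\<^sub>M cube"

lemma unit_cube_eq_cbox: "unit_cube = cbox (0 :: real ^ 'n::finite) 1"
  by (auto simp: unit_cube_def mem_box_cart)

lemma compact_unit_cube: "compact (unit_cube :: (real ^ 'n::finite) set)"
  by (simp add: unit_cube_eq_cbox compact_cbox)

lemma measure_cbox_cart:
  fixes a b :: "real ^ 'n::finite"
  assumes "\<And>i. a $ i \<le> b $ i"
  shows "measure lebesgue (cbox a b) = (\<Prod>i\<in>UNIV. b $ i - a $ i)"
proof -
  have "a \<in> cbox a b" using assms by (simp add: mem_box_cart)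
  then have "cbox a b \<noteq> {}" by blast
  then show ?thesis using content_cbox_cart by (simp add: measure_completion)
qed

lemma prob_space_cube: "prob_space (cube :: (real ^ 'n::finite) measure)"
proof
  have "emeasure lebesgue (cbox (0 :: real ^ 'n) 1) = 1"
    using measure_cbox_cart[of "0 :: real ^ 'n" 1] emeasure_eq_measure2[OF lmeasurable_cbox, of "0 :: real ^ 'n" 1]
    by simp
  then show "emeasure (cube :: (real ^ 'n) measure) (space cube) = 1"
    by (simp add: emeasure_restrict_space unit_cube_eq_cbox)
qed

interpretation cube: prob_space "cube :: (real ^ 'n::finite) measure"
  by (rule prob_space_cube)

interpretation cube2: pair_prob_space "cube :: (real ^ 'n::finite) measure" "cube :: (real ^ 'n::finite) measure" ..

section \<open>Square-integrable functions on the cube\<close>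

lemma L2_measurable: "f \<in> L2 \<Longrightarrow> f \<in> borel_measurable cube"
  and L2_integrable_square: "f \<in> L2 \<Longrightarrow> integrable cube (\<lambda>x. (f x)\<^sup>2)"
  by (auto simp: L2_def)

lemma L2_integrable_mult: "f \<in> L2 \<Longrightarrow> g \<in> L2 \<Longrightarrow> integrable cube (\<lambda>x. f x * g x)"
  by (rule integrable_mult_L2) (auto simp: L2_def)

lemma L2_add: "f \<in> L2 \<Longrightarrow> g \<in> L2 \<Longrightarrow> (\<lambda>x. f x + g x) \<in> L2"
proof -
  assume f: "f \<in> L2" and g: "g \<in> L2"
  have "(\<lambda>x. (f x + g x)\<^sup>2) = (\<lambda>x. (f x)\<^sup>2 + (g x)\<^sup>2 + 2 * (f x * g x))"
    by (auto simp: power2_eq_square algebra_simps)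
  then show ?thesis using f g L2_integrable_mult[OF f g] by (auto simp: L2_def)
qed

lemma L2_cmult: "f \<in> L2 \<Longrightarrow> (\<lambda>x. c * f x) \<in> L2"
  by (auto simp: L2_def power_mult_distrib)

lemma L2_diff: "f \<in> L2 \<Longrightarrow> g \<in> L2 \<Longrightarrow> (\<lambda>x. f x - g x) \<in> L2"
  using L2_add[of f "\<lambda>x. -1 * g x"] L2_cmult[of g "-1"] by simp

lemma L2_zero: "(\<lambda>x. 0) \<in> L2"
  by (auto simp: L2_def)

lemma L2_sum: "(\<And>i. i \<in> A \<Longrightarrow> f i \<in> L2) \<Longrightarrow> (\<lambda>x. \<Sum>i\<in>A. f i x) \<in> L2"
  by (induction A rule: infinite_finite_induct) (auto intro: L2_zero L2_add)

lemma L2_bounded_mult: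
  fixes w f :: "real ^ 'n::finite \<Rightarrow> real"
  assumes f: "f \<in> L2" and w: "w \<in> borel_measurable cube" and b: "\<And>x. x \<in> unit_cube \<Longrightarrow> \<bar>w x\<bar> \<le> c"
  shows "(\<lambda>x. w x * f x) \<in> L2"
proof -
  note [measurable] = w L2_measurable[OF f]
  have "integrable cube (\<lambda>x. (w x * f x)\<^sup>2)"
  proof (rule Bochner_Integration.integrable_bound[where f = "\<lambda>x. c\<^sup>2 * (f x)\<^sup>2"])
    show "AE x in cube. norm ((w x * f x)\<^sup>2) \<le> norm (c\<^sup>2 * (f x)\<^sup>2)"
    proof (rule AE_I2)
      fix x :: "real ^ 'n" assume "x \<in> space cube"
      then have "\<bar>w x\<bar>\<^sup>2 \<le> c\<^sup>2" using b by (intro power_mono) auto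
      then show "norm ((w x * f x)\<^sup>2) \<le> norm (c\<^sup>2 * (f x)\<^sup>2)"
        by (auto simp: power_mult_distrib intro: mult_right_mono)
    qed
  qed (use L2_integrable_square[OF f] in auto)
  then show ?thesis by (auto simp: L2_def)
qed

lemma L2_bounded:
  fixes w :: "real ^ 'n::finite \<Rightarrow> real"
  assumes "w \<in> borel_measurable cube" "\<And>x. x \<in> unit_cube \<Longrightarrow> \<bar>w x\<bar> \<le> c"
  shows "w \<in> L2"
  using L2_bounded_mult[of "\<lambda>_. 1" w c] assms by (simp add: L2_def)

lemma inner_L2_self_nonneg: "0 \<le> inner_L2 f f"
  by (simp add: inner_L2_def)

lemma inner_L2_self: "inner_L2 f f = (LINT x|cube. (f x)\<^sup>2)"
  by (simp add: inner_L2_def power2_eq_square)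

lemma norm_L2_square: "(norm_L2 f)\<^sup>2 = inner_L2 f f"
  by (simp add: norm_L2_def inner_L2_self_nonneg)

lemma norm_L2_nonneg: "0 \<le> norm_L2 f"
  by (simp add: norm_L2_def inner_L2_self_nonneg)

lemma inner_L2_Cauchy_Schwarz: "f \<in> L2 \<Longrightarrow> g \<in> L2 \<Longrightarrow> (inner_L2 f g)\<^sup>2 \<le> inner_L2 f f * inner_L2 g g"
  using Cauchy_Schwarz_integral(2)[of f cube g] by (auto simp: L2_def inner_L2_self) (simp add: inner_L2_def)

lemma inner_L2_le_norm: "f \<in> L2 \<Longrightarrow> g \<in> L2 \<Longrightarrow> \<bar>inner_L2 f g\<bar> \<le> norm_L2 f * norm_L2 g"
  using inner_L2_Cauchy_Schwarz[of f g]
  by (intro abs_le_square_iff[THEN iffD2, THEN order_trans[OF _ eq_refl[OF abs_of_nonneg]]])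
     (auto simp: power_mult_distrib norm_L2_square norm_L2_nonneg)

lemma inner_L2_commute: "inner_L2 f g = inner_L2 g f"
  by (simp add: inner_L2_def mult.commute)

lemma inner_L2_add_left: "f \<in> L2 \<Longrightarrow> g \<in> L2 \<Longrightarrow> h \<in> L2 \<Longrightarrow> inner_L2 (\<lambda>x. f x + g x) h = inner_L2 f h + inner_L2 g h"
  by (simp add: inner_L2_def L2_integrable_mult distrib_right)

lemma inner_L2_diff_left: "f \<in> L2 \<Longrightarrow> g \<in> L2 \<Longrightarrow> h \<in> L2 \<Longrightarrow> inner_L2 (\<lambda>x. f x - g x) h = inner_L2 f h - inner_L2 g h"
  by (simp add: inner_L2_def L2_integrable_mult left_diff_distrib)

lemma inner_L2_cmult_left: "inner_L2 (\<lambda>x. c * f x) h = c * inner_L2 f h"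
  by (simp add: inner_L2_def mult.assoc)

lemma inner_L2_sum_left: "(\<And>i. i \<in> A \<Longrightarrow> f i \<in> L2) \<Longrightarrow> h \<in> L2 \<Longrightarrow> inner_L2 (\<lambda>x. \<Sum>i\<in>A. f i x) h = (\<Sum>i\<in>A. inner_L2 (f i) h)"
  by (simp add: inner_L2_def L2_integrable_mult sum_distrib_right)

lemma norm_L2_cong: "(\<And>x. x \<in> unit_cube \<Longrightarrow> f x = g x) \<Longrightarrow> norm_L2 f = norm_L2 g"
  unfolding norm_L2_def inner_L2_def by (intro arg_cong[where f = sqrt] Bochner_Integration.integral_cong) auto

lemma norm_L2_cong_AE: "AE x in cube. f x = g x \<Longrightarrow> f \<in> borel_measurable cube \<Longrightarrow> g \<in> borel_measurable cube \<Longrightarrow> norm_L2 f = norm_L2 g"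
  unfolding norm_L2_def inner_L2_def by (intro arg_cong[where f = sqrt] integral_cong_AE) auto

lemma inner_L2_expand:
  assumes f: "f \<in> L2" and g: "g \<in> L2"
  shows "inner_L2 (\<lambda>x. f x + g x) (\<lambda>x. f x + g x) = inner_L2 f f + 2 * inner_L2 f g + inner_L2 g g"
    and "inner_L2 (\<lambda>x. f x - g x) (\<lambda>x. f x - g x) = inner_L2 f f - 2 * inner_L2 f g + inner_L2 g g"
proof -
  note i = L2_integrable_mult[OF f f] L2_integrable_mult[OF f g] L2_integrable_mult[OF g g]
  have 1: "(f x + g x) * (f x + g x) = f x * f x + 2 * (f x * g x) + g x * g x"
    and 2: "(f x - g x) * (f x - g x) = f x * f x - 2 * (f x * g x) + g x * g x" for x
    by (simp_all add: algebra_simps)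
  show "inner_L2 (\<lambda>x. f x + g x) (\<lambda>x. f x + g x) = inner_L2 f f + 2 * inner_L2 f g + inner_L2 g g"
    and "inner_L2 (\<lambda>x. f x - g x) (\<lambda>x. f x - g x) = inner_L2 f f - 2 * inner_L2 f g + inner_L2 g g"
    unfolding inner_L2_def 1 2 using i by simp_all
qed

lemma norm_L2_triangle:
  assumes "f \<in> L2" "g \<in> L2"
  shows "norm_L2 (\<lambda>x. f x + g x) \<le> norm_L2 f + norm_L2 g"
proof (rule power2_le_imp_le)
  have "(norm_L2 (\<lambda>x. f x + g x))\<^sup>2 = inner_L2 f f + 2 * inner_L2 f g + inner_L2 g g"
    by (simp add: norm_L2_square inner_L2_expand[OF assms])
  also have "\<dots> \<le> (norm_L2 f + norm_L2 g)\<^sup>2"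
    using inner_L2_le_norm[OF assms] by (simp add: power2_sum norm_L2_square)
  finally show "(norm_L2 (\<lambda>x. f x + g x))\<^sup>2 \<le> (norm_L2 f + norm_L2 g)\<^sup>2" .
qed (simp add: norm_L2_nonneg)

section \<open>Hilbert-Schmidt kernels and their quadratic forms\<close>

text \<open>Sample kernels are built from paths that are only square-integrable, so no pointwise
  bound is available. Square-integrability on the product is what tensor products of paths have and
  what sums and bounded weights preserve.\<close>

definition hs_kernel :: "(real ^ 'n::finite \<Rightarrow> real ^ 'n \<Rightarrow> real) \<Rightarrow> bool" where
  "hs_kernel T \<longleftrightarrow> (\<lambda>z. T (fst z) (snd z)) \<in> borel_measurable (cube \<Otimes>\<^sub>M cube) \<and>
     integrable (cube \<Otimes>\<^sub>M cube) (\<lambda>z. (T (fst z) (snd z))\<^sup>2)"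

text \<open>The form \<open>\<langle>T f, g\<rangle>\<close> as one integral over the square.
  Linearity in the kernel then holds as an identity of integrals, whereas \<open>integral_op\<close>
  takes default values on a null set of rows.\<close>

definition bil :: "(real ^ 'n::finite \<Rightarrow> real ^ 'n \<Rightarrow> real) \<Rightarrow> (real ^ 'n \<Rightarrow> real) \<Rightarrow> (real ^ 'n \<Rightarrow> real) \<Rightarrow> real" where
  "bil T f g = (LINT z|cube_sq. T (fst z) (snd z) * (g (fst z) * f (snd z)))"

lemma hs_kernel_bounded:
  fixes T :: "real ^ 'n::finite \<Rightarrow> real ^ 'n \<Rightarrow> real"
  assumes "(\<lambda>z. T (fst z) (snd z)) \<in> borel_measurable (cube \<Otimes>\<^sub>M cube)"
    and b: "\<And>x y. x \<in> unit_cube \<Longrightarrow> y \<in> unit_cube \<Longrightarrow> \<bar>T x y\<bar> \<le> c"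
  shows "hs_kernel T"
  unfolding hs_kernel_def
proof
  note [measurable] = assms(1)
  show "integrable (cube \<Otimes>\<^sub>M cube) (\<lambda>z. (T (fst z) (snd z))\<^sup>2)"
  proof (rule cube2.P.integrable_const_bound[where B = "c\<^sup>2"])
    show "AE z in cube \<Otimes>\<^sub>M cube. norm ((T (fst z) (snd z))\<^sup>2) \<le> c\<^sup>2"
    proof (rule AE_I2)
      fix z :: "(real ^ 'n) \<times> (real ^ 'n)" assume "z \<in> space (cube \<Otimes>\<^sub>M cube)"
      then have "\<bar>T (fst z) (snd z)\<bar>\<^sup>2 \<le> c\<^sup>2" using b by (intro power_mono) (auto simp: space_pair_measure)
      then show "norm ((T (fst z) (snd z))\<^sup>2) \<le> c\<^sup>2" by simp
    qed
  qed measurable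
qed (rule assms(1))

lemma hs_kernel_mult_bounded:
  fixes T :: "real ^ 'n::finite \<Rightarrow> real ^ 'n \<Rightarrow> real"
  assumes T: "hs_kernel T" and w: "(\<lambda>z. w (fst z) (snd z)) \<in> borel_measurable (cube \<Otimes>\<^sub>M cube)"
    and b: "\<And>x y. x \<in> unit_cube \<Longrightarrow> y \<in> unit_cube \<Longrightarrow> \<bar>w x y\<bar> \<le> c"
  shows "hs_kernel (\<lambda>x y. T x y * w x y)"
proof -
  have [measurable]: "(\<lambda>z. T (fst z) (snd z)) \<in> borel_measurable (cube \<Otimes>\<^sub>M cube)" using T by (simp add: hs_kernel_def)
  note [measurable] = w
  have "integrable (cube \<Otimes>\<^sub>M cube) (\<lambda>z. (T (fst z) (snd z) * w (fst z) (snd z))\<^sup>2)"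
  proof (rule Bochner_Integration.integrable_bound[where f = "\<lambda>z. c\<^sup>2 * (T (fst z) (snd z))\<^sup>2"])
    show "AE z in cube \<Otimes>\<^sub>M cube. norm ((T (fst z) (snd z) * w (fst z) (snd z))\<^sup>2) \<le> norm (c\<^sup>2 * (T (fst z) (snd z))\<^sup>2)"
    proof (rule AE_I2)
      fix z :: "(real ^ 'n) \<times> (real ^ 'n)" assume "z \<in> space (cube \<Otimes>\<^sub>M cube)"
      then have "\<bar>w (fst z) (snd z)\<bar>\<^sup>2 \<le> c\<^sup>2" using b by (intro power_mono) (auto simp: space_pair_measure)
      then have "(w (fst z) (snd z))\<^sup>2 \<le> c\<^sup>2" by simp
      then show "norm ((T (fst z) (snd z) * w (fst z) (snd z))\<^sup>2) \<le> norm (c\<^sup>2 * (T (fst z) (snd z))\<^sup>2)"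
        unfolding power_mult_distrib using mult_right_mono[of "(w (fst z) (snd z))\<^sup>2" "c\<^sup>2" "(T (fst z) (snd z))\<^sup>2"]
        by (simp add: mult.commute)
    qed
  qed (use T in \<open>auto simp: hs_kernel_def\<close>)
  then show ?thesis by (simp add: hs_kernel_def)
qed

lemma hs_kernel_tensor:
  assumes f: "f \<in> L2" and g: "g \<in> L2"
  shows "hs_kernel (\<lambda>x y. f x * g y)"
proof -
  note [measurable] = L2_measurable[OF f] L2_measurable[OF g]
  have "integrable (cube \<Otimes>\<^sub>M cube) (\<lambda>z. (f (fst z) * g (snd z))\<^sup>2)"
  proof (rule cube2.Fubini_integrable)
    show "integrable cube (\<lambda>x. LINT y|cube. norm ((f (fst (x, y)) * g (snd (x, y)))\<^sup>2))"
      using L2_integrable_square[OF f] by (simp add: power_mult_distrib)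
  qed (use L2_integrable_square[OF g] in \<open>auto simp: power_mult_distrib\<close>)
  then show ?thesis by (simp add: hs_kernel_def)
qed

lemma hs_kernel_add:
  assumes T: "hs_kernel T" "hs_kernel T'"
  shows "hs_kernel (\<lambda>x y. T x y + T' x y)"
proof -
  have [measurable]: "(\<lambda>z. T (fst z) (snd z)) \<in> borel_measurable (cube \<Otimes>\<^sub>M cube)" "(\<lambda>z. T' (fst z) (snd z)) \<in> borel_measurable (cube \<Otimes>\<^sub>M cube)"
    using T by (auto simp: hs_kernel_def)
  have i: "integrable (cube \<Otimes>\<^sub>M cube) (\<lambda>z. T (fst z) (snd z) * T' (fst z) (snd z))"
    by (rule integrable_mult_L2) (use T in \<open>auto simp: hs_kernel_def\<close>)
  have "(\<lambda>z. (T (fst z) (snd z) + T' (fst z) (snd z))\<^sup>2) =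
    (\<lambda>z. (T (fst z) (snd z))\<^sup>2 + (T' (fst z) (snd z))\<^sup>2 + 2 * (T (fst z) (snd z) * T' (fst z) (snd z)))"
    by (auto simp: power2_eq_square algebra_simps)
  then show ?thesis using T i by (auto simp: hs_kernel_def)
qed

lemma hs_kernel_cmult: "hs_kernel T \<Longrightarrow> hs_kernel (\<lambda>x y. c * T x y)"
  by (auto simp: hs_kernel_def power_mult_distrib)

lemma hs_kernel_diff: "hs_kernel T \<Longrightarrow> hs_kernel T' \<Longrightarrow> hs_kernel (\<lambda>x y. T x y - T' x y)"
  using hs_kernel_add[of T "\<lambda>x y. -1 * T' x y"] hs_kernel_cmult[of T' "-1"] by simp

lemma hs_kernel_sum: "(\<And>i. i \<in> A \<Longrightarrow> hs_kernel (T i)) \<Longrightarrow> hs_kernel (\<lambda>x y. \<Sum>i\<in>A. T i x y)"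
proof (induction A rule: infinite_finite_induct)
  case (insert x F) then show ?case by (auto intro: hs_kernel_add)
qed (auto simp: hs_kernel_def)

lemma hs_kernel_cong:
  assumes "\<And>x y. x \<in> unit_cube \<Longrightarrow> y \<in> unit_cube \<Longrightarrow> T x y = T' x y"
  shows "hs_kernel T \<longleftrightarrow> hs_kernel T'"
proof -
  have "(\<lambda>z. T (fst z) (snd z)) \<in> borel_measurable (cube \<Otimes>\<^sub>M cube) \<longleftrightarrow> (\<lambda>z. T' (fst z) (snd z)) \<in> borel_measurable (cube \<Otimes>\<^sub>M cube)"
    by (intro measurable_cong) (auto simp: space_pair_measure assms)
  moreover have "integrable (cube \<Otimes>\<^sub>M cube) (\<lambda>z. (T (fst z) (snd z))\<^sup>2) \<longleftrightarrow> integrable (cube \<Otimes>\<^sub>M cube) (\<lambda>z. (T' (fst z) (snd z))\<^sup>2)"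
    by (intro Bochner_Integration.integrable_cong) (auto simp: space_pair_measure assms)
  ultimately show ?thesis by (simp add: hs_kernel_def)
qed

lemma bil_cong:
  assumes "\<And>x y. x \<in> unit_cube \<Longrightarrow> y \<in> unit_cube \<Longrightarrow> T x y = T' x y"
  shows "bil T f g = bil T' f g"
  unfolding bil_def by (intro Bochner_Integration.integral_cong) (auto simp: space_pair_measure assms)

text \<open>The sigma-algebra on the square is the product of two Lebesgue ones. It contains the
  Borel sets of the product space, so the identity into those is measurable and the kernel can be
  composed with it.\<close>

lemma continuous_kernel_measurable:
  fixes k :: "real ^ 'n::finite \<Rightarrow> real ^ 'n \<Rightarrow> real"
  assumes "continuous_on (unit_cube \<times> unit_cube) (\<lambda>z. k (fst z) (snd z))"
  shows "(\<lambda>z. k (fst z) (snd z)) \<in> borel_measurable (cube \<Otimes>\<^sub>M cube)"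
proof -
  have id [measurable]: "(\<lambda>x. x) \<in> measurable (cube :: (real ^ 'n) measure) borel"
    using id_borel_measurable_lebesgue_on[of unit_cube] by (simp add: id_def)
  have fs: "(\<lambda>z. fst z) \<in> borel_measurable (cube_sq :: ((real ^ 'n) \<times> (real ^ 'n)) measure)"
    "(\<lambda>z. snd z) \<in> borel_measurable (cube_sq :: ((real ^ 'n) \<times> (real ^ 'n)) measure)"
    by (rule measurable_compose[OF measurable_fst id], rule measurable_compose[OF measurable_snd id])
  have "(\<lambda>z. (fst z, snd z)) \<in> measurable (cube_sq :: ((real ^ 'n) \<times> (real ^ 'n)) measure) (borel \<Otimes>\<^sub>M borel)"
    by (rule measurable_Pair[OF fs])
  then have "(\<lambda>z. z) \<in> measurable (cube \<Otimes>\<^sub>M cube) (borel :: ((real ^ 'n) \<times> (real ^ 'n)) measure)"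
    unfolding borel_prod by simp
  then have "(\<lambda>z. z) \<in> measurable (cube \<Otimes>\<^sub>M cube) (restrict_space borel (unit_cube \<times> unit_cube :: ((real ^ 'n) \<times> (real ^ 'n)) set))"
    by (intro measurable_restrict_space2) (auto simp: space_pair_measure)
  from measurable_compose[OF this borel_measurable_continuous_on_restrict[OF assms]] show ?thesis .
qed

lemma bil_integrable:
  assumes T: "hs_kernel T" and f: "f \<in> L2" and g: "g \<in> L2"
  shows "integrable (cube \<Otimes>\<^sub>M cube) (\<lambda>z. T (fst z) (snd z) * (g (fst z) * f (snd z)))"
  by (rule integrable_mult_L2) (use T hs_kernel_tensor[OF g f] in \<open>auto simp: hs_kernel_def\<close>)

lemma bil_eq_inner:
  assumes T: "hs_kernel T" and f: "f \<in> L2" and g: "g \<in> L2"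
  shows "bil T f g = inner_L2 (integral_op T f) g"
proof -
  have "inner_L2 (integral_op T f) g = (LINT x|cube. LINT y|cube. T x y * (g x * f y))"
    unfolding inner_L2_def integral_op_def
    by (intro Bochner_Integration.integral_cong refl) (simp add: mult_ac flip: integral_mult_right_zero)
  also have "\<dots> = bil T f g"
    using bil_integrable[OF assms] cube2.integral_fst[of "\<lambda>x y. T x y * (g x * f y)"]
    by (simp add: bil_def split_beta')
  finally show ?thesis ..
qed

text \<open>Cauchy-Schwarz on almost every row, then integration over the rows. The Hilbert-Schmidt
  bound is what makes the supremum in \<open>op_norm\<close> finite.\<close>

lemma integral_op_L2:
  assumes T: "hs_kernel T" and f: "f \<in> L2"
  shows "integral_op T f \<in> L2"
    and "inner_L2 (integral_op T f) (integral_op T f) \<le> (LINT z|cube_sq. (T (fst z) (snd z))\<^sup>2) * inner_L2 f f"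
proof -
  have Tm [measurable]: "(\<lambda>z. T (fst z) (snd z)) \<in> borel_measurable (cube \<Otimes>\<^sub>M cube)" and
    T2: "integrable (cube \<Otimes>\<^sub>M cube) (\<lambda>z. (T (fst z) (snd z))\<^sup>2)" using T by (auto simp: hs_kernel_def)
  note [measurable] = L2_measurable[OF f]
  have T2': "integrable (cube \<Otimes>\<^sub>M cube) (\<lambda>(x, y). (T x y)\<^sup>2)" using T2 by (simp add: split_beta')
  have m: "integral_op T f \<in> borel_measurable cube"
    unfolding integral_op_def
    by (rule cube.borel_measurable_lebesgue_integral) (simp add: split_beta')
  define F where "F x = (LINT y|cube. (T x y)\<^sup>2) * inner_L2 f f" for x
  have F: "integrable cube F" unfolding F_def using cube2.integrable_fst[OF T2'] by simp
  have Fi: "(LINT x|cube. F x) = (LINT z|cube_sq. (T (fst z) (snd z))\<^sup>2) * inner_L2 f f"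
    unfolding F_def using cube2.integral_fst[OF T2'] by (simp add: split_beta')
  have le: "AE x in cube. (integral_op T f x)\<^sup>2 \<le> F x"
    using cube2.AE_integrable_fst[OF T2'] AE_space
  proof eventually_elim
    case (elim x)
    have "(\<lambda>y. T x y) \<in> borel_measurable cube"
      using measurable_compose[OF measurable_Pair1'[of x cube cube] Tm] elim by simp
    then show ?case unfolding F_def integral_op_def inner_L2_self
      using L2_integrable_square[OF f] elim by (intro Cauchy_Schwarz_integral(2)) auto
  qed
  have i: "integrable cube (\<lambda>x. (integral_op T f x)\<^sup>2)"
    by (rule Bochner_Integration.integrable_bound[OF F]) (use m le in auto)
  show "integral_op T f \<in> L2" using m i by (simp add: L2_def)
  show "inner_L2 (integral_op T f) (integral_op T f) \<le> (LINT z|cube_sq. (T (fst z) (snd z))\<^sup>2) * inner_L2 f f"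
    using integral_mono_AE[OF i F le] unfolding Fi inner_L2_self[of "integral_op T f"] .
qed

lemma bil_diff_kernel:
  "hs_kernel T \<Longrightarrow> hs_kernel T' \<Longrightarrow> f \<in> L2 \<Longrightarrow> g \<in> L2 \<Longrightarrow> bil (\<lambda>x y. T x y - T' x y) f g = bil T f g - bil T' f g"
  by (simp add: bil_def bil_integrable left_diff_distrib)

lemma bil_cmult_kernel: "bil (\<lambda>x y. c * T x y) f g = c * bil T f g"
  by (simp add: bil_def mult.assoc)

lemma bil_sum_kernel:
  "(\<And>i. i \<in> A \<Longrightarrow> hs_kernel (T i)) \<Longrightarrow> f \<in> L2 \<Longrightarrow> g \<in> L2 \<Longrightarrow> bil (\<lambda>x y. \<Sum>i\<in>A. T i x y) f g = (\<Sum>i\<in>A. bil (T i) f g)"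
  by (simp add: bil_def bil_integrable sum_distrib_right)

lemma bil_tensor:
  assumes "u \<in> L2" "v \<in> L2" "f \<in> L2" "g \<in> L2"
  shows "bil (\<lambda>x y. u x * v y) f g = inner_L2 u g * inner_L2 v f"
proof -
  have "bil (\<lambda>x y. u x * v y) f g = inner_L2 (integral_op (\<lambda>x y. u x * v y) f) g"
    using assms by (intro bil_eq_inner hs_kernel_tensor)
  also have "integral_op (\<lambda>x y. u x * v y) f = (\<lambda>x. u x * inner_L2 v f)"
    by (simp add: integral_op_def inner_L2_def mult.assoc)
  finally show ?thesis using inner_L2_cmult_left[of "inner_L2 v f" u g] by (simp add: mult.commute)
qed

text \<open>Expanding both forms leaves twice the sum of the two mixed terms; swapping the factors
  of the square and using symmetry identifies them.\<close>

lemma bil_polarization: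
  assumes T: "hs_kernel T" and sym: "\<And>x y. x \<in> unit_cube \<Longrightarrow> y \<in> unit_cube \<Longrightarrow> T x y = T y x"
    and f: "f \<in> L2" and g: "g \<in> L2"
  shows "4 * bil T f g = bil T (\<lambda>x. f x + g x) (\<lambda>x. f x + g x) - bil T (\<lambda>x. f x - g x) (\<lambda>x. f x - g x)"
proof -
  note i = bil_integrable[OF T]
  have swap: "bil T g f = bil T f g"
  proof -
    have "bil T f g = (LINT (x, y)|cube_sq. T y x * (g y * f x))"
      unfolding bil_def using i[OF f g]
      by (subst cube2.integral_product_swap[symmetric]) (auto dest: borel_measurable_integrable)
    also have "\<dots> = bil T g f"
      unfolding bil_def by (intro Bochner_Integration.integral_cong) (auto simp: space_pair_measure sym mult_ac)
    finally show ?thesis ..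
  qed
  have "bil T (\<lambda>x. f x + g x) (\<lambda>x. f x + g x) = bil T f f + bil T g f + bil T f g + bil T g g"
    unfolding bil_def using i[OF f f] i[OF f g] i[OF g f] i[OF g g]
    by (simp add: algebra_simps)
  moreover have "bil T (\<lambda>x. f x - g x) (\<lambda>x. f x - g x) = bil T f f - bil T g f - bil T f g + bil T g g"
    unfolding bil_def using i[OF f f] i[OF f g] i[OF g f] i[OF g g]
    by (simp add: algebra_simps)
  ultimately show ?thesis using swap by simp
qed

text \<open>For a symmetric operator the quadratic form controls the norm. Polarization and the
  parallelogram law bound \<open>\<langle>T f, g\<rangle>\<close> by a multiple of the sum of the
  squared norms, and the choice \<open>g = T f\<close> closes the estimate.\<close>

lemma norm_L2_integral_op_le:
  assumes T: "hs_kernel T" and sym: "\<And>x y. x \<in> unit_cube \<Longrightarrow> y \<in> unit_cube \<Longrightarrow> T x y = T y x"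
    and e: "0 \<le> e" and form: "\<And>g. g \<in> L2 \<Longrightarrow> \<bar>bil T g g\<bar> \<le> e * inner_L2 g g" and f: "f \<in> L2"
  shows "norm_L2 (integral_op T f) \<le> e * norm_L2 f"
proof -
  have b: "\<bar>bil T f g\<bar> \<le> e / 2 * (inner_L2 f f + inner_L2 g g)" if f: "f \<in> L2" and g: "g \<in> L2" for f g
  proof -
    have p: "inner_L2 (\<lambda>x. f x + g x) (\<lambda>x. f x + g x) + inner_L2 (\<lambda>x. f x - g x) (\<lambda>x. f x - g x) = 2 * (inner_L2 f f + inner_L2 g g)"
      by (simp add: inner_L2_expand[OF f g])
    have "4 * \<bar>bil T f g\<bar> \<le> \<bar>bil T (\<lambda>x. f x + g x) (\<lambda>x. f x + g x)\<bar> + \<bar>bil T (\<lambda>x. f x - g x) (\<lambda>x. f x - g x)\<bar>"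
      using bil_polarization[OF T sym f g] by linarith
    also have "\<dots> \<le> e * inner_L2 (\<lambda>x. f x + g x) (\<lambda>x. f x + g x) + e * inner_L2 (\<lambda>x. f x - g x) (\<lambda>x. f x - g x)"
      by (intro add_mono form L2_add L2_diff f g)
    also have "\<dots> = e * (2 * (inner_L2 f f + inner_L2 g g))"
      unfolding p[symmetric] by (simp add: distrib_left)
    also have "\<dots> = 4 * (e / 2 * (inner_L2 f f + inner_L2 g g))" by simp
    finally show ?thesis by linarith
  qed
  define G where "G = integral_op T f"
  have G: "G \<in> L2" unfolding G_def by (rule integral_op_L2(1)[OF T f])
  have GG: "inner_L2 G G = bil T f G" using bil_eq_inner[OF T f G] by (simp add: G_def)
  have scale: "inner_L2 (\<lambda>x. c * h x) (\<lambda>x. c * h x) = c\<^sup>2 * inner_L2 h h" for c h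
    by (simp add: inner_L2_self power_mult_distrib)
  have "inner_L2 G G \<le> e\<^sup>2 * inner_L2 f f"
  proof (cases "e = 0")
    case True
    then show ?thesis using b[OF f G] GG by simp
  next
    case False
    have r: "(1 / sqrt e) * sqrt e = 1" using False e by simp
    \<comment> \<open>Multiplying \<open>f\<close> by \<open>sqrt e\<close> and \<open>T f\<close>
      by its inverse balances the two squares, so that exactly half of the squared norm of
      \<open>T f\<close> stays on the right and is absorbed.\<close>
    have "bil T (\<lambda>x. sqrt e * f x) (\<lambda>x. 1 / sqrt e * G x) = bil T f G"
    proof -
      have eq: "T x y * (1 / sqrt e * G x * (sqrt e * f y)) = T x y * (G x * f y)" for x y
        using False e by simp
      show ?thesis unfolding bil_def eq ..
    qed
    then have "inner_L2 G G \<le> e / 2 * (e * inner_L2 f f + 1 / e * inner_L2 G G)"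
      using b[OF L2_cmult[OF f, of "sqrt e"] L2_cmult[OF G, of "1 / sqrt e"]] GG e
      unfolding scale by (simp add: power_divide)
    also have "\<dots> = e\<^sup>2 * inner_L2 f f / 2 + inner_L2 G G / 2"
      using False by (simp add: power2_eq_square field_simps)
    finally show ?thesis by simp
  qed
  then have "(norm_L2 G)\<^sup>2 \<le> (e * norm_L2 f)\<^sup>2" by (simp add: norm_L2_square power_mult_distrib)
  then show ?thesis unfolding G_def[symmetric]
    by (rule power2_le_imp_le) (simp add: e norm_L2_nonneg)
qed

section \<open>Operator norms and the Schur test\<close>

lemma op_norm_le:
  fixes T :: "(real ^ 'n::finite \<Rightarrow> real) \<Rightarrow> (real ^ 'n \<Rightarrow> real)"
  assumes "\<And>f. f \<in> L2 \<Longrightarrow> norm_L2 f \<le> 1 \<Longrightarrow> norm_L2 (T f) \<le> c"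
  shows "op_norm T \<le> c"
proof -
  have "(\<lambda>_. 0) \<in> {f :: real ^ 'n \<Rightarrow> real. f \<in> L2 \<and> norm_L2 f \<le> 1}"
    by (auto simp: L2_zero norm_L2_def inner_L2_def)
  then have "{f :: real ^ 'n \<Rightarrow> real. f \<in> L2 \<and> norm_L2 f \<le> 1} \<noteq> {}" by blast
  then show ?thesis unfolding op_norm_def using assms by (intro cSUP_least) auto
qed

text \<open>The bound \<open>c\<close> guarantees a supremum over a bounded set; on an unbounded set
  of reals \<open>SUP\<close> is unspecified.\<close>

lemma le_op_norm:
  fixes T :: "(real ^ 'n::finite \<Rightarrow> real) \<Rightarrow> (real ^ 'n \<Rightarrow> real)"
  assumes b: "\<And>f. f \<in> L2 \<Longrightarrow> norm_L2 f \<le> 1 \<Longrightarrow> norm_L2 (T f) \<le> c"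
    and f: "f \<in> L2" "norm_L2 f \<le> 1"
  shows "norm_L2 (T f) \<le> op_norm T"
  unfolding op_norm_def using assms by (intro cSUP_upper bdd_aboveI[of _ c]) auto

lemma op_norm_cong:
  assumes "\<And>f. f \<in> L2 \<Longrightarrow> norm_L2 (T f) = norm_L2 (T' f)"
  shows "op_norm T = op_norm T'"
  unfolding op_norm_def using assms by (intro SUP_cong) auto

lemma norm_L2_integral_op_hs:
  assumes "hs_kernel T" "f \<in> L2" "norm_L2 f \<le> 1"
  shows "norm_L2 (integral_op T f) \<le> sqrt (LINT z|cube_sq. (T (fst z) (snd z))\<^sup>2)"
proof -
  have "inner_L2 f f \<le> 1" using assms(3) by (simp add: norm_L2_def)
  then have "(LINT z|cube_sq. (T (fst z) (snd z))\<^sup>2) * inner_L2 f f \<le> (LINT z|cube_sq. (T (fst z) (snd z))\<^sup>2) * 1"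
    by (intro mult_left_mono) auto
  then show ?thesis using integral_op_L2(2)[OF assms(1,2)] unfolding norm_L2_def
    by (intro real_sqrt_le_mono) linarith
qed

lemma form_le_op_norm:
  assumes T: "hs_kernel T" and f: "f \<in> L2" "norm_L2 f \<le> 1"
  shows "\<bar>bil T f f\<bar> \<le> op_norm (integral_op T)"
proof -
  have "\<bar>bil T f f\<bar> \<le> norm_L2 (integral_op T f) * norm_L2 f"
    unfolding bil_eq_inner[OF T f(1) f(1)] by (intro inner_L2_le_norm integral_op_L2(1) T f)
  also have "\<dots> \<le> norm_L2 (integral_op T f) * 1"
    using f by (intro mult_left_mono) (auto simp: norm_L2_nonneg)
  also have "\<dots> \<le> op_norm (integral_op T)"
    using le_op_norm[of "integral_op T", OF norm_L2_integral_op_hs[OF T] f] by simp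
  finally show ?thesis .
qed

text \<open>The two functions may differ at points whose row is not integrable, where the integrals
  take default values. These points form a null set, so it is the norms that are compared.\<close>

lemma norm_L2_integral_op_diff:
  assumes T: "hs_kernel T" "hs_kernel T'" and f: "f \<in> L2"
  shows "norm_L2 (\<lambda>x. integral_op T f x - integral_op T' f x) = norm_L2 (integral_op (\<lambda>x y. T x y - T' x y) f)"
proof (rule norm_L2_cong_AE)
  have one: "(\<lambda>x. 1) \<in> L2" by (simp add: L2_def)
  have ae: "AE x in cube. integrable cube (\<lambda>y. T x y * f y)" if "hs_kernel T" for T
  proof -
    have "integrable (cube \<Otimes>\<^sub>M cube) (\<lambda>(x, y). T x y * f y)"
      using bil_integrable[OF that f one] by (simp add: split_beta')
    then show ?thesis by (rule cube2.AE_integrable_fst)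
  qed
  show "AE x in cube. integral_op T f x - integral_op T' f x = integral_op (\<lambda>x y. T x y - T' x y) f x"
    using ae[OF T(1)] ae[OF T(2)]
    by eventually_elim (simp add: integral_op_def left_diff_distrib)
  show "(\<lambda>x. integral_op T f x - integral_op T' f x) \<in> borel_measurable cube"
    by (rule borel_measurable_diff[OF L2_measurable L2_measurable]) (rule integral_op_L2(1)[OF T(1) f], rule integral_op_L2(1)[OF T(2) f])
qed (rule L2_measurable[OF integral_op_L2(1)[OF hs_kernel_diff[OF T] f]])

text \<open>Schur test with constant weights: \<open>2 |g x| |g y| \<le> (g x)^2 + (g y)^2\<close>
  splits the form into two halves, and symmetry turns both into row integrals against
  \<open>g^2\<close>. The pointwise bound \<open>c\<close> supplies the integrability for
  Fubini.\<close>

lemma Schur_form_bound: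
  fixes T :: "real ^ 'n::finite \<Rightarrow> real ^ 'n \<Rightarrow> real"
  assumes T: "hs_kernel T" and sym: "\<And>x y. x \<in> unit_cube \<Longrightarrow> y \<in> unit_cube \<Longrightarrow> T x y = T y x"
    and bd: "\<And>x y. x \<in> unit_cube \<Longrightarrow> y \<in> unit_cube \<Longrightarrow> \<bar>T x y\<bar> \<le> c"
    and row: "\<And>x. x \<in> unit_cube \<Longrightarrow> (LINT y|cube. \<bar>T x y\<bar>) \<le> e" and g: "g \<in> L2"
  shows "\<bar>bil T g g\<bar> \<le> e * inner_L2 g g"
proof -
  have Tm [measurable]: "(\<lambda>z. T (fst z) (snd z)) \<in> borel_measurable (cube \<Otimes>\<^sub>M cube)" using T by (simp add: hs_kernel_def)
  note [measurable] = L2_measurable[OF g]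
  have one: "(\<lambda>x. 1) \<in> L2" by (simp add: L2_def)
  define A where "A x y = \<bar>T x y\<bar> * (g x)\<^sup>2" for x y
  have rowi: "integrable cube (\<lambda>y. \<bar>T x y\<bar>)" if "x \<in> unit_cube" for x
  proof (rule cube.integrable_const_bound[where B = c])
    show "(\<lambda>y. \<bar>T x y\<bar>) \<in> borel_measurable cube"
      using measurable_compose[OF measurable_Pair1'[of x cube cube] Tm] that by simp
  qed (use bd that in auto)
  have A: "integrable (cube \<Otimes>\<^sub>M cube) (\<lambda>z. A (fst z) (snd z))"
  proof (rule Bochner_Integration.integrable_bound[where f = "\<lambda>z. c * ((g (fst z))\<^sup>2 * 1\<^sup>2)"])
    show "integrable (cube \<Otimes>\<^sub>M cube) (\<lambda>z :: (real ^ 'n) \<times> (real ^ 'n). c * ((g (fst z))\<^sup>2 * 1\<^sup>2))"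
      using hs_kernel_tensor[OF g one] by (simp add: hs_kernel_def)
    show "AE z in cube \<Otimes>\<^sub>M cube. norm (A (fst z) (snd z)) \<le> norm (c * ((g (fst z))\<^sup>2 * 1\<^sup>2))"
    proof (rule AE_I2)
      fix z :: "(real ^ 'n) \<times> (real ^ 'n)" assume "z \<in> space (cube \<Otimes>\<^sub>M cube)"
      then have "\<bar>T (fst z) (snd z)\<bar> \<le> \<bar>c\<bar>" using bd[of "fst z" "snd z"] by (auto simp: space_pair_measure)
      then show "norm (A (fst z) (snd z)) \<le> norm (c * ((g (fst z))\<^sup>2 * 1\<^sup>2))"
        by (auto simp: A_def abs_mult intro: mult_right_mono)
    qed
  qed (simp add: A_def)
  have Ai: "(LINT z|cube_sq. A (fst z) (snd z)) \<le> e * inner_L2 g g"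
  proof -
    have A': "integrable (cube \<Otimes>\<^sub>M cube) (\<lambda>(x, y). A x y)" using A by (simp add: split_beta')
    have "(LINT z|cube_sq. A (fst z) (snd z)) = (LINT x|cube. LINT y|cube. A x y)"
      using cube2.integral_fst[OF A'] by (simp add: split_beta')
    also have "\<dots> \<le> (LINT x|cube. e * (g x)\<^sup>2)"
    proof (rule integral_mono)
      show "integrable cube (\<lambda>x. LINT y|cube. A x y)" using cube2.integrable_fst[OF A'] .
      show "integrable cube (\<lambda>x. e * (g x)\<^sup>2)" using L2_integrable_square[OF g] by simp
      fix x :: "real ^ 'n" assume "x \<in> space cube"
      then show "(LINT y|cube. A x y) \<le> e * (g x)\<^sup>2"
        using row[of x] by (simp add: A_def mult_right_mono)
    qed
    also have "\<dots> = e * inner_L2 g g" by (simp add: inner_L2_self)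
    finally show ?thesis .
  qed
  have Asw: "integrable (cube \<Otimes>\<^sub>M cube) (\<lambda>z. A (snd z) (fst z))"
    "(LINT z|cube_sq. A (snd z) (fst z)) = (LINT z|cube_sq. A (fst z) (snd z))"
    using cube2.integrable_product_swap[OF A] cube2.integral_product_swap[OF borel_measurable_integrable[OF A]]
    by (simp_all add: split_beta')
  have "\<bar>bil T g g\<bar> \<le> (LINT z|cube_sq. \<bar>T (fst z) (snd z) * (g (fst z) * g (snd z))\<bar>)"
    unfolding bil_def by (rule integral_abs_bound)
  also have "\<dots> \<le> (LINT z|cube_sq. (A (fst z) (snd z) + A (snd z) (fst z)) / 2)"
  proof (rule integral_mono)
    show "integrable (cube \<Otimes>\<^sub>M cube) (\<lambda>z. \<bar>T (fst z) (snd z) * (g (fst z) * g (snd z))\<bar>)"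
      using bil_integrable[OF T g g] by simp
    show "integrable (cube \<Otimes>\<^sub>M cube) (\<lambda>z. (A (fst z) (snd z) + A (snd z) (fst z)) / 2)" using A Asw by simp
    fix z :: "(real ^ 'n) \<times> (real ^ 'n)" assume "z \<in> space (cube \<Otimes>\<^sub>M cube)"
    then have s: "T (snd z) (fst z) = T (fst z) (snd z)" using sym by (auto simp: space_pair_measure)
    have "2 * (\<bar>g (fst z)\<bar> * \<bar>g (snd z)\<bar>) \<le> (g (fst z))\<^sup>2 + (g (snd z))\<^sup>2"
      using sum_squares_bound[of "\<bar>g (fst z)\<bar>" "\<bar>g (snd z)\<bar>"] by simp
    then have "\<bar>T (fst z) (snd z)\<bar> * (2 * (\<bar>g (fst z)\<bar> * \<bar>g (snd z)\<bar>)) \<le> \<bar>T (fst z) (snd z)\<bar> * ((g (fst z))\<^sup>2 + (g (snd z))\<^sup>2)"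
      by (rule mult_left_mono) simp
    then show "\<bar>T (fst z) (snd z) * (g (fst z) * g (snd z))\<bar> \<le> (A (fst z) (snd z) + A (snd z) (fst z)) / 2"
      by (simp add: A_def s abs_mult distrib_left)
  qed
  also have "\<dots> = (LINT z|cube_sq. A (fst z) (snd z))" using A Asw by simp
  finally show ?thesis using Ai by linarith
qed

section \<open>Discretization\<close>

text \<open>A rounding map instead of a partition: its fibres are the cells, its finitely many
  values are the grid points, and composing a function with it gives the piecewise constant
  version.\<close>

definition discretization :: "real \<Rightarrow> (real ^ 'n::finite \<Rightarrow> real ^ 'n) \<Rightarrow> bool" where
  "discretization \<eta> c \<longleftrightarrow> c \<in> measurable cube (count_space (c ` unit_cube)) \<and> finite (c ` unit_cube) \<and>
     c ` unit_cube \<subseteq> unit_cube \<and> (\<forall>x\<in>unit_cube. dist x (c x) \<le> \<eta>)"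

text \<open>Every coordinate is rounded down to a multiple of \<open>1 / n\<close>. Rounding down
  stays inside the cube, the face on which a coordinate equals 1 being a layer of its own, and the
  distance moved is at most \<open>d / n\<close> by the l1 norm.\<close>

lemma ex_discretization:
  assumes "\<eta> > 0"
  shows "\<exists>c :: real ^ 'n::finite \<Rightarrow> real ^ 'n. discretization \<eta> c"
proof -
  obtain m :: nat where m: "real CARD('n) / \<eta> < real m" using reals_Archimedean2 by blast
  define n where "n = Suc m"
  have n: "n \<ge> 1" "real CARD('n) / real n \<le> \<eta>"
  proof -
    have "real CARD('n) / \<eta> < real n" using m by (simp add: n_def)
    then show "real CARD('n) / real n \<le> \<eta>" using assms by (simp add: field_simps n_def)
  qed (simp add: n_def)
  define c :: "real ^ 'n \<Rightarrow> real ^ 'n" where "c x = (\<chi> i. real_of_int \<lfloor>real n * x $ i\<rfloor> / real n)" for x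
  have ci: "c x $ i = real_of_int \<lfloor>real n * x $ i\<rfloor> / real n" for x i by (simp add: c_def)
  have sub: "c ` unit_cube \<subseteq> unit_cube"
  proof (rule image_subsetI)
    fix x :: "real ^ 'n" assume x: "x \<in> unit_cube"
    have "0 \<le> c x $ i \<and> c x $ i \<le> 1" for i
    proof -
      have xi: "0 \<le> x $ i" "x $ i \<le> 1" using x by (auto simp: unit_cube_def)
      have "real_of_int \<lfloor>real n * x $ i\<rfloor> \<le> real n * x $ i" by simp
      also have "\<dots> \<le> real n * 1" using xi by (intro mult_left_mono) auto
      finally show ?thesis using xi n by (simp add: ci)
    qed
    then show "c x \<in> unit_cube" by (simp add: unit_cube_def)
  qed
  have fin: "finite (c ` unit_cube)"
  proof (rule finite_subset)
    let ?F = "(\<lambda>f :: 'n \<Rightarrow> int. (\<chi> i. real_of_int (f i) / real n) :: real ^ 'n) ` (PiE UNIV (\<lambda>_. {0..int n}))"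
    show "finite ?F" by (intro finite_imageI finite_PiE) auto
    show "c ` unit_cube \<subseteq> ?F"
    proof
      fix p assume "p \<in> c ` unit_cube"
      then obtain x where x: "x \<in> unit_cube" "p = c x" by auto
      have "\<lfloor>real n * x $ i\<rfloor> \<in> {0..int n}" for i
      proof -
        have xi: "0 \<le> x $ i" "x $ i \<le> 1" using x by (auto simp: unit_cube_def)
        have "real n * x $ i \<le> real n * 1" using xi by (intro mult_left_mono) auto
        then have "\<lfloor>real n * x $ i\<rfloor> \<le> \<lfloor>real n\<rfloor>" by (intro floor_mono) simp
        then show ?thesis using xi by simp
      qed
      then show "p \<in> ?F" using x by (intro image_eqI[of _ _ "\<lambda>i. \<lfloor>real n * x $ i\<rfloor>"]) (auto simp: c_def)
    qed
  qed
  have dist: "dist x (c x) \<le> \<eta>" for x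
  proof -
    have "dist x (c x) \<le> (\<Sum>i\<in>UNIV. \<bar>(x - c x) $ i\<bar>)" unfolding dist_norm by (rule norm_le_l1_cart)
    also have "\<dots> \<le> (\<Sum>i\<in>(UNIV :: 'n set). 1 / real n)"
    proof (rule sum_mono)
      fix i
      have "(x - c x) $ i = (real n * x $ i - real_of_int \<lfloor>real n * x $ i\<rfloor>) / real n"
        using n by (simp add: ci field_simps)
      moreover have "0 \<le> real n * x $ i - real_of_int \<lfloor>real n * x $ i\<rfloor>" "real n * x $ i - real_of_int \<lfloor>real n * x $ i\<rfloor> \<le> 1"
        by linarith+
      ultimately show "\<bar>(x - c x) $ i\<bar> \<le> 1 / real n" by (simp add: divide_right_mono)
    qed
    also have "\<dots> \<le> \<eta>" using n by simp
    finally show ?thesis .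
  qed
  have id: "(\<lambda>x. x) \<in> measurable (cube :: (real ^ 'n) measure) borel"
    using id_borel_measurable_lebesgue_on[of unit_cube] by (simp add: id_def)
  have meas: "c \<in> measurable cube (count_space (c ` unit_cube))"
  proof (subst measurable_count_space_eq2[OF fin], intro conjI ballI)
    fix a
    have [measurable]: "(\<lambda>x. x $ i) \<in> borel_measurable (cube :: (real ^ 'n) measure)" for i
      by (rule measurable_compose[OF id borel_measurable_continuous_onI]) (intro continuous_intros)
    have "{x \<in> space cube. \<forall>i. real_of_int \<lfloor>real n * x $ i\<rfloor> / real n = a $ i} \<in> sets (cube :: (real ^ 'n) measure)"
      by measurable
    moreover have "c -` {a} \<inter> space cube = {x \<in> space cube. \<forall>i. real_of_int \<lfloor>real n * x $ i\<rfloor> / real n = a $ i}"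
      by (auto simp: c_def vec_eq_iff)
    ultimately show "c -` {a} \<inter> space cube \<in> sets cube" by simp
  qed auto
  show ?thesis using sub fin dist meas unfolding discretization_def by blast
qed

context
  fixes c :: "real ^ 'n::finite \<Rightarrow> real ^ 'n" and \<eta> :: real
  assumes disc: "discretization \<eta> c"
begin

definition cell :: "real ^ 'n \<Rightarrow> real ^ 'n \<Rightarrow> real" where
  "cell p x = (if c x = p then 1 else 0)"

definition cell_weight :: "real ^ 'n \<Rightarrow> real" where
  "cell_weight p = (LINT x|cube. cell p x)"

definition cell_coeff :: "(real ^ 'n \<Rightarrow> real) \<Rightarrow> real ^ 'n \<Rightarrow> real" where
  "cell_coeff g p = inner_L2 (cell p) g"

lemma finite_cells: "finite (c ` unit_cube)"
  and cells_subset: "c ` unit_cube \<subseteq> unit_cube"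
  and dist_cell: "x \<in> unit_cube \<Longrightarrow> dist x (c x) \<le> \<eta>"
  using disc by (auto simp: discretization_def)

lemma measurable_disc: "f \<in> measurable (count_space (c ` unit_cube)) N \<Longrightarrow> (\<lambda>x. f (c x)) \<in> measurable cube N"
  using disc measurable_compose[of c cube "count_space (c ` unit_cube)"] by (auto simp: discretization_def)

lemma cell_measurable [measurable]: "cell p \<in> borel_measurable cube"
  unfolding cell_def[abs_def] by (rule measurable_disc[where f = "\<lambda>q. if q = p then 1 else 0"]) simp

lemma cell_L2: "cell p \<in> L2"
  by (rule L2_bounded[where c = 1]) (auto simp: cell_def)

lemma disc_L2: "(\<lambda>x. F (c x) :: real) \<in> L2"
proof -
  have "finite ((\<lambda>p. \<bar>F p\<bar>) ` c ` unit_cube)" using finite_cells by simp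
  then obtain M where "\<And>p. p \<in> c ` unit_cube \<Longrightarrow> \<bar>F p\<bar> \<le> M"
    using bdd_above_finite[of "(\<lambda>p. \<bar>F p\<bar>) ` c ` unit_cube"] by (auto simp: bdd_above_def)
  then show ?thesis by (intro L2_bounded[where c = M] measurable_disc) auto
qed

lemma disc_expand: "x \<in> unit_cube \<Longrightarrow> (F (c x) :: real) = (\<Sum>p\<in>c ` unit_cube. F p * cell p x)"
  using finite_cells by (simp add: cell_def if_distrib cong: if_cong)

lemma inner_disc: "g \<in> L2 \<Longrightarrow> inner_L2 (\<lambda>x. F (c x)) g = (\<Sum>p\<in>c ` unit_cube. F p * cell_coeff g p)"
proof -
  assume g: "g \<in> L2"
  have "inner_L2 (\<lambda>x. F (c x)) g = inner_L2 (\<lambda>x. \<Sum>p\<in>c ` unit_cube. F p * cell p x) g"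
    unfolding inner_L2_def by (intro Bochner_Integration.integral_cong) (auto simp: disc_expand[of _ F])
  also have "\<dots> = (\<Sum>p\<in>c ` unit_cube. inner_L2 (\<lambda>x. F p * cell p x) g)"
    using g by (intro inner_L2_sum_left L2_cmult cell_L2)
  finally show ?thesis by (simp add: inner_L2_cmult_left cell_coeff_def)
qed

lemma integral_disc: "(LINT x|cube. F (c x)) = (\<Sum>p\<in>c ` unit_cube. F p * cell_weight p)"
  using inner_disc[of "\<lambda>_. 1" F] by (simp add: L2_def inner_L2_def cell_coeff_def cell_weight_def)

lemma cell_weight_nonneg: "0 \<le> cell_weight p"
  unfolding cell_weight_def by (intro Bochner_Integration.integral_nonneg) (auto simp: cell_def)

lemma cell_coeff_square:
  assumes g: "g \<in> L2"
  shows "(cell_coeff g p)\<^sup>2 \<le> cell_weight p * (LINT x|cube. cell p x * (g x)\<^sup>2)"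
proof -
  have "(\<lambda>x. cell p x * g x) \<in> L2"
    by (rule L2_bounded_mult[OF g cell_measurable, where c = 1]) (auto simp: cell_def)
  from inner_L2_Cauchy_Schwarz[OF cell_L2[of p] this]
  have "(inner_L2 (cell p) (\<lambda>x. cell p x * g x))\<^sup>2 \<le> inner_L2 (cell p) (cell p) * inner_L2 (\<lambda>x. cell p x * g x) (\<lambda>x. cell p x * g x)" .
  moreover have "inner_L2 (cell p) (\<lambda>x. cell p x * g x) = cell_coeff g p"
    unfolding inner_L2_def cell_coeff_def by (intro Bochner_Integration.integral_cong) (auto simp: cell_def)
  moreover have "inner_L2 (cell p) (cell p) = cell_weight p"
    unfolding inner_L2_def cell_weight_def by (intro Bochner_Integration.integral_cong) (auto simp: cell_def)
  moreover have "inner_L2 (\<lambda>x. cell p x * g x) (\<lambda>x. cell p x * g x) = (LINT x|cube. cell p x * (g x)\<^sup>2)"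
    unfolding inner_L2_def by (intro Bochner_Integration.integral_cong) (auto simp: cell_def power2_eq_square)
  ultimately show ?thesis by simp
qed

text \<open>Coordinates with respect to the normalized cell indicators. On a cell of weight zero the
  division yields 0, which is the right value because Cauchy-Schwarz makes the coefficient vanish
  there.\<close>

definition cell_vec :: "(real ^ 'n \<Rightarrow> real) \<Rightarrow> real ^ 'n \<Rightarrow> real" where
  "cell_vec g p = cell_coeff g p / sqrt (cell_weight p)"

lemma cell_vec_scale: "g \<in> L2 \<Longrightarrow> sqrt (cell_weight p) * cell_vec g p = cell_coeff g p"
  using cell_coeff_square[of g p] by (auto simp: cell_vec_def)

text \<open>Bessel's inequality for the normalized cell indicators: Cauchy-Schwarz within each cell,
  and the cells are disjoint, so the local square integrals add up to that of
  \<open>g\<close>.\<close>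

lemma cell_vec_norm:
  assumes g: "g \<in> L2" and P: "P \<subseteq> c ` unit_cube"
  shows "(\<Sum>p\<in>P. (cell_vec g p)\<^sup>2) \<le> inner_L2 g g"
proof -
  have i: "integrable cube (\<lambda>x. cell p x * (g x)\<^sup>2)" for p
  proof -
    have "(\<lambda>x. cell p x * g x) \<in> L2"
      by (rule L2_bounded_mult[OF g cell_measurable, where c = 1]) (auto simp: cell_def)
    from L2_integrable_mult[OF this g] show ?thesis by (simp add: power2_eq_square mult_ac)
  qed
  have nn: "0 \<le> (LINT x|cube. cell p x * (g x)\<^sup>2)" for p
    by (intro Bochner_Integration.integral_nonneg) (auto simp: cell_def)
  have "(\<Sum>p\<in>P. (cell_vec g p)\<^sup>2) \<le> (\<Sum>p\<in>P. (LINT x|cube. cell p x * (g x)\<^sup>2))"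
  proof (rule sum_mono)
    fix p
    show "(cell_vec g p)\<^sup>2 \<le> (LINT x|cube. cell p x * (g x)\<^sup>2)"
    proof (cases "cell_weight p = 0")
      case False
      then have "cell_weight p > 0" using cell_weight_nonneg[of p] by simp
      then show ?thesis using cell_coeff_square[OF g, of p]
        by (simp add: cell_vec_def power_divide divide_le_eq mult.commute)
    qed (use nn in \<open>simp add: cell_vec_def\<close>)
  qed
  also have "\<dots> \<le> (\<Sum>p\<in>c ` unit_cube. (LINT x|cube. cell p x * (g x)\<^sup>2))"
    using P finite_cells nn by (intro sum_mono2) auto
  also have "\<dots> = (LINT x|cube. (\<Sum>p\<in>c ` unit_cube. cell p x * (g x)\<^sup>2))"
    using i by simp
  also have "\<dots> = inner_L2 g g"
    unfolding inner_L2_self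
    by (intro Bochner_Integration.integral_cong refl) (use disc_expand[of _ "\<lambda>_. 1"] in \<open>simp add: sum_distrib_right[symmetric]\<close>)
  finally show ?thesis .
qed

text \<open>A rounded kernel is a finite combination of tensor products of cell indicators, whatever
  \<open>T\<close> is.\<close>

lemma hs_disc: "hs_kernel (\<lambda>x y. T (c x) (c y))"
  and bil_disc: "g \<in> L2 \<Longrightarrow> h \<in> L2 \<Longrightarrow> bil (\<lambda>x y. T (c x) (c y)) g h =
    (\<Sum>p\<in>c ` unit_cube. \<Sum>q\<in>c ` unit_cube. T p q * (cell_coeff h p * cell_coeff g q))"
proof -
  have eq: "T (c x) (c y) = (\<Sum>p\<in>c ` unit_cube. \<Sum>q\<in>c ` unit_cube. T p q * (cell p x * cell q y))"
    if "x \<in> unit_cube" "y \<in> unit_cube" for x y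
  proof -
    have "T (c x) (c y) = (\<Sum>p\<in>c ` unit_cube. T p (c y) * cell p x)"
      using disc_expand[OF that(1), of "\<lambda>p. T p (c y)"] .
    also have "\<dots> = (\<Sum>p\<in>c ` unit_cube. (\<Sum>q\<in>c ` unit_cube. T p q * cell q y) * cell p x)"
      using disc_expand[OF that(2), of "T p" for p] by simp
    also have "\<dots> = (\<Sum>p\<in>c ` unit_cube. \<Sum>q\<in>c ` unit_cube. T p q * (cell p x * cell q y))"
      by (simp only: sum_distrib_right) (simp add: mult_ac)
    finally show ?thesis .
  qed
  have hs: "hs_kernel (\<lambda>x y. T p q * (cell p x * cell q y))" for p q
    by (intro hs_kernel_cmult hs_kernel_tensor cell_L2)
  show "hs_kernel (\<lambda>x y. T (c x) (c y))"
    by (subst hs_kernel_cong[OF eq]) (auto intro!: hs_kernel_sum hs)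
  assume g: "g \<in> L2" "h \<in> L2"
  have "bil (\<lambda>x y. T (c x) (c y)) g h = bil (\<lambda>x y. \<Sum>p\<in>c ` unit_cube. \<Sum>q\<in>c ` unit_cube. T p q * (cell p x * cell q y)) g h"
    by (intro bil_cong eq)
  also have "\<dots> = (\<Sum>p\<in>c ` unit_cube. \<Sum>q\<in>c ` unit_cube. bil (\<lambda>x y. T p q * (cell p x * cell q y)) g h)"
    using g by (simp add: bil_sum_kernel hs hs_kernel_sum)
  also have "\<dots> = (\<Sum>p\<in>c ` unit_cube. \<Sum>q\<in>c ` unit_cube. T p q * (cell_coeff h p * cell_coeff g q))"
    using g by (simp add: bil_cmult_kernel bil_tensor cell_L2 cell_coeff_def)
  finally show "bil (\<lambda>x y. T (c x) (c y)) g h =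
    (\<Sum>p\<in>c ` unit_cube. \<Sum>q\<in>c ` unit_cube. T p q * (cell_coeff h p * cell_coeff g q))" .
qed

end

text \<open>Uniform continuity on the compact square. Letting each argument be rounded or kept
  covers all later uses: the form of the kernel, its rows with one rounded argument, and the
  increments of the process.\<close>

lemma continuous_kernel_discretization:
  fixes k :: "real ^ 'n::finite \<Rightarrow> real ^ 'n \<Rightarrow> real"
  assumes k: "continuous_on (unit_cube \<times> unit_cube) (\<lambda>z. k (fst z) (snd z))" and e: "e > 0" and d: "d > 0"
  obtains c where "discretization d c"
    "\<And>x y x' y'. x \<in> unit_cube \<Longrightarrow> y \<in> unit_cube \<Longrightarrow> x' \<in> {x, c x} \<Longrightarrow> y' \<in> {y, c y} \<Longrightarrow> \<bar>k x y - k x' y'\<bar> \<le> e"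
proof -
  have "uniformly_continuous_on (unit_cube \<times> unit_cube) (\<lambda>z. k (fst z) (snd z))"
    using k compact_unit_cube by (intro compact_uniformly_continuous compact_Times)
  then obtain \<delta> where \<delta>: "\<delta> > 0"
    "\<And>z z'. z \<in> unit_cube \<times> unit_cube \<Longrightarrow> z' \<in> unit_cube \<times> unit_cube \<Longrightarrow> dist z' z < \<delta> \<Longrightarrow> dist (k (fst z') (snd z')) (k (fst z) (snd z)) < e"
    using e unfolding uniformly_continuous_on_def by metis
  obtain c :: "real ^ 'n \<Rightarrow> real ^ 'n" where c: "discretization (min d (\<delta> / 3)) c"
    using ex_discretization[of "min d (\<delta> / 3)"] d \<delta> by auto
  have dist: "dist x (c x) \<le> min d (\<delta> / 3)" if "x \<in> unit_cube" for x using dist_cell[OF c that] .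
  show thesis
  proof (rule that[of c])
    show "discretization d c" using c by (auto simp: discretization_def)
    fix x y x' y' assume *: "x \<in> unit_cube" "y \<in> unit_cube" "x' \<in> {x, c x}" "y' \<in> {y, c y}"
    have "dist x x' \<le> \<delta> / 3" "dist y y' \<le> \<delta> / 3" using * dist[of x] dist[of y] \<delta>(1) by auto
    then have "dist (x, y) (x', y') < \<delta>"
      using \<delta>(1) norm_Pair_le[of "x - x'" "y - y'"] by (simp add: dist_norm)
    moreover have "(x', y') \<in> unit_cube \<times> unit_cube" using * cells_subset[OF c] by auto
    ultimately have "dist (k x y) (k x' y') < e" using \<delta>(2)[of "(x', y')" "(x, y)"] * by simp
    then show "\<bar>k x y - k x' y'\<bar> \<le> e" by (simp add: dist_real_def)
  qed
qed

text \<open>Schur test for the difference of the two kernels; the cube has volume one, so a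
  pointwise bound is also a bound for the rows.\<close>

lemma kernel_form_discretization:
  fixes k :: "real ^ 'n::finite \<Rightarrow> real ^ 'n \<Rightarrow> real"
  assumes c: "discretization \<eta> c" and hs: "hs_kernel k"
    and sym: "\<And>x y. x \<in> unit_cube \<Longrightarrow> y \<in> unit_cube \<Longrightarrow> k x y = k y x"
    and close: "\<And>x y x' y'. x \<in> unit_cube \<Longrightarrow> y \<in> unit_cube \<Longrightarrow> x' \<in> {x, c x} \<Longrightarrow> y' \<in> {y, c y} \<Longrightarrow> \<bar>k x y - k x' y'\<bar> \<le> \<epsilon>"
    and g: "g \<in> L2"
  shows "\<bar>bil k g g - bil (\<lambda>x y. k (c x) (c y)) g g\<bar> \<le> \<epsilon> * inner_L2 g g"
proof -
  have "\<bar>bil (\<lambda>x y. k x y - k (c x) (c y)) g g\<bar> \<le> \<epsilon> * inner_L2 g g"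
  proof (rule Schur_form_bound[where c = \<epsilon>])
    show "hs_kernel (\<lambda>x y. k x y - k (c x) (c y))" by (intro hs_kernel_diff hs hs_disc[OF c])
    show "k x y - k (c x) (c y) = k y x - k (c y) (c x)" if "x \<in> unit_cube" "y \<in> unit_cube" for x y
    proof -
      have "c x \<in> unit_cube" "c y \<in> unit_cube" using cells_subset[OF c] that by auto
      then show ?thesis using sym[OF that] sym[of "c x" "c y"] by simp
    qed
    show *: "\<bar>k x y - k (c x) (c y)\<bar> \<le> \<epsilon>" if "x \<in> unit_cube" "y \<in> unit_cube" for x y
      using close[OF that] by simp
    show "(LINT y|cube. \<bar>k x y - k (c x) (c y)\<bar>) \<le> \<epsilon>" if x: "x \<in> unit_cube" for x
    proof -
      have "0 \<le> \<epsilon>" using *[OF x x] by linarith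
      then have "(LINT y|cube. \<bar>k x y - k (c x) (c y)\<bar>) \<le> (LINT y|(cube :: (real ^ 'n) measure). \<epsilon>)"
        using *[OF x] by (intro Bochner_Integration.integral_mono') auto
      then show ?thesis by (simp add: cube.prob_space[simplified])
    qed
  qed (rule g)
  then show ?thesis using bil_diff_kernel[OF hs hs_disc[OF c, of k] g g] by simp
qed

section \<open>Traces\<close>

lemma Bessel_inequality:
  assumes F: "finite F" "F \<subseteq> L2" "\<And>e. e \<in> F \<Longrightarrow> inner_L2 e e = 1"
    "\<And>e e'. e \<in> F \<Longrightarrow> e' \<in> F \<Longrightarrow> e \<noteq> e' \<Longrightarrow> inner_L2 e e' = 0" and f: "f \<in> L2"
  shows "(\<Sum>e\<in>F. (inner_L2 f e)\<^sup>2) \<le> inner_L2 f f"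
proof -
  define p where "p x = (\<Sum>e\<in>F. inner_L2 f e * e x)" for x
  have p: "p \<in> L2" unfolding p_def[abs_def] using F(2) by (intro L2_sum L2_cmult) auto
  have inner_p: "inner_L2 p h = (\<Sum>e\<in>F. inner_L2 f e * inner_L2 e h)" if "h \<in> L2" for h
  proof -
    have "inner_L2 p h = (\<Sum>e\<in>F. inner_L2 (\<lambda>x. inner_L2 f e * e x) h)"
      unfolding p_def[abs_def] using F(2) that by (intro inner_L2_sum_left L2_cmult) auto
    then show ?thesis by (simp add: inner_L2_cmult_left)
  qed
  have pf: "inner_L2 p f = (\<Sum>e\<in>F. (inner_L2 f e)\<^sup>2)"
    using inner_p[OF f] by (simp add: inner_L2_commute[of _ f] power2_eq_square)
  have pe: "inner_L2 p e = inner_L2 f e" if e: "e \<in> F" for e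
  proof -
    have "inner_L2 p e = (\<Sum>e'\<in>F. inner_L2 f e' * inner_L2 e' e)"
      using inner_p e F(2) by blast
    also have "\<dots> = (\<Sum>e'\<in>F. if e' = e then inner_L2 f e else 0)"
      by (intro sum.cong refl) (use F(3,4) e in auto)
    finally show ?thesis using F e by simp
  qed
  have pp: "inner_L2 p p = (\<Sum>e\<in>F. (inner_L2 f e)\<^sup>2)"
  proof -
    have "inner_L2 e p = inner_L2 f e" if "e \<in> F" for e using pe[OF that] inner_L2_commute[of e p] by simp
    then show ?thesis using inner_p[OF p] by (simp add: power2_eq_square)
  qed
  have "0 \<le> inner_L2 (\<lambda>x. f x - p x) (\<lambda>x. f x - p x)" by (rule inner_L2_self_nonneg)
  then show ?thesis using inner_L2_expand(2)[OF f p] pf pp by (simp add: inner_L2_commute[of f p])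
qed

text \<open>On the grid the kernel is a finite sum of tensor squares of functions
  \<open>b i\<close>. Summing its forms over an orthonormal family and applying Bessel to each
  \<open>b i\<close> leaves the integral of the diagonal, at most \<open>K0\<close>. Discretization
  costs \<open>card F * \<epsilon>\<close> with \<epsilon> arbitrary. This takes the place of
  Mercer's expansion.\<close>

lemma psd_kernel_trace_bound:
  fixes k :: "real ^ 'n::finite \<Rightarrow> real ^ 'n \<Rightarrow> real"
  assumes k: "continuous_on (unit_cube \<times> unit_cube) (\<lambda>z. k (fst z) (snd z))"
    and sym: "\<And>x y. x \<in> unit_cube \<Longrightarrow> y \<in> unit_cube \<Longrightarrow> k x y = k y x"
    and psd: "\<And>S c. finite S \<Longrightarrow> S \<subseteq> unit_cube \<Longrightarrow> 0 \<le> (\<Sum>x\<in>S. \<Sum>y\<in>S. c x * c y * k x y)"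
    and hs: "hs_kernel k"
    and diag: "\<And>x. x \<in> unit_cube \<Longrightarrow> k x x \<le> K0"
    and F: "finite F" "F \<subseteq> L2" "\<And>e. e \<in> F \<Longrightarrow> inner_L2 e e = 1"
    "\<And>e e'. e \<in> F \<Longrightarrow> e' \<in> F \<Longrightarrow> e \<noteq> e' \<Longrightarrow> inner_L2 e e' = 0"
  shows "(\<Sum>e\<in>F. bil k e e) \<le> K0" and "\<And>e. e \<in> F \<Longrightarrow> 0 \<le> bil k e e"
proof -
  have main: "(\<Sum>e\<in>F. bil k e e) \<le> K0 + real (card F) * \<epsilon> \<and> (\<forall>e\<in>F. - \<epsilon> \<le> bil k e e)" if \<epsilon>: "\<epsilon> > 0" for \<epsilon>
  proof -
    obtain c where c: "discretization 1 c" and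
      close: "\<And>x y x' y'. x \<in> unit_cube \<Longrightarrow> y \<in> unit_cube \<Longrightarrow> x' \<in> {x, c x} \<Longrightarrow> y' \<in> {y, c y} \<Longrightarrow> \<bar>k x y - k x' y'\<bar> \<le> \<epsilon>"
      using continuous_kernel_discretization[OF k \<epsilon>, of 1] by auto
    let ?I = "c ` unit_cube"
    note cells = finite_cells[OF c] cells_subset[OF c]
    obtain b where b: "\<And>x y. x \<in> ?I \<Longrightarrow> y \<in> ?I \<Longrightarrow> k x y = (\<Sum>i\<in>?I. b i x * b i y)"
    proof -
      have "k x y = k y x" if "x \<in> ?I" "y \<in> ?I" for x y using sym that cells(2) by blast
      from psd_gram_factorization[OF cells(1) this psd[OF cells]] show thesis using that by blast
    qed
    have form: "bil (\<lambda>x y. k (c x) (c y)) e e = (\<Sum>i\<in>?I. (inner_L2 (\<lambda>x. b i (c x)) e)\<^sup>2)" if "e \<in> L2" for e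
    proof -
      have "bil (\<lambda>x y. k (c x) (c y)) e e = (\<Sum>p\<in>?I. \<Sum>q\<in>?I. k p q * (cell_coeff c e p * cell_coeff c e q))"
        using bil_disc[OF c that that] .
      also have "\<dots> = (\<Sum>p\<in>?I. \<Sum>q\<in>?I. \<Sum>i\<in>?I. (b i p * cell_coeff c e p) * (b i q * cell_coeff c e q))"
        by (intro sum.cong refl, simp only: b sum_distrib_right, intro sum.cong refl, simp add: mult_ac)
      also have "\<dots> = (\<Sum>p\<in>?I. \<Sum>i\<in>?I. \<Sum>q\<in>?I. (b i p * cell_coeff c e p) * (b i q * cell_coeff c e q))"
        by (intro sum.cong refl sum.swap)
      also have "\<dots> = (\<Sum>i\<in>?I. \<Sum>p\<in>?I. \<Sum>q\<in>?I. (b i p * cell_coeff c e p) * (b i q * cell_coeff c e q))"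
        by (rule sum.swap)
      also have "\<dots> = (\<Sum>i\<in>?I. (inner_L2 (\<lambda>x. b i (c x)) e)\<^sup>2)"
        by (simp add: inner_disc[OF c that] power2_eq_square sum_product)
      finally show ?thesis .
    qed
    have diff: "\<bar>bil k e e - bil (\<lambda>x y. k (c x) (c y)) e e\<bar> \<le> \<epsilon>" if e: "e \<in> F" for e
    proof -
      have "e \<in> L2" using e F by auto
      from kernel_form_discretization[OF c hs sym close this] show ?thesis using F(3)[OF e] by simp
    qed
    have "(\<Sum>e\<in>F. bil k e e) \<le> (\<Sum>e\<in>F. bil (\<lambda>x y. k (c x) (c y)) e e + \<epsilon>)"
      using diff by (intro sum_mono) (smt (verit))
    also have "\<dots> = (\<Sum>e\<in>F. \<Sum>i\<in>?I. (inner_L2 (\<lambda>x. b i (c x)) e)\<^sup>2) + real (card F) * \<epsilon>"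
      using form F(2) by (simp add: sum.distrib subset_iff)
    also have "(\<Sum>e\<in>F. \<Sum>i\<in>?I. (inner_L2 (\<lambda>x. b i (c x)) e)\<^sup>2) = (\<Sum>i\<in>?I. \<Sum>e\<in>F. (inner_L2 (\<lambda>x. b i (c x)) e)\<^sup>2)"
      by (rule sum.swap)
    also have "\<dots> \<le> (\<Sum>i\<in>?I. inner_L2 (\<lambda>x. b i (c x)) (\<lambda>x. b i (c x)))"
      by (intro sum_mono Bessel_inequality F disc_L2[OF c])
    also have "\<dots> = (LINT x|cube. (\<Sum>i\<in>?I. (b i (c x))\<^sup>2))"
      using L2_integrable_square[OF disc_L2[OF c]] by (simp add: inner_L2_self)
    also have "\<dots> \<le> (LINT x|(cube :: (real ^ 'n) measure). K0)"
    proof (rule integral_mono)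
      show "integrable cube (\<lambda>x. \<Sum>i\<in>?I. (b i (c x))\<^sup>2)"
        using L2_integrable_square[OF disc_L2[OF c]] by simp
      fix x :: "real ^ 'n" assume "x \<in> space cube"
      then have x: "c x \<in> ?I" by simp
      then have "c x \<in> unit_cube" using cells(2) by auto
      from diag[OF this] b[OF x x] show "(\<Sum>i\<in>?I. (b i (c x))\<^sup>2) \<le> K0" by (simp add: power2_eq_square)
    qed simp
    also have "\<dots> = K0" by (simp add: cube.prob_space[simplified])
    finally have 1: "(\<Sum>e\<in>F. bil k e e) \<le> K0 + real (card F) * \<epsilon>" by simp
    have "- \<epsilon> \<le> bil k e e" if e: "e \<in> F" for e
    proof -
      have eL: "e \<in> L2" using F(2) e by blast
      have "0 \<le> bil (\<lambda>x y. k (c x) (c y)) e e" unfolding form[OF eL] by (intro sum_nonneg) simp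
      then show ?thesis using diff[OF e] by linarith
    qed
    with 1 show ?thesis by blast
  qed
  show "(\<Sum>e\<in>F. bil k e e) \<le> K0"
  proof (rule field_le_epsilon)
    fix \<epsilon> :: real assume "\<epsilon> > 0"
    then have p: "\<epsilon> / (real (card F) + 1) > 0" by (simp add: add_nonneg_pos)
    have "real (card F) * (\<epsilon> / (real (card F) + 1)) \<le> \<epsilon>" using \<open>\<epsilon> > 0\<close> by (simp add: field_simps)
    then show "(\<Sum>e\<in>F. bil k e e) \<le> K0 + \<epsilon>" using main[OF p] by linarith
  qed
  show "0 \<le> bil k e e" if "e \<in> F" for e
  proof (rule field_le_epsilon)
    fix \<epsilon> :: real assume "\<epsilon> > 0"
    then show "0 \<le> bil k e e + \<epsilon>" using main[of \<epsilon>] that by fastforce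
  qed
qed

text \<open>A maximal orthonormal family, from Zorn's lemma, is total: a function of nonzero norm
  orthogonal to it could be normalized and added. One basis has to be exhibited because
  \<open>has_trace\<close> quantifies over all of them and would be vacuous otherwise.\<close>

lemma ex_orthonormal_basis_L2: "\<exists>E :: (real ^ 'n::finite \<Rightarrow> real) set. orthonormal_basis_L2 E"
proof -
  define \<A> :: "(real ^ 'n \<Rightarrow> real) set set" where
    "\<A> = {E. E \<subseteq> L2 \<and> (\<forall>e\<in>E. inner_L2 e e = 1) \<and> (\<forall>e\<in>E. \<forall>e'\<in>E. e \<noteq> e' \<longrightarrow> inner_L2 e e' = 0)}"
  have "\<exists>E\<in>\<A>. \<forall>X\<in>\<A>. E \<subseteq> X \<longrightarrow> X = E"
  proof (rule subset_Zorn_nonempty)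
    show "\<A> \<noteq> {}" by (auto simp: \<A>_def intro!: exI[of _ "{}"])
    fix \<C> assume ne: "\<C> \<noteq> {}" and ch: "subset.chain \<A> \<C>"
    have sub: "\<C> \<subseteq> \<A>" using ch by (auto simp: subset.chain_def)
    have tot: "X \<subseteq> Y \<or> Y \<subseteq> X" if "X \<in> \<C>" "Y \<in> \<C>" for X Y
      using ch that by (auto simp: subset.chain_def)
    have orth: "inner_L2 e e' = 0" if ee: "e \<in> \<Union>\<C>" "e' \<in> \<Union>\<C>" "e \<noteq> e'" for e e'
    proof -
      obtain X Y where XY: "X \<in> \<C>" "Y \<in> \<C>" "e \<in> X" "e' \<in> Y" using ee by auto
      then obtain Z where "Z \<in> \<C>" "e \<in> Z" "e' \<in> Z" using tot[OF XY(1,2)] by auto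
      then show ?thesis using sub ee by (auto simp: \<A>_def)
    qed
    have "e \<in> L2" "inner_L2 e e = 1" if "e \<in> \<Union>\<C>" for e using that sub by (auto simp: \<A>_def)
    then show "\<Union>\<C> \<in> \<A>" using orth unfolding \<A>_def by blast
  qed
  then obtain E where E: "E \<in> \<A>" and max: "\<And>X. X \<in> \<A> \<Longrightarrow> E \<subseteq> X \<Longrightarrow> X = E" by blast
  have "norm_L2 f = 0" if f: "f \<in> L2" and o: "\<And>e. e \<in> E \<Longrightarrow> inner_L2 f e = 0" for f
  proof (rule ccontr)
    assume nz: "norm_L2 f \<noteq> 0"
    define g where "g x = 1 / norm_L2 f * f x" for x
    have g: "g \<in> L2" unfolding g_def[abs_def] by (rule L2_cmult[OF f])
    have ge: "inner_L2 g h = 1 / norm_L2 f * inner_L2 f h" for h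
      unfolding g_def[abs_def] by (rule inner_L2_cmult_left)
    have "inner_L2 g g = 1 / norm_L2 f * (1 / norm_L2 f * inner_L2 f f)"
      using ge[of g] ge[of f] inner_L2_commute[of f g] by simp
    also have "inner_L2 f f = norm_L2 f * norm_L2 f" using norm_L2_square[of f] by (simp add: power2_eq_square)
    finally have gg: "inner_L2 g g = 1" using nz by simp
    have go: "inner_L2 g e = 0" "inner_L2 e g = 0" if "e \<in> E" for e
      using ge[of e] o[OF that] inner_L2_commute[of e g] by simp_all
    have "insert g E \<in> \<A>" using E g gg go unfolding \<A>_def by (simp add: insert_subset)
    then have "g \<in> E" using max[of "insert g E"] by auto
    then show False using go(1)[of g] gg by simp
  qed
  moreover have "E \<subseteq> L2" "\<forall>e\<in>E. inner_L2 e e = 1" "\<forall>e\<in>E. \<forall>e'\<in>E. e \<noteq> e' \<longrightarrow> inner_L2 e e' = 0"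
    using E by (simp_all add: \<A>_def)
  ultimately have "orthonormal_basis_L2 E" by (simp add: orthonormal_basis_L2_def)
  then show ?thesis ..
qed

text \<open>Evaluation in a single basis shows that the trace is unique, so the description in
  \<open>op_trace\<close> picks it; the diagonal entries are nonnegative and their finite sums stay
  below \<open>K0\<close>.\<close>

lemma op_trace_bounds:
  fixes k :: "real ^ 'n::finite \<Rightarrow> real ^ 'n \<Rightarrow> real"
  assumes k: "continuous_on (unit_cube \<times> unit_cube) (\<lambda>z. k (fst z) (snd z))"
    and sym: "\<And>x y. x \<in> unit_cube \<Longrightarrow> y \<in> unit_cube \<Longrightarrow> k x y = k y x"
    and psd: "\<And>S c. finite S \<Longrightarrow> S \<subseteq> unit_cube \<Longrightarrow> 0 \<le> (\<Sum>x\<in>S. \<Sum>y\<in>S. c x * c y * k x y)"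
    and hs: "hs_kernel k"
    and diag: "\<And>x. x \<in> unit_cube \<Longrightarrow> k x x \<le> K0"
    and tc: "trace_class (integral_op k)"
  shows "0 \<le> op_trace (integral_op k)" "op_trace (integral_op k) \<le> K0"
proof -
  obtain E :: "(real ^ 'n \<Rightarrow> real) set" where E: "orthonormal_basis_L2 E" using ex_orthonormal_basis_L2 by blast
  obtain t where t: "has_trace (integral_op k) t" using tc by (auto simp: trace_class_def)
  have uniq: "t' = t" if "has_trace (integral_op k) t'" for t'
  proof (rule has_sum_unique)
    show "((\<lambda>e. inner_L2 (integral_op k e) e) has_sum t') E" using that E by (simp add: has_trace_def)
    show "((\<lambda>e. inner_L2 (integral_op k e) e) has_sum t) E" using t E by (simp add: has_trace_def)
  qed
  have tr: "op_trace (integral_op k) = t"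
    unfolding op_trace_def using t uniq by (rule the_equality)
  have sum: "((\<lambda>e. inner_L2 (integral_op k e) e) has_sum t) E" using t E by (simp add: has_trace_def)
  have EL: "E \<subseteq> L2" and E1: "\<And>e. e \<in> E \<Longrightarrow> inner_L2 e e = 1"
    and E0: "\<And>e e'. e \<in> E \<Longrightarrow> e' \<in> E \<Longrightarrow> e \<noteq> e' \<Longrightarrow> inner_L2 e e' = 0"
    using E by (auto simp: orthonormal_basis_L2_def)
  have eq: "inner_L2 (integral_op k e) e = bil k e e" if "e \<in> E" for e
    using bil_eq_inner[OF hs, of e e] that EL by auto
  have bd: "(\<Sum>e\<in>F. inner_L2 (integral_op k e) e) \<le> K0" if F: "finite F" "F \<subseteq> E" for F
  proof -
    have "(\<Sum>e\<in>F. inner_L2 (integral_op k e) e) = (\<Sum>e\<in>F. bil k e e)"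
      using eq F by (intro sum.cong) auto
    also have "\<dots> \<le> K0"
    proof -
      have "F \<subseteq> L2" "\<And>e. e \<in> F \<Longrightarrow> inner_L2 e e = 1"
        "\<And>e e'. e \<in> F \<Longrightarrow> e' \<in> F \<Longrightarrow> e \<noteq> e' \<Longrightarrow> inner_L2 e e' = 0"
        using F EL E1 E0 by (blast+)
      from psd_kernel_trace_bound(1)[OF k sym psd hs diag F(1) this] show ?thesis .
    qed
    finally show ?thesis .
  qed
  have nn: "0 \<le> inner_L2 (integral_op k e) e" if e: "e \<in> E" for e
  proof -
    have "0 \<le> bil k e e"
      by (rule psd_kernel_trace_bound(2)[OF k sym psd hs diag, of "{e}"]) (use e EL E1 in auto)
    then show ?thesis using eq[OF e] by simp
  qed
  show "op_trace (integral_op k) \<le> K0" unfolding tr by (rule has_sum_le_finite_sums[OF sum bd])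
  show "0 \<le> op_trace (integral_op k)" unfolding tr by (rule has_sum_nonneg[OF sum nn])
qed

section \<open>Isotropic kernels with a small lengthscale\<close>

lemma cube_indicator_measurable:
  fixes S :: "(real ^ 'n::finite) set"
  assumes "S \<in> lmeasurable"
  shows "(indicator S :: real ^ 'n \<Rightarrow> real) \<in> borel_measurable cube"
proof -
  have "S \<inter> unit_cube \<in> sets cube"
    unfolding sets_restrict_space using fmeasurableD[OF assms] by blast
  then show ?thesis by (subst borel_measurable_indicator_iff) (simp add: Int_commute)
qed

lemma measure_norm_ball_le:
  fixes x :: "real ^ 'n::finite"
  assumes "0 \<le> r"
  shows "(LINT y|cube. indicator {y. norm (x - y) \<le> r} y) \<le> (2 * r) ^ CARD('n)"
proof -
  have "{y. norm (x - y) \<le> r} = cball x r" by (auto simp: dist_norm)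
  then have "(LINT y|cube. indicator {y. norm (x - y) \<le> r} y) = (LINT y|cube. indicator (cball x r \<inter> unit_cube) y :: real)"
    by (intro Bochner_Integration.integral_cong) (auto simp: indicator_def)
  also have "\<dots> = measure cube (cball x r \<inter> unit_cube)" by simp
  also have "\<dots> = measure lebesgue (cball x r \<inter> unit_cube)"
    by (subst measure_restrict_space) (auto simp: unit_cube_eq_cbox)
  also have "\<dots> \<le> measure lebesgue (cbox (\<chi> i. x $ i - r) (\<chi> i. x $ i + r))"
  proof (rule measure_mono_fmeasurable)
    show "cball x r \<inter> unit_cube \<subseteq> cbox (\<chi> i. x $ i - r) (\<chi> i. x $ i + r)"
    proof
      fix y assume "y \<in> cball x r \<inter> unit_cube"
      then have "norm (x - y) \<le> r" by (simp add: dist_norm)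
      then have "\<bar>(x - y) $ i\<bar> \<le> r" for i using component_le_norm_cart[of "x - y" i] by linarith
      then have "\<bar>x $ i - y $ i\<bar> \<le> r" for i by simp
      then have "x $ i - r \<le> y $ i \<and> y $ i \<le> x $ i + r" for i by (smt (verit))
      then show "y \<in> cbox (\<chi> i. x $ i - r) (\<chi> i. x $ i + r)" by (simp add: mem_box_cart)
    qed
  qed (auto simp: unit_cube_eq_cbox)
  also have "\<dots> = (2 * r) ^ CARD('n)"
    using assms by (subst measure_cbox_cart) (auto simp: algebra_simps)
  finally show ?thesis .
qed

text \<open>The parameters \<open>K\<close>, \<nu>, \<open>A\<close> and \<open>B\<close> are fixed
  before the lengthscale, so constants built from them are uniform in it.\<close>

locale lengthscale_kernel =
  fixes K :: "real \<Rightarrow> real"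
    and k :: "real \<Rightarrow> real ^ 'n::finite \<Rightarrow> real ^ 'n \<Rightarrow> real"
    and \<nu> :: "nat \<Rightarrow> real" and A B :: real
  assumes trace_class: "\<And>l. l > 0 \<Longrightarrow> trace_class (integral_op (k l))"
    and sup_diag: "\<And>l x. l > 0 \<Longrightarrow> x \<in> unit_cube \<Longrightarrow> k l x x \<le> A * op_trace (integral_op (k l))"
    and \<nu>_pos: "\<And>m. 1 \<le> m \<Longrightarrow> 0 < \<nu> m"
    and \<nu>_decreasing: "\<And>m n. 1 \<le> m \<Longrightarrow> m \<le> n \<Longrightarrow> \<nu> n \<le> \<nu> m"
    and \<nu>_one: "\<nu> 1 = 1"
    and \<nu>_tendsto_0: "\<nu> \<longlonglongrightarrow> 0"
    and tail: "\<And>l. l > 0 \<Longrightarrow>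
      tail_bound (k l) (eff_dim (integral_op (k l)) powr (- 1 / real CARD('n))) \<nu> B"
    and base_kernel: "positive_semidefinite_kernel (\<lambda>x y :: real ^ 'n. K (norm (x - y)))"
    and k_eq: "\<And>l x y. l > 0 \<Longrightarrow> x \<in> unit_cube \<Longrightarrow> y \<in> unit_cube \<Longrightarrow>
      k l x y = K (norm (x - y) / l)"
    and K_pos: "\<And>r. 0 \<le> r \<Longrightarrow> 0 < K r"
    and K_diff: "K differentiable_on {0..}"
    and K_strict: "strict_antimono_on {0..} K"
    and K_lim: "(K \<longlongrightarrow> 0) at_top"
begin

lemma K_cont: "continuous_on {0..} K"
  by (rule differentiable_imp_continuous_on[OF K_diff])

lemma K_antimono: "0 \<le> r \<Longrightarrow> r \<le> s \<Longrightarrow> K s \<le> K r"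
  using monotone_onD[OF K_strict, of r s] by (cases "r = s") auto

lemma k_cont: "l > 0 \<Longrightarrow> continuous_on (unit_cube \<times> unit_cube) (\<lambda>z. k l (fst z) (snd z))"
proof -
  assume l: "l > 0"
  have "continuous_on (unit_cube \<times> unit_cube) (\<lambda>z :: (real ^ 'n) \<times> (real ^ 'n). K (norm (fst z - snd z) / l))"
    using l by (intro continuous_on_compose2[OF K_cont] continuous_intros) auto
  then show ?thesis by (rule continuous_on_eq) (auto simp: k_eq l)
qed

lemma k_sym: "l > 0 \<Longrightarrow> x \<in> unit_cube \<Longrightarrow> y \<in> unit_cube \<Longrightarrow> k l x y = k l y x"
  by (simp add: k_eq norm_minus_commute)

lemma k_pos: "l > 0 \<Longrightarrow> x \<in> unit_cube \<Longrightarrow> y \<in> unit_cube \<Longrightarrow> 0 < k l x y"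
  by (simp add: k_eq K_pos)

lemma k_le: "l > 0 \<Longrightarrow> x \<in> unit_cube \<Longrightarrow> y \<in> unit_cube \<Longrightarrow> k l x y \<le> K 0"
  by (simp add: k_eq K_antimono)

lemma k_diag: "l > 0 \<Longrightarrow> x \<in> unit_cube \<Longrightarrow> k l x x = K 0"
  by (simp add: k_eq)

lemma k_hs: "l > 0 \<Longrightarrow> hs_kernel (k l)"
  using k_le k_pos by (intro hs_kernel_bounded[where c = "K 0"] continuous_kernel_measurable k_cont) (auto simp: less_imp_le abs_of_pos)

lemma k_row_measurable: "l > 0 \<Longrightarrow> x \<in> unit_cube \<Longrightarrow> k l x \<in> borel_measurable cube"
  using measurable_compose[OF measurable_Pair1'[of x cube cube] continuous_kernel_measurable[OF k_cont]] by simp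

lemma k_row_integrable: "l > 0 \<Longrightarrow> x \<in> unit_cube \<Longrightarrow> integrable cube (\<lambda>y. k l x y)"
  using k_le k_pos by (intro cube.integrable_const_bound[where B = "K 0"] k_row_measurable) (auto simp: less_imp_le abs_of_pos)

text \<open>Dividing the points by \<open>l\<close> turns the sum into one for the base
  kernel.\<close>

lemma k_psd:
  assumes l: "l > 0" and S: "finite S" "S \<subseteq> unit_cube"
  shows "0 \<le> (\<Sum>x\<in>S. \<Sum>y\<in>S. c x * c y * k l x y)"
proof -
  let ?s = "\<lambda>x :: real ^ 'n. (1 / l) *\<^sub>R x"
  have inj: "inj_on ?s S" using l by (auto simp: inj_on_def)
  have "\<forall>S c. finite S \<longrightarrow> 0 \<le> (\<Sum>x\<in>S. \<Sum>y\<in>S. c x * c y * K (norm (x - y :: real ^ 'n)))"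
    using base_kernel unfolding positive_semidefinite_kernel_def by (rule conjunct2)
  from this[rule_format, OF finite_imageI[OF S(1), of ?s], of "\<lambda>x. c (l *\<^sub>R x)"]
  have "0 \<le> (\<Sum>x\<in>?s ` S. \<Sum>y\<in>?s ` S. c (l *\<^sub>R x) * c (l *\<^sub>R y) * K (norm (x - y)))" .
  also have "\<dots> = (\<Sum>x\<in>S. \<Sum>y\<in>S. c (l *\<^sub>R ?s x) * c (l *\<^sub>R ?s y) * K (norm (?s x - ?s y)))"
    by (simp add: sum.reindex[OF inj])
  also have "\<dots> = (\<Sum>x\<in>S. \<Sum>y\<in>S. c x * c y * k l x y)"
  proof (intro sum.cong refl)
    fix x y assume xy: "x \<in> S" "y \<in> S"
    have "norm (?s x - ?s y) = norm (x - y) / l"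
      using l by (simp add: scaleR_diff_right[symmetric])
    then show "c (l *\<^sub>R ?s x) * c (l *\<^sub>R ?s y) * K (norm (?s x - ?s y)) = c x * c y * k l x y"
      using l xy S(2) by (simp add: k_eq subset_iff)
  qed
  finally show ?thesis .
qed

lemma zero_in_cube: "(0 :: real ^ 'n) \<in> unit_cube"
  by (simp add: unit_cube_def)

text \<open>The diagonal is constant, so the hypothesis on it at a single point reads
  \<open>K 0 \<le> A * op_trace (integral_op (k l))\<close>. This bounds the trace from below and,
  the trace being nonnegative, forces \<open>A > 0\<close>.\<close>

lemma trace_bounds:
  assumes l: "l > 0"
  shows "A > 0" "K 0 / A \<le> op_trace (integral_op (k l))" "op_trace (integral_op (k l)) \<le> K 0"
proof -
  have t: "0 \<le> op_trace (integral_op (k l))" "op_trace (integral_op (k l)) \<le> K 0"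
    using op_trace_bounds[OF k_cont[OF l] k_sym[OF l] k_psd[OF l] k_hs[OF l] _ trace_class[OF l], of "K 0"] l
    by (simp_all add: k_diag)
  have le: "K 0 \<le> A * op_trace (integral_op (k l))"
    using sup_diag[OF l zero_in_cube] by (simp add: k_diag l zero_in_cube)
  have "K 0 > 0" by (rule K_pos) simp
  then have "0 < A * op_trace (integral_op (k l))" using le by linarith
  then show "A > 0" using t(1) by (simp add: zero_less_mult_iff)
  then show "K 0 / A \<le> op_trace (integral_op (k l))" using le by (simp add: field_simps)
  show "op_trace (integral_op (k l)) \<le> K 0" by (rule t(2))
qed

section \<open>Two-sided bounds for the norm and the effective dimension\<close>

text \<open>Its support sits in a corner so that it fits into the domain for every
  \<open>l \<le> 1\<close>; the height makes the norm equal to one.\<close>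

definition corner :: "real \<Rightarrow> real ^ 'n \<Rightarrow> real" where
  "corner l x = (if x \<in> cbox 0 (\<chi> i. l) then 1 / sqrt (l ^ CARD('n)) else 0)"

lemma corner_L2: "corner l \<in> L2"
proof (rule L2_bounded[where c = "\<bar>1 / sqrt (l ^ CARD('n))\<bar>"])
  have "corner l = (\<lambda>x. 1 / sqrt (l ^ CARD('n)) * indicator (cbox 0 (\<chi> i. l)) x)"
    by (auto simp: corner_def indicator_def)
  moreover have "(indicator (cbox 0 (\<chi> i. l)) :: real ^ 'n \<Rightarrow> real) \<in> borel_measurable cube"
    by (rule cube_indicator_measurable[OF lmeasurable_cbox])
  ultimately show "corner l \<in> borel_measurable cube" by simp
qed (auto simp: corner_def)

lemma corner_nonneg: "0 < l \<Longrightarrow> 0 \<le> corner l x"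
  by (simp add: corner_def)

lemma corner_integral:
  assumes l: "0 < l" "l \<le> 1"
  shows "(LINT x|cube. corner l x) = sqrt (l ^ CARD('n))" and "inner_L2 (corner l) (corner l) = 1"
proof -
  have sub: "cbox 0 (\<chi> i. l) \<subseteq> (unit_cube :: (real ^ 'n) set)"
  proof
    fix x :: "real ^ 'n" assume "x \<in> cbox 0 (\<chi> i. l)"
    then have "0 \<le> x $ i \<and> x $ i \<le> l" for i by (simp add: mem_box_cart)
    then have "0 \<le> x $ i \<and> x $ i \<le> 1" for i using l(2) order_trans by blast
    then show "x \<in> unit_cube" by (simp add: unit_cube_def)
  qed
  have m: "(LINT x|cube. indicator (cbox 0 (\<chi> i. l) :: (real ^ 'n) set) x) = l ^ CARD('n)"
  proof -
    have "(LINT x|cube. indicator (cbox 0 (\<chi> i. l) :: (real ^ 'n) set) x) = (LINT x|cube. indicator (cbox 0 (\<chi> i. l) \<inter> unit_cube :: (real ^ 'n) set) x :: real)"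
      by (intro Bochner_Integration.integral_cong) (auto simp: indicator_def)
    also have "\<dots> = measure cube (cbox 0 (\<chi> i. l) \<inter> unit_cube :: (real ^ 'n) set)" by simp
    also have "\<dots> = measure lebesgue (cbox 0 (\<chi> i. l) :: (real ^ 'n) set)"
      using sub by (subst measure_restrict_space) (auto simp: unit_cube_eq_cbox Int_absorb2)
    also have "\<dots> = l ^ CARD('n)" using l by (subst measure_cbox_cart) auto
    finally show ?thesis .
  qed
  define s where "s = sqrt (l ^ CARD('n))"
  have s: "s > 0" "s * s = l ^ CARD('n)" using l by (auto simp: s_def)
  have "(\<lambda>x. corner l x) = (\<lambda>x. 1 / s * indicator (cbox 0 (\<chi> i. l)) x)"
    by (auto simp: corner_def indicator_def s_def)
  then have "(LINT x|cube. corner l x) = 1 / s * (s * s)" using m s by simp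
  then show "(LINT x|cube. corner l x) = sqrt (l ^ CARD('n))" using s(1) unfolding s_def[symmetric] by simp
  have "(\<lambda>x. (corner l x)\<^sup>2) = (\<lambda>x. 1 / (s * s) * indicator (cbox 0 (\<chi> i. l)) x)"
    by (auto simp: corner_def indicator_def s_def power_divide power2_eq_square)
  then have "inner_L2 (corner l) (corner l) = 1 / (s * s) * (s * s)"
    unfolding inner_L2_self using m s by simp
  then show "inner_L2 (corner l) (corner l) = 1" using s(1) by simp
qed

lemma corner_dist:
  assumes "x \<in> cbox 0 (\<chi> i. l)" "y \<in> cbox (0 :: real ^ 'n) (\<chi> i. l)"
  shows "norm (x - y) \<le> real CARD('n) * l"
proof -
  have "norm (x - y) \<le> (\<Sum>i\<in>UNIV. \<bar>(x - y) $ i\<bar>)" by (rule norm_le_l1_cart)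
  also have "\<dots> \<le> (\<Sum>i\<in>(UNIV :: 'n set). l)"
  proof (rule sum_mono)
    fix i
    have "0 \<le> x $ i" "x $ i \<le> l" "0 \<le> y $ i" "y $ i \<le> l" using assms by (auto simp: mem_box_cart)
    then show "\<bar>(x - y) $ i\<bar> \<le> l" by simp
  qed
  finally show ?thesis by simp
qed

lemma corner_form_ge:
  assumes l: "0 < l" "l \<le> 1" and hs: "hs_kernel T"
    and T: "\<And>x y. x \<in> unit_cube \<Longrightarrow> y \<in> unit_cube \<Longrightarrow> x \<in> cbox 0 (\<chi> i. l) \<Longrightarrow> y \<in> cbox 0 (\<chi> i. l) \<Longrightarrow> a \<le> T x y"
  shows "a * l ^ CARD('n) \<le> bil T (corner l) (corner l)"
proof -
  have one: "hs_kernel (\<lambda>x y :: real ^ 'n. a * (1 * 1))"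
    by (intro hs_kernel_cmult hs_kernel_tensor) (auto simp: L2_def)
  have "a * l ^ CARD('n) = bil (\<lambda>x y. a * (1 * 1)) (corner l) (corner l)"
  proof -
    have "bil (\<lambda>x y. 1 * 1) (corner l) (corner l) = inner_L2 (\<lambda>_. 1) (corner l) * inner_L2 (\<lambda>_. 1) (corner l)"
      by (rule bil_tensor) (auto simp: corner_L2, auto simp: L2_def)
    also have "\<dots> = l ^ CARD('n)" using l corner_integral(1)[OF l] by (simp add: inner_L2_def)
    finally show ?thesis by (simp add: bil_cmult_kernel[of a "\<lambda>x y. 1 * 1", simplified])
  qed
  also have "\<dots> \<le> bil T (corner l) (corner l)"
    unfolding bil_def
  proof (rule integral_mono)
    fix z :: "(real ^ 'n) \<times> (real ^ 'n)" assume z: "z \<in> space (cube \<Otimes>\<^sub>M cube)"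
    then have z': "fst z \<in> unit_cube" "snd z \<in> unit_cube" by (auto simp: space_pair_measure)
    show "a * (1 * 1) * (corner l (fst z) * corner l (snd z)) \<le> T (fst z) (snd z) * (corner l (fst z) * corner l (snd z))"
    proof (cases "fst z \<in> cbox 0 (\<chi> i. l) \<and> snd z \<in> cbox 0 (\<chi> i. l)")
      case True
      then have "a \<le> T (fst z) (snd z)" using T z' by blast
      then show ?thesis using corner_nonneg[OF l(1)] by (intro mult_right_mono) auto
    qed (auto simp: corner_def)
  qed (auto intro!: bil_integrable[OF hs] corner_L2 simp: bil_integrable[OF one, simplified, OF corner_L2 corner_L2])
  finally show ?thesis .
qed

text \<open>Two points of the corner cube are at most \<open>d * l\<close> apart, by the l1 norm, so
  after rescaling the kernel is at least \<open>K d\<close> on it, a constant free of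
  \<open>l\<close>.\<close>

lemma corner_bil_ge:
  assumes l: "0 < l" "l \<le> 1"
  shows "K (real CARD('n)) * l ^ CARD('n) \<le> bil (k l) (corner l) (corner l)"
proof (rule corner_form_ge[OF l k_hs[OF l(1)]])
  fix x y :: "real ^ 'n" assume xy: "x \<in> unit_cube" "y \<in> unit_cube" "x \<in> cbox 0 (\<chi> i. l)" "y \<in> cbox 0 (\<chi> i. l)"
  have "norm (x - y) / l \<le> real CARD('n)" using corner_dist[OF xy(3,4)] l by (simp add: divide_le_eq)
  then show "K (real CARD('n)) \<le> k l x y" using l xy by (simp add: k_eq K_antimono)
qed

lemma op_norm_ge:
  assumes l: "0 < l" "l \<le> 1"
  shows "K (real CARD('n)) * l ^ CARD('n) \<le> op_norm (integral_op (k l))"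
proof -
  note corner_bil_ge[OF l]
  also have "bil (k l) (corner l) (corner l) \<le> \<bar>bil (k l) (corner l) (corner l)\<bar>" by simp
  also have "\<dots> \<le> op_norm (integral_op (k l))"
    by (rule form_le_op_norm[OF k_hs[OF l(1)] corner_L2]) (simp add: norm_L2_def corner_integral[OF l])
  finally show ?thesis .
qed

lemma op_norm_pos: "0 < l \<Longrightarrow> l \<le> 1 \<Longrightarrow> 0 < op_norm (integral_op (k l))"
  using op_norm_ge[of l] mult_pos_pos[OF K_pos[of "real CARD('n)"] zero_less_power[of l "CARD('n)"]] by simp

lemma tail_integral:
  assumes x: "x \<in> (unit_cube :: (real ^ 'n) set)"
  shows "(LINT y:{y \<in> unit_cube. norm (x - y) > r}|lebesgue. \<bar>f y\<bar>) =
    (LINT y|cube. indicator {y. norm (x - y) > r} y * \<bar>f y\<bar> :: real)"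
  unfolding set_lebesgue_integral_def
  by (subst integral_restrict_space) (auto simp: unit_cube_eq_cbox indicator_def intro!: Bochner_Integration.integral_cong)

text \<open>A row is split at the radii \<open>R * l\<close> and \<open>m * h\<close>, where
  \<open>h = r(C)^(-1/d)\<close>. Within the first the kernel is at most \<open>K 0\<close>, beyond
  the second the tail hypothesis applies, and in between the kernel is at most \<open>K R\<close>.
  Since \<open>h^d\<close> is the norm divided by the trace, the middle part is again proportional
  to the norm, so \<open>R\<close> must be chosen after \<open>m\<close> to make its coefficient
  small.\<close>

lemma ex_row_bound:
  "\<exists>c>0. \<forall>l. 0 < l \<and> l \<le> 1 \<longrightarrow> op_norm (integral_op (k l)) \<le> c * l ^ CARD('n) \<and>
     (\<forall>x\<in>unit_cube. (LINT y|cube. \<bar>k l x y\<bar>) \<le> c * l ^ CARD('n))"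
proof -
  have K0: "K 0 > 0" by (rule K_pos) simp
  have A: "A > 0" using trace_bounds(1)[of 1] by simp
  \<comment> \<open>Here the convergence of \<nu> to zero enters: \<open>m\<close> is fixed so large
    that the tail beyond \<open>m * h\<close> is at most half of the norm.\<close>
  have "(\<lambda>m. B * \<nu> m) \<longlonglongrightarrow> B * 0" by (intro tendsto_mult tendsto_const \<nu>_tendsto_0)
  then have "eventually (\<lambda>m. B * \<nu> m < 1 / 2) sequentially" by (rule order_tendstoD) simp
  then obtain m0 where "\<And>m. m \<ge> m0 \<Longrightarrow> B * \<nu> m < 1 / 2" by (auto simp: eventually_sequentially)
  then have m: "1 \<le> max m0 1" "B * \<nu> (max m0 1) < 1 / 2" by auto
  define m where "m = max m0 1"
  note m = m[folded m_def]
  \<comment> \<open>The norm times \<open>q\<close> bounds the volume of a ball of radius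
    \<open>m * h\<close>, because \<open>h^d\<close> is the norm over the trace and the trace is at
    least \<open>K 0 / A\<close>.\<close>
  define q where "q = (2 * real m) ^ CARD('n) * (A / K 0)"
  have q: "q > 0" using m A K0 by (simp add: q_def)
  have "eventually (\<lambda>R. K R < 1 / (4 * q)) at_top"
    using order_tendstoD(2)[OF K_lim, of "1 / (4 * q)"] q by simp
  then obtain R0 where "\<And>R. R \<ge> R0 \<Longrightarrow> K R < 1 / (4 * q)" by (auto simp: eventually_at_top_linorder)
  then have R: "max R0 1 > 0" "K (max R0 1) < 1 / (4 * q)" by auto
  define R where "R = max R0 1"
  note R = R[folded R_def]
  have KR: "0 < K R" using R K_pos by simp
  define c0 where "c0 = K 0 * (2 * R) ^ CARD('n)"
  have c0: "c0 > 0" using K0 R by (simp add: c0_def)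
  \<comment> \<open>Three quarters of the norm: one half from the tail, one quarter from the middle
    ball.\<close>
  have row: "(LINT y|cube. \<bar>k l x y\<bar>) \<le> c0 * l ^ CARD('n) + 3 / 4 * op_norm (integral_op (k l))"
    if l: "0 < l" "l \<le> 1" and x: "x \<in> unit_cube" for l x
  proof -
    define c where "c = op_norm (integral_op (k l))"
    define t where "t = op_trace (integral_op (k l))"
    have c: "c > 0" unfolding c_def by (rule op_norm_pos[OF l])
    have t: "K 0 / A \<le> t" unfolding t_def by (rule trace_bounds(2)[OF l(1)])
    then have t0: "t > 0" using divide_pos_pos[OF K0 A] by linarith
    define h where "h = eff_dim (integral_op (k l)) powr (- 1 / real CARD('n))"
    have h: "h = (t / c) powr (- 1 / real CARD('n))" by (simp add: h_def eff_dim_def c_def t_def)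
    have h0: "h > 0" using c t0 by (simp add: h)
    have hd: "h ^ CARD('n) = c / t"
    proof -
      have "h ^ CARD('n) = h powr real CARD('n)" using h0 by (simp add: powr_realpow)
      also have "\<dots> = (t / c) powr (- 1)" by (simp add: h powr_powr)
      finally show ?thesis using c t0 by (simp add: powr_minus)
    qed
    have nn: "0 < k l x y" "k l x y \<le> K 0" if "y \<in> unit_cube" for y
      using k_pos[OF l(1) x that] k_le[OF l(1) x that] by auto
    have ind [measurable]: "(indicator {y. norm (x - y) \<le> r} :: real ^ 'n \<Rightarrow> real) \<in> borel_measurable (cube :: (real ^ 'n) measure)" for r
    proof -
      have "{y. norm (x - y) \<le> r} = cball x r" by (auto simp: dist_norm)
      then show ?thesis using cube_indicator_measurable[OF lmeasurable_cball[of x r]] by simp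
    qed
    have ii: "integrable cube (\<lambda>y. indicator {y. norm (x - y) \<le> r} y :: real)" for r
      by (rule cube.integrable_const_bound[where B = 1]) (rule AE_I2, simp add: indicator_def, rule ind)
    have ir: "integrable cube (\<lambda>y. indicator {y. norm (x - y) > r} y * \<bar>k l x y\<bar>)" for r
    proof (rule cube.integrable_const_bound[where B = "K 0"])
      have "indicator {y. norm (x - y) > r} y = 1 - (indicator {y. norm (x - y) \<le> r} y :: real)" for y
        by (auto simp: indicator_def)
      then show "(\<lambda>y. indicator {y. norm (x - y) > r} y * \<bar>k l x y\<bar>) \<in> borel_measurable cube"
        using k_row_measurable[OF l(1) x] by simp
    qed (use nn K0 in \<open>auto simp: indicator_def less_imp_le abs_of_pos\<close>)
    have tl: "(LINT y|cube. indicator {y. norm (x - y) > real m * h} y * \<bar>k l x y\<bar>) \<le> c / 2"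
    proof -
      have "(LINT y|cube. indicator {y. norm (x - y) > real m * h} y * \<bar>k l x y\<bar>) \<le> B * (c * \<nu> m)"
        using tail[OF l(1)] m(1) x unfolding tail_bound_def h_def[symmetric] c_def[symmetric] tail_integral[OF x, symmetric]
        by blast
      also have "\<dots> = c * (B * \<nu> m)" by simp
      also have "\<dots> \<le> c * (1 / 2)" using m c by (intro mult_left_mono) auto
      finally show ?thesis by simp
    qed
    have "(LINT y|cube. \<bar>k l x y\<bar>) \<le> (LINT y|cube. K 0 * indicator {y. norm (x - y) \<le> R * l} y +
        K R * indicator {y. norm (x - y) \<le> real m * h} y + indicator {y. norm (x - y) > real m * h} y * \<bar>k l x y\<bar>)"
    proof (rule integral_mono)
      show "integrable cube (\<lambda>y. \<bar>k l x y\<bar>)" using k_row_integrable[OF l(1) x] by simp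
      show "integrable cube (\<lambda>y. K 0 * indicator {y. norm (x - y) \<le> R * l} y +
        K R * indicator {y. norm (x - y) \<le> real m * h} y + indicator {y. norm (x - y) > real m * h} y * \<bar>k l x y\<bar>)"
        using ii ir by simp
      fix y :: "real ^ 'n" assume "y \<in> space cube"
      then have y: "y \<in> unit_cube" by simp
      note n = nn[OF y]
      have KR': "k l x y \<le> K R" if "norm (x - y) > R * l"
        using that l R by (simp add: k_eq x y K_antimono less_divide_eq less_imp_le)
      show "\<bar>k l x y\<bar> \<le> K 0 * indicator {y. norm (x - y) \<le> R * l} y +
        K R * indicator {y. norm (x - y) \<le> real m * h} y + indicator {y. norm (x - y) > real m * h} y * \<bar>k l x y\<bar>"
      proof (cases "norm (x - y) \<le> R * l")
        case True
        have "\<bar>k l x y\<bar> \<le> K 0" using n by simp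
        then show ?thesis using True KR n by (simp add: indicator_def add_increasing2)
      next
        case False
        then have "\<bar>k l x y\<bar> \<le> K R" using n KR' by simp
        then show ?thesis using False by (simp add: indicator_def)
      qed
    qed
    also have "\<dots> = K 0 * (LINT y|cube. indicator {y. norm (x - y) \<le> R * l} y) +
       K R * (LINT y|cube. indicator {y. norm (x - y) \<le> real m * h} y) +
       (LINT y|cube. indicator {y. norm (x - y) > real m * h} y * \<bar>k l x y\<bar>)"
      using ii ir by simp
    also have "\<dots> \<le> K 0 * (2 * (R * l)) ^ CARD('n) + K R * (2 * (real m * h)) ^ CARD('n) + c / 2"
      using K0 KR R l h0 tl by (intro add_mono mult_left_mono measure_norm_ball_le) auto
    also have "K 0 * (2 * (R * l)) ^ CARD('n) = c0 * l ^ CARD('n)"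
      by (simp add: c0_def power_mult_distrib)
    also have "K R * (2 * (real m * h)) ^ CARD('n) \<le> c / 4"
    proof -
      have "c / t \<le> c * (A / K 0)"
      proof -
        have "1 / t \<le> A / K 0" using t t0 A K0 by (simp add: field_simps)
        then have "c * (1 / t) \<le> c * (A / K 0)" using c by (intro mult_left_mono) auto
        then show ?thesis by simp
      qed
      then have "(2 * real m) ^ CARD('n) * (c / t) \<le> (2 * real m) ^ CARD('n) * (c * (A / K 0))"
        by (intro mult_left_mono) auto
      then have "(2 * (real m * h)) ^ CARD('n) \<le> q * c"
        by (simp add: q_def power_mult_distrib hd mult_ac)
      then have "K R * (2 * (real m * h)) ^ CARD('n) \<le> 1 / (4 * q) * (q * c)"
        using R KR q c h0 by (intro mult_mono) auto
      then show ?thesis using q by simp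
    qed
    finally show ?thesis by (simp add: c_def)
  qed
  \<comment> \<open>By the Schur test the norm is at most three quarters of itself plus
    \<open>c0 * l^d\<close>; subtracting gives the factor 4.\<close>
  have nb: "op_norm (integral_op (k l)) \<le> 4 * c0 * l ^ CARD('n)" if l: "0 < l" "l \<le> 1" for l
  proof -
    define S where "S = c0 * l ^ CARD('n) + 3 / 4 * op_norm (integral_op (k l))"
    have S0: "0 \<le> S" using op_norm_pos[OF l] c0 l by (simp add: S_def)
    have "op_norm (integral_op (k l)) \<le> S"
    proof (rule op_norm_le)
      fix f :: "real ^ 'n \<Rightarrow> real" assume f: "f \<in> L2" "norm_L2 f \<le> 1"
      have "norm_L2 (integral_op (k l) f) \<le> S * norm_L2 f"
      proof (rule norm_L2_integral_op_le[OF k_hs[OF l(1)] k_sym[OF l(1)] S0 _ f(1)])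
        fix g :: "real ^ 'n \<Rightarrow> real" assume g: "g \<in> L2"
        show "\<bar>bil (k l) g g\<bar> \<le> S * inner_L2 g g"
          by (rule Schur_form_bound[OF k_hs[OF l(1)] k_sym[OF l(1)] _ _ g, where c = "K 0"])
             (use row[OF l] k_pos[OF l(1)] k_le[OF l(1)] in \<open>auto simp: S_def abs_of_pos\<close>)
      qed
      also have "\<dots> \<le> S * 1" using f S0 by (intro mult_left_mono) auto
      finally show "norm_L2 (integral_op (k l) f) \<le> S" by simp
    qed
    then show ?thesis by (simp add: S_def)
  qed
  show ?thesis
  proof (intro exI[of _ "4 * c0"] conjI allI impI ballI)
    fix l :: real and x assume l: "0 < l \<and> l \<le> 1" and x: "x \<in> (unit_cube :: (real ^ 'n) set)"
    \<comment> \<open>The norm bound is inserted into the row bound: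
      \<open>c0 + 3/4 * 4 * c0 = 4 * c0\<close>.\<close>
    show "(LINT y|cube. \<bar>k l x y\<bar>) \<le> 4 * c0 * l ^ CARD('n)"
      using row[of l x] nb[of l] l x by auto
  qed (use nb c0 in auto)
qed

text \<open>Numerator and denominator are both known up to constants: the trace is of order one and
  the norm of order \<open>l^d\<close>.\<close>

lemma eff_dim_bounds:
  "\<exists>a>0. \<exists>b>0. \<forall>l. 0 < l \<and> l \<le> 1 \<longrightarrow>
      a * l powr (- real CARD('n)) \<le> eff_dim (integral_op (k l)) \<and>
      eff_dim (integral_op (k l)) \<le> b * l powr (- real CARD('n))"
proof -
  obtain c where c: "c > 0" "\<And>l. 0 < l \<Longrightarrow> l \<le> 1 \<Longrightarrow> op_norm (integral_op (k l)) \<le> c * l ^ CARD('n)"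
    using ex_row_bound by blast
  have K0: "K 0 > 0" by (rule K_pos) simp
  have Kd: "K (real CARD('n)) > 0" by (rule K_pos) simp
  have A: "A > 0" using trace_bounds(1)[of 1] by simp
  have "\<forall>l. 0 < l \<and> l \<le> 1 \<longrightarrow>
      K 0 / A / c * l powr (- real CARD('n)) \<le> eff_dim (integral_op (k l)) \<and>
      eff_dim (integral_op (k l)) \<le> K 0 / K (real CARD('n)) * l powr (- real CARD('n))"
  proof (intro conjI allI impI)
    fix l :: real assume l: "0 < l \<and> l \<le> 1"
    then have p: "l powr (- real CARD('n)) = 1 / l ^ CARD('n)"
      by (simp add: powr_minus powr_realpow divide_inverse)
    have t: "K 0 / A \<le> op_trace (integral_op (k l))" "op_trace (integral_op (k l)) \<le> K 0"
      using trace_bounds[of l] l by auto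
    have n: "K (real CARD('n)) * l ^ CARD('n) \<le> op_norm (integral_op (k l))" "op_norm (integral_op (k l)) \<le> c * l ^ CARD('n)"
      "0 < op_norm (integral_op (k l))"
      using op_norm_ge[of l] op_norm_pos[of l] c l by auto
    have t0: "0 \<le> op_trace (integral_op (k l))" using t(1) divide_pos_pos[OF K0 A] by linarith
    have "K 0 / A / (c * l ^ CARD('n)) \<le> op_trace (integral_op (k l)) / op_norm (integral_op (k l))"
      using t t0 n K0 A by (intro frac_le) auto
    then show "K 0 / A / c * l powr (- real CARD('n)) \<le> eff_dim (integral_op (k l))"
      by (simp add: p eff_dim_def)
    have "op_trace (integral_op (k l)) / op_norm (integral_op (k l)) \<le> K 0 / (K (real CARD('n)) * l ^ CARD('n))"
      using t t0 n K0 A Kd l by (intro frac_le) auto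
    then show "eff_dim (integral_op (k l)) \<le> K 0 / K (real CARD('n)) * l powr (- real CARD('n))"
      by (simp add: p eff_dim_def)
  qed
  moreover have "K 0 / A / c > 0" "K 0 / K (real CARD('n)) > 0" using K0 A c Kd by auto
  ultimately show ?thesis by blast
qed

end

section \<open>Samples of Gaussian processes\<close>

text \<open>If \<open>f\<close> is not integrable, its Bochner integral is 0 by convention.\<close>

lemma ennreal_integral_le_nn_integral:
  assumes "f \<in> borel_measurable M" "\<And>x. 0 \<le> (f x :: real)"
  shows "ennreal (LINT x|M. f x) \<le> (\<integral>\<^sup>+x. ennreal (f x) \<partial>M)"
proof (cases "integrable M f")
  case True then show ?thesis using assms by (simp add: nn_integral_eq_integral)
qed (simp add: not_integrable_integral_eq)

lemma average_tensor_form: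
  fixes f :: "nat \<Rightarrow> real ^ 'n::finite \<Rightarrow> real"
  assumes L2: "\<forall>n\<in>{1..N}. f n \<in> L2"
  shows "hs_kernel (\<lambda>x y. (\<Sum>n=1..N. f n x * f n y) / real N)"
    and "g \<in> L2 \<Longrightarrow> bil (\<lambda>x y. (\<Sum>n=1..N. f n x * f n y) / real N) g g = (\<Sum>n=1..N. (inner_L2 (f n) g)\<^sup>2) / real N"
proof -
  have eq: "(\<lambda>x y. (\<Sum>n=1..N. f n x * f n y) / real N) = (\<lambda>x y. 1 / real N * (\<Sum>n=1..N. f n x * f n y))"
    by (intro ext) simp
  have hs: "hs_kernel (\<lambda>x y. f n x * f n y)" if "n \<in> {1..N}" for n
    using L2 that by (intro hs_kernel_tensor) auto
  show "hs_kernel (\<lambda>x y. (\<Sum>n=1..N. f n x * f n y) / real N)"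
    unfolding eq by (intro hs_kernel_cmult hs_kernel_sum hs)
  assume g: "g \<in> L2"
  have "bil (\<lambda>x y. (\<Sum>n=1..N. f n x * f n y) / real N) g g = 1 / real N * (\<Sum>n=1..N. bil (\<lambda>x y. f n x * f n y) g g)"
    unfolding eq bil_cmult_kernel by (subst bil_sum_kernel) (use hs g in auto)
  also have "(\<Sum>n=1..N. bil (\<lambda>x y. f n x * f n y) g g) = (\<Sum>n=1..N. (inner_L2 (f n) g)\<^sup>2)"
    using L2 g by (intro sum.cong refl) (auto simp: bil_tensor power2_eq_square)
  finally show "bil (\<lambda>x y. (\<Sum>n=1..N. f n x * f n y) / real N) g g = (\<Sum>n=1..N. (inner_L2 (f n) g)\<^sup>2) / real N" by simp
qed

text \<open>One fixed kernel without a lengthscale. The deviation bounds see it through continuity,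
  square-integrability and a bound on the diagonal; bounds on its rows enter as parameters of the
  single lemmas.\<close>

locale gaussian_kernel_sample = prob_space M for M :: "'w measure" +
  fixes N :: nat and u :: "nat \<Rightarrow> real ^ 'n::finite \<Rightarrow> 'w \<Rightarrow> real"
    and k :: "real ^ 'n \<Rightarrow> real ^ 'n \<Rightarrow> real" and K0 :: real
  assumes sample: "gaussian_sample M N u k" and N: "1 \<le> N"
    and k_cont: "continuous_on (unit_cube \<times> unit_cube) (\<lambda>z. k (fst z) (snd z))"
    and k_hs: "hs_kernel k"
    and k_diag: "\<And>x. x \<in> unit_cube \<Longrightarrow> k x x \<le> K0" and K0: "K0 > 0"
begin

lemma process: "n \<in> {1..N} \<Longrightarrow> centered_gaussian_process M (u n) k"
  using sample by (simp add: gaussian_sample_def)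

lemma joint_measurable: "n \<in> {1..N} \<Longrightarrow> (\<lambda>(x, \<omega>). u n x \<omega>) \<in> borel_measurable (cube \<Otimes>\<^sub>M M)"
  using process[of n] by (simp add: centered_gaussian_process_def)

lemma gaussian_sum: "n \<in> {1..N} \<Longrightarrow> finite S \<Longrightarrow> S \<subseteq> unit_cube \<Longrightarrow> centered_gaussian M (\<lambda>\<omega>. \<Sum>x\<in>S. c x * u n x \<omega>)"
  using process[of n] by (simp add: centered_gaussian_process_def)

lemma gaussian_point: "n \<in> {1..N} \<Longrightarrow> x \<in> unit_cube \<Longrightarrow> centered_gaussian M (u n x)"
  using gaussian_sum[of n "{x}" "\<lambda>_. 1"] by simp

lemma point_measurable: "n \<in> {1..N} \<Longrightarrow> x \<in> unit_cube \<Longrightarrow> u n x \<in> borel_measurable M"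
  using gaussian_point by (simp add: centered_gaussian_def)

lemma point_square_integrable: "n \<in> {1..N} \<Longrightarrow> x \<in> unit_cube \<Longrightarrow> integrable M (\<lambda>\<omega>. (u n x \<omega>)\<^sup>2)"
  using centered_gaussian_even_moment(1)[OF gaussian_point, of n x 1] by simp

lemma point_mult_integrable: "n \<in> {1..N} \<Longrightarrow> x \<in> unit_cube \<Longrightarrow> y \<in> unit_cube \<Longrightarrow> integrable M (\<lambda>\<omega>. u n x \<omega> * u n y \<omega>)"
  by (intro integrable_mult_L2 point_measurable point_square_integrable)

lemma covariance: "n \<in> {1..N} \<Longrightarrow> x \<in> unit_cube \<Longrightarrow> y \<in> unit_cube \<Longrightarrow> (LINT \<omega>|M. u n x \<omega> * u n y \<omega>) = k x y"
  using process[of n] by (simp add: centered_gaussian_process_def)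

lemma k_sym: "x \<in> unit_cube \<Longrightarrow> y \<in> unit_cube \<Longrightarrow> k x y = k y x"
  using covariance[of 1 x y] covariance[of 1 y x] N by (simp add: mult.commute)

lemma variance_sum:
  assumes n: "n \<in> {1..N}" and S: "finite S" "S \<subseteq> unit_cube"
  shows "(LINT \<omega>|M. (\<Sum>x\<in>S. c x * u n x \<omega>)\<^sup>2) = (\<Sum>x\<in>S. \<Sum>y\<in>S. c x * c y * k x y)"
proof -
  have "(LINT \<omega>|M. (\<Sum>x\<in>S. c x * u n x \<omega>)\<^sup>2) = (LINT \<omega>|M. (\<Sum>x\<in>S. \<Sum>y\<in>S. c x * c y * (u n x \<omega> * u n y \<omega>)))"
    by (simp add: power2_eq_square sum_product mult_ac)
  also have "\<dots> = (\<Sum>x\<in>S. \<Sum>y\<in>S. c x * c y * (LINT \<omega>|M. u n x \<omega> * u n y \<omega>))"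
    using point_mult_integrable[OF n] S by (simp add: Bochner_Integration.integral_sum subset_iff)
  also have "\<dots> = (\<Sum>x\<in>S. \<Sum>y\<in>S. c x * c y * k x y)"
    using covariance[OF n] S by (intro sum.cong refl) (auto simp: subset_iff)
  finally show ?thesis .
qed

text \<open>Independence is given for the paths as elements of a product space. A finite combination
  of point values is a measurable function of finitely many coordinates, so independence passes to
  it.\<close>

lemma indep_sum:
  assumes S: "finite S" "S \<subseteq> unit_cube"
  shows "indep_vars (\<lambda>_. borel) (\<lambda>n \<omega>. \<Sum>x\<in>S. c x * u n x \<omega>) {1..N}"
proof -
  have "indep_vars (\<lambda>_. Pi\<^sub>M unit_cube (\<lambda>_. borel)) (\<lambda>n \<omega>. \<lambda>x\<in>unit_cube. u n x \<omega>) {1..N}"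
    using sample by (simp add: gaussian_sample_def)
  then have "indep_vars (\<lambda>_. borel) (\<lambda>n \<omega>. \<Sum>x\<in>S. c x * (\<lambda>x\<in>unit_cube. u n x \<omega>) x) {1..N}"
  proof (rule indep_vars_compose2)
    have "(\<lambda>f. f x) \<in> borel_measurable (Pi\<^sub>M unit_cube (\<lambda>_. borel :: real measure))" if "x \<in> S" for x
      using that S by (intro measurable_component_singleton) auto
    then show "(\<lambda>f. \<Sum>x\<in>S. c x * f x) \<in> borel_measurable (Pi\<^sub>M unit_cube (\<lambda>_. borel))"
      by (intro borel_measurable_sum borel_measurable_times borel_measurable_const)
  qed
  moreover have "(\<lambda>n \<omega>. \<Sum>x\<in>S. c x * (\<lambda>x\<in>unit_cube. u n x \<omega>) x) = (\<lambda>n \<omega>. \<Sum>x\<in>S. c x * u n x \<omega>)"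
    using S by (intro ext sum.cong refl) (auto simp: subset_iff)
  ultimately show ?thesis by simp
qed

lemma paths_L2: "AE \<omega> in M. \<forall>n\<in>{1..N}. (\<lambda>x. u n x \<omega>) \<in> L2"
  using process by (intro AE_finite_allI) (auto simp: centered_gaussian_process_def)

sublocale cM: pair_sigma_finite cube M ..

text \<open>Fubini reduces the mean energies to the covariance. The increment has mean square
  \<open>2 (k x x - k x (c x)) - (k x x - k (c x) (c x))\<close>, at most \<open>3 * e\<close>. The
  energy of the sum is wanted as well because a difference of squares factors into increment and
  sum.\<close>

lemma increment_energy:
  assumes disc: "discretization \<eta> c" and n: "n \<in> {1..N}"
    and close: "\<And>x y x' y'. x \<in> unit_cube \<Longrightarrow> y \<in> unit_cube \<Longrightarrow> x' \<in> {x, c x} \<Longrightarrow> y' \<in> {y, c y} \<Longrightarrow> \<bar>k x y - k x' y'\<bar> \<le> e"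
  shows "(\<lambda>\<omega>. LINT x|cube. (u n x \<omega> + a * u n (c x) \<omega>)\<^sup>2) \<in> borel_measurable M"
    and "(\<integral>\<^sup>+\<omega>. ennreal (LINT x|cube. (u n x \<omega> + (- 1) * u n (c x) \<omega>)\<^sup>2) \<partial>M) \<le> ennreal (3 * e)"
    and "(\<integral>\<^sup>+\<omega>. ennreal (LINT x|cube. (u n x \<omega> + 1 * u n (c x) \<omega>)\<^sup>2) \<partial>M) \<le> ennreal (4 * K0)"
proof -
  note cells = finite_cells[OF disc] cells_subset[OF disc]
  have cc: "c x \<in> unit_cube" if "x \<in> unit_cube" for x using that cells by auto
  \<comment> \<open>The rounded path is jointly measurable as a finite combination of cell
    indicators times point evaluations.\<close>
  have mc: "(\<lambda>z. u n (c (fst z)) (snd z)) \<in> borel_measurable (cube \<Otimes>\<^sub>M M)"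
  proof -
    have "(\<lambda>z. \<Sum>p\<in>c ` unit_cube. cell c p (fst z) * u n p (snd z)) \<in> borel_measurable (cube \<Otimes>\<^sub>M M)"
    proof (intro borel_measurable_sum borel_measurable_times)
      fix p assume p: "p \<in> c ` unit_cube"
      show "(\<lambda>z. cell c p (fst z)) \<in> borel_measurable (cube \<Otimes>\<^sub>M M)"
        by (rule measurable_compose[OF measurable_fst cell_measurable[OF disc]])
      show "(\<lambda>z. u n p (snd z)) \<in> borel_measurable (cube \<Otimes>\<^sub>M M)"
        by (rule measurable_compose[OF measurable_snd point_measurable[OF n]]) (use p cells in auto)
    qed
    moreover have "(\<lambda>z. u n (c (fst z)) (snd z)) \<in> borel_measurable (cube \<Otimes>\<^sub>M M) \<longleftrightarrow>
       (\<lambda>z. \<Sum>p\<in>c ` unit_cube. cell c p (fst z) * u n p (snd z)) \<in> borel_measurable (cube \<Otimes>\<^sub>M M)"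
    proof (intro measurable_cong)
      fix z :: "(real ^ 'n) \<times> 'w" assume "z \<in> space (cube \<Otimes>\<^sub>M M)"
      then have z: "fst z \<in> unit_cube" by (auto simp: space_pair_measure)
      show "u n (c (fst z)) (snd z) = (\<Sum>p\<in>c ` unit_cube. cell c p (fst z) * u n p (snd z))"
        using disc_expand[OF disc z, of "\<lambda>p. u n p (snd z)"] by (simp add: mult.commute)
    qed
    ultimately show ?thesis by blast
  qed
  have mu: "(\<lambda>z. u n (fst z) (snd z)) \<in> borel_measurable (cube \<Otimes>\<^sub>M M)"
    using joint_measurable[OF n] by (simp add: split_beta')
  have m: "(\<lambda>z. (u n (fst z) (snd z) + a * u n (c (fst z)) (snd z))\<^sup>2) \<in> borel_measurable (cube \<Otimes>\<^sub>M M)" for a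
    using mc mu by simp
  interpret Mc: pair_sigma_finite M cube ..
  show meas: "(\<lambda>\<omega>. LINT x|cube. (u n x \<omega> + a * u n (c x) \<omega>)\<^sup>2) \<in> borel_measurable M" for a
  proof (rule cube.borel_measurable_lebesgue_integral)
    have "(\<lambda>(\<omega>, x). (u n x \<omega> + a * u n (c x) \<omega>)\<^sup>2) \<in> borel_measurable (M \<Otimes>\<^sub>M cube)"
      using m[of a] measurable_pair_swap_iff[of "\<lambda>z. (u n (fst z) (snd z) + a * u n (c (fst z)) (snd z))\<^sup>2" cube M borel]
      by (simp add: split_beta')
    then show "(\<lambda>(\<omega>, x). (u n x \<omega> + a * u n (c x) \<omega>)\<^sup>2) \<in> borel_measurable (M \<Otimes>\<^sub>M cube)" .
  qed
  have en: "(\<integral>\<^sup>+\<omega>. ennreal (LINT x|cube. (u n x \<omega> + a * u n (c x) \<omega>)\<^sup>2) \<partial>M) \<le> ennreal B"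
    if B: "\<And>x. x \<in> unit_cube \<Longrightarrow> k x x + 2 * a * k x (c x) + a\<^sup>2 * k (c x) (c x) \<le> B" for a B
  proof -
    have "(\<integral>\<^sup>+\<omega>. ennreal (LINT x|cube. (u n x \<omega> + a * u n (c x) \<omega>)\<^sup>2) \<partial>M)
        \<le> (\<integral>\<^sup>+\<omega>. \<integral>\<^sup>+x. ennreal ((u n x \<omega> + a * u n (c x) \<omega>)\<^sup>2) \<partial>cube \<partial>M)"
    proof (intro nn_integral_mono ennreal_integral_le_nn_integral)
      fix \<omega> assume "\<omega> \<in> space M"
      from measurable_compose[OF measurable_Pair2'[OF this] m[of a]]
      show "(\<lambda>x. (u n x \<omega> + a * u n (c x) \<omega>)\<^sup>2) \<in> borel_measurable cube" by simp
    qed simp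
    also have "\<dots> = (\<integral>\<^sup>+x. \<integral>\<^sup>+\<omega>. ennreal ((u n x \<omega> + a * u n (c x) \<omega>)\<^sup>2) \<partial>M \<partial>cube)"
      using m[of a] by (intro cM.Fubini') (simp add: split_beta')
    also have "\<dots> \<le> (\<integral>\<^sup>+x. ennreal B \<partial>(cube :: (real ^ 'n) measure))"
    proof (intro nn_integral_mono)
      fix x :: "real ^ 'n" assume "x \<in> space cube"
      then have x: "x \<in> unit_cube" by simp
      have eq: "(u n x \<omega> + a * u n (c x) \<omega>)\<^sup>2 = (u n x \<omega> * u n x \<omega> + 2 * a * (u n x \<omega> * u n (c x) \<omega>)) + a\<^sup>2 * (u n (c x) \<omega> * u n (c x) \<omega>)" for \<omega>
        by (simp add: power2_eq_square algebra_simps)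
      note i = point_mult_integrable[OF n x x] point_mult_integrable[OF n x cc[OF x]] point_mult_integrable[OF n cc[OF x] cc[OF x]]
      have I: "integrable M (\<lambda>\<omega>. (u n x \<omega> + a * u n (c x) \<omega>)\<^sup>2)" unfolding eq using i by simp
      have "(LINT \<omega>|M. (u n x \<omega> + a * u n (c x) \<omega>)\<^sup>2) = k x x + 2 * a * k x (c x) + a\<^sup>2 * k (c x) (c x)"
        unfolding eq using i by (simp add: covariance[OF n] x cc)
      then show "(\<integral>\<^sup>+\<omega>. ennreal ((u n x \<omega> + a * u n (c x) \<omega>)\<^sup>2) \<partial>M) \<le> ennreal B"
        using B[OF x] by (subst nn_integral_eq_integral[OF I]) (auto intro: ennreal_leI)
    qed
    also have "\<dots> = ennreal B" by (simp add: cube.emeasure_space_1[simplified])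
    finally show ?thesis .
  qed
  show "(\<integral>\<^sup>+\<omega>. ennreal (LINT x|cube. (u n x \<omega> + (- 1) * u n (c x) \<omega>)\<^sup>2) \<partial>M) \<le> ennreal (3 * e)"
  proof (rule en)
    fix x :: "real ^ 'n" assume x: "x \<in> unit_cube"
    have "\<bar>k x x - k x (c x)\<bar> \<le> e" "\<bar>k x x - k (c x) (c x)\<bar> \<le> e" using close[OF x x] by auto
    then show "k x x + 2 * - 1 * k x (c x) + (- 1)\<^sup>2 * k (c x) (c x) \<le> 3 * e" by (simp add: abs_le_iff)
  qed
  show "(\<integral>\<^sup>+\<omega>. ennreal (LINT x|cube. (u n x \<omega> + 1 * u n (c x) \<omega>)\<^sup>2) \<partial>M) \<le> ennreal (4 * K0)"
  proof (rule en)
    fix x :: "real ^ 'n" assume x: "x \<in> unit_cube"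
    \<comment> \<open>Nonnegativity of the mean squared increment bounds the mixed covariance by the
      two diagonal values.\<close>
    have "0 \<le> (LINT \<omega>|M. (u n x \<omega> - u n (c x) \<omega>)\<^sup>2)" by simp
    also have "(LINT \<omega>|M. (u n x \<omega> - u n (c x) \<omega>)\<^sup>2) =
        (LINT \<omega>|M. u n x \<omega> * u n x \<omega> - 2 * (u n x \<omega> * u n (c x) \<omega>) + u n (c x) \<omega> * u n (c x) \<omega>)"
      by (intro Bochner_Integration.integral_cong) (auto simp: power2_eq_square algebra_simps)
    also have "\<dots> = k x x - 2 * k x (c x) + k (c x) (c x)"
      using point_mult_integrable[OF n] x cc by (simp add: covariance[OF n])
    finally show "k x x + 2 * 1 * k x (c x) + 1\<^sup>2 * k (c x) (c x) \<le> 4 * K0"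
      using k_diag[OF x] k_diag[OF cc[OF x]] by simp
  qed
qed

lemma sample_form:
  assumes L2: "\<forall>n\<in>{1..N}. (\<lambda>x. u n x \<omega>) \<in> L2" and g: "g \<in> L2"
  shows "hs_kernel (sample_kernel N u \<omega>)"
    and "bil (sample_kernel N u \<omega>) g g = (\<Sum>n=1..N. (inner_L2 (\<lambda>x. u n x \<omega>) g)\<^sup>2) / real N"
  using average_tensor_form[OF L2] g by (simp_all add: sample_kernel_def[abs_def])

text \<open>Factor \<open>a^2 - b^2 = (a - b) (a + b)\<close> and apply the arithmetic-geometric
  inequality with weight \<delta>. The result is linear in the two energies, so its mean follows
  from their means alone, with no root of a random quantity to be integrated.\<close>

lemma form_discretization_error:
  assumes disc: "discretization \<eta> c"
    and close: "\<And>x y x' y'. x \<in> unit_cube \<Longrightarrow> y \<in> unit_cube \<Longrightarrow> x' \<in> {x, c x} \<Longrightarrow> y' \<in> {y, c y} \<Longrightarrow> \<bar>k x y - k x' y'\<bar> \<le> e"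
    and L2: "\<forall>n\<in>{1..N}. (\<lambda>x. u n x \<omega>) \<in> L2" and g: "g \<in> L2" and \<delta>: "\<delta> > 0"
  shows "\<bar>bil (\<lambda>x y. sample_kernel N u \<omega> x y - k x y) g g -
      ((\<Sum>n=1..N. (inner_L2 (\<lambda>x. u n (c x) \<omega>) g)\<^sup>2) / real N - bil (\<lambda>x y. k (c x) (c y)) g g)\<bar>
    \<le> (e + (\<Sum>n=1..N. (LINT x|cube. (u n x \<omega> + (- 1) * u n (c x) \<omega>)\<^sup>2) / (2 * \<delta>)
        + \<delta> / 2 * (LINT x|cube. (u n x \<omega> + 1 * u n (c x) \<omega>)\<^sup>2)) / real N) * inner_L2 g g"
proof -
  have N0: "real N > 0" using N by simp
  define G where "G = inner_L2 g g"
  have G: "0 \<le> G" by (simp add: G_def inner_L2_self_nonneg)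
  define R where "R n = (LINT x|cube. (u n x \<omega> + (- 1) * u n (c x) \<omega>)\<^sup>2) / (2 * \<delta>)
        + \<delta> / 2 * (LINT x|cube. (u n x \<omega> + 1 * u n (c x) \<omega>)\<^sup>2)" for n
  have 1: "\<bar>(inner_L2 (\<lambda>x. u n x \<omega>) g)\<^sup>2 - (inner_L2 (\<lambda>x. u n (c x) \<omega>) g)\<^sup>2\<bar> \<le> R n * G" if n: "n \<in> {1..N}" for n
  proof -
    have u: "(\<lambda>x. u n x \<omega>) \<in> L2" using L2 n by blast
    have uc: "(\<lambda>x. u n (c x) \<omega>) \<in> L2" by (rule disc_L2[OF disc, of "\<lambda>p. u n p \<omega>"])
    define p where "p = inner_L2 (\<lambda>x. u n x \<omega> - u n (c x) \<omega>) g"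
    define q where "q = inner_L2 (\<lambda>x. u n x \<omega> + u n (c x) \<omega>) g"
    define P where "P = (LINT x|cube. (u n x \<omega> - u n (c x) \<omega>)\<^sup>2)"
    define Q where "Q = (LINT x|cube. (u n x \<omega> + u n (c x) \<omega>)\<^sup>2)"
    have p2: "p\<^sup>2 \<le> P * G" unfolding p_def P_def G_def inner_L2_self[symmetric, of "\<lambda>x. u n x \<omega> - u n (c x) \<omega>"]
      by (rule inner_L2_Cauchy_Schwarz[OF L2_diff[OF u uc] g])
    have q2: "q\<^sup>2 \<le> Q * G" unfolding q_def Q_def G_def inner_L2_self[symmetric, of "\<lambda>x. u n x \<omega> + u n (c x) \<omega>"]
      by (rule inner_L2_Cauchy_Schwarz[OF L2_add[OF u uc] g])
    have "(inner_L2 (\<lambda>x. u n x \<omega>) g)\<^sup>2 - (inner_L2 (\<lambda>x. u n (c x) \<omega>) g)\<^sup>2 = p * q"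
      unfolding p_def q_def using u uc g
      by (simp add: inner_L2_add_left inner_L2_diff_left power2_eq_square algebra_simps)
    also have "\<bar>p * q\<bar> \<le> p\<^sup>2 / (2 * \<delta>) + \<delta> / 2 * q\<^sup>2"
    proof -
      have "0 \<le> (\<bar>p\<bar> - \<delta> * \<bar>q\<bar>)\<^sup>2" by simp
      then have "2 * \<delta> * \<bar>p * q\<bar> \<le> p\<^sup>2 + \<delta>\<^sup>2 * q\<^sup>2"
        by (simp add: power2_diff abs_mult power_mult_distrib mult_ac)
      then have "\<bar>p * q\<bar> \<le> (p\<^sup>2 + \<delta>\<^sup>2 * q\<^sup>2) / (2 * \<delta>)"
        using \<delta> by (simp add: pos_le_divide_eq mult_ac)
      also have "\<dots> = p\<^sup>2 / (2 * \<delta>) + \<delta> / 2 * q\<^sup>2" using \<delta> by (simp add: add_divide_distrib power2_eq_square)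
      finally show ?thesis .
    qed
    also have "\<dots> \<le> (P * G) / (2 * \<delta>) + \<delta> / 2 * (Q * G)"
      using p2 q2 \<delta> by (intro add_mono divide_right_mono mult_left_mono) auto
    also have "\<dots> = R n * G" by (simp add: R_def P_def Q_def distrib_right)
    finally show ?thesis .
  qed
  have 2: "\<bar>bil k g g - bil (\<lambda>x y. k (c x) (c y)) g g\<bar> \<le> e * G"
    unfolding G_def by (rule kernel_form_discretization[OF disc k_hs k_sym close g])
  define a where "a = (\<Sum>n=1..N. (inner_L2 (\<lambda>x. u n x \<omega>) g)\<^sup>2) / real N"
  define a' where "a' = (\<Sum>n=1..N. (inner_L2 (\<lambda>x. u n (c x) \<omega>) g)\<^sup>2) / real N"
  have 3: "\<bar>a - a'\<bar> \<le> (\<Sum>n=1..N. R n) / real N * G"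
  proof -
    have "\<bar>a - a'\<bar> = \<bar>\<Sum>n=1..N. (inner_L2 (\<lambda>x. u n x \<omega>) g)\<^sup>2 - (inner_L2 (\<lambda>x. u n (c x) \<omega>) g)\<^sup>2\<bar> / real N"
      by (simp add: a_def a'_def sum_subtractf diff_divide_distrib[symmetric])
    also have "\<dots> \<le> (\<Sum>n=1..N. R n * G) / real N"
      by (intro divide_right_mono order_trans[OF sum_abs sum_mono] 1) auto
    finally show ?thesis by (simp add: sum_distrib_right)
  qed
  have "bil (\<lambda>x y. sample_kernel N u \<omega> x y - k x y) g g = a - bil k g g"
    unfolding a_def sample_form(2)[OF L2 g, symmetric] by (rule bil_diff_kernel[OF sample_form(1)[OF L2 g] k_hs g g])
  then have "\<bar>bil (\<lambda>x y. sample_kernel N u \<omega> x y - k x y) g g - (a' - bil (\<lambda>x y. k (c x) (c y)) g g)\<bar>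
     \<le> e * G + (\<Sum>n=1..N. R n) / real N * G"
    using 2 3 by linarith
  then show ?thesis unfolding a'_def R_def G_def by (simp add: distrib_right)
qed

end

section \<open>Uniform deviation of sample forms with localized support\<close>

lemma ennreal_lincomb:
  assumes "0 \<le> a" "0 \<le> x" "0 \<le> b" "0 \<le> y"
  shows "ennreal a * ennreal x + ennreal b * ennreal y = ennreal (a * x + b * y)"
  using assms by (simp add: ennreal_mult)

context gaussian_kernel_sample
begin

text \<open>In the coordinates \<open>cell_vec\<close> the forms become those of the vectors with
  entries \<open>w p * u n p\<close>, and a discrete Schur test bounds the norm of their covariance
  matrix. Working with the cells in \<open>P\<close> lets \<tau> be the trace over \<open>P\<close>
  alone, while the row bound stays global.\<close>

lemma cells_deviation:
  assumes disc: "discretization \<eta> c" and P: "P \<subseteq> c ` unit_cube"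
    and row: "\<And>p. p \<in> c ` unit_cube \<Longrightarrow> (\<Sum>q\<in>c ` unit_cube. \<bar>k p q\<bar> * cell_weight c q) \<le> \<sigma>"
    and trace: "(\<Sum>p\<in>P. cell_weight c p * k p p) \<le> \<tau>"
    and pos: "\<sigma> > 0" "\<tau> > 0" "s > 0" and s: "s \<le> real N / (24 * \<sigma>)"
  shows "\<exists>Y \<in> borel_measurable M. (\<integral>\<^sup>+\<omega>. Y \<omega> \<partial>M) \<le> 2 \<and>
    (\<forall>\<omega>. Y \<omega> < \<infinity> \<longrightarrow> (\<forall>g\<in>L2. (\<forall>p\<in>c ` unit_cube - P. cell_coeff c g p = 0) \<longrightarrow>
      \<bar>(\<Sum>n=1..N. (inner_L2 (\<lambda>x. u n (c x) \<omega>) g)\<^sup>2) / real N - bil (\<lambda>x y. k (c x) (c y)) g g\<bar>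
        \<le> (96 * s * \<sigma>\<^sup>2 / real N + 2 * (\<tau> / \<sigma> + 2 * ln (1 + enn2real (Y \<omega>))) / s) * inner_L2 g g))"
proof -
  note cells = finite_cells[OF disc] cells_subset[OF disc]
  have P': "finite P" "P \<subseteq> unit_cube" using P cells finite_subset by blast+
  define w where "w p = sqrt (cell_weight c p)" for p
  have w0: "0 \<le> w p" "w p * w p = cell_weight c p" for p
    using cell_weight_nonneg[OF disc] by (auto simp: w_def)
  define X where "X n p \<omega> = w p * u n p \<omega>" for n p \<omega>
  define S where "S p q = w p * w q * k p q" for p q
  have lin: "(\<Sum>p\<in>P. \<theta> p * X n p \<omega>) = (\<Sum>p\<in>P. (\<theta> p * w p) * u n p \<omega>)" for \<theta> n \<omega>
    by (simp add: X_def mult.assoc)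
  have quad: "(\<Sum>p\<in>P. \<Sum>q\<in>P. \<theta> p * \<theta> q * S p q) = (\<Sum>p\<in>P. \<Sum>q\<in>P. (\<theta> p * w p) * (\<theta> q * w q) * k p q)" for \<theta>
    by (simp add: S_def mult_ac)
  have "\<exists>Y \<in> borel_measurable M. (\<integral>\<^sup>+\<omega>. Y \<omega> \<partial>M) \<le> 2 \<and>
    (\<forall>\<omega>. Y \<omega> < \<infinity> \<longrightarrow> (\<forall>v. (\<Sum>p\<in>P. (v p)\<^sup>2) \<le> 1 \<longrightarrow>
      \<bar>(\<Sum>n=1..N. (\<Sum>p\<in>P. v p * X n p \<omega>)\<^sup>2) / real N - (\<Sum>p\<in>P. \<Sum>q\<in>P. v p * v q * S p q)\<bar>
        \<le> 96 * s * \<sigma>\<^sup>2 / real N + 2 * (\<tau> / \<sigma> + 2 * ln (1 + enn2real (Y \<omega>))) / s))"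
  proof (rule gaussian_forms_deviation[OF P'(1) N _ _ _ _ _ _ _ pos s])
    show "X n p \<in> borel_measurable M" if "n \<in> {1..N}" "p \<in> P" for n p
      using point_measurable[of n p] that P' by (auto simp: X_def[abs_def])
    show "centered_gaussian M (\<lambda>\<omega>. \<Sum>p\<in>P. \<theta> p * X n p \<omega>)" if "n \<in> {1..N}" for n \<theta>
      unfolding lin by (rule gaussian_sum[OF that P'])
    show "(LINT \<omega>|M. (\<Sum>p\<in>P. \<theta> p * X n p \<omega>)\<^sup>2) = (\<Sum>p\<in>P. \<Sum>q\<in>P. \<theta> p * \<theta> q * S p q)" if "n \<in> {1..N}" for n \<theta>
      unfolding lin quad by (rule variance_sum[OF that P'])
    show "indep_vars (\<lambda>_. borel) (\<lambda>n \<omega>. \<Sum>p\<in>P. \<theta> p * X n p \<omega>) {1..N}" for \<theta>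
      unfolding lin by (rule indep_sum[OF P'])
    show "S p q = S q p" if "p \<in> P" "q \<in> P" for p q
      using k_sym[of p q] that P' by (auto simp: S_def)
    show "(\<Sum>p\<in>P. S p p) \<le> \<tau>" using trace by (simp add: S_def w0)
    show "(\<Sum>p\<in>P. \<Sum>q\<in>P. \<theta> p * \<theta> q * S p q) \<le> \<sigma> * (\<Sum>p\<in>P. (\<theta> p)\<^sup>2)" for \<theta>
    proof -
      have amgm: "\<bar>a * b\<bar> \<le> (a\<^sup>2 + b\<^sup>2) / 2" for a b :: real
        using sum_squares_bound[of "\<bar>a\<bar>" "\<bar>b\<bar>"] by (simp add: abs_mult)
      have ptw: "\<theta> p * \<theta> q * S p q \<le> ((\<theta> p)\<^sup>2 * (\<bar>k p q\<bar> * cell_weight c q) + (\<theta> q)\<^sup>2 * (\<bar>k q p\<bar> * cell_weight c p)) / 2"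
        if pq: "p \<in> P" "q \<in> P" for p q
      proof -
        \<comment> \<open>The weights are exchanged between the two factors, so that each square
          \<open>(\<theta> p)^2\<close> comes with the weight of the other point, as in a row
          sum.\<close>
        have "\<theta> p * \<theta> q * S p q = ((\<theta> p * w q) * (\<theta> q * w p)) * k p q" by (simp add: S_def mult_ac)
        also have "\<dots> \<le> \<bar>(\<theta> p * w q) * (\<theta> q * w p)\<bar> * \<bar>k p q\<bar>" by (metis abs_ge_self abs_mult)
        also have "\<dots> \<le> (((\<theta> p * w q)\<^sup>2 + (\<theta> q * w p)\<^sup>2) / 2) * \<bar>k p q\<bar>"
          by (intro mult_right_mono amgm) auto
        also have "\<dots> = ((\<theta> p)\<^sup>2 * (\<bar>k p q\<bar> * (w q * w q)) + (\<theta> q)\<^sup>2 * (\<bar>k p q\<bar> * (w p * w p))) / 2"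
          by (simp add: power2_eq_square algebra_simps)
        also have "\<bar>k p q\<bar> * (w p * w p) = \<bar>k q p\<bar> * (w p * w p)"
          using k_sym[of p q] subsetD[OF P'(2) pq(1)] subsetD[OF P'(2) pq(2)] by simp
        finally show ?thesis by (simp add: w0)
      qed
      have "(\<Sum>p\<in>P. \<Sum>q\<in>P. \<theta> p * \<theta> q * S p q) \<le>
         (\<Sum>p\<in>P. \<Sum>q\<in>P. ((\<theta> p)\<^sup>2 * (\<bar>k p q\<bar> * cell_weight c q) + (\<theta> q)\<^sup>2 * (\<bar>k q p\<bar> * cell_weight c p)) / 2)"
        by (intro sum_mono ptw)
      also have "\<dots> = ((\<Sum>p\<in>P. \<Sum>q\<in>P. (\<theta> p)\<^sup>2 * (\<bar>k p q\<bar> * cell_weight c q)) + (\<Sum>p\<in>P. \<Sum>q\<in>P. (\<theta> q)\<^sup>2 * (\<bar>k q p\<bar> * cell_weight c p))) / 2"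
        by (simp add: sum_divide_distrib[symmetric] sum.distrib)
      also have "(\<Sum>p\<in>P. \<Sum>q\<in>P. (\<theta> q)\<^sup>2 * (\<bar>k q p\<bar> * cell_weight c p)) = (\<Sum>p\<in>P. \<Sum>q\<in>P. (\<theta> p)\<^sup>2 * (\<bar>k p q\<bar> * cell_weight c q))"
        by (rule sum.swap)
      also have "(\<Sum>p\<in>P. \<Sum>q\<in>P. (\<theta> p)\<^sup>2 * (\<bar>k p q\<bar> * cell_weight c q)) \<le> (\<Sum>p\<in>P. (\<theta> p)\<^sup>2 * \<sigma>)"
      proof (rule sum_mono)
        fix p assume p: "p \<in> P"
        have "(\<Sum>q\<in>P. \<bar>k p q\<bar> * cell_weight c q) \<le> (\<Sum>q\<in>c ` unit_cube. \<bar>k p q\<bar> * cell_weight c q)"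
          using P cells cell_weight_nonneg[OF disc] by (intro sum_mono2) auto
        also have "\<dots> \<le> \<sigma>" using row p P by auto
        finally show "(\<Sum>q\<in>P. (\<theta> p)\<^sup>2 * (\<bar>k p q\<bar> * cell_weight c q)) \<le> (\<theta> p)\<^sup>2 * \<sigma>"
          unfolding sum_distrib_left[symmetric] by (rule mult_left_mono) simp
      qed
      also have "(\<Sum>p\<in>P. (\<theta> p)\<^sup>2 * \<sigma>) = \<sigma> * (\<Sum>p\<in>P. (\<theta> p)\<^sup>2)" by (simp add: sum_distrib_left mult.commute)
      finally show ?thesis by simp
    qed
  qed
  then obtain Y where Y: "Y \<in> borel_measurable M" "(\<integral>\<^sup>+\<omega>. Y \<omega> \<partial>M) \<le> 2" and
    dev: "\<And>\<omega> v. Y \<omega> < \<infinity> \<Longrightarrow> (\<Sum>p\<in>P. (v p)\<^sup>2) \<le> 1 \<Longrightarrow>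
      \<bar>(\<Sum>n=1..N. (\<Sum>p\<in>P. v p * X n p \<omega>)\<^sup>2) / real N - (\<Sum>p\<in>P. \<Sum>q\<in>P. v p * v q * S p q)\<bar>
        \<le> 96 * s * \<sigma>\<^sup>2 / real N + 2 * (\<tau> / \<sigma> + 2 * ln (1 + enn2real (Y \<omega>))) / s" by blast
  show ?thesis
  proof (intro bexI[of _ Y] conjI allI impI ballI Y)
    fix \<omega> g assume fin: "Y \<omega> < \<infinity>" and g: "g \<in> L2" and zero: "\<forall>p\<in>c ` unit_cube - P. cell_coeff c g p = 0"
    define R where "R = 96 * s * \<sigma>\<^sup>2 / real N + 2 * (\<tau> / \<sigma> + 2 * ln (1 + enn2real (Y \<omega>))) / s"
    have R: "0 \<le> R" unfolding R_def using pos by (intro add_nonneg_nonneg divide_nonneg_nonneg mult_nonneg_nonneg) auto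
    define v where "v = cell_vec c g"
    have wv: "w p * v p = cell_coeff c g p" for p
      using cell_vec_scale[OF disc g] by (simp add: w_def v_def)
    define V where "V = (\<Sum>p\<in>P. (v p)\<^sup>2)"
    have V: "0 \<le> V" "V \<le> inner_L2 g g"
      using cell_vec_norm[OF disc g P] by (auto simp: V_def v_def intro: sum_nonneg)
    have f1: "inner_L2 (\<lambda>x. u n (c x) \<omega>) g = (\<Sum>p\<in>P. v p * X n p \<omega>)" for n
    proof -
      have "inner_L2 (\<lambda>x. u n (c x) \<omega>) g = (\<Sum>p\<in>c ` unit_cube. u n p \<omega> * cell_coeff c g p)"
        by (rule inner_disc[OF disc g])
      also have "\<dots> = (\<Sum>p\<in>P. u n p \<omega> * cell_coeff c g p)"
        using P cells zero by (intro sum.mono_neutral_right) auto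
      also have "\<dots> = (\<Sum>p\<in>P. v p * X n p \<omega>)" by (simp add: X_def wv[symmetric] mult_ac)
      finally show ?thesis .
    qed
    have f2: "bil (\<lambda>x y. k (c x) (c y)) g g = (\<Sum>p\<in>P. \<Sum>q\<in>P. v p * v q * S p q)"
    proof -
      have "bil (\<lambda>x y. k (c x) (c y)) g g = (\<Sum>p\<in>c ` unit_cube. \<Sum>q\<in>c ` unit_cube. k p q * (cell_coeff c g p * cell_coeff c g q))"
        by (rule bil_disc[OF disc g g])
      also have "\<dots> = (\<Sum>p\<in>P. \<Sum>q\<in>c ` unit_cube. k p q * (cell_coeff c g p * cell_coeff c g q))"
        using P cells zero by (intro sum.mono_neutral_right) auto
      also have "\<dots> = (\<Sum>p\<in>P. \<Sum>q\<in>P. k p q * (cell_coeff c g p * cell_coeff c g q))"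
        using P cells zero by (intro sum.cong refl sum.mono_neutral_right) auto
      also have "\<dots> = (\<Sum>p\<in>P. \<Sum>q\<in>P. v p * v q * S p q)" by (simp add: S_def wv[symmetric] mult_ac)
      finally show ?thesis .
    qed
    have "\<bar>(\<Sum>n=1..N. (\<Sum>p\<in>P. v p * X n p \<omega>)\<^sup>2) / real N - (\<Sum>p\<in>P. \<Sum>q\<in>P. v p * v q * S p q)\<bar> \<le> R * V"
    proof (cases "V = 0")
      case True
      then have "v p = 0" if "p \<in> P" for p using that P'(1) by (simp add: V_def sum_nonneg_eq_0_iff)
      then show ?thesis by (simp add: True)
    next
      case False
      then have V0: "V > 0" using V by simp
      define r where "r = sqrt V"
      have r: "r > 0" "r * r = V" using V0 by (auto simp: r_def)
      define v' where "v' p = v p / r" for p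
      have v: "v p = r * v' p" for p using r by (simp add: v'_def)
      have "(\<Sum>p\<in>P. (v' p)\<^sup>2) = V / r\<^sup>2"
        by (simp add: v'_def power_divide sum_divide_distrib[symmetric] V_def)
      then have "(\<Sum>p\<in>P. (v' p)\<^sup>2) \<le> 1" using r V0 by (simp add: power2_eq_square)
      from dev[OF fin this] have d: "\<bar>(\<Sum>n=1..N. (\<Sum>p\<in>P. v' p * X n p \<omega>)\<^sup>2) / real N - (\<Sum>p\<in>P. \<Sum>q\<in>P. v' p * v' q * S p q)\<bar> \<le> R"
        unfolding R_def .
      have "(\<Sum>p\<in>P. v p * X n p \<omega>)\<^sup>2 = V * (\<Sum>p\<in>P. v' p * X n p \<omega>)\<^sup>2" for n
      proof -
        have "(\<Sum>p\<in>P. v p * X n p \<omega>) = r * (\<Sum>p\<in>P. v' p * X n p \<omega>)" by (simp add: v sum_distrib_left mult.assoc)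
        then show ?thesis using r by (simp add: power_mult_distrib power2_eq_square)
      qed
      moreover have "(\<Sum>p\<in>P. \<Sum>q\<in>P. v p * v q * S p q) = V * (\<Sum>p\<in>P. \<Sum>q\<in>P. v' p * v' q * S p q)"
        by (simp add: v sum_distrib_left r(2)[symmetric] mult_ac)
      ultimately have "(\<Sum>n=1..N. (\<Sum>p\<in>P. v p * X n p \<omega>)\<^sup>2) / real N - (\<Sum>p\<in>P. \<Sum>q\<in>P. v p * v q * S p q) =
        V * ((\<Sum>n=1..N. (\<Sum>p\<in>P. v' p * X n p \<omega>)\<^sup>2) / real N - (\<Sum>p\<in>P. \<Sum>q\<in>P. v' p * v' q * S p q))"
        by (simp add: sum_distrib_left[symmetric] right_diff_distrib)
      then show ?thesis using mult_left_mono[OF d V(1)] V by (simp add: abs_mult mult.commute)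
    qed
    also have "\<dots> \<le> R * inner_L2 g g" using V R by (intro mult_left_mono)
    finally show "\<bar>(\<Sum>n=1..N. (inner_L2 (\<lambda>x. u n (c x) \<omega>) g)\<^sup>2) / real N - bil (\<lambda>x y. k (c x) (c y)) g g\<bar>
        \<le> (96 * s * \<sigma>\<^sup>2 / real N + 2 * (\<tau> / \<sigma> + 2 * ln (1 + enn2real (Y \<omega>))) / s) * inner_L2 g g"
      unfolding f1 f2 R_def .
  qed
qed

text \<open>The sets \<open>U b\<close> are the admissible supports and \<open>V b\<close> contain
  their \<eta>-neighbourhoods: a function living on \<open>U b\<close> meets only cells inside
  \<open>V b\<close>, so the relevant trace is at most \<open>K0\<close> times a volume. One
  majorant \<open>G\<close> serves all \<open>b\<close>. The union over \<open>J\<close> costs only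
  a logarithm because each deviation depends on its random variable through
  \<open>ln (1 + Y)\<close>.\<close>

lemma sample_form_deviation:
  fixes U V :: "'j \<Rightarrow> (real ^ 'n) set"
  assumes rows: "\<forall>x\<in>unit_cube. (LINT y|cube. \<bar>k x y\<bar>) \<le> \<sigma>"
    and J: "finite J" "J \<noteq> {}"
    and \<eta>: "\<eta> > 0" and nbhd: "\<forall>b\<in>J. \<forall>x\<in>U b. \<forall>y. dist x y \<le> \<eta> \<longrightarrow> y \<in> V b"
    and volume: "\<forall>b\<in>J. V b \<in> lmeasurable \<and> K0 * measure lebesgue (V b) \<le> \<tau>"
    and pos: "\<sigma> > 0" "\<tau> > 0"
  defines "L \<equiv> \<tau> / (2 * \<sigma>) + 4 * ln (1 + 2 * real (card J))"
  shows "\<exists>G \<in> borel_measurable M. (\<integral>\<^sup>+\<omega>. G \<omega> \<partial>M) \<le> ennreal (200 * \<sigma> * (sqrt (L / real N) + L / real N)) \<and>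
    (AE \<omega> in M. \<forall>b\<in>J. \<forall>g\<in>L2. (\<forall>x\<in>unit_cube - U b. g x = 0) \<longrightarrow>
      ennreal \<bar>bil (\<lambda>x y. sample_kernel N u \<omega> x y - k x y) g g\<bar> \<le> G \<omega> * ennreal (inner_L2 g g))"
proof -
  note row = rows[rule_format] and UV = \<eta> nbhd[rule_format]
  have Vm: "\<And>b. b \<in> J \<Longrightarrow> V b \<in> lmeasurable" "\<And>b. b \<in> J \<Longrightarrow> K0 * measure lebesgue (V b) \<le> \<tau>"
    using volume by auto
  have N0: "real N > 0" using N by simp
  have cardJ: "1 \<le> card J" using J by (simp add: Suc_leI card_gt_0_iff)
  define LJ where "LJ = ln (1 + 2 * real (card J))"
  \<comment> \<open>This is where \<open>1 + 2 * card J \<ge> 3 \<ge> exp 1\<close> is used; it lets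
    additive constants be absorbed into \<open>L\<close>.\<close>
  have LJ: "LJ \<ge> 1"
  proof -
    have "exp 1 \<le> (3 :: real)" by (rule exp_le)
    also have "\<dots> \<le> 1 + 2 * real (card J)" using cardJ by simp
    finally show ?thesis unfolding LJ_def by (subst ln_ge_iff) auto
  qed
  have L: "L = \<tau> / (2 * \<sigma>) + 4 * LJ" by (simp add: L_def LJ_def)
  have L0: "L > 0" using LJ pos by (simp add: L add_nonneg_pos)
  define \<epsilon> where "\<epsilon> = \<sigma> * sqrt (L / real N)"
  have \<epsilon>: "\<epsilon> > 0" using pos L0 N0 by (simp add: \<epsilon>_def)
  define \<delta> where "\<delta> = \<epsilon> / (4 * K0)"
  have \<delta>: "\<delta> > 0" using \<epsilon> K0 by (simp add: \<delta>_def)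
  \<comment> \<open>The weight \<delta> makes the energy of the sum contribute
    \<open>\<epsilon> / 2\<close>. The tolerance is below \<sigma>, so that rows on the grid are at
    most \<open>2 * \<sigma>\<close>, below \<epsilon>, and below
    \<open>\<epsilon> * \<delta>\<close>, so that the energy of the increment divided by \<delta> is
    of order \<epsilon>.\<close>
  define e where "e = min \<sigma> (min \<epsilon> (\<epsilon> * \<delta>))"
  have e: "e > 0" "e \<le> \<sigma>" "e \<le> \<epsilon>" "e \<le> \<epsilon> * \<delta>" using pos \<epsilon> \<delta> by (auto simp: e_def)
  obtain c where disc: "discretization (\<eta> / 2) c" and
    close: "\<And>x y x' y'. x \<in> unit_cube \<Longrightarrow> y \<in> unit_cube \<Longrightarrow> x' \<in> {x, c x} \<Longrightarrow> y' \<in> {y, c y} \<Longrightarrow> \<bar>k x y - k x' y'\<bar> \<le> e"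
    using continuous_kernel_discretization[OF k_cont e(1), of "\<eta> / 2"] UV(1) by auto
  note cells = finite_cells[OF disc] cells_subset[OF disc]
  have rowc: "(\<Sum>q\<in>c ` unit_cube. \<bar>k p q\<bar> * cell_weight c q) \<le> 2 * \<sigma>" if p: "p \<in> c ` unit_cube" for p
  proof -
    have pD: "p \<in> unit_cube" using p cells by auto
    have km: "k p \<in> borel_measurable cube"
      using measurable_compose[OF measurable_Pair1'[of p cube cube] continuous_kernel_measurable[OF k_cont]] pD by simp
    have ci: "integrable cube (\<lambda>y. \<bar>k p (c y)\<bar>)"
      using L2_integrable_mult[OF disc_L2[OF disc, of "\<lambda>q. \<bar>k p q\<bar>"], of "\<lambda>_. 1"] by (simp add: L2_def)
    have ki: "integrable cube (\<lambda>y. \<bar>k p y\<bar>)"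
    proof (rule Bochner_Integration.integrable_bound[where f = "\<lambda>y. \<bar>k p (c y)\<bar> + e"])
      show "AE y in cube. norm \<bar>k p y\<bar> \<le> norm (\<bar>k p (c y)\<bar> + e)"
      proof (rule AE_I2)
        fix y :: "real ^ 'n" assume "y \<in> space cube"
        then have "\<bar>k p y - k p (c y)\<bar> \<le> e" using close[of p y p "c y"] pD by simp
        then show "norm \<bar>k p y\<bar> \<le> norm (\<bar>k p (c y)\<bar> + e)" by simp
      qed
    qed (use ci km in auto)
    have "(\<Sum>q\<in>c ` unit_cube. \<bar>k p q\<bar> * cell_weight c q) = (LINT y|cube. \<bar>k p (c y)\<bar>)"
      using integral_disc[OF disc, of "\<lambda>q. \<bar>k p q\<bar>"] by simp
    also have "\<dots> \<le> (LINT y|cube. \<bar>k p y\<bar> + e)"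
    proof (rule integral_mono)
      fix y :: "real ^ 'n" assume "y \<in> space cube"
      then have "\<bar>k p y - k p (c y)\<bar> \<le> e" using close[of p y p "c y"] pD by simp
      then show "\<bar>k p (c y)\<bar> \<le> \<bar>k p y\<bar> + e" by simp
    qed (use ci ki in auto)
    also have "\<dots> = (LINT y|cube. \<bar>k p y\<bar>) + e" using ki by (simp add: cube.prob_space[simplified])
    finally show ?thesis using row[OF pD] e by simp
  qed
  define Q where "Q b = c ` (U b \<inter> unit_cube)" for b
  have Q: "Q b \<subseteq> c ` unit_cube" for b by (auto simp: Q_def)
  have trace: "(\<Sum>p\<in>Q b. cell_weight c p * k p p) \<le> \<tau>" if b: "b \<in> J" for b
  proof -
    have fin: "finite (Q b)" using Q cells finite_subset by blast
    have "(\<Sum>p\<in>Q b. cell_weight c p * k p p) \<le> (\<Sum>p\<in>Q b. cell_weight c p * K0)"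
    proof (intro sum_mono mult_left_mono cell_weight_nonneg[OF disc])
      fix p assume "p \<in> Q b"
      then have "p \<in> unit_cube" using Q cells by blast
      then show "k p p \<le> K0" by (rule k_diag)
    qed
    also have "\<dots> = K0 * (LINT x|cube. (\<Sum>p\<in>Q b. cell c p x))"
    proof -
      have "integrable cube (cell c p)" for p
        using L2_integrable_mult[OF cell_L2[OF disc], of "\<lambda>_. 1" p] by (simp add: L2_def)
      then show ?thesis by (simp add: cell_weight_def[OF disc] sum_distrib_left mult.commute)
    qed
    also have "(LINT x|cube. (\<Sum>p\<in>Q b. cell c p x)) \<le> (LINT x|cube. indicator (V b) x)"
    proof (rule integral_mono)
      show "integrable cube (\<lambda>x. \<Sum>p\<in>Q b. cell c p x)"
        using L2_integrable_mult[OF L2_sum[OF cell_L2[OF disc]], of "\<lambda>_. 1"] by (simp add: L2_def)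
      show "integrable cube (indicator (V b) :: _ \<Rightarrow> real)"
        by (rule cube.integrable_const_bound[where B = 1]) (auto simp: cube_indicator_measurable[OF Vm(1)[OF b]])
      fix x :: "real ^ 'n" assume "x \<in> space cube"
      then have x: "x \<in> unit_cube" by simp
      have "(\<Sum>p\<in>Q b. cell c p x) = (if c x \<in> Q b then 1 else 0)"
        using fin by (simp add: cell_def[OF disc])
      also have "\<dots> \<le> indicator (V b) x"
      proof (cases "c x \<in> Q b")
        case True
        then obtain x' where x': "x' \<in> U b" "x' \<in> unit_cube" "c x' = c x" by (auto simp: Q_def)
        \<comment> \<open>Two points with a common grid point are within \<eta> of each other; this
          is why the mesh is \<open>\<eta> / 2\<close>.\<close>
        have "dist x' x \<le> dist x' (c x') + dist x (c x)" unfolding x'(3) by (rule dist_triangle2)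
        also have "\<dots> \<le> \<eta> / 2 + \<eta> / 2" by (intro add_mono dist_cell[OF disc] x x')
        finally have "x \<in> V b" using UV(2)[OF b x'(1)] by simp
        then show ?thesis by simp
      qed simp
      finally show "(\<Sum>p\<in>Q b. cell c p x) \<le> indicator (V b) x" .
    qed
    also have "(LINT x|cube. indicator (V b) x) \<le> measure lebesgue (V b)"
    proof -
      have "(LINT x|cube. indicator (V b) x) = (LINT x|cube. indicator (V b \<inter> unit_cube) x :: real)"
        by (intro Bochner_Integration.integral_cong) (auto simp: indicator_def)
      also have "\<dots> = measure cube (V b \<inter> unit_cube)" by simp
      also have "\<dots> = measure lebesgue (V b \<inter> unit_cube)"
        using fmeasurableD[OF Vm(1)[OF b]] by (subst measure_restrict_space) (auto simp: unit_cube_eq_cbox)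
      also have "\<dots> \<le> measure lebesgue (V b)"
        using Vm(1)[OF b] by (intro measure_mono_fmeasurable) (auto simp: unit_cube_eq_cbox)
      finally show ?thesis .
    qed
    finally show ?thesis using Vm(2)[OF b] K0 by simp
  qed
  define \<sigma>2 where "\<sigma>2 = 2 * \<sigma>"
  have \<sigma>2: "\<sigma>2 > 0" using pos by (simp add: \<sigma>2_def)
  \<comment> \<open>The value \<open>sqrt (N * L) / \<sigma>2\<close> makes
    \<open>96 * s * \<sigma>2^2 / N\<close> and \<open>2 * L / s\<close> of the same order; the cap
    is the range in which the deviation bound is valid. The first regime yields
    \<open>sqrt (L / N)\<close>, the second \<open>L / N\<close>.\<close>
  define s where "s = min (sqrt (real N * L) / \<sigma>2) (real N / (24 * \<sigma>2))"
  have s: "s > 0" "s \<le> real N / (24 * \<sigma>2)" using N0 L0 \<sigma>2 by (auto simp: s_def)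
  have "\<exists>Y \<in> borel_measurable M. (\<integral>\<^sup>+\<omega>. Y \<omega> \<partial>M) \<le> 2 \<and>
    (\<forall>\<omega>. Y \<omega> < \<infinity> \<longrightarrow> (\<forall>g\<in>L2. (\<forall>p\<in>c ` unit_cube - Q b. cell_coeff c g p = 0) \<longrightarrow>
      \<bar>(\<Sum>n=1..N. (inner_L2 (\<lambda>x. u n (c x) \<omega>) g)\<^sup>2) / real N - bil (\<lambda>x y. k (c x) (c y)) g g\<bar>
        \<le> (96 * s * \<sigma>2\<^sup>2 / real N + 2 * (\<tau> / \<sigma>2 + 2 * ln (1 + enn2real (Y \<omega>))) / s) * inner_L2 g g))"
    if b: "b \<in> J" for b
    by (rule cells_deviation[OF disc Q _ trace[OF b] \<sigma>2 pos(2) s]) (use rowc in \<open>simp add: \<sigma>2_def\<close>)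
  then obtain Y where Y: "\<And>b. b \<in> J \<Longrightarrow> Y b \<in> borel_measurable M" "\<And>b. b \<in> J \<Longrightarrow> (\<integral>\<^sup>+\<omega>. Y b \<omega> \<partial>M) \<le> 2" and
    dev: "\<And>b \<omega> g. b \<in> J \<Longrightarrow> Y b \<omega> < \<infinity> \<Longrightarrow> g \<in> L2 \<Longrightarrow> (\<And>p. p \<in> c ` unit_cube - Q b \<Longrightarrow> cell_coeff c g p = 0) \<Longrightarrow>
      \<bar>(\<Sum>n=1..N. (inner_L2 (\<lambda>x. u n (c x) \<omega>) g)\<^sup>2) / real N - bil (\<lambda>x y. k (c x) (c y)) g g\<bar>
        \<le> (96 * s * \<sigma>2\<^sup>2 / real N + 2 * (\<tau> / \<sigma>2 + 2 * ln (1 + enn2real (Y b \<omega>))) / s) * inner_L2 g g"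
    by metis
  \<comment> \<open>The sum dominates every \<open>Y b\<close>, and its mean is at most
    \<open>2 * card J\<close>.\<close>
  define W where "W \<omega> = (\<Sum>b\<in>J. Y b \<omega>)" for \<omega>
  have Wm [measurable]: "W \<in> borel_measurable M" unfolding W_def[abs_def] using Y(1) by (intro borel_measurable_sum)
  have Wi: "(\<integral>\<^sup>+\<omega>. W \<omega> \<partial>M) \<le> ennreal (2 * real (card J))"
  proof -
    have "(\<integral>\<^sup>+\<omega>. W \<omega> \<partial>M) = (\<Sum>b\<in>J. \<integral>\<^sup>+\<omega>. Y b \<omega> \<partial>M)"
      unfolding W_def using Y(1) by (intro nn_integral_sum)
    also have "\<dots> \<le> (\<Sum>b\<in>J. 2)" using Y(2) by (intro sum_mono)
    also have "\<dots> = ennreal (2 * real (card J))"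
      by (simp add: ennreal_mult ennreal_of_nat_eq_real_of_nat[symmetric] mult.commute)
    finally show ?thesis .
  qed
  define D where "D n a \<omega> = (LINT x|cube. (u n x \<omega> + a * u n (c x) \<omega>)\<^sup>2)" for n a \<omega>
  have Dm [measurable]: "n \<in> {1..N} \<Longrightarrow> D n a \<in> borel_measurable M" for n a
    unfolding D_def[abs_def] by (rule increment_energy(1)[OF disc _ close])
  have D0: "0 \<le> D n a \<omega>" for n a \<omega> by (simp add: D_def)
  \<comment> \<open>\<open>c0\<close> collects the deterministic part. The slope \<open>c1\<close>
    of the linearized logarithm is scaled so that \<open>c1 * W\<close> has mean at most
    \<open>4 / s\<close>.\<close>
  define c0 where "c0 = 96 * s * \<sigma>2\<^sup>2 / real N + 2 * (\<tau> / \<sigma>2 + 2 * LJ) / s + e"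
  define c1 where "c1 = 4 / s / (2 * real (card J))"
  have c01: "0 \<le> c0" "0 \<le> c1" unfolding c0_def c1_def using s \<sigma>2 pos LJ e
    by (auto intro!: add_nonneg_nonneg divide_nonneg_nonneg mult_nonneg_nonneg)
  define G where "G \<omega> = ennreal c0 + ennreal c1 * W \<omega> +
    (\<Sum>n=1..N. ennreal (1 / (2 * \<delta> * real N)) * ennreal (D n (- 1) \<omega>) + ennreal (\<delta> / (2 * real N)) * ennreal (D n 1 \<omega>))" for \<omega>
  have Gm: "G \<in> borel_measurable M" unfolding G_def[abs_def]
    by (intro borel_measurable_add borel_measurable_sum borel_measurable_times_ennreal borel_measurable_const
        measurable_compose[OF Dm measurable_ennreal] Wm) auto
  have Gi: "(\<integral>\<^sup>+\<omega>. G \<omega> \<partial>M) \<le> ennreal (200 * \<sigma> * (sqrt (L / real N) + L / real N))"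
  proof -
    have "(\<integral>\<^sup>+\<omega>. G \<omega> \<partial>M) = ennreal c0 + ennreal c1 * (\<integral>\<^sup>+\<omega>. W \<omega> \<partial>M) +
      (\<Sum>n=1..N. ennreal (1 / (2 * \<delta> * real N)) * (\<integral>\<^sup>+\<omega>. ennreal (D n (- 1) \<omega>) \<partial>M) + ennreal (\<delta> / (2 * real N)) * (\<integral>\<^sup>+\<omega>. ennreal (D n 1 \<omega>) \<partial>M))"
    proof -
      have mD: "(\<lambda>\<omega>. ennreal (D n a \<omega>)) \<in> borel_measurable M" if "n \<in> {1..N}" for n a
        using Dm[OF that] by measurable
      have "(\<integral>\<^sup>+\<omega>. (\<Sum>n=1..N. ennreal (1 / (2 * \<delta> * real N)) * ennreal (D n (- 1) \<omega>) + ennreal (\<delta> / (2 * real N)) * ennreal (D n 1 \<omega>)) \<partial>M)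
        = (\<Sum>n=1..N. \<integral>\<^sup>+\<omega>. ennreal (1 / (2 * \<delta> * real N)) * ennreal (D n (- 1) \<omega>) + ennreal (\<delta> / (2 * real N)) * ennreal (D n 1 \<omega>) \<partial>M)"
        by (intro nn_integral_sum borel_measurable_add borel_measurable_times_ennreal borel_measurable_const mD)
      also have "\<dots> = (\<Sum>n=1..N. ennreal (1 / (2 * \<delta> * real N)) * (\<integral>\<^sup>+\<omega>. ennreal (D n (- 1) \<omega>) \<partial>M) + ennreal (\<delta> / (2 * real N)) * (\<integral>\<^sup>+\<omega>. ennreal (D n 1 \<omega>) \<partial>M))"
        using mD by (intro sum.cong refl) (simp add: nn_integral_add nn_integral_cmult)
      finally have S: "(\<integral>\<^sup>+\<omega>. (\<Sum>n=1..N. ennreal (1 / (2 * \<delta> * real N)) * ennreal (D n (- 1) \<omega>) + ennreal (\<delta> / (2 * real N)) * ennreal (D n 1 \<omega>)) \<partial>M)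
        = (\<Sum>n=1..N. ennreal (1 / (2 * \<delta> * real N)) * (\<integral>\<^sup>+\<omega>. ennreal (D n (- 1) \<omega>) \<partial>M) + ennreal (\<delta> / (2 * real N)) * (\<integral>\<^sup>+\<omega>. ennreal (D n 1 \<omega>) \<partial>M))" .
      have mS: "(\<lambda>\<omega>. \<Sum>n=1..N. ennreal (1 / (2 * \<delta> * real N)) * ennreal (D n (- 1) \<omega>) + ennreal (\<delta> / (2 * real N)) * ennreal (D n 1 \<omega>)) \<in> borel_measurable M"
        by (intro borel_measurable_sum borel_measurable_add borel_measurable_times_ennreal borel_measurable_const mD)
      show ?thesis
        unfolding G_def by (subst nn_integral_add) (auto simp: mS S[simplified] nn_integral_add nn_integral_cmult emeasure_space_1 intro: mS[simplified])
    qed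
    also have "\<dots> \<le> ennreal c0 + ennreal c1 * ennreal (2 * real (card J)) +
      (\<Sum>n=1..N. ennreal (1 / (2 * \<delta> * real N)) * ennreal (3 * e) + ennreal (\<delta> / (2 * real N)) * ennreal (4 * K0))"
    proof -
      have "(\<integral>\<^sup>+\<omega>. ennreal (D n (- 1) \<omega>) \<partial>M) \<le> ennreal (3 * e)" "(\<integral>\<^sup>+\<omega>. ennreal (D n 1 \<omega>) \<partial>M) \<le> ennreal (4 * K0)"
        if "n \<in> {1..N}" for n
        unfolding D_def using increment_energy(2,3)[OF disc that close] by auto
      then show ?thesis using Wi by (intro add_mono mult_left_mono sum_mono order_refl) auto
    qed
    also have "\<dots> = ennreal (c0 + c1 * (2 * real (card J)) + (\<Sum>n=1..N. 1 / (2 * \<delta> * real N) * (3 * e) + \<delta> / (2 * real N) * (4 * K0)))"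
    proof -
      have x0: "0 \<le> 1 / (2 * \<delta> * real N) * (3 * e)" "0 \<le> \<delta> / (2 * real N) * (4 * K0)" using \<delta> e K0 N0 by auto
      have "ennreal (1 / (2 * \<delta> * real N)) * ennreal (3 * e) + ennreal (\<delta> / (2 * real N)) * ennreal (4 * K0) =
          ennreal (1 / (2 * \<delta> * real N) * (3 * e) + \<delta> / (2 * real N) * (4 * K0))"
        using \<delta> e K0 N0 by (intro ennreal_lincomb) auto
      moreover have "(\<Sum>n=1..N. ennreal (1 / (2 * \<delta> * real N) * (3 * e) + \<delta> / (2 * real N) * (4 * K0)))
          = ennreal (\<Sum>n=1..N. 1 / (2 * \<delta> * real N) * (3 * e) + \<delta> / (2 * real N) * (4 * K0))"
        using x0 by (intro sum_ennreal) simp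
      moreover have "0 \<le> (\<Sum>n=1..N. 1 / (2 * \<delta> * real N) * (3 * e) + \<delta> / (2 * real N) * (4 * K0))"
        using x0 by (intro sum_nonneg) simp
      moreover have "ennreal c1 * ennreal (2 * real (card J)) = ennreal (c1 * (2 * real (card J)))"
        using c01 by (simp add: ennreal_mult)
      moreover have "0 \<le> c1 * (2 * real (card J))" using c01 by simp
      ultimately show ?thesis using c01 by (simp only: ennreal_plus add_nonneg_nonneg)
    qed
    also have "\<dots> \<le> ennreal (200 * \<sigma> * (sqrt (L / real N) + L / real N))"
    proof (rule ennreal_leI)
      have "(\<Sum>n=1..N. 1 / (2 * \<delta> * real N) * (3 * e) + \<delta> / (2 * real N) * (4 * K0)) = 3 * e / (2 * \<delta>) + 2 * \<delta> * K0"
        using N0 by (simp add: field_simps)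
      also have "\<dots> \<le> 3 / 2 * \<epsilon> + \<epsilon> / 2"
      proof -
        have "3 * e / (2 * \<delta>) \<le> 3 / 2 * \<epsilon>" using e(4) \<delta> by (simp add: field_simps)
        moreover have "2 * \<delta> * K0 = \<epsilon> / 2" using K0 by (simp add: \<delta>_def)
        ultimately show ?thesis by simp
      qed
      finally have r: "(\<Sum>n=1..N. 1 / (2 * \<delta> * real N) * (3 * e) + \<delta> / (2 * real N) * (4 * K0)) + e \<le> 3 * \<epsilon>"
        using e by simp
      define A where "A = sqrt (L / real N)"
      have A: "A > 0" "A\<^sup>2 = L / real N" using L0 N0 by (auto simp: A_def)
      have LN: "L = real N * A\<^sup>2" using A N0 by simp
      have "real N * L = (real N * A)\<^sup>2" by (simp add: LN power2_eq_square)
      then have sq: "sqrt (real N * L) = real N * A" using N0 A(1) by simp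
      have t1: "96 * s * \<sigma>2\<^sup>2 / real N \<le> 96 * \<sigma>2 * A"
      proof -
        have "s \<le> real N * A / \<sigma>2" by (simp add: s_def sq)
        then have "96 * s * \<sigma>2\<^sup>2 / real N \<le> 96 * (real N * A / \<sigma>2) * \<sigma>2\<^sup>2 / real N"
          using N0 by (intro divide_right_mono mult_right_mono mult_left_mono) auto
        also have "\<dots> = 96 * \<sigma>2 * A" using N0 \<sigma>2 by (simp add: power2_eq_square)
        finally show ?thesis .
      qed
      have t2: "2 * L / s \<le> 2 * \<sigma>2 * A + 48 * \<sigma>2 * A\<^sup>2"
      proof -
        have "s = real N * A / \<sigma>2 \<or> s = real N / (24 * \<sigma>2)" by (auto simp: s_def sq min_def)
        then show ?thesis
        proof
          assume "s = real N * A / \<sigma>2"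
          then have "2 * L / s = 2 * \<sigma>2 * A" using N0 A \<sigma>2 by (simp add: LN power2_eq_square)
          then show ?thesis using \<sigma>2 by simp
        next
          assume "s = real N / (24 * \<sigma>2)"
          then have "2 * L / s = 48 * \<sigma>2 * A\<^sup>2" using N0 \<sigma>2 by (simp add: LN)
          then show ?thesis using \<sigma>2 A by simp
        qed
      qed
      have cJ: "c1 * (2 * real (card J)) = 4 / s" using cardJ by (simp add: c1_def)
      \<comment> \<open>The extra \<open>4 / s\<close> is paid for by the coefficient 4 of the
        logarithm in \<open>L\<close>: the left side has \<open>4 * LJ + 4\<close>, the right side
        \<open>8 * LJ\<close>, and \<open>LJ \<ge> 1\<close>.\<close>
      have "2 * (\<tau> / \<sigma>2 + 2 * LJ) / s + 4 / s \<le> 2 * L / s"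
      proof -
        have "2 * (\<tau> / \<sigma>2 + 2 * LJ) + 4 \<le> 2 * L" using LJ by (simp add: L \<sigma>2_def)
        then show ?thesis using s by (simp add: add_divide_distrib[symmetric] divide_right_mono)
      qed
      then have "c0 + c1 * (2 * real (card J)) + (\<Sum>n=1..N. 1 / (2 * \<delta> * real N) * (3 * e) + \<delta> / (2 * real N) * (4 * K0))
          \<le> 96 * \<sigma>2 * A + (2 * \<sigma>2 * A + 48 * \<sigma>2 * A\<^sup>2) + 3 * \<epsilon>"
        unfolding c0_def cJ using t1 t2 r by linarith
      also have "\<dots> = 199 * \<sigma> * A + 96 * \<sigma> * A\<^sup>2" by (simp add: \<sigma>2_def \<epsilon>_def A_def)
      also have "\<dots> \<le> 200 * \<sigma> * (A + A\<^sup>2)"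
      proof -
        have "0 \<le> \<sigma> * A" "0 \<le> \<sigma> * A\<^sup>2" using pos A(1) by auto
        then show ?thesis unfolding distrib_left mult.assoc by linarith
      qed
      finally show "c0 + c1 * (2 * real (card J)) + (\<Sum>n=1..N. 1 / (2 * \<delta> * real N) * (3 * e) + \<delta> / (2 * real N) * (4 * K0))
          \<le> 200 * \<sigma> * (sqrt (L / real N) + L / real N)" unfolding A(2) A_def[symmetric] .
    qed
    finally show ?thesis .
  qed
  have "AE \<omega> in M. W \<omega> \<noteq> \<infinity>"
    using Wi by (intro nn_integral_PInf_AE) (auto simp: top_unique)
  then have "AE \<omega> in M. \<forall>b\<in>J. \<forall>g\<in>L2. (\<forall>x\<in>unit_cube - U b. g x = 0) \<longrightarrow>
      ennreal \<bar>bil (\<lambda>x y. sample_kernel N u \<omega> x y - k x y) g g\<bar> \<le> G \<omega> * ennreal (inner_L2 g g)"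
    using paths_L2
  proof eventually_elim
    case (elim \<omega>)
    show ?case
    proof (intro ballI impI)
      fix b g assume b: "b \<in> J" and g: "g \<in> L2" and zero: "\<forall>x\<in>unit_cube - U b. g x = 0"
      define y where "y = enn2real (W \<omega>)"
      have y: "0 \<le> y" "W \<omega> = ennreal y" using elim(1) by (auto simp: y_def less_top)
      have YW: "Y b \<omega> \<le> W \<omega>" unfolding W_def using b J by (intro member_le_sum) auto
      then have Yfin: "Y b \<omega> < \<infinity>" using elim(1) by (simp add: less_top top_unique)
      have Yy: "enn2real (Y b \<omega>) \<le> y" using YW y by (metis enn2real_ennreal enn2real_mono ennreal_less_top)
      have coeff: "cell_coeff c g p = 0" if "p \<in> c ` unit_cube - Q b" for p
      proof -
        have "cell c p x * g x = 0" if "x \<in> unit_cube" for x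
        proof (cases "x \<in> U b")
          case True
          then have "c x \<in> Q b" using that by (auto simp: Q_def)
          then have "c x \<noteq> p" using \<open>p \<in> c ` unit_cube - Q b\<close> by blast
          then show ?thesis by (simp add: cell_def[OF disc])
        qed (use zero that in simp)
        then have "cell_coeff c g p = (LINT x|(cube :: (real ^ 'n) measure). 0)"
          unfolding cell_coeff_def[OF disc] inner_L2_def by (intro Bochner_Integration.integral_cong) auto
        then show ?thesis by simp
      qed
      define J2 where "J2 = 1 + 2 * real (card J)"
      have J2: "J2 > 0" "ln J2 = LJ" "2 * real (card J) > 0" using cardJ by (auto simp: J2_def LJ_def)
      \<comment> \<open>The concave logarithm is replaced by an affine majorant with value
        \<open>LJ\<close> at 0 and slope \<open>1 / (2 * card J)\<close>, adapted to the mean of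
        \<open>W\<close>. The majorant is then integrable, and the number of sets survives only
        inside \<open>LJ\<close>.\<close>
      have lnY: "ln (1 + enn2real (Y b \<omega>)) \<le> LJ + y / (2 * real (card J))"
      proof -
        have "ln (1 + enn2real (Y b \<omega>)) \<le> ln (1 + y)"
          by (subst ln_le_cancel_iff) (use Yy y(1) in \<open>auto intro: add_pos_nonneg\<close>)
        also have "\<dots> = LJ + ln ((1 + y) / J2)" using y J2 by (simp add: ln_div add_pos_nonneg)
        also have "ln ((1 + y) / J2) \<le> (1 + y) / J2 - 1" using y J2 by (intro ln_le_minus_one) (simp add: add_pos_nonneg)
        also have "\<dots> \<le> y / J2" using J2 cardJ by (simp add: field_simps J2_def)
        also have "\<dots> \<le> y / (2 * real (card J))" using y J2 by (intro divide_left_mono) (auto simp: J2_def)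
        finally show ?thesis by simp
      qed
      define E where "E = (\<Sum>n=1..N. D n (- 1) \<omega> / (2 * \<delta>) + \<delta> / 2 * D n 1 \<omega>) / real N"
      have "\<bar>bil (\<lambda>x y. sample_kernel N u \<omega> x y - k x y) g g\<bar>
          \<le> (96 * s * \<sigma>2\<^sup>2 / real N + 2 * (\<tau> / \<sigma>2 + 2 * ln (1 + enn2real (Y b \<omega>))) / s) * inner_L2 g g + (e + E) * inner_L2 g g"
        using form_discretization_error[OF disc close elim(2) g \<delta>] dev[OF b Yfin g coeff]
        unfolding D_def[symmetric] E_def[symmetric] by linarith
      also have "\<dots> = (96 * s * \<sigma>2\<^sup>2 / real N + 2 * (\<tau> / \<sigma>2 + 2 * ln (1 + enn2real (Y b \<omega>))) / s + e + E) * inner_L2 g g"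
        by (simp add: algebra_simps)
      also have "\<dots> \<le> (c0 + c1 * y + E) * inner_L2 g g"
      proof (rule mult_right_mono[OF _ inner_L2_self_nonneg])
        have "2 * (\<tau> / \<sigma>2 + 2 * ln (1 + enn2real (Y b \<omega>))) / s \<le> 2 * (\<tau> / \<sigma>2 + 2 * (LJ + y / (2 * real (card J)))) / s"
          using lnY s by (intro divide_right_mono) auto
        also have "\<dots> = 2 * (\<tau> / \<sigma>2 + 2 * LJ) / s + c1 * y" by (simp add: c1_def add_divide_distrib distrib_left)
        finally show "96 * s * \<sigma>2\<^sup>2 / real N + 2 * (\<tau> / \<sigma>2 + 2 * ln (1 + enn2real (Y b \<omega>))) / s + e + E \<le> c0 + c1 * y + E"
          by (simp add: c0_def)
      qed
      finally have le: "\<bar>bil (\<lambda>x y. sample_kernel N u \<omega> x y - k x y) g g\<bar> \<le> (c0 + c1 * y + E) * inner_L2 g g" .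
      have E: "0 \<le> E" unfolding E_def using \<delta> N0 D0 by (intro divide_nonneg_nonneg sum_nonneg add_nonneg_nonneg) auto
      have "G \<omega> = ennreal (c0 + c1 * y + E)"
      proof -
        have "(\<Sum>n=1..N. ennreal (1 / (2 * \<delta> * real N)) * ennreal (D n (- 1) \<omega>) + ennreal (\<delta> / (2 * real N)) * ennreal (D n 1 \<omega>))
          = (\<Sum>n=1..N. ennreal (1 / (2 * \<delta> * real N) * D n (- 1) \<omega> + \<delta> / (2 * real N) * D n 1 \<omega>))"
          using \<delta> D0 by (intro sum.cong refl ennreal_lincomb) auto
        also have "\<dots> = ennreal (\<Sum>n=1..N. 1 / (2 * \<delta> * real N) * D n (- 1) \<omega> + \<delta> / (2 * real N) * D n 1 \<omega>)"
          using \<delta> D0 by (intro sum_ennreal) auto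
        also have "(\<Sum>n=1..N. 1 / (2 * \<delta> * real N) * D n (- 1) \<omega> + \<delta> / (2 * real N) * D n 1 \<omega>) = E"
          unfolding E_def sum_divide_distrib by (intro sum.cong refl) (simp add: add_divide_distrib)
        finally show ?thesis unfolding G_def y(2) using c01 y E by (simp add: ennreal_mult ennreal_plus)
      qed
      then have "G \<omega> * ennreal (inner_L2 g g) = ennreal ((c0 + c1 * y + E) * inner_L2 g g)"
        using c01 y E by (simp only: ennreal_mult inner_L2_self_nonneg add_nonneg_nonneg mult_nonneg_nonneg)
      then show "ennreal \<bar>bil (\<lambda>x y. sample_kernel N u \<omega> x y - k x y) g g\<bar> \<le> G \<omega> * ennreal (inner_L2 g g)"
        using ennreal_leI[OF le] by simp
    qed
  qed
  then show ?thesis using Gm Gi by blast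
qed

end

section \<open>Tapering\<close>

lemma coordinate_measurable [measurable]: "(\<lambda>x. x $ i) \<in> borel_measurable (cube :: (real ^ 'n::finite) measure)"
proof -
  have id: "(\<lambda>x. x) \<in> measurable (cube :: (real ^ 'n) measure) borel"
    using id_borel_measurable_lebesgue_on[of unit_cube] by (simp add: id_def)
  show ?thesis by (rule measurable_compose[OF id borel_measurable_continuous_onI]) (intro continuous_intros)
qed

text \<open>Multiplication by it compresses a function to a slab; \<open>t\<close> is kept as a
  parameter because the taper is recovered by integrating over it.\<close>

definition window :: "real \<Rightarrow> 'n::finite \<Rightarrow> real \<Rightarrow> real ^ 'n \<Rightarrow> real" where
  "window h i t x = (if t \<le> x $ i \<and> x $ i \<le> t + h then 1 else 0)"

lemma window_L2: "g \<in> L2 \<Longrightarrow> (\<lambda>x. window h i t x * g x) \<in> L2"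
  by (rule L2_bounded_mult[where c = 1]) (auto simp: window_def)

text \<open>The parameters whose slab contains both points form an interval of length
  \<open>h - |x_i - y_i|\<close> when this is nonnegative. The triangle function is thus an average
  of products of indicators.\<close>

lemma window_overlap:
  assumes "0 \<le> h"
  shows "has_bochner_integral lborel (\<lambda>t. window h i t x * window h i t y) (max (h - \<bar>x $ i - y $ i\<bar>) 0)"
proof -
  define A where "A = {max (x $ i - h) (y $ i - h) .. min (x $ i) (y $ i)}"
  have "has_bochner_integral lborel (indicator A) (measure lborel A)"
    by (rule has_bochner_integral_real_indicator) (auto simp: A_def emeasure_lborel_Icc_eq)
  moreover have "(\<lambda>t. window h i t x * window h i t y) = indicator A"
    by (intro ext) (auto simp: window_def A_def split: split_indicator)
  moreover have "measure lborel A = max (h - \<bar>x $ i - y $ i\<bar>) 0"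
  proof (cases "max (x $ i - h) (y $ i - h) \<le> min (x $ i) (y $ i)")
    case True then show ?thesis by (simp add: A_def) (simp add: max_def min_def abs_if)
  next
    case False
    then have "A = {}" by (auto simp: A_def)
    then show ?thesis using False by (simp add: max_def min_def abs_if split: if_splits)
  qed
  ultimately show ?thesis by simp
qed

lemma overlap_kernel_measurable:
  "(\<lambda>z. max (h - \<bar>fst z $ i - snd z $ i\<bar>) 0) \<in> borel_measurable (cube_sq :: ((real ^ 'n::finite) \<times> (real ^ 'n)) measure)"
  by measurable

text \<open>Multiplying the kernel by the triangle averages its compressions to slabs. Each
  compression obeys the hypothesis, and the energies of the compressed functions integrate to
  \<open>h\<close> times that of \<open>g\<close>, as each point lies in the slabs of a parameter
  interval of length \<open>h\<close>.\<close>

lemma overlap_form_bound: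
  fixes T :: "real ^ 'n::finite \<Rightarrow> real ^ 'n \<Rightarrow> real"
  assumes T: "hs_kernel T" and g: "g \<in> L2" and h: "0 \<le> h" and e: "0 \<le> e"
    and form: "\<And>t. \<bar>bil T (\<lambda>x. window h i t x * g x) (\<lambda>x. window h i t x * g x)\<bar>
      \<le> e * inner_L2 (\<lambda>x. window h i t x * g x) (\<lambda>x. window h i t x * g x)"
  shows "\<bar>bil (\<lambda>x y. T x y * max (h - \<bar>x $ i - y $ i\<bar>) 0) g g\<bar> \<le> e * h * inner_L2 g g"
proof -
  interpret P: pair_sigma_finite "cube_sq :: ((real ^ 'n) \<times> (real ^ 'n)) measure" "lborel :: real measure" ..
  interpret Q: pair_sigma_finite "cube :: (real ^ 'n) measure" "lborel :: real measure" ..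
  define q where "q z = T (fst z) (snd z) * (g (fst z) * g (snd z))" for z
  have qi: "integrable cube_sq q" unfolding q_def[abs_def] by (rule bil_integrable[OF T g g])
  have [measurable]: "q \<in> borel_measurable cube_sq" using qi by simp
  note [measurable] = L2_measurable[OF g]
  define F where "F z t = q z * (window h i t (fst z) * window h i t (snd z))" for z t
  have Fm: "(\<lambda>(z, t). F z t) \<in> borel_measurable (cube_sq \<Otimes>\<^sub>M lborel)"
    unfolding F_def window_def by measurable
  have Fz: "has_bochner_integral lborel (F z) (q z * max (h - \<bar>fst z $ i - snd z $ i\<bar>) 0)" for z
    unfolding F_def by (intro has_bochner_integral_mult_right window_overlap h)
  have absF: "norm (F z t) = norm (q z) * (window h i t (fst z) * window h i t (snd z))" for z t
    by (simp add: F_def window_def)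
  have Fint: "integrable (cube_sq \<Otimes>\<^sub>M lborel) (\<lambda>(z, t). F z t)"
  proof (rule P.Fubini_integrable[OF Fm])
    have "(LINT t|lborel. norm (F z t)) = norm (q z) * max (h - \<bar>fst z $ i - snd z $ i\<bar>) 0" for z
      unfolding absF using window_overlap[OF h, of i "fst z" "snd z"] by (simp add: has_bochner_integral_iff)
    moreover have "integrable cube_sq (\<lambda>z. norm (q z) * max (h - \<bar>fst z $ i - snd z $ i\<bar>) 0)"
    proof (rule Bochner_Integration.integrable_bound[where f = "\<lambda>z. h * q z"])
      show "AE z in cube_sq. norm (norm (q z) * max (h - \<bar>fst z $ i - snd z $ i\<bar>) 0) \<le> norm (h * q z)"
      proof (rule AE_I2)
        fix z
        have "norm (q z) * max (h - \<bar>fst z $ i - snd z $ i\<bar>) 0 \<le> norm (q z) * h"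
          using h by (intro mult_left_mono) auto
        then show "norm (norm (q z) * max (h - \<bar>fst z $ i - snd z $ i\<bar>) 0) \<le> norm (h * q z)"
          using h by (simp add: abs_mult mult.commute)
      qed
    qed (use qi in auto)
    ultimately show "integrable cube_sq (\<lambda>z. LINT t|lborel. norm (case (z, t) of (z, t) \<Rightarrow> F z t))" by simp
    show "AE z in cube_sq. integrable lborel (\<lambda>t. case (z, t) of (z, t) \<Rightarrow> F z t)"
      using Fz by (simp add: has_bochner_integral_iff)
  qed
  define A where "A t = (LINT z|cube_sq. F z t)" for t
  have Ab: "A t = bil T (\<lambda>x. window h i t x * g x) (\<lambda>x. window h i t x * g x)" for t
    unfolding A_def bil_def F_def q_def by (intro Bochner_Integration.integral_cong) (auto simp: mult_ac)
  have Ai: "integrable lborel A" unfolding A_def using P.integrable_snd[OF Fint] .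
  have "(LINT t|lborel. A t) = (LINT z|cube_sq. LINT t|lborel. F z t)"
    unfolding A_def using P.Fubini_integral[OF Fint] .
  also have "\<dots> = bil (\<lambda>x y. T x y * max (h - \<bar>x $ i - y $ i\<bar>) 0) g g"
    unfolding bil_def
    by (intro Bochner_Integration.integral_cong refl) (simp add: has_bochner_integral_integral_eq[OF Fz], simp add: q_def mult_ac)
  finally have eq: "(LINT t|lborel. A t) = bil (\<lambda>x y. T x y * max (h - \<bar>x $ i - y $ i\<bar>) 0) g g" .
  define E where "E x t = (g x)\<^sup>2 * (window h i t x * window h i t x)" for x t
  have Em: "(\<lambda>(x, t). E x t) \<in> borel_measurable (cube \<Otimes>\<^sub>M lborel)"
    unfolding E_def window_def by measurable
  have Ex: "has_bochner_integral lborel (E x) ((g x)\<^sup>2 * h)" for x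
    unfolding E_def using has_bochner_integral_mult_right[OF window_overlap[OF h, of i x x], of "(g x)\<^sup>2"] h by simp
  have En: "0 \<le> E x t" for x t by (simp add: E_def)
  have Eint: "integrable (cube \<Otimes>\<^sub>M lborel) (\<lambda>(x, t). E x t)"
  proof (rule Q.Fubini_integrable[OF Em])
    have "(LINT t|lborel. norm (E x t)) = (g x)\<^sup>2 * h" for x
      using Ex[of x] En by (simp add: has_bochner_integral_iff)
    then show "integrable cube (\<lambda>x. LINT t|lborel. norm (case (x, t) of (x, t) \<Rightarrow> E x t))"
      using L2_integrable_square[OF g] by simp
    show "AE x in cube. integrable lborel (\<lambda>t. case (x, t) of (x, t) \<Rightarrow> E x t)"
      using Ex by (simp add: has_bochner_integral_iff)
  qed
  define B where "B t = (LINT x|cube. E x t)" for t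
  have Bb: "B t = inner_L2 (\<lambda>x. window h i t x * g x) (\<lambda>x. window h i t x * g x)" for t
    unfolding B_def inner_L2_def E_def by (intro Bochner_Integration.integral_cong) (auto simp: power2_eq_square mult_ac)
  have Bi: "integrable lborel B" unfolding B_def using Q.integrable_snd[OF Eint] .
  have "(LINT t|lborel. B t) = (LINT x|cube. LINT t|lborel. E x t)"
    unfolding B_def using Q.Fubini_integral[OF Eint] .
  also have "\<dots> = h * inner_L2 g g"
    by (simp add: has_bochner_integral_integral_eq[OF Ex] inner_L2_self mult.commute)
  finally have BI: "(LINT t|lborel. B t) = h * inner_L2 g g" .
  have "\<bar>LINT t|lborel. A t\<bar> \<le> (LINT t|lborel. \<bar>A t\<bar>)" by (rule integral_abs_bound)
  also have "\<dots> \<le> (LINT t|lborel. e * B t)"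
  proof (rule integral_mono)
    show "integrable lborel (\<lambda>t. \<bar>A t\<bar>)" "integrable lborel (\<lambda>t. e * B t)" using Ai Bi by auto
    show "\<bar>A t\<bar> \<le> e * B t" for t unfolding Ab Bb by (rule form)
  qed
  also have "\<dots> = e * h * inner_L2 g g" by (simp add: BI)
  finally show ?thesis unfolding eq .
qed

definition taper1 :: "real \<Rightarrow> real \<Rightarrow> real" where
  "taper1 \<kappa> t = min (max (2 * \<kappa> - \<bar>t\<bar>) 0 / \<kappa>) 1"

lemma taper_eq_prod: "taper \<kappa> x y = (\<Prod>i\<in>UNIV. taper1 \<kappa> (x $ i - y $ i))"
  by (simp add: taper_def taper1_def)

lemma taper1_bounds: "\<kappa> > 0 \<Longrightarrow> 0 \<le> taper1 \<kappa> t" "taper1 \<kappa> t \<le> 1"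
  by (auto simp: taper1_def)

text \<open>The trapezoid is a difference of two triangles, of half-widths
  \<open>2 * \<kappa>\<close> and \<kappa>; the slopes cancel on the plateau.\<close>

lemma taper1_eq: "\<kappa> > 0 \<Longrightarrow> taper1 \<kappa> t = 1 / \<kappa> * (max (2 * \<kappa> - \<bar>t\<bar>) 0 - max (\<kappa> - \<bar>t\<bar>) 0)"
  by (auto simp: taper1_def max_def min_def field_simps)

lemma taper_prod_measurable:
  "(\<lambda>z. \<Prod>i\<in>R. taper1 \<kappa> (fst z $ i - snd z $ i)) \<in> borel_measurable (cube_sq :: ((real ^ 'n::finite) \<times> (real ^ 'n)) measure)"
  unfolding taper1_def by measurable

lemma taper_prod_bounds:
  assumes "\<kappa> > 0"
  shows "0 \<le> (\<Prod>i\<in>R. taper1 \<kappa> (f i))" "(\<Prod>i\<in>R. taper1 \<kappa> (f i)) \<le> 1"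
  using taper1_bounds assms by (auto intro: prod_nonneg prod_le_1)

lemma taper_prod_hs:
  fixes T :: "real ^ 'n::finite \<Rightarrow> real ^ 'n \<Rightarrow> real"
  assumes "hs_kernel T" "\<kappa> > 0"
  shows "hs_kernel (\<lambda>x y. T x y * (\<Prod>i\<in>R. taper1 \<kappa> (x $ i - y $ i)))"
proof (rule hs_kernel_mult_bounded[OF assms(1) taper_prod_measurable, where c = 1])
  show "\<bar>\<Prod>i\<in>R. taper1 \<kappa> (x $ i - y $ i)\<bar> \<le> 1" for x y :: "real ^ 'n"
    using taper_prod_bounds[OF assms(2), of "\<lambda>i. x $ i - y $ i" R] by linarith
qed

text \<open>Each factor of the taper is a difference of two averages over windows, in which the kernel is
  compressed to a slab. Doing this in all coordinates leaves compressions to boxes of side \<open>2\<kappa>\<close>.\<close>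

lemma taper_form_bound:
  fixes T :: "real ^ 'n::finite \<Rightarrow> real ^ 'n \<Rightarrow> real"
  assumes T: "hs_kernel T" and \<kappa>: "\<kappa> > 0" and e: "0 \<le> e"
    and local: "\<And>z g. g \<in> L2 \<Longrightarrow> (\<And>x. x \<in> unit_cube \<Longrightarrow> g x \<noteq> 0 \<Longrightarrow> \<forall>i. z i \<le> x $ i \<and> x $ i \<le> z i + 2 * \<kappa>) \<Longrightarrow>
      \<bar>bil T g g\<bar> \<le> e * inner_L2 g g"
    and g: "g \<in> L2"
  shows "\<bar>bil (\<lambda>x y. T x y * taper \<kappa> x y) g g\<bar> \<le> 3 ^ CARD('n) * e * inner_L2 g g"
proof -
  \<comment> \<open>Generalized for the induction: \<open>R\<close> holds the coordinates still
    tapered, and in every other coordinate \<open>g\<close> is already confined to the interval of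
    length \<open>2 * \<kappa>\<close> starting at \<open>z i\<close>.\<close>
  have "\<bar>bil (\<lambda>x y. T x y * (\<Prod>i\<in>R. taper1 \<kappa> (x $ i - y $ i))) g g\<bar> \<le> 3 ^ card R * e * inner_L2 g g"
    if "finite R" "g \<in> L2" "\<And>x. x \<in> unit_cube \<Longrightarrow> g x \<noteq> 0 \<Longrightarrow> \<forall>i. i \<notin> R \<longrightarrow> z i \<le> x $ i \<and> x $ i \<le> z i + 2 * \<kappa>"
    for R g z
    using that
  proof (induction R arbitrary: g z rule: finite_induct)
    case empty
    then show ?case using local[of g z] by simp
  next
    case (insert j R)
    let ?T = "\<lambda>x y. T x y * (\<Prod>i\<in>R. taper1 \<kappa> (x $ i - y $ i))"
    let ?O = "\<lambda>h x y. ?T x y * max (h - \<bar>x $ j - y $ j\<bar>) 0"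
    note hsT = taper_prod_hs[OF T \<kappa>, of R]
    have hsO: "hs_kernel (?O h)" if "0 \<le> h" for h
      by (rule hs_kernel_mult_bounded[OF hsT overlap_kernel_measurable, where c = h]) (use that in auto)
    define E where "E = 3 ^ card R * e"
    have E: "0 \<le> E" using e by (simp add: E_def)
    have ov: "\<bar>bil (?O h) g g\<bar> \<le> E * h * inner_L2 g g" if h: "0 \<le> h" "h \<le> 2 * \<kappa>" for h
    proof (rule overlap_form_bound[OF hsT insert.prems(1) h(1) E])
      fix t
      show "\<bar>bil ?T (\<lambda>x. window h j t x * g x) (\<lambda>x. window h j t x * g x)\<bar>
        \<le> E * inner_L2 (\<lambda>x. window h j t x * g x) (\<lambda>x. window h j t x * g x)"
        unfolding E_def
      proof (rule insert.IH[where z = "z(j := t)"])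
        show "(\<lambda>x. window h j t x * g x) \<in> L2" by (rule window_L2[OF insert.prems(1)])
        fix x :: "real ^ 'n" assume x: "x \<in> unit_cube" "window h j t x * g x \<noteq> 0"
        then have "g x \<noteq> 0" "t \<le> x $ j" "x $ j \<le> t + h" by (auto simp: window_def split: if_splits)
        then show "\<forall>i. i \<notin> R \<longrightarrow> (z(j := t)) i \<le> x $ i \<and> x $ i \<le> (z(j := t)) i + 2 * \<kappa>"
          using insert.prems(2)[OF x(1)] h by auto
      qed
    qed
    have "bil (\<lambda>x y. T x y * (\<Prod>i\<in>insert j R. taper1 \<kappa> (x $ i - y $ i))) g g =
       bil (\<lambda>x y. 1 / \<kappa> * (?O (2 * \<kappa>) x y - ?O \<kappa> x y)) g g"
    proof (rule bil_cong)
      fix x y :: "real ^ 'n"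
      show "T x y * (\<Prod>i\<in>insert j R. taper1 \<kappa> (x $ i - y $ i)) = 1 / \<kappa> * (?O (2 * \<kappa>) x y - ?O \<kappa> x y)"
      proof -
        have "r * ((c * (a - b)) * P) = c * (r * P * a - r * P * b)" for r c a b P :: real
          by (simp add: algebra_simps)
        then show ?thesis
          unfolding prod.insert[OF insert.hyps] taper1_eq[OF \<kappa>, of "x $ j - y $ j"] .
      qed
    qed
    also have "\<dots> = 1 / \<kappa> * (bil (?O (2 * \<kappa>)) g g - bil (?O \<kappa>) g g)"
      unfolding bil_cmult_kernel
      by (subst bil_diff_kernel[OF hsO hsO insert.prems(1) insert.prems(1)]) (use \<kappa> in auto)
    finally have eq: "bil (\<lambda>x y. T x y * (\<Prod>i\<in>insert j R. taper1 \<kappa> (x $ i - y $ i))) g g =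
      1 / \<kappa> * (bil (?O (2 * \<kappa>)) g g - bil (?O \<kappa>) g g)" .
    \<comment> \<open>The bounds for the two triangles add up to \<open>3 * \<kappa>\<close> before
      the division by \<kappa>, whence a factor 3 for each coordinate.\<close>
    have "\<bar>1 / \<kappa> * (bil (?O (2 * \<kappa>)) g g - bil (?O \<kappa>) g g)\<bar> \<le> 1 / \<kappa> * (E * (2 * \<kappa>) * inner_L2 g g + E * \<kappa> * inner_L2 g g)"
    proof -
      define p q where "p = bil (?O (2 * \<kappa>)) g g" and "q = bil (?O \<kappa>) g g"
      have "\<bar>p\<bar> \<le> E * (2 * \<kappa>) * inner_L2 g g" "\<bar>q\<bar> \<le> E * \<kappa> * inner_L2 g g"
        unfolding p_def q_def by (rule ov; use \<kappa> in simp)+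
      then have "\<bar>p - q\<bar> \<le> E * (2 * \<kappa>) * inner_L2 g g + E * \<kappa> * inner_L2 g g" by linarith
      then have "1 / \<kappa> * \<bar>p - q\<bar> \<le> 1 / \<kappa> * (E * (2 * \<kappa>) * inner_L2 g g + E * \<kappa> * inner_L2 g g)"
        by (rule mult_left_mono) (use \<kappa> in simp)
      moreover have "\<bar>1 / \<kappa> * (p - q)\<bar> = 1 / \<kappa> * \<bar>p - q\<bar>" using \<kappa> by (simp add: abs_mult del: times_divide_eq_left)
      ultimately show ?thesis unfolding p_def[symmetric] q_def[symmetric] by (simp only:)
    qed
    also have "\<dots> = 3 * E * inner_L2 g g"
    proof -
      have "r * (E * (2 * \<kappa>) * G + E * \<kappa> * G) = (r * \<kappa>) * (3 * E * G)" for r G by (simp add: algebra_simps)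
      then show ?thesis using \<kappa> by simp
    qed
    finally have "\<bar>1 / \<kappa> * (bil (?O (2 * \<kappa>)) g g - bil (?O \<kappa>) g g)\<bar> \<le> 3 * E * inner_L2 g g" .
    then show ?case unfolding eq card_insert_disjoint[OF insert.hyps] by (simp add: E_def mult.assoc)
  qed
  from this[of UNIV g] g show ?thesis by (simp add: taper_eq_prod)
qed

lemma taper_bounds: "\<kappa> > 0 \<Longrightarrow> 0 \<le> taper \<kappa> x y" "\<kappa> > 0 \<Longrightarrow> taper \<kappa> x y \<le> 1"
  unfolding taper_eq_prod by (auto intro: taper_prod_bounds)

lemma taper_sym: "taper \<kappa> x y = taper \<kappa> y x"
  by (simp add: taper_def abs_minus_commute)

text \<open>Such a pair lies on the plateau of every factor. Tapering therefore changes only entries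
  farther than \<kappa>, and its bias is a tail integral.\<close>

lemma taper_near:
  assumes "\<kappa> > 0" "norm (x - y) \<le> \<kappa>"
  shows "taper \<kappa> x y = 1"
proof -
  have "taper1 \<kappa> (x $ i - y $ i) = 1" for i
  proof -
    have "\<bar>x $ i - y $ i\<bar> \<le> \<kappa>" using component_le_norm_cart[of "x - y" i] assms by simp
    then have "\<kappa> \<le> max (2 * \<kappa> - \<bar>x $ i - y $ i\<bar>) 0" by simp
    then have "1 \<le> max (2 * \<kappa> - \<bar>x $ i - y $ i\<bar>) 0 / \<kappa>" using assms(1) by (simp add: pos_le_divide_eq)
    then show ?thesis unfolding taper1_def by (rule min_absorb2)
  qed
  then show ?thesis by (simp add: taper_eq_prod)
qed

section \<open>Upper bounds for the estimation errors\<close>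

context gaussian_kernel_sample
begin

lemma sample_kernel_sym: "sample_kernel N u \<omega> x y = sample_kernel N u \<omega> y x"
  by (simp add: sample_kernel_def mult.commute)

text \<open>A single support, the whole cube, with neighbourhood radius 1 inside
  \<open>[-1, 2]^d\<close>: hence the volume \<open>3^d\<close> and, \<open>J\<close> having one
  element, the logarithm \<open>ln 3\<close>.\<close>

lemma sample_cov_error_upper:
  assumes row: "\<And>x. x \<in> unit_cube \<Longrightarrow> (LINT y|cube. \<bar>k x y\<bar>) \<le> \<sigma>" and pos: "\<sigma> > 0"
  defines "L \<equiv> K0 * 3 ^ CARD('n) / (2 * \<sigma>) + 4 * ln 3"
  shows "(\<integral>\<^sup>+\<omega>. ennreal (op_norm (\<lambda>f x. sample_cov N u \<omega> f x - integral_op k f x)) \<partial>M)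
    \<le> ennreal (200 * \<sigma> * (sqrt (L / real N) + L / real N))"
proof -
  define V :: "(real ^ 'n) set" where "V = cbox (\<chi> i. - 1) (\<chi> i. 2)"
  have mV: "measure lebesgue V = 3 ^ CARD('n)"
    unfolding V_def by (subst measure_cbox_cart) auto
  have UV: "y \<in> V" if "x \<in> unit_cube" "dist x y \<le> 1" for x y :: "real ^ 'n"
  proof -
    have "\<bar>x $ i - y $ i\<bar> \<le> 1" for i using component_le_norm_cart[of "x - y" i] that(2) by (simp add: dist_norm)
    moreover have "0 \<le> x $ i" "x $ i \<le> 1" for i using that(1) by (auto simp: unit_cube_def)
    ultimately have "- 1 \<le> y $ i \<and> y $ i \<le> 2" for i by (smt (verit))
    then show ?thesis by (simp add: V_def mem_box_cart)
  qed
  have "K0 * 3 ^ CARD('n) > 0" using K0 by simp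
  from sample_form_deviation[where J = "{()}" and U = "\<lambda>_. unit_cube" and V = "\<lambda>_. V" and \<eta> = 1, OF _ _ _ _ _ _ pos this]
  obtain G where G: "(\<integral>\<^sup>+\<omega>. G \<omega> \<partial>M) \<le> ennreal (200 * \<sigma> * (sqrt (L / real N) + L / real N))"
    "AE \<omega> in M. \<forall>g\<in>L2. ennreal \<bar>bil (\<lambda>x y. sample_kernel N u \<omega> x y - k x y) g g\<bar> \<le> G \<omega> * ennreal (inner_L2 g g)"
    using mV UV row by (auto simp: V_def L_def)
  have "(\<integral>\<^sup>+\<omega>. ennreal (op_norm (\<lambda>f x. sample_cov N u \<omega> f x - integral_op k f x)) \<partial>M) \<le> (\<integral>\<^sup>+\<omega>. G \<omega> \<partial>M)"
  proof (rule nn_integral_mono_AE)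
    show "AE \<omega> in M. ennreal (op_norm (\<lambda>f x. sample_cov N u \<omega> f x - integral_op k f x)) \<le> G \<omega>"
      using G(2) paths_L2
    proof eventually_elim
      case (elim \<omega>)
      show ?case
      proof (cases "G \<omega> = \<infinity>")
        case False
        define e where "e = enn2real (G \<omega>)"
        have e: "0 \<le> e" "G \<omega> = ennreal e" using False by (auto simp: e_def less_top)
        let ?T = "\<lambda>x y. sample_kernel N u \<omega> x y - k x y"
        note hs = sample_form(1)[OF elim(2) L2_zero]
        have form: "\<bar>bil ?T g g\<bar> \<le> e * inner_L2 g g" if "g \<in> L2" for g
          using elim(1) that e by (simp add: ennreal_mult[symmetric] inner_L2_self_nonneg ennreal_le_iff)
        have "op_norm (\<lambda>f x. sample_cov N u \<omega> f x - integral_op k f x) \<le> e"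
        proof (rule op_norm_le)
          fix f :: "real ^ 'n \<Rightarrow> real" assume f: "f \<in> L2" "norm_L2 f \<le> 1"
          have "norm_L2 (\<lambda>x. sample_cov N u \<omega> f x - integral_op k f x) = norm_L2 (integral_op ?T f)"
            unfolding sample_cov_def by (rule norm_L2_integral_op_diff[OF hs k_hs f(1)])
          also have "\<dots> \<le> e * norm_L2 f"
          proof (rule norm_L2_integral_op_le[OF hs_kernel_diff[OF hs k_hs] _ e(1) form f(1)])
            show "?T x y = ?T y x" if "x \<in> unit_cube" "y \<in> unit_cube" for x y
              using k_sym[OF that] sample_kernel_sym[of \<omega> x y] by simp
          qed
          also have "\<dots> \<le> e * 1" using f e by (intro mult_left_mono) auto
          finally show "norm_L2 (\<lambda>x. sample_cov N u \<omega> f x - integral_op k f x) \<le> e" by simp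
        qed
        then show ?thesis using e by (simp add: ennreal_leI)
      qed simp
    qed
  qed
  then show ?thesis using G(1) by (rule order_trans)
qed

text \<open>The error kernel is \<open>D * taper\<close> minus \<open>k\<close> times
  \<open>1 - taper\<close>, where \<open>D\<close> is the untapered error. The first part is a
  stochastic error, reduced to boxes by the window decomposition; the second is a bias, bounded by
  its rows. The boxes range over a continuum, so they are covered by finitely many with corners on a
  grid of mesh \<kappa>.\<close>

lemma tapered_cov_error_upper:
  assumes row: "\<And>x. x \<in> unit_cube \<Longrightarrow> (LINT y|cube. \<bar>k x y\<bar>) \<le> \<sigma>" and pos: "\<sigma> > 0" and \<kappa>: "\<kappa> > 0"
    and bias: "\<And>x. x \<in> unit_cube \<Longrightarrow> (LINT y|cube. \<bar>k x y * (1 - taper \<kappa> x y)\<bar>) \<le> \<beta>" and \<beta>: "0 \<le> \<beta>"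
    and bd: "\<And>x y. x \<in> unit_cube \<Longrightarrow> y \<in> unit_cube \<Longrightarrow> \<bar>k x y\<bar> \<le> K0"
  defines "L \<equiv> K0 * (5 * \<kappa>) ^ CARD('n) / (2 * \<sigma>) + 4 * ln (1 + 2 * (1 / \<kappa> + 3) ^ CARD('n))"
  shows "(\<integral>\<^sup>+\<omega>. ennreal (op_norm (\<lambda>f x. tapered_cov \<kappa> N u \<omega> f x - integral_op k f x)) \<partial>M)
    \<le> ennreal (3 ^ CARD('n) * (200 * \<sigma> * (sqrt (L / real N) + L / real N)) + \<beta>)"
proof -
  have N0: "real N > 0" using N by simp
  define m where "m = \<lfloor>1 / \<kappa>\<rfloor>"
  have m0: "0 \<le> m" using \<kappa> by (simp add: m_def)
  \<comment> \<open>A box of side \<open>2 * \<kappa>\<close> that meets the unit cube has its lower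
    corner coordinates between \<open>- 2 * \<kappa>\<close> and 1, which leaves these multiples of
    \<kappa> after rounding down.\<close>
  define J :: "('n \<Rightarrow> int) set" where "J = PiE UNIV (\<lambda>_. {- 2..m})"
  \<comment> \<open>Rounding the corner down enlarges the side from \<open>2 * \<kappa>\<close> to
    \<open>3 * \<kappa>\<close>; the neighbourhood of radius \<kappa> then fits into a box of side
    \<open>5 * \<kappa>\<close>.\<close>
  define U :: "('n \<Rightarrow> int) \<Rightarrow> (real ^ 'n) set" where "U b = cbox (\<chi> i. real_of_int (b i) * \<kappa>) (\<chi> i. (real_of_int (b i) + 3) * \<kappa>)" for b
  define V :: "('n \<Rightarrow> int) \<Rightarrow> (real ^ 'n) set" where "V b = cbox (\<chi> i. (real_of_int (b i) - 1) * \<kappa>) (\<chi> i. (real_of_int (b i) + 4) * \<kappa>)" for b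
  have J: "finite J" "J \<noteq> {}" unfolding J_def using m0 by (auto intro!: finite_PiE simp: PiE_eq_empty_iff)
  have cardJ: "real (card J) \<le> (1 / \<kappa> + 3) ^ CARD('n)"
  proof -
    have "card J = (nat (m + 3)) ^ CARD('n)" unfolding J_def by (subst card_PiE) (auto simp: add.commute)
    then have "real (card J) = (real_of_int m + 3) ^ CARD('n)" using m0 by simp
    also have "\<dots> \<le> (1 / \<kappa> + 3) ^ CARD('n)" using m0 by (intro power_mono) (auto simp: m_def)
    finally show ?thesis .
  qed
  have mV: "measure lebesgue (V b) = (5 * \<kappa>) ^ CARD('n)" for b
    unfolding V_def using \<kappa> by (subst measure_cbox_cart) (auto simp: algebra_simps)
  have UV: "y \<in> V b" if "b \<in> J" "x \<in> U b" "dist x y \<le> \<kappa>" for x y b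
  proof -
    have "\<bar>x $ i - y $ i\<bar> \<le> \<kappa>" for i using component_le_norm_cart[of "x - y" i] that(3) by (simp add: dist_norm)
    moreover have "real_of_int (b i) * \<kappa> \<le> x $ i" "x $ i \<le> (real_of_int (b i) + 3) * \<kappa>" for i
      using that(2) by (auto simp: U_def mem_box_cart)
    ultimately have "real_of_int (b i) * \<kappa> - \<kappa> \<le> y $ i \<and> y $ i \<le> (real_of_int (b i) + 3) * \<kappa> + \<kappa>" for i by (smt (verit))
    then show ?thesis by (simp add: V_def mem_box_cart algebra_simps)
  qed
  have \<tau>: "K0 * (5 * \<kappa>) ^ CARD('n) > 0" using K0 \<kappa> by simp
  define L' where "L' = K0 * (5 * \<kappa>) ^ CARD('n) / (2 * \<sigma>) + 4 * ln (1 + 2 * real (card J))"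
  have LL: "0 \<le> L'" "L' \<le> L"
  proof -
    show "0 \<le> L'" unfolding L'_def using K0 \<kappa> pos by (intro add_nonneg_nonneg divide_nonneg_nonneg mult_nonneg_nonneg) auto
    have "ln (1 + 2 * real (card J)) \<le> ln (1 + 2 * (1 / \<kappa> + 3) ^ CARD('n))"
      using cardJ by (subst ln_le_cancel_iff) (auto intro: add_pos_nonneg order_trans)
    then show "L' \<le> L" by (simp add: L'_def L_def)
  qed
  obtain G where Gm: "G \<in> borel_measurable M" and G: "(\<integral>\<^sup>+\<omega>. G \<omega> \<partial>M) \<le> ennreal (200 * \<sigma> * (sqrt (L' / real N) + L' / real N))"
    "AE \<omega> in M. \<forall>b\<in>J. \<forall>g\<in>L2. (\<forall>x\<in>unit_cube - U b. g x = 0) \<longrightarrow>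
      ennreal \<bar>bil (\<lambda>x y. sample_kernel N u \<omega> x y - k x y) g g\<bar> \<le> G \<omega> * ennreal (inner_L2 g g)"
  proof -
    have 1: "\<forall>x\<in>unit_cube. (LINT y|cube. \<bar>k x y\<bar>) \<le> \<sigma>" using row by blast
    have 2: "\<forall>b\<in>J. \<forall>x\<in>U b. \<forall>y. dist x y \<le> \<kappa> \<longrightarrow> y \<in> V b" using UV by blast
    have 3: "\<forall>b\<in>J. V b \<in> lmeasurable \<and> K0 * measure lebesgue (V b) \<le> K0 * (5 * \<kappa>) ^ CARD('n)"
      unfolding mV by (simp add: V_def)
    show thesis using sample_form_deviation[OF 1 J \<kappa> 2 3 pos \<tau>] that unfolding L'_def by blast
  qed
  have GL: "(\<integral>\<^sup>+\<omega>. G \<omega> \<partial>M) \<le> ennreal (200 * \<sigma> * (sqrt (L / real N) + L / real N))"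
  proof -
    have "200 * \<sigma> * (sqrt (L' / real N) + L' / real N) \<le> 200 * \<sigma> * (sqrt (L / real N) + L / real N)"
      using LL pos N0 by (intro mult_left_mono add_mono real_sqrt_le_mono divide_right_mono) auto
    then show ?thesis using G(1) by (meson ennreal_leI order_trans)
  qed
  have "(\<integral>\<^sup>+\<omega>. ennreal (op_norm (\<lambda>f x. tapered_cov \<kappa> N u \<omega> f x - integral_op k f x)) \<partial>M) \<le> (\<integral>\<^sup>+\<omega>. ennreal (3 ^ CARD('n)) * G \<omega> + ennreal \<beta> \<partial>M)"
  proof (rule nn_integral_mono_AE)
    show "AE \<omega> in M. ennreal (op_norm (\<lambda>f x. tapered_cov \<kappa> N u \<omega> f x - integral_op k f x)) \<le> ennreal (3 ^ CARD('n)) * G \<omega> + ennreal \<beta>"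
      using G(2) paths_L2
    proof eventually_elim
      case (elim \<omega>)
      show ?case
      proof (cases "G \<omega> = \<infinity>")
        case True
        then show ?thesis by (simp add: ennreal_mult_top)
      next
        case False
        define e where "e = enn2real (G \<omega>)"
        have e: "0 \<le> e" "G \<omega> = ennreal e" using False by (auto simp: e_def less_top)
        let ?D = "\<lambda>x y. sample_kernel N u \<omega> x y - k x y"
        let ?S = "\<lambda>x y. sample_kernel N u \<omega> x y * taper \<kappa> x y"
        let ?B = "\<lambda>x y. k x y * (1 - taper \<kappa> x y)"
        let ?T = "\<lambda>x y. ?S x y - k x y"
        note hs = sample_form(1)[OF elim(2) L2_zero]
        have hsD: "hs_kernel ?D" by (rule hs_kernel_diff[OF hs k_hs])
        have mt: "(\<lambda>z. taper \<kappa> (fst z) (snd z)) \<in> borel_measurable (cube_sq :: ((real ^ 'n) \<times> (real ^ 'n)) measure)"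
          unfolding taper_eq_prod by (rule taper_prod_measurable)
        have hsDt: "hs_kernel (\<lambda>x y. ?D x y * taper \<kappa> x y)"
          by (rule hs_kernel_mult_bounded[OF hsD mt, where c = 1]) (simp add: taper_bounds[OF \<kappa>] abs_of_nonneg)
        have hsS: "hs_kernel ?S"
          by (rule hs_kernel_mult_bounded[OF hs mt, where c = 1]) (simp add: taper_bounds[OF \<kappa>] abs_of_nonneg)
        have hsB: "hs_kernel ?B"
        proof (rule hs_kernel_mult_bounded[OF k_hs, where c = 1])
          show "\<bar>1 - taper \<kappa> x y\<bar> \<le> 1" for x y :: "real ^ 'n"
            using taper_bounds[OF \<kappa>, of x y] by linarith
        qed (use mt in simp)
        have local: "\<bar>bil ?D g g\<bar> \<le> e * inner_L2 g g"
          if g: "g \<in> L2" and supp: "\<And>x. x \<in> unit_cube \<Longrightarrow> g x \<noteq> 0 \<Longrightarrow> \<forall>i. z i \<le> x $ i \<and> x $ i \<le> z i + 2 * \<kappa>" for z g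
        proof (cases "\<exists>x\<in>unit_cube. g x \<noteq> 0")
          case False
          then have "bil ?D g g = (LINT z|(cube_sq :: ((real ^ 'n) \<times> (real ^ 'n)) measure). 0)"
            unfolding bil_def by (intro Bochner_Integration.integral_cong) (auto simp: space_pair_measure)
          then show ?thesis using e inner_L2_self_nonneg[of g] by simp
        next
          case True
          then obtain x where x: "x \<in> unit_cube" "g x \<noteq> 0" by blast
          define b where "b i = \<lfloor>z i / \<kappa>\<rfloor>" for i
          have bz: "real_of_int (b i) * \<kappa> \<le> z i" "z i \<le> (real_of_int (b i) + 1) * \<kappa>" for i
          proof -
            have "real_of_int (b i) \<le> z i / \<kappa>" "z i / \<kappa> \<le> real_of_int (b i) + 1" by (auto simp: b_def)
            then show "real_of_int (b i) * \<kappa> \<le> z i" "z i \<le> (real_of_int (b i) + 1) * \<kappa>"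
              using \<kappa> by (auto simp: pos_le_divide_eq pos_divide_le_eq)
          qed
          have "b i \<in> {- 2..m}" for i
          proof -
            have xi: "0 \<le> x $ i" "x $ i \<le> 1" using x(1) by (auto simp: unit_cube_def)
            have "z i \<le> x $ i" "x $ i \<le> z i + 2 * \<kappa>" using supp[OF x] by auto
            then have "- 2 \<le> z i / \<kappa>" "z i / \<kappa> \<le> 1 / \<kappa>"
              using xi \<kappa> by (auto simp: pos_le_divide_eq intro: divide_right_mono)
            then have "\<lfloor>- 2 :: real\<rfloor> \<le> b i" "b i \<le> m" unfolding b_def m_def by (auto intro: floor_mono simp del: floor_neg_numeral)
            then show ?thesis by simp
          qed
          then have bJ: "b \<in> J" by (auto simp: J_def)
          have "g y = 0" if y: "y \<in> unit_cube - U b" for y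
          proof (rule ccontr)
            assume "g y \<noteq> 0"
            then have "z i \<le> y $ i" "y $ i \<le> z i + 2 * \<kappa>" for i using supp[of y] y by auto
            then have "real_of_int (b i) * \<kappa> \<le> y $ i" "y $ i \<le> (real_of_int (b i) + 3) * \<kappa>" for i
              using bz[of i] by (auto simp: algebra_simps intro: order_trans) (smt (verit))
            then have "y \<in> U b" by (simp add: U_def mem_box_cart)
            then show False using y by simp
          qed
          then have "ennreal \<bar>bil ?D g g\<bar> \<le> G \<omega> * ennreal (inner_L2 g g)" using elim(1) bJ g by blast
          then show ?thesis using e by (simp add: ennreal_mult[symmetric] inner_L2_self_nonneg ennreal_le_iff)
        qed
        have form: "\<bar>bil ?T g g\<bar> \<le> (3 ^ CARD('n) * e + \<beta>) * inner_L2 g g" if g: "g \<in> L2" for g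
        proof -
          have "bil ?T g g = bil (\<lambda>x y. ?D x y * taper \<kappa> x y - ?B x y) g g"
            by (rule bil_cong) (simp add: algebra_simps)
          also have "\<dots> = bil (\<lambda>x y. ?D x y * taper \<kappa> x y) g g - bil ?B g g"
            by (rule bil_diff_kernel[OF hsDt hsB g g])
          finally have eq: "bil ?T g g = bil (\<lambda>x y. ?D x y * taper \<kappa> x y) g g - bil ?B g g" .
          have 1: "\<bar>bil (\<lambda>x y. ?D x y * taper \<kappa> x y) g g\<bar> \<le> 3 ^ CARD('n) * e * inner_L2 g g"
            by (rule taper_form_bound[OF hsD \<kappa> e(1) local g])
          have 2: "\<bar>bil ?B g g\<bar> \<le> \<beta> * inner_L2 g g"
          proof (rule Schur_form_bound[OF hsB _ _ bias g, where c = K0])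
            show "?B x y = ?B y x" if "x \<in> unit_cube" "y \<in> unit_cube" for x y
              using k_sym[OF that] taper_sym[of \<kappa> x y] by simp
            show "\<bar>?B x y\<bar> \<le> K0" if "x \<in> unit_cube" "y \<in> unit_cube" for x y
            proof -
              have "\<bar>k x y\<bar> * \<bar>1 - taper \<kappa> x y\<bar> \<le> K0 * 1"
                using bd[OF that] taper_bounds[OF \<kappa>, of x y] K0 by (intro mult_mono) auto
              then show ?thesis by (simp add: abs_mult)
            qed
          qed
          show ?thesis using eq 1 2 by (simp add: distrib_right)
        qed
        have c0: "0 \<le> 3 ^ CARD('n) * e + \<beta>" using e \<beta> by simp
        have "op_norm (\<lambda>f x. tapered_cov \<kappa> N u \<omega> f x - integral_op k f x) \<le> 3 ^ CARD('n) * e + \<beta>"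
        proof (rule op_norm_le)
          fix f :: "real ^ 'n \<Rightarrow> real" assume f: "f \<in> L2" "norm_L2 f \<le> 1"
          have "norm_L2 (\<lambda>x. tapered_cov \<kappa> N u \<omega> f x - integral_op k f x) = norm_L2 (integral_op ?T f)"
            unfolding tapered_cov_def by (rule norm_L2_integral_op_diff[OF hsS k_hs f(1)])
          also have "\<dots> \<le> (3 ^ CARD('n) * e + \<beta>) * norm_L2 f"
          proof (rule norm_L2_integral_op_le[OF hs_kernel_diff[OF hsS k_hs] _ c0 form f(1)])
            show "?T x y = ?T y x" if "x \<in> unit_cube" "y \<in> unit_cube" for x y
              using k_sym[OF that] sample_kernel_sym[of \<omega> x y] taper_sym[of \<kappa> x y] by simp
          qed
          also have "\<dots> \<le> (3 ^ CARD('n) * e + \<beta>) * 1" using f c0 by (intro mult_left_mono) auto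
          finally show "norm_L2 (\<lambda>x. tapered_cov \<kappa> N u \<omega> f x - integral_op k f x) \<le> 3 ^ CARD('n) * e + \<beta>" by simp
        qed
        then have "ennreal (op_norm (\<lambda>f x. tapered_cov \<kappa> N u \<omega> f x - integral_op k f x)) \<le> ennreal (3 ^ CARD('n) * e + \<beta>)"
          by (rule ennreal_leI)
        also have "\<dots> = ennreal (3 ^ CARD('n)) * G \<omega> + ennreal \<beta>"
          using e \<beta> by (simp add: ennreal_mult)
        finally show ?thesis .
      qed
    qed
  qed
  also have "\<dots> = ennreal (3 ^ CARD('n)) * (\<integral>\<^sup>+\<omega>. G \<omega> \<partial>M) + ennreal \<beta>"
    using Gm by (simp add: nn_integral_add nn_integral_cmult emeasure_space_1)
  also have "\<dots> \<le> ennreal (3 ^ CARD('n)) * ennreal (200 * \<sigma> * (sqrt (L / real N) + L / real N)) + ennreal \<beta>"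
    using GL by (intro add_mono mult_left_mono) auto
  also have "\<dots> = ennreal (3 ^ CARD('n) * (200 * \<sigma> * (sqrt (L / real N) + L / real N)) + \<beta>)"
  proof -
    have "0 \<le> 200 * \<sigma> * (sqrt (L / real N) + L / real N)" using LL pos N0 by simp
    then show ?thesis using \<beta> by (simp add: ennreal_mult)
  qed
  finally show ?thesis .
qed

end

section \<open>Lower bounds for the error of the sample covariance\<close>

text \<open>Adding one summand, every term with a first power of a centered factor vanishes, and the
  mixed term \<open>6 * v * (n * v)\<close> is part of the expansion of
  \<open>3 * ((n + 1) * v)^2\<close>.\<close>

lemma (in prob_space) indep_sum_moments:
  fixes Z :: "'i \<Rightarrow> 'a \<Rightarrow> real"
  assumes "finite J" "indep_vars (\<lambda>_. borel) Z J"
    and "\<And>n. n \<in> J \<Longrightarrow> integrable M (\<lambda>\<omega>. Z n \<omega> ^ 4)" "\<And>n. n \<in> J \<Longrightarrow> expectation (Z n) = 0"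
    and "\<And>n. n \<in> J \<Longrightarrow> expectation (\<lambda>\<omega>. (Z n \<omega>)\<^sup>2) = v" "\<And>n. n \<in> J \<Longrightarrow> expectation (\<lambda>\<omega>. Z n \<omega> ^ 4) \<le> w"
    and "0 \<le> v" "0 \<le> w"
  shows "integrable M (\<lambda>\<omega>. (\<Sum>n\<in>J. Z n \<omega>) ^ 4) \<and> expectation (\<lambda>\<omega>. \<Sum>n\<in>J. Z n \<omega>) = 0 \<and>
    expectation (\<lambda>\<omega>. (\<Sum>n\<in>J. Z n \<omega>)\<^sup>2) = real (card J) * v \<and>
    expectation (\<lambda>\<omega>. (\<Sum>n\<in>J. Z n \<omega>) ^ 4) \<le> real (card J) * w + 3 * (real (card J) * v)\<^sup>2"
  using assms
proof (induction J rule: finite_induct)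
  case (insert i J)
  have lower: "integrable M (\<lambda>\<omega>. X \<omega> ^ k)" if "X \<in> borel_measurable M" "integrable M (\<lambda>\<omega>. X \<omega> ^ 4)" "k \<le> 4" for X :: "'a \<Rightarrow> real" and k
  proof (rule Bochner_Integration.integrable_bound[where f = "\<lambda>\<omega>. 1 + X \<omega> ^ 4"])
    show "AE \<omega> in M. norm (X \<omega> ^ k) \<le> norm (1 + X \<omega> ^ 4)"
    proof (rule AE_I2)
      fix \<omega>
      have "\<bar>X \<omega>\<bar> ^ k \<le> 1 + \<bar>X \<omega>\<bar> ^ 4"
      proof (cases "\<bar>X \<omega>\<bar> \<le> 1")
        case True
        then have "\<bar>X \<omega>\<bar> ^ k \<le> 1" by (intro power_le_one) auto
        then show ?thesis by (simp add: add_increasing2)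
      next
        case False
        then have "\<bar>X \<omega>\<bar> ^ k \<le> \<bar>X \<omega>\<bar> ^ 4" using that(3) by (intro power_increasing) auto
        then show ?thesis by simp
      qed
      then show "norm (X \<omega> ^ k) \<le> norm (1 + X \<omega> ^ 4)" by (simp add: power_abs)
    qed
  qed (use that in auto)
  define S where "S \<omega> = (\<Sum>n\<in>J. Z n \<omega>)" for \<omega>
  have ind: "indep_vars (\<lambda>_. borel) Z J" by (rule indep_vars_subset[OF insert.prems(1)]) auto
  have meas: "Z n \<in> borel_measurable M" if "n \<in> insert i J" for n
    using insert.prems(1) that by (auto simp: indep_vars_def)
  have IH: "integrable M (\<lambda>\<omega>. S \<omega> ^ 4)" "expectation S = 0" "expectation (\<lambda>\<omega>. (S \<omega>)\<^sup>2) = real (card J) * v"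
    "expectation (\<lambda>\<omega>. S \<omega> ^ 4) \<le> real (card J) * w + 3 * (real (card J) * v)\<^sup>2"
    using insert.IH[OF ind] insert.prems unfolding S_def[abs_def] by auto
  have Sm [measurable]: "S \<in> borel_measurable M" unfolding S_def[abs_def] using meas by (intro borel_measurable_sum) auto
  have Zm [measurable]: "Z i \<in> borel_measurable M" using meas by simp
  have iv: "indep_var borel (Z i) borel S"
    unfolding S_def[abs_def] by (rule indep_vars_sum[OF insert.hyps insert.prems(1)])
  have ivp: "indep_var borel (\<lambda>\<omega>. Z i \<omega> ^ a) borel (\<lambda>\<omega>. S \<omega> ^ b)" for a b
    using indep_var_compose[OF iv, of "\<lambda>x. x ^ a" borel "\<lambda>x. x ^ b" borel] by (simp add: comp_def)
  have iZ: "integrable M (\<lambda>\<omega>. Z i \<omega> ^ a)" if "a \<le> 4" for a using lower[OF Zm _ that] insert.prems(2) by simp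
  have iS: "integrable M (\<lambda>\<omega>. S \<omega> ^ a)" if "a \<le> 4" for a using lower[OF Sm IH(1) that] .
  have ip: "integrable M (\<lambda>\<omega>. Z i \<omega> ^ a * S \<omega> ^ b)" "expectation (\<lambda>\<omega>. Z i \<omega> ^ a * S \<omega> ^ b) = expectation (\<lambda>\<omega>. Z i \<omega> ^ a) * expectation (\<lambda>\<omega>. S \<omega> ^ b)"
    if "a \<le> 4" "b \<le> 4" for a b
    using indep_var_integrable[OF ivp iZ[OF that(1)] iS[OF that(2)]] indep_var_lebesgue_integral[OF ivp iZ[OF that(1)] iS[OF that(2)]] by auto
  have Z0: "expectation (Z i) = 0" "expectation (\<lambda>\<omega>. (Z i \<omega>)\<^sup>2) = v" "expectation (\<lambda>\<omega>. Z i \<omega> ^ 4) \<le> w"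
    using insert.prems by auto
  have sum: "(\<Sum>n\<in>insert i J. Z n \<omega>) = Z i \<omega> + S \<omega>" for \<omega> using insert.hyps by (simp add: S_def)
  have e2: "(Z i \<omega> + S \<omega>)\<^sup>2 = Z i \<omega> ^ 2 + 2 * (Z i \<omega> ^ 1 * S \<omega> ^ 1) + S \<omega> ^ 2" for \<omega>
    by (simp add: power2_eq_square algebra_simps)
  have e4: "(Z i \<omega> + S \<omega>) ^ 4 = Z i \<omega> ^ 4 + 4 * (Z i \<omega> ^ 3 * S \<omega> ^ 1) + 6 * (Z i \<omega> ^ 2 * S \<omega> ^ 2) + 4 * (Z i \<omega> ^ 1 * S \<omega> ^ 3) + S \<omega> ^ 4" for \<omega>
    by algebra
  have 1: "expectation (\<lambda>\<omega>. \<Sum>n\<in>insert i J. Z n \<omega>) = 0"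
    unfolding sum using iZ[of 1] iS[of 1] Z0 IH by simp
  have 2: "expectation (\<lambda>\<omega>. (\<Sum>n\<in>insert i J. Z n \<omega>)\<^sup>2) = real (card (insert i J)) * v"
  proof -
    have "expectation (\<lambda>\<omega>. (\<Sum>n\<in>insert i J. Z n \<omega>)\<^sup>2) = expectation (\<lambda>\<omega>. Z i \<omega> ^ 2) + 2 * expectation (\<lambda>\<omega>. Z i \<omega> ^ 1 * S \<omega> ^ 1) + expectation (\<lambda>\<omega>. S \<omega> ^ 2)"
      unfolding sum e2 using ip(1)[of 1 1] iZ[of 2] iS[of 2] by simp
    also have "expectation (\<lambda>\<omega>. Z i \<omega> ^ 1 * S \<omega> ^ 1) = 0" by (subst ip(2)) (auto simp: Z0)
    finally show ?thesis using insert.hyps IH Z0 by (simp add: algebra_simps)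
  qed
  have 3: "integrable M (\<lambda>\<omega>. (\<Sum>n\<in>insert i J. Z n \<omega>) ^ 4)"
    unfolding sum e4 using ip(1)[of 3 1] ip(1)[of 2 2] ip(1)[of 1 3] iZ[of 4] iS[of 4] by simp
  have 4: "expectation (\<lambda>\<omega>. (\<Sum>n\<in>insert i J. Z n \<omega>) ^ 4) \<le> real (card (insert i J)) * w + 3 * (real (card (insert i J)) * v)\<^sup>2"
  proof -
    have "expectation (\<lambda>\<omega>. (\<Sum>n\<in>insert i J. Z n \<omega>) ^ 4) = expectation (\<lambda>\<omega>. Z i \<omega> ^ 4) + 4 * expectation (\<lambda>\<omega>. Z i \<omega> ^ 3 * S \<omega> ^ 1)
      + 6 * expectation (\<lambda>\<omega>. Z i \<omega> ^ 2 * S \<omega> ^ 2) + 4 * expectation (\<lambda>\<omega>. Z i \<omega> ^ 1 * S \<omega> ^ 3) + expectation (\<lambda>\<omega>. S \<omega> ^ 4)"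
      unfolding sum e4 using ip(1)[of 3 1] ip(1)[of 2 2] ip(1)[of 1 3] iZ[of 4] iS[of 4] by simp
    also have "expectation (\<lambda>\<omega>. Z i \<omega> ^ 3 * S \<omega> ^ 1) = 0" by (subst ip(2)) (auto simp: IH)
    also have "expectation (\<lambda>\<omega>. Z i \<omega> ^ 1 * S \<omega> ^ 3) = 0" by (subst ip(2)) (auto simp: Z0)
    also have "expectation (\<lambda>\<omega>. Z i \<omega> ^ 2 * S \<omega> ^ 2) = v * (real (card J) * v)" by (subst ip(2)) (auto simp: Z0 IH)
    finally have "expectation (\<lambda>\<omega>. (\<Sum>n\<in>insert i J. Z n \<omega>) ^ 4) \<le> w + 6 * (v * (real (card J) * v)) + (real (card J) * w + 3 * (real (card J) * v)\<^sup>2)"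
      using Z0 IH by simp
    also have "\<dots> \<le> (real (card J) + 1) * w + 3 * ((real (card J) + 1) * v)\<^sup>2"
    proof -
      have "3 * ((real (card J) + 1) * v)\<^sup>2 = 3 * (real (card J) * v)\<^sup>2 + 6 * (v * (real (card J) * v)) + 3 * v\<^sup>2"
        by (simp add: power2_eq_square algebra_simps)
      then show ?thesis by (simp add: distrib_right)
    qed
    finally show ?thesis using insert.hyps by (simp add: add.commute)
  qed
  show ?case using 1 2 3 4 by blast
qed auto

text \<open>Sum and difference are Gaussian, and polarizing fourth powers expresses the second
  moment of \<open>X * Y\<close> through theirs; this yields Isserlis' formula without a joint
  density. The fourth moment goes through Cauchy-Schwarz and the eighth moments, with
  \<open>105 = 8! / (2^4 * 4!)\<close>, and \<open>848 = 8 * (105 + 1)\<close>.\<close>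

lemma (in prob_space) gaussian_pair_moments:
  assumes g: "centered_gaussian M X" "centered_gaussian M Y" "centered_gaussian M (\<lambda>\<omega>. X \<omega> + Y \<omega>)" "centered_gaussian M (\<lambda>\<omega>. X \<omega> - Y \<omega>)"
  defines "b \<equiv> expectation (\<lambda>\<omega>. (X \<omega>)\<^sup>2)" and "a \<equiv> expectation (\<lambda>\<omega>. (Y \<omega>)\<^sup>2)" and "r \<equiv> expectation (\<lambda>\<omega>. X \<omega> * Y \<omega>)"
  shows "integrable M (\<lambda>\<omega>. X \<omega> * Y \<omega>)" "r\<^sup>2 \<le> a * b"
    and "integrable M (\<lambda>\<omega>. (X \<omega> * Y \<omega> - r) ^ 4)" "expectation (\<lambda>\<omega>. (X \<omega> * Y \<omega> - r)\<^sup>2) = a * b + r\<^sup>2"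
    and "expectation (\<lambda>\<omega>. (X \<omega> * Y \<omega> - r) ^ 4) \<le> 848 * (a * b)\<^sup>2"
proof -
  have [measurable]: "X \<in> borel_measurable M" "Y \<in> borel_measurable M" using g by (auto simp: centered_gaussian_def)
  note m2 = centered_gaussian_even_moment[of _ 1] and m4 = centered_gaussian_even_moment[of _ 2] and m8 = centered_gaussian_even_moment[of _ 4]
  have X: "integrable M (\<lambda>\<omega>. (X \<omega>)\<^sup>2)" "integrable M (\<lambda>\<omega>. X \<omega> ^ 4)" "integrable M (\<lambda>\<omega>. X \<omega> ^ 8)"
    "expectation (\<lambda>\<omega>. X \<omega> ^ 4) = 3 * b\<^sup>2" "expectation (\<lambda>\<omega>. X \<omega> ^ 8) = 105 * b ^ 4"
    using m2[OF g(1)] m4[OF g(1)] m8[OF g(1)] by (auto simp: b_def fact_numeral)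
  have Y: "integrable M (\<lambda>\<omega>. (Y \<omega>)\<^sup>2)" "integrable M (\<lambda>\<omega>. Y \<omega> ^ 4)" "integrable M (\<lambda>\<omega>. Y \<omega> ^ 8)"
    "expectation (\<lambda>\<omega>. Y \<omega> ^ 4) = 3 * a\<^sup>2" "expectation (\<lambda>\<omega>. Y \<omega> ^ 8) = 105 * a ^ 4"
    using m2[OF g(2)] m4[OF g(2)] m8[OF g(2)] by (auto simp: a_def fact_numeral)
  have ab: "0 \<le> a" "0 \<le> b" by (auto simp: a_def b_def)
  show XY: "integrable M (\<lambda>\<omega>. X \<omega> * Y \<omega>)" by (rule integrable_mult_L2) (use X Y in auto)
  show r2: "r\<^sup>2 \<le> a * b"
    using Cauchy_Schwarz_integral(2)[of X M Y] X Y by (simp add: r_def a_def b_def mult.commute)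
  have P: "expectation (\<lambda>\<omega>. (X \<omega> + Y \<omega>)\<^sup>2) = b + 2 * r + a" "expectation (\<lambda>\<omega>. (X \<omega> - Y \<omega>)\<^sup>2) = b - 2 * r + a"
  proof -
    have 1: "(X \<omega> + Y \<omega>)\<^sup>2 = (X \<omega>)\<^sup>2 + 2 * (X \<omega> * Y \<omega>) + (Y \<omega>)\<^sup>2"
      and 2: "(X \<omega> - Y \<omega>)\<^sup>2 = (X \<omega>)\<^sup>2 - 2 * (X \<omega> * Y \<omega>) + (Y \<omega>)\<^sup>2" for \<omega>
      by (simp_all add: power2_eq_square algebra_simps)
    show "expectation (\<lambda>\<omega>. (X \<omega> + Y \<omega>)\<^sup>2) = b + 2 * r + a" "expectation (\<lambda>\<omega>. (X \<omega> - Y \<omega>)\<^sup>2) = b - 2 * r + a"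
      unfolding 1 2 using X Y XY by (simp_all add: a_def b_def r_def)
  qed
  have P4: "integrable M (\<lambda>\<omega>. (X \<omega> + Y \<omega>) ^ 4)" "expectation (\<lambda>\<omega>. (X \<omega> + Y \<omega>) ^ 4) = 3 * (b + 2 * r + a)\<^sup>2"
    "integrable M (\<lambda>\<omega>. (X \<omega> - Y \<omega>) ^ 4)" "expectation (\<lambda>\<omega>. (X \<omega> - Y \<omega>) ^ 4) = 3 * (b - 2 * r + a)\<^sup>2"
    using m4[OF g(3)] m4[OF g(4)] P by (auto simp: fact_numeral)
  have e22: "(X \<omega> * Y \<omega>)\<^sup>2 = ((X \<omega> + Y \<omega>) ^ 4 + (X \<omega> - Y \<omega>) ^ 4 - 2 * X \<omega> ^ 4 - 2 * Y \<omega> ^ 4) / 12" for \<omega>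
    by (simp add: field_simps) algebra
  have i22: "integrable M (\<lambda>\<omega>. (X \<omega> * Y \<omega>)\<^sup>2)" unfolding e22 using P4 X Y by simp
  have E22: "expectation (\<lambda>\<omega>. (X \<omega> * Y \<omega>)\<^sup>2) = a * b + 2 * r\<^sup>2"
  proof -
    have "expectation (\<lambda>\<omega>. (X \<omega> * Y \<omega>)\<^sup>2) = (3 * (b + 2 * r + a)\<^sup>2 + 3 * (b - 2 * r + a)\<^sup>2 - 2 * (3 * b\<^sup>2) - 2 * (3 * a\<^sup>2)) / 12"
      unfolding e22 using P4 X Y by simp
    also have "\<dots> = a * b + 2 * r\<^sup>2" by (simp add: field_simps) algebra
    finally show ?thesis .
  qed
  have p8: "(X \<omega> ^ 4)\<^sup>2 = X \<omega> ^ 8" "(Y \<omega> ^ 4)\<^sup>2 = Y \<omega> ^ 8" for \<omega> by (simp_all flip: power_mult)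
  have i44: "integrable M (\<lambda>\<omega>. X \<omega> ^ 4 * Y \<omega> ^ 4)"
    by (rule integrable_mult_L2) (use X Y in \<open>auto simp: p8\<close>)
  have E44: "expectation (\<lambda>\<omega>. X \<omega> ^ 4 * Y \<omega> ^ 4) \<le> 105 * (a * b)\<^sup>2"
  proof (rule power2_le_imp_le)
    have "(expectation (\<lambda>\<omega>. X \<omega> ^ 4 * Y \<omega> ^ 4))\<^sup>2 \<le> (105 * b ^ 4) * (105 * a ^ 4)"
      using Cauchy_Schwarz_integral(2)[of "\<lambda>\<omega>. X \<omega> ^ 4" M "\<lambda>\<omega>. Y \<omega> ^ 4"] X Y by (simp add: p8)
    also have "\<dots> = (105 * (a * b)\<^sup>2)\<^sup>2" by (simp add: power_mult_distrib)
    finally show "(expectation (\<lambda>\<omega>. X \<omega> ^ 4 * Y \<omega> ^ 4))\<^sup>2 \<le> (105 * (a * b)\<^sup>2)\<^sup>2" .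
  qed simp
  have q: "(x - r) ^ 4 \<le> 8 * (x ^ 4 + r ^ 4)" for x :: real
  proof -
    have "(x - r)\<^sup>2 \<le> 2 * (x\<^sup>2 + r\<^sup>2)"
      using zero_le_power2[of "x + r"] by (simp add: power2_eq_square algebra_simps)
    then have "((x - r)\<^sup>2)\<^sup>2 \<le> (2 * (x\<^sup>2 + r\<^sup>2))\<^sup>2" by (intro power_mono) auto
    also have "\<dots> \<le> 8 * (x ^ 4 + r ^ 4)"
    proof -
      have "8 * (x ^ 4 + r ^ 4) - (2 * (x\<^sup>2 + r\<^sup>2))\<^sup>2 = 4 * (x\<^sup>2 - r\<^sup>2)\<^sup>2" by algebra
      then show ?thesis using zero_le_power2[of "x\<^sup>2 - r\<^sup>2"] by linarith
    qed
    finally show ?thesis by simp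
  qed
  show i4: "integrable M (\<lambda>\<omega>. (X \<omega> * Y \<omega> - r) ^ 4)"
  proof (rule Bochner_Integration.integrable_bound[where f = "\<lambda>\<omega>. 8 * (X \<omega> ^ 4 * Y \<omega> ^ 4 + r ^ 4)"])
    show "AE \<omega> in M. norm ((X \<omega> * Y \<omega> - r) ^ 4) \<le> norm (8 * (X \<omega> ^ 4 * Y \<omega> ^ 4 + r ^ 4))"
      using q[of "X \<omega> * Y \<omega>" for \<omega>] by (intro AE_I2) (simp add: power_mult_distrib)
  qed (use i44 in auto)
  have e2: "(X \<omega> * Y \<omega> - r)\<^sup>2 = (X \<omega> * Y \<omega>)\<^sup>2 - 2 * r * (X \<omega> * Y \<omega>) + r\<^sup>2" for \<omega>
    by (simp add: power2_eq_square algebra_simps)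
  have "expectation (\<lambda>\<omega>. (X \<omega> * Y \<omega> - r)\<^sup>2) = (a * b + 2 * r\<^sup>2) - 2 * r * r + r\<^sup>2"
    unfolding e2 using i22 XY E22 by (simp add: prob_space r_def[symmetric])
  then show "expectation (\<lambda>\<omega>. (X \<omega> * Y \<omega> - r)\<^sup>2) = a * b + r\<^sup>2" by (simp add: power2_eq_square)
  have "expectation (\<lambda>\<omega>. (X \<omega> * Y \<omega> - r) ^ 4) \<le> expectation (\<lambda>\<omega>. 8 * (X \<omega> ^ 4 * Y \<omega> ^ 4 + r ^ 4))"
    using i4 i44 q[of "X \<omega> * Y \<omega>" for \<omega>] by (intro integral_mono) (auto simp: power_mult_distrib)
  also have "\<dots> = 8 * (expectation (\<lambda>\<omega>. X \<omega> ^ 4 * Y \<omega> ^ 4) + (r\<^sup>2)\<^sup>2)"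
    using i44 by (simp add: prob_space)
  also have "\<dots> \<le> 8 * (105 * (a * b)\<^sup>2 + (a * b)\<^sup>2)"
    using E44 r2 by (intro mult_left_mono add_mono power_mono) auto
  finally show "expectation (\<lambda>\<omega>. (X \<omega> * Y \<omega> - r) ^ 4) \<le> 848 * (a * b)\<^sup>2" by simp
qed

text \<open>Negative values of \<open>f\<close> are cut off by \<open>ennreal\<close>, which only
  increases the integral.\<close>

lemma ennreal_integral_le_nn_integral':
  assumes "integrable M (f :: 'a \<Rightarrow> real)"
  shows "ennreal (LINT x|M. f x) \<le> (\<integral>\<^sup>+x. ennreal (f x) \<partial>M)"
proof -
  have "(LINT x|M. f x) \<le> (LINT x|M. max 0 (f x))" using assms by (intro integral_mono) auto
  then have "ennreal (LINT x|M. f x) \<le> ennreal (LINT x|M. max 0 (f x))" by (rule ennreal_leI)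
  also have "\<dots> = (\<integral>\<^sup>+x. ennreal (max 0 (f x)) \<partial>M)" using assms by (intro nn_integral_eq_integral[symmetric]) auto
  also have "(\<lambda>x. ennreal (max 0 (f x))) = (\<lambda>x. ennreal (f x))" by (auto simp: max_def ennreal_neg)
  finally show ?thesis .
qed

text \<open>A polynomial minorant of the absolute value: once integrated, it turns a lower bound on
  the second moment and an upper bound on the fourth into a lower bound on the first.\<close>

lemma abs_ge_quartic:
  fixes z D :: real
  assumes "D > 0"
  shows "z\<^sup>2 / D - z ^ 4 / D ^ 3 \<le> \<bar>z\<bar>"
proof -
  define t where "t = \<bar>z\<bar> / D"
  have t: "0 \<le> t" "\<bar>z\<bar> = D * t" using assms by (auto simp: t_def)
  have "t * (1 - t\<^sup>2) \<le> 1"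
  proof (cases "t \<le> 1")
    case True
    then have "t * (1 - t\<^sup>2) \<le> 1 * 1" using t(1) by (intro mult_mono) (auto simp: power_le_one)
    then show ?thesis by simp
  next
    case False
    then have "1 \<le> t\<^sup>2" by (simp add: one_le_power)
    then have "t * (1 - t\<^sup>2) \<le> 0" using t(1) by (intro mult_nonneg_nonpos) auto
    then show ?thesis by simp
  qed
  then have "(D * t) * (t * (1 - t\<^sup>2)) \<le> (D * t) * 1" using t assms by (intro mult_left_mono) auto
  moreover have "z\<^sup>2 = (D * t)\<^sup>2" "z ^ 4 = (D * t) ^ 4" using t(2) by (metis power2_abs, metis power_even_abs_numeral even_numeral)
  ultimately show ?thesis using assms t by (simp add: field_simps power2_eq_square power3_eq_cube power4_eq_xxxx)
qed

context gaussian_kernel_sample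
begin

lemma op_norm_sample_diff:
  assumes "\<forall>n\<in>{1..N}. (\<lambda>x. u n x \<omega>) \<in> L2"
  shows "op_norm (\<lambda>f x. sample_cov N u \<omega> f x - integral_op k f x) = op_norm (integral_op (\<lambda>x y. sample_kernel N u \<omega> x y - k x y))"
  unfolding sample_cov_def
  by (intro op_norm_cong norm_L2_integral_op_diff sample_form(1)[OF assms L2_zero] k_hs)

text \<open>The test function is random, namely the first path normalized. It makes the first
  summand of the sample form equal to the squared norm of that path over \<open>N\<close>, while the
  true form is at most \<sigma> by the Schur test. The squared norm has mean \<open>K0\<close>, the
  cube having volume one.\<close>

lemma sample_cov_error_lower_large:
  assumes diag: "\<And>x. x \<in> unit_cube \<Longrightarrow> k x x = K0"
    and row: "\<And>x. x \<in> unit_cube \<Longrightarrow> (LINT y|cube. \<bar>k x y\<bar>) \<le> \<sigma>"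
    and bd: "\<And>x y. x \<in> unit_cube \<Longrightarrow> y \<in> unit_cube \<Longrightarrow> \<bar>k x y\<bar> \<le> K0"
  shows "ennreal (K0 / real N - \<sigma>) \<le> (\<integral>\<^sup>+\<omega>. ennreal (op_norm (\<lambda>f x. sample_cov N u \<omega> f x - integral_op k f x)) \<partial>M)"
proof -
  have N1: "1 \<in> {1..N}" and N0: "real N > 0" using N by auto
  define q where "q \<omega> = (LINT x|cube. (u 1 x \<omega>)\<^sup>2)" for \<omega>
  interpret Mc: pair_sigma_finite M cube ..
  have mu: "(\<lambda>z. (u 1 (fst z) (snd z))\<^sup>2) \<in> borel_measurable (cube \<Otimes>\<^sub>M M)"
    using joint_measurable[OF N1] by (simp add: split_beta')
  have qm [measurable]: "q \<in> borel_measurable M"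
    unfolding q_def[abs_def]
  proof (rule cube.borel_measurable_lebesgue_integral)
    show "(\<lambda>(\<omega>, x). (u 1 x \<omega>)\<^sup>2) \<in> borel_measurable (M \<Otimes>\<^sub>M cube)"
      using mu measurable_pair_swap_iff[of "\<lambda>z. (u 1 (fst z) (snd z))\<^sup>2" cube M borel] by (simp add: split_beta')
  qed
  have qi: "(\<integral>\<^sup>+\<omega>. ennreal (q \<omega>) \<partial>M) = ennreal K0"
  proof -
    have "(\<integral>\<^sup>+\<omega>. ennreal (q \<omega>) \<partial>M) = (\<integral>\<^sup>+\<omega>. \<integral>\<^sup>+x. ennreal ((u 1 x \<omega>)\<^sup>2) \<partial>cube \<partial>M)"
      unfolding q_def using paths_L2
    proof (intro nn_integral_cong_AE, eventually_elim)
      case (elim \<omega>)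
      then show ?case using N1 by (intro nn_integral_eq_integral[symmetric]) (auto intro: L2_integrable_square)
    qed
    also have "\<dots> = (\<integral>\<^sup>+x. \<integral>\<^sup>+\<omega>. ennreal ((u 1 x \<omega>)\<^sup>2) \<partial>M \<partial>cube)"
      using mu by (intro cM.Fubini') (simp add: split_beta')
    also have "\<dots> = (\<integral>\<^sup>+x. ennreal K0 \<partial>(cube :: (real ^ 'n) measure))"
    proof (intro nn_integral_cong)
      fix x :: "real ^ 'n" assume "x \<in> space cube"
      then have x: "x \<in> unit_cube" by simp
      show "(\<integral>\<^sup>+\<omega>. ennreal ((u 1 x \<omega>)\<^sup>2) \<partial>M) = ennreal K0"
        using covariance[OF N1 x x] diag[OF x] point_square_integrable[OF N1 x]
        by (subst nn_integral_eq_integral) (auto simp: power2_eq_square)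
    qed
    also have "\<dots> = ennreal K0" by (simp add: cube.emeasure_space_1[simplified])
    finally show ?thesis .
  qed
  have hq: "has_bochner_integral M q K0"
    by (rule has_bochner_integral_nn_integral) (use qi K0 in \<open>auto simp: q_def\<close>)
  then have "has_bochner_integral M (\<lambda>\<omega>. q \<omega> / real N - \<sigma>) (K0 / real N - \<sigma>)"
    by (auto simp: has_bochner_integral_iff prob_space)
  then have "ennreal (K0 / real N - \<sigma>) \<le> (\<integral>\<^sup>+\<omega>. ennreal (q \<omega> / real N - \<sigma>) \<partial>M)"
    using ennreal_integral_le_nn_integral'[of M "\<lambda>\<omega>. q \<omega> / real N - \<sigma>"] by (simp add: has_bochner_integral_iff)
  also have "\<dots> \<le> (\<integral>\<^sup>+\<omega>. ennreal (op_norm (\<lambda>f x. sample_cov N u \<omega> f x - integral_op k f x)) \<partial>M)"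
    using paths_L2
  proof (intro nn_integral_mono_AE, eventually_elim)
    case (elim \<omega>)
    let ?T = "\<lambda>x y. sample_kernel N u \<omega> x y - k x y"
    note hs = sample_form(1)[OF elim(2) L2_zero]
    have U: "(\<lambda>x. u 1 x \<omega>) \<in> L2" using elim(2) N1 by blast
    have qU: "inner_L2 (\<lambda>x. u 1 x \<omega>) (\<lambda>x. u 1 x \<omega>) = q \<omega>" by (simp add: inner_L2_self q_def)
    \<comment> \<open>For a path of norm zero the division gives \<open>g = 0\<close>, and the
      identities below hold in that case too.\<close>
    define g where "g x = 1 / sqrt (q \<omega>) * u 1 x \<omega>" for x
    have g: "g \<in> L2" unfolding g_def[abs_def] by (rule L2_cmult[OF U])
    have q0: "0 \<le> q \<omega>" by (simp add: q_def)
    have gg: "inner_L2 g g = (if q \<omega> = 0 then 0 else 1)"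
    proof -
      have "inner_L2 g g = (1 / sqrt (q \<omega>))\<^sup>2 * q \<omega>" unfolding inner_L2_self g_def power_mult_distrib by (simp add: q_def)
      then show ?thesis using q0 by (simp add: power_divide)
    qed
    then have gn: "norm_L2 g \<le> 1" by (simp add: norm_L2_def)
    have Ug: "(inner_L2 (\<lambda>x. u 1 x \<omega>) g)\<^sup>2 = q \<omega>"
    proof -
      have "inner_L2 (\<lambda>x. u 1 x \<omega>) g = 1 / sqrt (q \<omega>) * q \<omega>"
        using inner_L2_cmult_left[of "1 / sqrt (q \<omega>)" "\<lambda>x. u 1 x \<omega>" "\<lambda>x. u 1 x \<omega>"]
          inner_L2_commute[of "\<lambda>x. u 1 x \<omega>" g] unfolding qU g_def[abs_def] by (rule trans[rotated])
      then show ?thesis using q0 by (simp add: real_div_sqrt)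
    qed
    have "q \<omega> / real N \<le> (\<Sum>n=1..N. (inner_L2 (\<lambda>x. u n x \<omega>) g)\<^sup>2) / real N"
      using member_le_sum[of 1 "{1..N}" "\<lambda>n. (inner_L2 (\<lambda>x. u n x \<omega>) g)\<^sup>2"] N1 N0 Ug
      by (intro divide_right_mono) auto
    also have "\<dots> = bil (sample_kernel N u \<omega>) g g" by (rule sample_form(2)[OF elim(2) g, symmetric])
    also have "\<dots> = bil ?T g g + bil k g g" by (simp add: bil_diff_kernel[OF hs k_hs g g])
    also have "bil ?T g g \<le> op_norm (integral_op ?T)"
      using form_le_op_norm[OF hs_kernel_diff[OF hs k_hs] g gn] by simp
    also have "bil k g g \<le> \<sigma>"
    proof -
      have "\<bar>bil k g g\<bar> \<le> \<sigma> * inner_L2 g g" by (rule Schur_form_bound[OF k_hs k_sym bd row g])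
      moreover have "0 \<le> \<sigma>"
      proof -
        have "0 \<le> (LINT y|cube. \<bar>k 0 y\<bar>)" by simp
        also have "\<dots> \<le> \<sigma>" by (rule row) (simp add: unit_cube_def)
        finally show ?thesis .
      qed
      ultimately show ?thesis using gg by (auto split: if_splits)
    qed
    finally have "q \<omega> / real N - \<sigma> \<le> op_norm (integral_op ?T)" by simp
    then show ?case unfolding op_norm_sample_diff[OF elim(2)] by (rule ennreal_leI)
  qed
  finally show ?thesis .
qed

end

context gaussian_kernel_sample
begin

lemma indep_paths:
  assumes "G \<in> borel_measurable (Pi\<^sub>M unit_cube (\<lambda>_. borel))"
  shows "indep_vars (\<lambda>_. borel) (\<lambda>n \<omega>. G (\<lambda>x\<in>unit_cube. u n x \<omega>) :: real) {1..N}"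
proof -
  have "indep_vars (\<lambda>_. Pi\<^sub>M unit_cube (\<lambda>_. borel)) (\<lambda>n \<omega>. \<lambda>x\<in>unit_cube. u n x \<omega>) {1..N}"
    using sample by (simp add: gaussian_sample_def)
  then show ?thesis by (rule indep_vars_compose2) (use assms in auto)
qed

text \<open>The variable \<open>z\<close> is the value at the grid point \<open>p\<close> of the
  sample error applied to a function with cell coefficients \<open>v\<close>: an average of
  independent centered products. Both moments have the order given by the same number
  \<open>a * K0 / N\<close>, which is what the polynomial minorant of the absolute value
  requires.\<close>

lemma product_average_moments:
  fixes v :: "real ^ 'n \<Rightarrow> real" and p :: "real ^ 'n" and I :: "(real ^ 'n) set"
  assumes I: "finite I" "I \<subseteq> unit_cube" and p: "p \<in> I" and pp: "k p p = K0"
  defines "a \<equiv> (\<Sum>q\<in>I. \<Sum>q'\<in>I. v q * v q' * k q q')" and "r \<equiv> (\<Sum>q\<in>I. v q * k p q)"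
  defines "z \<equiv> \<lambda>\<omega>. (\<Sum>n=1..N. u n p \<omega> * (\<Sum>q\<in>I. v q * u n q \<omega>) - r) / real N"
  shows "integrable M (\<lambda>\<omega>. z \<omega> ^ 4)" "integrable M (\<lambda>\<omega>. (z \<omega>)\<^sup>2)"
    and "a * K0 / real N \<le> expectation (\<lambda>\<omega>. (z \<omega>)\<^sup>2)"
    and "expectation (\<lambda>\<omega>. z \<omega> ^ 4) \<le> 860 * (a * K0 / real N)\<^sup>2"
proof -
  have N0: "real N > 0" and N1: "1 \<le> real N" using N by auto
  have pD: "p \<in> unit_cube" using p I by auto
  define \<xi> where "\<xi> n \<omega> = (\<Sum>q\<in>I. v q * u n q \<omega>)" for n \<omega>
  define Z where "Z n \<omega> = u n p \<omega> * \<xi> n \<omega> - r" for n \<omega>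
  have delta: "(\<Sum>q\<in>I. (if q = p then 1 else 0) * u n q \<omega>) = u n p \<omega>" for n \<omega>
  proof -
    have "(\<Sum>q\<in>I. (if q = p then 1 else 0) * u n q \<omega>) = (\<Sum>q\<in>I. if q = p then u n q \<omega> else 0)"
      by (intro sum.cong) auto
    then show ?thesis using I p by simp
  qed
  have gm: "integrable M (\<lambda>\<omega>. Z n \<omega> ^ 4)" "expectation (Z n) = 0" "expectation (\<lambda>\<omega>. (Z n \<omega>)\<^sup>2) = a * K0 + r\<^sup>2"
    "expectation (\<lambda>\<omega>. Z n \<omega> ^ 4) \<le> 848 * (a * K0)\<^sup>2" "r\<^sup>2 \<le> a * K0" if n: "n \<in> {1..N}" for n
  proof -
    have gX: "centered_gaussian M (u n p)" by (rule gaussian_point[OF n pD])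
    have gY: "centered_gaussian M (\<xi> n)" unfolding \<xi>_def[abs_def] by (rule gaussian_sum[OF n I])
    have gP: "centered_gaussian M (\<lambda>\<omega>. u n p \<omega> + \<xi> n \<omega>)"
      using gaussian_sum[OF n I, of "\<lambda>q. (if q = p then 1 else 0) + v q"]
      by (simp add: distrib_right sum.distrib delta \<xi>_def)
    have gM: "centered_gaussian M (\<lambda>\<omega>. u n p \<omega> - \<xi> n \<omega>)"
      using gaussian_sum[OF n I, of "\<lambda>q. (if q = p then 1 else 0) - v q"]
      by (simp add: left_diff_distrib sum_subtractf delta \<xi>_def)
    have eX: "expectation (\<lambda>\<omega>. (u n p \<omega>)\<^sup>2) = K0" using covariance[OF n pD pD] pp by (simp add: power2_eq_square)
    have eY: "expectation (\<lambda>\<omega>. (\<xi> n \<omega>)\<^sup>2) = a" unfolding \<xi>_def a_def by (rule variance_sum[OF n I])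
    have eXY: "expectation (\<lambda>\<omega>. u n p \<omega> * \<xi> n \<omega>) = r"
    proof -
      have "expectation (\<lambda>\<omega>. u n p \<omega> * \<xi> n \<omega>) = expectation (\<lambda>\<omega>. \<Sum>q\<in>I. v q * (u n p \<omega> * u n q \<omega>))"
        by (simp add: \<xi>_def sum_distrib_left mult_ac)
      also have "\<dots> = (\<Sum>q\<in>I. v q * expectation (\<lambda>\<omega>. u n p \<omega> * u n q \<omega>))"
        using point_mult_integrable[OF n pD] I by (simp add: subset_iff)
      also have "\<dots> = r" unfolding r_def using covariance[OF n pD] I by (intro sum.cong) (auto simp: subset_iff)
      finally show ?thesis .
    qed
    note m = gaussian_pair_moments[OF gX gY gP gM, unfolded eX eY eXY]
    show "integrable M (\<lambda>\<omega>. Z n \<omega> ^ 4)" "expectation (\<lambda>\<omega>. (Z n \<omega>)\<^sup>2) = a * K0 + r\<^sup>2"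
      "expectation (\<lambda>\<omega>. Z n \<omega> ^ 4) \<le> 848 * (a * K0)\<^sup>2" "r\<^sup>2 \<le> a * K0"
      unfolding Z_def using m(2-5) by auto
    show "expectation (Z n) = 0" unfolding Z_def using m(1) eXY by (simp add: prob_space)
  qed
  have ind: "indep_vars (\<lambda>_. borel) Z {1..N}"
  proof -
    have m: "(\<lambda>f. f x) \<in> borel_measurable (Pi\<^sub>M unit_cube (\<lambda>_. borel :: real measure))" if "x \<in> I" for x
      using that I by (intro measurable_component_singleton) auto
    have "indep_vars (\<lambda>_. borel) (\<lambda>n \<omega>. (\<lambda>f. f p * (\<Sum>q\<in>I. v q * f q) - r) (\<lambda>x\<in>unit_cube. u n x \<omega>)) {1..N}"
      by (intro indep_paths borel_measurable_diff borel_measurable_times borel_measurable_sum borel_measurable_const m p)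
    moreover have "(\<lambda>n \<omega>. (\<lambda>f. f p * (\<Sum>q\<in>I. v q * f q) - r) (\<lambda>x\<in>unit_cube. u n x \<omega>)) = Z"
    proof (intro ext)
      fix n \<omega>
      have "(\<Sum>q\<in>I. v q * (\<lambda>x\<in>unit_cube. u n x \<omega>) q) = (\<Sum>q\<in>I. v q * u n q \<omega>)"
        using I by (intro sum.cong refl) (auto simp: subset_iff)
      then show "(\<lambda>f. f p * (\<Sum>q\<in>I. v q * f q) - r) (\<lambda>x\<in>unit_cube. u n x \<omega>) = Z n \<omega>"
        using pD by (simp add: Z_def \<xi>_def)
    qed
    ultimately show ?thesis by simp
  qed
  define h where "h = a * K0"
  have h: "0 \<le> h" "r\<^sup>2 \<le> h" using gm(5)[of 1] N by (auto simp: h_def intro: order_trans[OF zero_le_power2])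
  have S: "integrable M (\<lambda>\<omega>. (\<Sum>n=1..N. Z n \<omega>) ^ 4)"
    "expectation (\<lambda>\<omega>. (\<Sum>n=1..N. Z n \<omega>)\<^sup>2) = real N * (h + r\<^sup>2)"
    "expectation (\<lambda>\<omega>. (\<Sum>n=1..N. Z n \<omega>) ^ 4) \<le> real N * (848 * h\<^sup>2) + 3 * (real N * (h + r\<^sup>2))\<^sup>2"
    using indep_sum_moments[OF _ ind gm(1) gm(2) gm(3) gm(4)] h by (auto simp: h_def)
  have zS: "z \<omega> = (\<Sum>n=1..N. Z n \<omega>) / real N" for \<omega> by (simp add: z_def Z_def \<xi>_def)
  show "integrable M (\<lambda>\<omega>. z \<omega> ^ 4)" unfolding zS power_divide using S(1) by simp
  have Zm: "Z n \<in> borel_measurable M" if "n \<in> {1..N}" for n using ind that by (auto simp: indep_vars_def)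
  then have sm: "(\<lambda>\<omega>. \<Sum>n=1..N. Z n \<omega>) \<in> borel_measurable M" by (intro borel_measurable_sum)
  show "integrable M (\<lambda>\<omega>. (z \<omega>)\<^sup>2)"
    unfolding zS power_divide
  proof (rule Bochner_Integration.integrable_divide, rule square_integrable_imp_integrable)
    show "(\<lambda>\<omega>. (\<Sum>n=1..N. Z n \<omega>)\<^sup>2) \<in> borel_measurable M" by (rule borel_measurable_power[OF sm])
    show "integrable M (\<lambda>\<omega>. ((\<Sum>n=1..N. Z n \<omega>)\<^sup>2)\<^sup>2)" using S(1) by simp
  qed
  have "a * K0 / real N = real N * h / (real N)\<^sup>2" using N0 by (simp add: h_def power2_eq_square)
  also have "\<dots> \<le> real N * (h + r\<^sup>2) / (real N)\<^sup>2" using N0 by (intro divide_right_mono mult_left_mono) auto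
  also have "\<dots> = expectation (\<lambda>\<omega>. (z \<omega>)\<^sup>2)" unfolding zS power_divide S(2)[symmetric] by simp
  finally show "a * K0 / real N \<le> expectation (\<lambda>\<omega>. (z \<omega>)\<^sup>2)" .
  have "expectation (\<lambda>\<omega>. z \<omega> ^ 4) = expectation (\<lambda>\<omega>. (\<Sum>n=1..N. Z n \<omega>) ^ 4) / real N ^ 4"
    unfolding zS power_divide by simp
  also have "\<dots> \<le> (860 * (real N)\<^sup>2 * h\<^sup>2) / real N ^ 4"
  proof (rule divide_right_mono)
    \<comment> \<open>The constant is \<open>860 = 848 + 12\<close>: the individual fourth moments,
      using \<open>N \<le> N^2\<close>, and \<open>3 * (2 * N * h)^2 = 12 * N^2 * h^2\<close>, using
      \<open>r^2 \<le> h\<close>.\<close>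
    have a: "real N * (848 * h\<^sup>2) \<le> (real N)\<^sup>2 * (848 * h\<^sup>2)"
      using N1 by (intro mult_right_mono) (auto simp: power2_eq_square)
    have b: "3 * (real N * (h + r\<^sup>2))\<^sup>2 \<le> 3 * (real N * (2 * h))\<^sup>2"
      using h N0 by (intro mult_left_mono power_mono) auto
    show "expectation (\<lambda>\<omega>. (\<Sum>n=1..N. Z n \<omega>) ^ 4) \<le> 860 * (real N)\<^sup>2 * h\<^sup>2"
    proof -
      have "(real N)\<^sup>2 * (848 * h\<^sup>2) + 3 * (real N * (2 * h))\<^sup>2 = 860 * (real N)\<^sup>2 * h\<^sup>2"
        by (simp add: power_mult_distrib)
      with a b S(3) show ?thesis by linarith
    qed
  qed simp
  also have "\<dots> = 860 * (a * K0 / real N)\<^sup>2"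
    using N0 by (simp add: h_def power_divide power2_eq_square power4_eq_xxxx)
  finally show "expectation (\<lambda>\<omega>. z \<omega> ^ 4) \<le> 860 * (a * K0 / real N)\<^sup>2" .
qed

text \<open>The norm is at least that of the error applied to \<open>v\<close>, hence at least the
  mean absolute value of this function over the cube. At each grid point the first moment is bounded
  below through the second and fourth; the discretization error \<open>R\<close> is subtracted at
  the end.\<close>

lemma sample_cov_error_lower_root:
  assumes diag: "\<And>x. x \<in> unit_cube \<Longrightarrow> k x x = K0"
    and v: "v \<in> L2" "norm_L2 v \<le> 1" and a0: "0 < a0" "a0 \<le> bil k v v"
  shows "ennreal (sqrt (a0 * K0 / (2 * real N)) / 160) \<le> (\<integral>\<^sup>+\<omega>. ennreal (op_norm (\<lambda>f x. sample_cov N u \<omega> f x - integral_op k f x)) \<partial>M)"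
proof -
  have N0: "real N > 0" using N by simp
  define s0 where "s0 = sqrt (a0 * K0 / (2 * real N))"
  have s0: "s0 > 0" using a0 K0 N0 by (simp add: s0_def)
  define \<epsilon> where "\<epsilon> = s0 / 1000"
  have \<epsilon>: "\<epsilon> > 0" using s0 by (simp add: \<epsilon>_def)
  define \<delta> where "\<delta> = \<epsilon> / (4 * K0)"
  have \<delta>: "\<delta> > 0" using \<epsilon> K0 by (simp add: \<delta>_def)
  \<comment> \<open>The bound \<open>a0 / 2\<close> keeps the form of \<open>v\<close> on the grid
    at least half of \<open>a0\<close>; the other two keep the mean discretization error below a
    fixed small fraction of \<open>s0\<close>.\<close>
  define e where "e = min (a0 / 2) (min \<epsilon> (\<epsilon> * \<delta>))"
  have e: "e > 0" "e \<le> a0 / 2" "e \<le> \<epsilon>" "e \<le> \<epsilon> * \<delta>" using a0 \<epsilon> \<delta> by (auto simp: e_def)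
  obtain c where disc: "discretization 1 c" and
    close: "\<And>x y x' y'. x \<in> unit_cube \<Longrightarrow> y \<in> unit_cube \<Longrightarrow> x' \<in> {x, c x} \<Longrightarrow> y' \<in> {y, c y} \<Longrightarrow> \<bar>k x y - k x' y'\<bar> \<le> e"
    using continuous_kernel_discretization[OF k_cont e(1), of 1] by auto
  define I where "I = c ` unit_cube"
  have I: "finite I" "I \<subseteq> unit_cube" using finite_cells[OF disc] cells_subset[OF disc] by (auto simp: I_def)
  define cf where "cf = cell_coeff c v"
  define a where "a = (\<Sum>q\<in>I. \<Sum>q'\<in>I. cf q * cf q' * k q q')"
  define r where "r p = (\<Sum>q\<in>I. cf q * k p q)" for p
  define z where "z p \<omega> = (\<Sum>n=1..N. u n p \<omega> * (\<Sum>q\<in>I. cf q * u n q \<omega>) - r p) / real N" for p \<omega>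
  have vv: "inner_L2 v v \<le> 1" using v(2) by (simp add: norm_L2_def)
  have a: "a0 / 2 \<le> a"
  proof -
    have "bil (\<lambda>x y. k (c x) (c y)) v v = a"
      unfolding bil_disc[OF disc v(1) v(1)] a_def I_def cf_def by (simp add: mult_ac)
    moreover have "\<bar>bil k v v - bil (\<lambda>x y. k (c x) (c y)) v v\<bar> \<le> e * inner_L2 v v"
      by (rule kernel_form_discretization[OF disc k_hs k_sym close v(1)])
    moreover have "e * inner_L2 v v \<le> e * 1" using e vv by (intro mult_left_mono) auto
    ultimately show ?thesis using e a0 by linarith
  qed
  define s where "s = sqrt (a * K0 / real N)"
  have s: "s0 \<le> s" "s\<^sup>2 = a * K0 / real N"
  proof -
    have "a0 / 2 * K0 / real N \<le> a * K0 / real N" using a K0 N0 by (intro divide_right_mono mult_right_mono) auto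
    then show "s0 \<le> s" unfolding s0_def s_def by (intro real_sqrt_le_mono) (simp add: field_simps)
    show "s\<^sup>2 = a * K0 / real N" using a a0 K0 N0 by (simp add: s_def)
  qed
  have sp: "s > 0" using s s0 by simp
  \<comment> \<open>With this choice the second-moment term is \<open>s / 60\<close> and the quartic
    one at most \<open>860 * s / 216000\<close>, less than a quarter of it, so \<open>s / 80\<close>
    remains.\<close>
  define D where "D = 60 * s"
  have D: "D > 0" using sp by (simp add: D_def)
  have zp: "integrable M (\<lambda>\<omega>. z p \<omega> ^ 4)" "integrable M (\<lambda>\<omega>. (z p \<omega>)\<^sup>2)" "s\<^sup>2 \<le> expectation (\<lambda>\<omega>. (z p \<omega>)\<^sup>2)"
    "expectation (\<lambda>\<omega>. z p \<omega> ^ 4) \<le> 860 * (s\<^sup>2)\<^sup>2" if p: "p \<in> I" for p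
  proof -
    have "p \<in> unit_cube" using p I by blast
    note m = product_average_moments[OF I p diag[OF this], of cf]
    show "integrable M (\<lambda>\<omega>. z p \<omega> ^ 4)" "integrable M (\<lambda>\<omega>. (z p \<omega>)\<^sup>2)" "s\<^sup>2 \<le> expectation (\<lambda>\<omega>. (z p \<omega>)\<^sup>2)"
      "expectation (\<lambda>\<omega>. z p \<omega> ^ 4) \<le> 860 * (s\<^sup>2)\<^sup>2"
      unfolding s(2) unfolding z_def r_def a_def by (fact m)+
  qed
  define w where "w p = cell_weight c p" for p
  have w0: "0 \<le> w p" for p by (simp add: w_def cell_weight_nonneg[OF disc])
  have w1: "(\<Sum>p\<in>I. w p) = 1"
    using integral_disc[OF disc, of "\<lambda>_. 1"] by (simp add: w_def I_def cube.prob_space[simplified])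
  define Dn where "Dn n b \<omega> = (LINT x|cube. (u n x \<omega> + b * u n (c x) \<omega>)\<^sup>2)" for n b \<omega>
  define R where "R \<omega> = e + (\<Sum>n=1..N. Dn n (- 1) \<omega> / (2 * \<delta>) + \<delta> / 2 * Dn n 1 \<omega>) / real N" for \<omega>
  have Dn0: "0 \<le> Dn n b \<omega>" for n b \<omega> by (simp add: Dn_def)
  have Dni: "integrable M (Dn n (- 1))" "expectation (Dn n (- 1)) \<le> 3 * e" "integrable M (Dn n 1)" "expectation (Dn n 1) \<le> 4 * K0"
    if n: "n \<in> {1..N}" for n
  proof -
    note inc = increment_energy[OF disc n close, folded Dn_def]
    have m: "Dn n b \<in> borel_measurable M" for b using inc(1)[of b] by (simp add: Dn_def[abs_def])
    have gen: "integrable M X" "expectation X \<le> B"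
      if "X \<in> borel_measurable M" "\<And>\<omega>. 0 \<le> X \<omega>" "(\<integral>\<^sup>+\<omega>. ennreal (X \<omega>) \<partial>M) \<le> ennreal B" "0 \<le> B" for X :: "'w \<Rightarrow> real" and B
    proof -
      show i: "integrable M X"
        using that by (intro integrableI_nonneg) (auto intro: le_less_trans)
      show "expectation X \<le> B" using that nn_integral_eq_integral[OF i] by (simp add: ennreal_le_iff)
    qed
    show "integrable M (Dn n (- 1))" "expectation (Dn n (- 1)) \<le> 3 * e"
      using gen[of "Dn n (- 1)" "3 * e"] m Dn0 inc(2) e by auto
    show "integrable M (Dn n 1)" "expectation (Dn n 1) \<le> 4 * K0"
      using gen[of "Dn n 1" "4 * K0"] m Dn0 inc(3) K0 by auto
  qed
  have Ri: "integrable M R" "expectation R \<le> s0 / 160"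
  proof -
    have t: "integrable M (\<lambda>\<omega>. Dn n (- 1) \<omega> / (2 * \<delta>) + \<delta> / 2 * Dn n 1 \<omega>)"
      "expectation (\<lambda>\<omega>. Dn n (- 1) \<omega> / (2 * \<delta>) + \<delta> / 2 * Dn n 1 \<omega>) = expectation (Dn n (- 1)) / (2 * \<delta>) + \<delta> / 2 * expectation (Dn n 1)"
      if "n \<in> {1..N}" for n using Dni[OF that] by auto
    have S: "integrable M (\<lambda>\<omega>. \<Sum>n=1..N. Dn n (- 1) \<omega> / (2 * \<delta>) + \<delta> / 2 * Dn n 1 \<omega>)"
      by (rule Bochner_Integration.integrable_sum[OF t(1)])
    show "integrable M R" unfolding R_def
      by (intro Bochner_Integration.integrable_add Bochner_Integration.integrable_divide S) simp
    have "expectation R = e + (\<Sum>n=1..N. expectation (Dn n (- 1)) / (2 * \<delta>) + \<delta> / 2 * expectation (Dn n 1)) / real N"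
    proof -
      have "expectation R = e + expectation (\<lambda>\<omega>. \<Sum>n=1..N. Dn n (- 1) \<omega> / (2 * \<delta>) + \<delta> / 2 * Dn n 1 \<omega>) / real N"
        unfolding R_def using S by (subst Bochner_Integration.integral_add) (auto simp: prob_space)
      also have "expectation (\<lambda>\<omega>. \<Sum>n=1..N. Dn n (- 1) \<omega> / (2 * \<delta>) + \<delta> / 2 * Dn n 1 \<omega>)
        = (\<Sum>n=1..N. expectation (Dn n (- 1)) / (2 * \<delta>) + \<delta> / 2 * expectation (Dn n 1))"
        by (subst Bochner_Integration.integral_sum[OF t(1)]) (assumption, intro sum.cong refl t(2))
      finally show ?thesis .
    qed
    also have "\<dots> \<le> e + (\<Sum>n=1..N. 3 * e / (2 * \<delta>) + \<delta> / 2 * (4 * K0)) / real N"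
      using Dni \<delta> N0 by (intro add_left_mono divide_right_mono sum_mono add_mono mult_left_mono) auto
    also have "\<dots> = e + (3 * e / (2 * \<delta>) + 2 * \<delta> * K0)" using N0 by simp
    also have "\<dots> \<le> \<epsilon> + (3 / 2 * \<epsilon> + \<epsilon> / 2)"
    proof -
      have "3 * e / (2 * \<delta>) \<le> 3 / 2 * \<epsilon>" using e(4) \<delta> by (simp add: field_simps)
      moreover have "2 * \<delta> * K0 = \<epsilon> / 2" using K0 by (simp add: \<delta>_def)
      ultimately show ?thesis using e by simp
    qed
    also have "\<dots> \<le> s0 / 160" using s0 by (simp add: \<epsilon>_def)
    finally show "expectation R \<le> s0 / 160" .
  qed
  define h where "h \<omega> = (\<Sum>p\<in>I. w p * ((z p \<omega>)\<^sup>2 / D - z p \<omega> ^ 4 / D ^ 3)) - R \<omega>" for \<omega>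
  have hi: "integrable M h" unfolding h_def using zp Ri by simp
  \<comment> \<open>Of the gain \<open>s / 80 \<ge> s0 / 80\<close>, one half pays for the
    discretization error.\<close>
  have "s0 / 160 \<le> expectation h"
  proof -
    have "expectation h = (\<Sum>p\<in>I. w p * (expectation (\<lambda>\<omega>. (z p \<omega>)\<^sup>2) / D - expectation (\<lambda>\<omega>. z p \<omega> ^ 4) / D ^ 3)) - expectation R"
      unfolding h_def using zp Ri by simp
    moreover have "(\<Sum>p\<in>I. w p * (s / 80)) \<le> (\<Sum>p\<in>I. w p * (expectation (\<lambda>\<omega>. (z p \<omega>)\<^sup>2) / D - expectation (\<lambda>\<omega>. z p \<omega> ^ 4) / D ^ 3))"
    proof (intro sum_mono mult_left_mono w0)
      fix p assume p: "p \<in> I"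
      have "s\<^sup>2 / D \<le> expectation (\<lambda>\<omega>. (z p \<omega>)\<^sup>2) / D" using zp(3)[OF p] D by (intro divide_right_mono) auto
      moreover have "expectation (\<lambda>\<omega>. z p \<omega> ^ 4) / D ^ 3 \<le> 860 * (s\<^sup>2)\<^sup>2 / D ^ 3"
        using zp(4)[OF p] D by (intro divide_right_mono) auto
      moreover have "s\<^sup>2 / D = s / 60" using sp by (simp add: D_def power2_eq_square)
      moreover have "860 * (s\<^sup>2)\<^sup>2 / D ^ 3 = 860 * s / 216000"
        using sp by (simp add: D_def power2_eq_square power3_eq_cube)
      ultimately show "s / 80 \<le> expectation (\<lambda>\<omega>. (z p \<omega>)\<^sup>2) / D - expectation (\<lambda>\<omega>. z p \<omega> ^ 4) / D ^ 3"
        using sp by linarith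
    qed
    moreover have "(\<Sum>p\<in>I. w p * (s / 80)) = s / 80" unfolding sum_distrib_right[symmetric] w1 by simp
    ultimately show ?thesis using Ri(2) s by linarith
  qed
  then have "ennreal (s0 / 160) \<le> ennreal (expectation h)" by (rule ennreal_leI)
  also have "\<dots> \<le> (\<integral>\<^sup>+\<omega>. ennreal (h \<omega>) \<partial>M)" by (rule ennreal_integral_le_nn_integral'[OF hi])
  also have "\<dots> \<le> (\<integral>\<^sup>+\<omega>. ennreal (op_norm (\<lambda>f x. sample_cov N u \<omega> f x - integral_op k f x)) \<partial>M)"
    using paths_L2
  proof (intro nn_integral_mono_AE, eventually_elim)
    case (elim \<omega>)
    note L2 = elim(2)
    let ?T = "\<lambda>x y. sample_kernel N u \<omega> x y - k x y"
    define F where "F p q = (\<Sum>n=1..N. u n p \<omega> * u n q \<omega>) / real N - k p q" for p q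
    let ?C = "\<lambda>x y. F (c x) (c y)"
    have hsT: "hs_kernel ?T" by (rule hs_kernel_diff[OF sample_form(1)[OF L2 L2_zero] k_hs])
    have hsC: "hs_kernel ?C" by (rule hs_disc[OF disc])
    have R0: "0 \<le> R \<omega>" unfolding R_def using e \<delta> N0 Dn0 by (intro add_nonneg_nonneg divide_nonneg_nonneg sum_nonneg) auto
    have form: "\<bar>bil (\<lambda>x y. ?C x y - ?T x y) g g\<bar> \<le> R \<omega> * inner_L2 g g" if g: "g \<in> L2" for g
    proof -
      have "\<forall>n\<in>{1..N}. (\<lambda>x. u n (c x) \<omega>) \<in> L2"
        using disc_L2[OF disc, of "\<lambda>p. u n p \<omega>" for n] by blast
      note av = average_tensor_form[OF this]
      have "bil ?C g g = (\<Sum>n=1..N. (inner_L2 (\<lambda>x. u n (c x) \<omega>) g)\<^sup>2) / real N - bil (\<lambda>x y. k (c x) (c y)) g g"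
        unfolding F_def av(2)[OF g, symmetric] by (rule bil_diff_kernel[OF av(1) hs_disc[OF disc] g g])
      then show ?thesis
        using form_discretization_error[OF disc close L2 g \<delta>] bil_diff_kernel[OF hsC hsT g g]
        unfolding R_def Dn_def by (simp add: abs_minus_commute)
    qed
    have Cv: "integral_op ?C v x = z (c x) \<omega>" if x: "x \<in> unit_cube" for x
    proof -
      have "integral_op ?C v x = inner_L2 (\<lambda>y. F (c x) (c y)) v" by (simp add: integral_op_def inner_L2_def)
      also have "\<dots> = (\<Sum>q\<in>I. F (c x) q * cf q)" using inner_disc[OF disc v(1), of "F (c x)"] by (simp add: I_def cf_def)
      also have "\<dots> = (\<Sum>q\<in>I. (\<Sum>n=1..N. u n (c x) \<omega> * (cf q * u n q \<omega>)) / real N) - r (c x)"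
      proof -
        have "F (c x) q * cf q = (\<Sum>n=1..N. u n (c x) \<omega> * (cf q * u n q \<omega>)) / real N - cf q * k (c x) q" for q
          unfolding F_def left_diff_distrib times_divide_eq_left sum_distrib_right by (simp add: mult_ac)
        then show ?thesis by (simp add: r_def sum_subtractf)
      qed
      also have "(\<Sum>q\<in>I. (\<Sum>n=1..N. u n (c x) \<omega> * (cf q * u n q \<omega>)) / real N) = (\<Sum>n=1..N. u n (c x) \<omega> * (\<Sum>q\<in>I. cf q * u n q \<omega>)) / real N"
        unfolding sum_divide_distrib[symmetric] sum_distrib_left by (subst sum.swap) simp
      also have "\<dots> - r (c x) = z (c x) \<omega>"
        unfolding z_def using N0 by (simp add: sum_subtractf diff_divide_distrib)
      finally show ?thesis .
    qed
    \<comment> \<open>The weights are the volumes of the cells, so the weighted sum is an integral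
      over the cube; as the volume is one, the L1 norm is at most the L2 norm.\<close>
    have "(\<Sum>p\<in>I. w p * ((z p \<omega>)\<^sup>2 / D - z p \<omega> ^ 4 / D ^ 3)) \<le> (\<Sum>p\<in>I. w p * \<bar>z p \<omega>\<bar>)"
      by (intro sum_mono mult_left_mono w0 abs_ge_quartic D)
    also have "\<dots> = inner_L2 (\<lambda>x. \<bar>z (c x) \<omega>\<bar>) (\<lambda>_. 1)"
      using integral_disc[OF disc, of "\<lambda>p. \<bar>z p \<omega>\<bar>"] by (simp add: inner_L2_def I_def w_def mult.commute)
    also have "\<dots> \<le> norm_L2 (\<lambda>x. \<bar>z (c x) \<omega>\<bar>) * norm_L2 (\<lambda>x :: real ^ 'n. 1)"
      using inner_L2_le_norm[OF disc_L2[OF disc, of "\<lambda>p. \<bar>z p \<omega>\<bar>"], of "\<lambda>_. 1"] by (simp add: L2_def)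
    also have "\<dots> = norm_L2 (\<lambda>x. \<bar>z (c x) \<omega>\<bar>)" by (simp add: norm_L2_def inner_L2_def cube.prob_space[simplified])
    also have "\<dots> = norm_L2 (integral_op ?C v)"
    proof -
      have "norm_L2 (integral_op ?C v) = norm_L2 (\<lambda>x. z (c x) \<omega>)" by (rule norm_L2_cong[OF Cv])
      then show ?thesis by (simp add: norm_L2_def inner_L2_def flip: abs_mult)
    qed
    also have "\<dots> \<le> norm_L2 (integral_op ?T v) + R \<omega>"
    proof -
      have "norm_L2 (\<lambda>x. integral_op ?T v x + (integral_op ?C v x - integral_op ?T v x)) \<le>
        norm_L2 (integral_op ?T v) + norm_L2 (\<lambda>x. integral_op ?C v x - integral_op ?T v x)"
        by (intro norm_L2_triangle L2_diff integral_op_L2(1) hsT hsC v)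
      also have "norm_L2 (\<lambda>x. integral_op ?C v x - integral_op ?T v x) = norm_L2 (integral_op (\<lambda>x y. ?C x y - ?T x y) v)"
        by (rule norm_L2_integral_op_diff[OF hsC hsT v(1)])
      also have "\<dots> \<le> R \<omega> * norm_L2 v"
      proof (rule norm_L2_integral_op_le[OF hs_kernel_diff[OF hsC hsT] _ R0 form v(1)])
        fix x y :: "real ^ 'n" assume xy: "x \<in> unit_cube" "y \<in> unit_cube"
        then have "c x \<in> unit_cube" "c y \<in> unit_cube" using I by (auto simp: I_def)
        then show "?C x y - ?T x y = ?C y x - ?T y x"
          using k_sym[OF xy] k_sym[of "c x" "c y"] sample_kernel_sym[of \<omega> x y] by (simp add: F_def mult.commute)
      qed
      also have "\<dots> \<le> R \<omega> * 1" using v R0 by (intro mult_left_mono) auto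
      finally show ?thesis by simp
    qed
    also have "norm_L2 (integral_op ?T v) \<le> op_norm (integral_op ?T)"
      using le_op_norm[of "integral_op ?T", OF norm_L2_integral_op_hs[OF hsT] v] by simp
    finally have "h \<omega> \<le> op_norm (integral_op ?T)" by (simp add: h_def)
    then show ?case unfolding op_norm_sample_diff[OF L2] by (rule ennreal_leI)
  qed
  finally show ?thesis unfolding s0_def .
qed

end

section \<open>The threshold and the rate\<close>

lemma eps_star_le:
  assumes "\<And>m. 1 \<le> m \<Longrightarrow> min (\<nu> m) (sqrt (real m ^ d / real N)) \<le> c"
  shows "eps_star \<nu> d N \<le> c"
  unfolding eps_star_def using assms by (intro cSUP_least) auto

lemma le_eps_star:
  assumes "\<And>m. 1 \<le> m \<Longrightarrow> \<nu> m \<le> b" "1 \<le> m"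
  shows "min (\<nu> m) (sqrt (real m ^ d / real N)) \<le> eps_star \<nu> d N"
proof -
  have "bdd_above ((\<lambda>m. min (\<nu> m) (sqrt (real m ^ d / real N))) ` {1..})"
    by (rule bdd_aboveI2[where M = b]) (use assms(1) in \<open>auto intro: min.coboundedI1\<close>)
  then show ?thesis unfolding eps_star_def using assms(2) by (intro cSUP_upper) auto
qed

text \<open>At \<open>m_star - 1\<close> the root is still the smaller of the two sequences, so it
  is at most \<open>eps_star\<close>; going back by one index costs at most \<open>2^d\<close>,
  since \<open>m \<le> 2 * (m - 1)\<close>. The defining set is nonempty because it contains
  \<open>N\<close>, and it misses 1 because \<open>\<nu> 1 = 1\<close> and
  \<open>N \<ge> 2\<close>.\<close>

lemma m_star_bounds:
  assumes d: "1 \<le> d" and N: "2 \<le> N" and \<nu>: "\<And>m. 1 \<le> m \<Longrightarrow> \<nu> m \<le> 1" "\<nu> 1 = 1"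
  shows "2 \<le> m_star \<nu> d N" "\<nu> (m_star \<nu> d N) \<le> eps_star \<nu> d N"
    and "sqrt (real (m_star \<nu> d N) ^ d / real N) \<le> 2 ^ d * eps_star \<nu> d N"
proof -
  define m where "m = m_star \<nu> d N"
  have ex: "1 \<le> N \<and> \<nu> N \<le> sqrt (real N ^ d / real N)"
  proof -
    have "real N ^ 1 \<le> real N ^ d" using d N by (intro power_increasing) auto
    then have "1 \<le> real N ^ d / real N" using N by (simp add: pos_le_divide_eq)
    then show ?thesis using \<nu>(1)[of N] N by (auto intro: order_trans)
  qed
  have m: "1 \<le> m \<and> \<nu> m \<le> sqrt (real m ^ d / real N)"
    unfolding m_def m_star_def by (rule LeastI[where P = "\<lambda>m. 1 \<le> m \<and> \<nu> m \<le> sqrt (real m ^ d / real N)", OF ex])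
  have least: "\<not> (1 \<le> j \<and> \<nu> j \<le> sqrt (real j ^ d / real N))" if "j < m" for j
    using that unfolding m_def m_star_def by (rule not_less_Least)
  have "m \<noteq> 1"
  proof
    assume "m = 1"
    then have "1 \<le> sqrt (1 / real N)" using m \<nu>(2) by simp
    then show False using N by simp
  qed
  then have m2: "2 \<le> m" using m by simp
  then show "2 \<le> m_star \<nu> d N" by (simp add: m_def)
  show "\<nu> (m_star \<nu> d N) \<le> eps_star \<nu> d N"
    using le_eps_star[of \<nu> 1 m d N] \<nu>(1) m by (simp add: m_def)
  have "sqrt (real (m - 1) ^ d / real N) < \<nu> (m - 1)" using least[of "m - 1"] m2 by auto
  then have le: "sqrt (real (m - 1) ^ d / real N) \<le> eps_star \<nu> d N"
    using le_eps_star[of \<nu> 1 "m - 1" d N] \<nu>(1) m2 by simp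
  have "real m ^ d \<le> (2 * real (m - 1)) ^ d" using m2 by (intro power_mono) auto
  also have "\<dots> = 2 ^ d * real (m - 1) ^ d" by (simp add: power_mult_distrib)
  also have "\<dots> \<le> (2 ^ d)\<^sup>2 * real (m - 1) ^ d"
  proof (intro mult_right_mono)
    have "(2 :: real) ^ d * 1 \<le> 2 ^ d * 2 ^ d" by (intro mult_left_mono) auto
    then show "(2 :: real) ^ d \<le> (2 ^ d)\<^sup>2" by (simp add: power2_eq_square)
  qed simp
  finally have "real m ^ d / real N \<le> (2 ^ d)\<^sup>2 * (real (m - 1) ^ d / real N)" by (simp add: divide_right_mono)
  then have "sqrt (real m ^ d / real N) \<le> sqrt ((2 ^ d)\<^sup>2 * (real (m - 1) ^ d / real N))" by (rule real_sqrt_le_mono)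
  also have "\<dots> = 2 ^ d * sqrt (real (m - 1) ^ d / real N)" by (simp only: real_sqrt_mult real_sqrt_abs) simp
  also have "\<dots> \<le> 2 ^ d * eps_star \<nu> d N" using le by (intro mult_left_mono) auto
  finally show "sqrt (real (m_star \<nu> d N) ^ d / real N) \<le> 2 ^ d * eps_star \<nu> d N" by (simp add: m_def)
qed

lemma eps_star_bounds:
  assumes N: "1 \<le> N" and \<nu>: "\<And>m. 1 \<le> m \<Longrightarrow> \<nu> m \<le> 1" "\<And>m. 1 \<le> m \<Longrightarrow> 0 < \<nu> m"
  shows "0 \<le> eps_star \<nu> d N" "eps_star \<nu> d N \<le> 1"
proof -
  have "0 \<le> min (\<nu> 1) (sqrt (real 1 ^ d / real N))" using \<nu>(2)[of 1] by simp
  also have "\<dots> \<le> eps_star \<nu> d N" using \<nu>(1) by (intro le_eps_star) auto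
  finally show "0 \<le> eps_star \<nu> d N" .
  show "eps_star \<nu> d N \<le> 1" using \<nu>(1) by (intro eps_star_le) (auto intro: min.coboundedI1)
qed

text \<open>The two sequences cross at the real number
  \<open>m0 = N^(1 / (2 * \<alpha> + d))\<close>, where both equal \<open>T\<close>. From
  \<open>m0\<close> on the first is at most \<open>T\<close>, before it the second. Rounding
  \<open>m0\<close> up at most doubles it, which accounts for the factor
  \<open>2^(- \<alpha>)\<close>.\<close>

lemma eps_star_polynomial:
  fixes d N :: nat and \<alpha> :: real and \<nu> :: "nat \<Rightarrow> real"
  assumes \<alpha>: "\<alpha> > 0" and \<nu>: "\<And>m. 1 \<le> m \<Longrightarrow> \<nu> m = real m powr (- \<alpha>)" and N: "1 \<le> N"
  defines "T \<equiv> real N powr (- \<alpha> / (2 * \<alpha> + real d))"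
  shows "2 powr (- \<alpha>) * T \<le> eps_star \<nu> d N" "eps_star \<nu> d N \<le> T"
proof -
  define D where "D = 2 * \<alpha> + real d"
  have D: "D > 0" using \<alpha> by (simp add: D_def add_pos_nonneg)
  have N0: "real N > 0" using N by simp
  define m0 where "m0 = real N powr (1 / D)"
  have m0: "1 \<le> m0" using N D by (simp add: m0_def ge_one_powr_ge_zero)
  have T1: "m0 powr (- \<alpha>) = T" by (simp add: m0_def powr_powr T_def D_def)
  have T2: "sqrt (m0 ^ d / real N) = T"
  proof -
    have "m0 ^ d / real N = real N powr (real d / D - 1)"
    proof -
      have "m0 ^ d = real N powr (real d / D)" using m0 N0 by (simp add: m0_def powr_powr flip: powr_realpow)
      then show ?thesis using N0 by (simp add: powr_diff)
    qed
    also have "real d / D - 1 = 2 * (- \<alpha> / D)" using D by (simp add: D_def field_simps)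
    also have "real N powr (2 * (- \<alpha> / D)) = T\<^sup>2"
    proof -
      have "T\<^sup>2 = T powr 2" using N0 by (simp add: T_def powr_numeral)
      then show ?thesis by (simp add: T_def D_def powr_powr mult.commute)
    qed
    finally show ?thesis by (simp add: T_def)
  qed
  show "eps_star \<nu> d N \<le> T"
  proof (rule eps_star_le)
    fix m :: nat assume m: "1 \<le> m"
    show "min (\<nu> m) (sqrt (real m ^ d / real N)) \<le> T"
    proof (cases "m0 \<le> real m")
      case True
      have "real m powr (- \<alpha>) \<le> m0 powr (- \<alpha>)" using True m0 \<alpha> by (intro powr_mono2') auto
      then show ?thesis using \<nu>[OF m] T1 by (simp add: min.coboundedI1)
    next
      case False
      then have "sqrt (real m ^ d / real N) \<le> sqrt (m0 ^ d / real N)"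
        using N0 by (intro real_sqrt_le_mono divide_right_mono power_mono) auto
      then show ?thesis using T2 by (simp add: min.coboundedI2)
    qed
  qed
  define m where "m = nat \<lceil>m0\<rceil>"
  have m: "1 \<le> m" "m0 \<le> real m" "real m \<le> 2 * m0"
  proof -
    have "real m = real_of_int \<lceil>m0\<rceil>" using m0 by (simp add: m_def)
    moreover have "m0 \<le> real_of_int \<lceil>m0\<rceil>" "real_of_int \<lceil>m0\<rceil> \<le> m0 + 1" by linarith+
    ultimately show "m0 \<le> real m" "real m \<le> 2 * m0" using m0 by linarith+
    then show "1 \<le> m" using m0 by linarith
  qed
  have "2 powr (- \<alpha>) * T \<le> min (\<nu> m) (sqrt (real m ^ d / real N))"
  proof (rule min.boundedI)
    have "2 powr (- \<alpha>) * T = (2 * m0) powr (- \<alpha>)" using m0 by (simp add: powr_mult T1)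
    also have "\<dots> \<le> real m powr (- \<alpha>)" using m m0 \<alpha> by (intro powr_mono2') auto
    finally show "2 powr (- \<alpha>) * T \<le> \<nu> m" using \<nu>[OF m(1)] by simp
    have "2 powr (- \<alpha>) \<le> 2 powr 0" using \<alpha> by (intro powr_mono) auto
    then have "2 powr (- \<alpha>) * T \<le> 1 * T" by (intro mult_right_mono) (auto simp: T_def)
    also have "1 * T \<le> sqrt (real m ^ d / real N)"
      unfolding mult_1 T2[symmetric] using m m0 N0 by (intro real_sqrt_le_mono divide_right_mono power_mono) auto
    finally show "2 powr (- \<alpha>) * T \<le> sqrt (real m ^ d / real N)" .
  qed
  also have "\<dots> \<le> eps_star \<nu> d N"
  proof (rule le_eps_star[OF _ m(1)])
    fix j :: nat assume j: "1 \<le> j"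
    then have "real j powr (- \<alpha>) \<le> 1 powr (- \<alpha>)" using \<alpha> by (intro powr_mono2') auto
    then show "\<nu> j \<le> 1" using \<nu>[OF j] by simp
  qed
  finally show "2 powr (- \<alpha>) * T \<le> eps_star \<nu> d N" .
qed

text \<open>The scale is \<open>p = (ln N)^(1/t)\<close>, where \<open>exp (- p^t) = 1 / N\<close>
  and \<open>p^d = (ln N)^(d/t)\<close>. For the lower bound a constant fraction of \<open>p\<close>
  is taken, at which the exponential is still of order \<open>N^(-1/4)\<close> and so dominates the
  target up to a constant, while the root loses only a constant factor.\<close>

lemma eps_star_exponential:
  assumes t: "t > 0" and d: "1 \<le> d" and ab: "a > 0" "b > 0"
    and \<nu>: "\<And>m. 1 \<le> m \<Longrightarrow> a * exp (- (real m powr t)) \<le> \<nu> m \<and> \<nu> m \<le> b * exp (- (real m powr t))"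
  shows "\<exists>a'>0. \<exists>b'>0. \<forall>N\<ge>2. a' * sqrt (ln (real N) powr (real d / t) / real N) \<le> eps_star \<nu> d N \<and>
    eps_star \<nu> d N \<le> b' * sqrt (ln (real N) powr (real d / t) / real N)"
proof -
  define e where "e = real d / t"
  have e: "e > 0" using t d by (simp add: e_def)
  \<comment> \<open>A lower bound for the power of the logarithm valid for all
    \<open>N \<ge> 2\<close>; it converts \<open>sqrt (1 / N)\<close> into the target rate in the
    range \<open>m \<ge> p\<close>.\<close>
  define l2 where "l2 = ln (2 :: real) powr e"
  have l2: "l2 > 0" by (simp add: l2_def)
  define b' where "b' = max 1 (b / sqrt l2)"
  \<comment> \<open>This exponent gives \<open>(ln N)^e \<le> C * sqrt N\<close>, so the target is
    at most \<open>sqrt C * N^(-1/4)\<close>.\<close>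
  define s where "s = 1 / (2 * e)"
  define C where "C = s powr (- e)"
  have C: "C > 0" using e by (simp add: C_def s_def)
  \<comment> \<open>Half of \<open>(1/4)^(1/t)\<close>: the point
    \<open>x = 2 * \<delta> * p\<close> satisfies \<open>x^t = ln N / 4\<close>, and the integer
    chosen near it is at least \<open>x / 2 = \<delta> * p\<close>.\<close>
  define \<delta> where "\<delta> = (1 / 4 :: real) powr (1 / t) / 2"
  have \<delta>: "\<delta> > 0" by (simp add: \<delta>_def)
  define a' where "a' = min (a * exp (- 1) / sqrt C) (sqrt (\<delta> ^ d))"
  have a': "a' > 0" using ab C \<delta> by (simp add: a'_def)
  have main: "a' * sqrt (ln (real N) powr e / real N) \<le> eps_star \<nu> d N \<and> eps_star \<nu> d N \<le> b' * sqrt (ln (real N) powr e / real N)"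
    if N: "2 \<le> N" for N
  proof -
    have N0: "real N > 0" "2 \<le> real N" using N by auto
    define L where "L = ln (real N)"
    have L2: "ln 2 \<le> L" using N0 by (simp add: L_def)
    then have L: "L > 0" using ln_gt_zero[of "2 :: real"] by linarith
    define p where "p = L powr (1 / t)"
    have p: "p > 0" using L by (simp add: p_def)
    have pt: "p powr t = L" using L t by (simp add: p_def powr_powr)
    have pd: "p ^ d = L powr e" using p by (simp add: p_def powr_powr e_def flip: powr_realpow)
    define E where "E = sqrt (L powr e / real N)"
    have E: "0 \<le> E" using N0 by (simp add: E_def)
    have up: "eps_star \<nu> d N \<le> b' * E"
    proof (rule eps_star_le)
      fix m :: nat assume m: "1 \<le> m"
      show "min (\<nu> m) (sqrt (real m ^ d / real N)) \<le> b' * E"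
      proof (cases "p \<le> real m")
        case True
        have "L \<le> real m powr t" using powr_mono2[of t p "real m"] True p t pt by simp
        then have "exp (- (real m powr t)) \<le> exp (- L)" by simp
        also have "exp (- L) = 1 / real N" using N0 by (simp add: L_def exp_minus inverse_eq_divide)
        finally have "\<nu> m \<le> b * (1 / real N)" using \<nu>[OF m] ab by (meson mult_left_mono less_imp_le order_trans)
        also have "1 / real N \<le> sqrt (1 / real N)"
        proof (rule real_le_rsqrt)
          have "1 / real N * (1 / real N) \<le> 1 / real N * 1" using N0 by (intro mult_left_mono) auto
          then show "(1 / real N)\<^sup>2 \<le> 1 / real N" by (simp add: power2_eq_square)
        qed
        also have "sqrt (1 / real N) \<le> E / sqrt l2"
        proof -
          have "l2 \<le> L powr e" unfolding l2_def using L2 e by (intro powr_mono2) auto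
          then have "1 / real N \<le> (L powr e / real N) / l2" using l2 N0 by (simp add: field_simps)
          then have "sqrt (1 / real N) \<le> sqrt ((L powr e / real N) / l2)" by (rule real_sqrt_le_mono)
          then show ?thesis by (simp add: E_def real_sqrt_divide real_sqrt_mult)
        qed
        finally have "\<nu> m \<le> b * (E / sqrt l2)" using ab by simp
        also have "\<dots> = (b / sqrt l2) * E" by simp
        also have "\<dots> \<le> b' * E" using E by (intro mult_right_mono) (auto simp: b'_def)
        finally show ?thesis by (rule min.coboundedI1)
      next
        case False
        then have "sqrt (real m ^ d / real N) \<le> sqrt (p ^ d / real N)"
          using N0 by (intro real_sqrt_le_mono divide_right_mono power_mono) auto
        also have "\<dots> = 1 * E" by (simp add: pd E_def)
        also have "\<dots> \<le> b' * E" using E by (intro mult_right_mono) (auto simp: b'_def)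
        finally show ?thesis by (rule min.coboundedI2)
      qed
    qed
    define x where "x = 2 * \<delta> * p"
    have x: "x > 0" using \<delta> p by (simp add: x_def)
    have xt: "x powr t = L / 4"
    proof -
      have "x = (1 / 4) powr (1 / t) * p" by (simp add: x_def \<delta>_def)
      then have "x powr t = ((1 / 4) powr (1 / t)) powr t * p powr t" using p by (simp add: powr_mult)
      then show ?thesis using t pt by (simp add: powr_powr)
    qed
    \<comment> \<open>The maximum with 1 matters when \<open>x < 1\<close>. It is the source of the
      additive 1 in the bound for \<open>m^t\<close>, and so of the factor \<open>exp (- 1)\<close>
      in \<open>a'\<close>.\<close>
    define m where "m = max 1 (nat \<lfloor>x\<rfloor>)"
    have m1: "1 \<le> m" by (simp add: m_def)
    have m: "x / 2 \<le> real m" "real m powr t \<le> 1 + L / 4"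
    proof -
      have "real (nat \<lfloor>x\<rfloor>) = real_of_int \<lfloor>x\<rfloor>" using x by simp
      then have "real m = max 1 (real_of_int \<lfloor>x\<rfloor>)" by (simp add: m_def)
      moreover have "real_of_int \<lfloor>x\<rfloor> \<le> x" "x - 1 < real_of_int \<lfloor>x\<rfloor>" by linarith+
      ultimately have *: "real m \<le> max 1 x" "x / 2 \<le> real m" by linarith+
      show "x / 2 \<le> real m" by (rule *)
      have "real m powr t \<le> max 1 x powr t" using * t by (intro powr_mono2) auto
      also have "\<dots> \<le> 1 + L / 4" using xt L by (auto simp: max_def)
      finally show "real m powr t \<le> 1 + L / 4" .
    qed
    have low: "a' * E \<le> min (\<nu> m) (sqrt (real m ^ d / real N))"
    proof (rule min.boundedI)
      have Lb: "L \<le> real N powr s / s"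
      proof -
        have s: "s > 0" using e by (simp add: s_def)
        have "s * L = ln (real N powr s)" using N0 by (simp add: ln_powr L_def)
        also have "\<dots> \<le> real N powr s - 1" using N0 by (intro ln_le_minus_one) simp
        finally show ?thesis using s by (simp add: pos_le_divide_eq mult.commute)
      qed
      have "L powr e \<le> (real N powr s / s) powr e" using Lb L e by (intro powr_mono2) auto
      also have "\<dots> = C * real N powr (1 / 2)"
      proof -
        have "(real N powr s / s) powr e = (real N powr s) powr e / s powr e"
          by (rule powr_divide)
        also have "(real N powr s) powr e = real N powr (1 / 2)" using e by (simp add: powr_powr s_def)
        finally show ?thesis by (simp add: C_def powr_minus_divide)
      qed
      finally have "L powr e / real N \<le> C * real N powr (1 / 2) / real N" using N0 by (simp add: divide_right_mono)
      also have "\<dots> = C * real N powr (- 1 / 2)"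
      proof -
        have "real N powr (1 / 2) / real N = real N powr (1 / 2 - 1)" using powr_diff[of "real N" "1 / 2" 1] N0 by simp
        then show ?thesis by (simp flip: times_divide_eq_right)
      qed
      also have "\<dots> = C * (real N powr (- 1 / 4))\<^sup>2"
      proof -
        have "(real N powr (- 1 / 4))\<^sup>2 = real N powr (- 1 / 4 + - 1 / 4)" unfolding power2_eq_square powr_add ..
        then show ?thesis by simp
      qed
      finally have "E \<le> sqrt (C * (real N powr (- 1 / 4))\<^sup>2)" unfolding E_def by (rule real_sqrt_le_mono)
      then have EC: "E \<le> sqrt C * real N powr (- 1 / 4)" by (simp add: real_sqrt_mult)
      have "a' * E \<le> a * exp (- 1) / sqrt C * E" using E by (intro mult_right_mono) (auto simp: a'_def)
      also have "\<dots> \<le> a * exp (- 1) / sqrt C * (sqrt C * real N powr (- 1 / 4))"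
        using EC ab C by (intro mult_left_mono) auto
      also have "\<dots> = a * (exp (- 1) * exp (- L / 4))"
        using C N0 by (simp add: powr_def L_def)
      also have "\<dots> = a * exp (- (1 + L / 4))" by (simp add: exp_add[symmetric])
      also have "\<dots> \<le> a * exp (- (real m powr t))" using m ab by (intro mult_left_mono) auto
      finally show "a' * E \<le> \<nu> m" using \<nu>[OF m1] by linarith
      have "a' * E \<le> sqrt (\<delta> ^ d) * E" using E by (intro mult_right_mono) (auto simp: a'_def)
      also have "\<dots> = sqrt ((\<delta> * p) ^ d / real N)"
        by (simp add: E_def pd[symmetric] power_mult_distrib real_sqrt_mult[symmetric])
      also have "\<dots> \<le> sqrt (real m ^ d / real N)"
        using m(1) N0 \<delta> p by (intro real_sqrt_le_mono divide_right_mono power_mono) (auto simp: x_def)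
      finally show "a' * E \<le> sqrt (real m ^ d / real N)" .
    qed
    also have "\<dots> \<le> eps_star \<nu> d N"
    proof (rule le_eps_star[OF _ m1])
      fix j :: nat assume j: "1 \<le> j"
      have "b * exp (- (real j powr t)) \<le> b * 1" using ab by (intro mult_left_mono) auto
      then show "\<nu> j \<le> b" using \<nu>[OF j] by linarith
    qed
    finally show ?thesis using up unfolding E_def L_def by blast
  qed
  have "b' > 0" by (simp add: b'_def)
  with main a' show ?thesis unfolding e_def by blast
qed

section \<open>Relative errors in the small lengthscale regime\<close>

text \<open>The part \<open>P * y\<close> is kept apart because it is to be compared with
  \<open>eps_star\<close>, whereas the part \<open>R * q\<close> is folded into the maximum.\<close>

lemma sqrt_plus_self_le:
  fixes x y q P R :: real
  assumes nn: "0 \<le> P" "0 \<le> R" "0 \<le> y" "0 \<le> q" and x: "x \<le> P * y + R * q"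
  shows "sqrt x + x \<le> (sqrt P * sqrt y + P * y) + (sqrt R + R) * max (sqrt q) q"
proof -
  have "sqrt x \<le> sqrt (P * y + R * q)" using x by simp
  also have "\<dots> \<le> sqrt (P * y) + sqrt (R * q)" using nn by (intro sqrt_add_le_add_sqrt) auto
  finally have "sqrt x \<le> sqrt P * sqrt y + sqrt R * sqrt q" by (simp add: real_sqrt_mult)
  moreover have "sqrt R * sqrt q \<le> sqrt R * max (sqrt q) q" "R * q \<le> R * max (sqrt q) q"
    using nn by (auto intro!: mult_left_mono)
  moreover have "(sqrt R + R) * max (sqrt q) q = sqrt R * max (sqrt q) q + R * max (sqrt q) q"
    by (rule distrib_right)
  ultimately show ?thesis using x by linarith
qed

text \<open>The linear lower bound loses 1. If \<open>a2 * q \<ge> 2\<close>, this costs at most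
  half of it; otherwise \<open>q\<close> is at most a multiple of \<open>sqrt q\<close> and the root
  bound suffices.\<close>

lemma max_sqrt_self_le:
  fixes a1 a2 q :: real
  assumes a: "0 < a1" "0 < a2" and q: "0 < q"
  shows "min a1 (min (a2 / 2) (a1 * sqrt (a2 / 2))) * max (sqrt q) q \<le> max (a1 * sqrt q) (a2 * q - 1)"
proof -
  define a where "a = min a1 (min (a2 / 2) (a1 * sqrt (a2 / 2)))"
  have a_le: "a \<le> a1" "a \<le> a2 / 2" "a \<le> a1 * sqrt (a2 / 2)" "0 \<le> a" using a by (auto simp: a_def)
  have root: "a * sqrt q \<le> a1 * sqrt q" using a_le q by (intro mult_right_mono) auto
  have "a * q \<le> max (a1 * sqrt q) (a2 * q - 1)"
  proof (cases "2 \<le> a2 * q")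
    case True
    have "a * q \<le> a2 / 2 * q" using a_le q by (intro mult_right_mono) auto
    also have "\<dots> \<le> a2 * q - 1" using True by simp
    finally show ?thesis by simp
  next
    case False
    then have "sqrt (a2 / 2 * q) \<le> 1" by simp
    then have "sqrt (a2 / 2) * sqrt q \<le> 1" by (simp only: real_sqrt_mult)
    then have "a1 * sqrt q * (sqrt (a2 / 2) * sqrt q) \<le> a1 * sqrt q * 1" using a q by (intro mult_left_mono) auto
    moreover have "a1 * sqrt q * (sqrt (a2 / 2) * sqrt q) = a1 * sqrt (a2 / 2) * q"
    proof -
      have "a1 * sqrt q * (sqrt (a2 / 2) * sqrt q) = a1 * sqrt (a2 / 2) * (sqrt q * sqrt q)" by (simp only: mult_ac)
      then show ?thesis using q by simp
    qed
    moreover have "a * q \<le> a1 * sqrt (a2 / 2) * q" using a_le q by (intro mult_right_mono) auto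
    ultimately have "a * q \<le> a1 * sqrt q" by linarith
    then show ?thesis by simp
  qed
  then show ?thesis unfolding a_def[symmetric] using root by (auto simp: max_def)
qed

lemma powr_minus_card: "l > 0 \<Longrightarrow> l powr (- real n) = 1 / l ^ n"
  by (simp add: powr_minus powr_realpow inverse_eq_divide)

context lengthscale_kernel
begin

lemma gaussian_kernel_sampleI:
  assumes "0 < l" "1 \<le> N" "gaussian_sample M N u (k l)"
  shows "gaussian_kernel_sample M N u (k l) (K 0)"
proof -
  interpret prob_space M using assms(3) by (simp add: gaussian_sample_def)
  show ?thesis
    using assms k_cont k_hs k_diag K_pos[of 0] by unfold_locales auto
qed

text \<open>The corner estimate bounds the denominator from below, and the powers of
  \<open>l\<close> cancel.\<close>

lemma relative_error_le:
  assumes l: "0 < l" "l \<le> 1" and E: "0 \<le> E"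
    and le: "(\<integral>\<^sup>+\<omega>. ennreal (op_norm (\<lambda>f x. T \<omega> f x - integral_op (k l) f x)) \<partial>M) \<le> ennreal (E * l ^ CARD('n))"
  shows "relative_error M T (integral_op (k l)) \<le> ennreal (E / K (real CARD('n)))"
proof -
  have Kd: "K (real CARD('n)) > 0" by (rule K_pos) simp
  have p: "op_norm (integral_op (k l)) > 0" by (rule op_norm_pos[OF l])
  have "relative_error M T (integral_op (k l)) \<le> ennreal (E * l ^ CARD('n)) / ennreal (op_norm (integral_op (k l)))"
    unfolding relative_error_def by (rule divide_right_mono_ennreal[OF le])
  also have "\<dots> = ennreal (E * l ^ CARD('n) / op_norm (integral_op (k l)))"
    using E l p by (simp add: divide_ennreal)
  also have "\<dots> \<le> ennreal (E * l ^ CARD('n) / (K (real CARD('n)) * l ^ CARD('n)))"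
    using op_norm_ge[OF l] E l Kd p by (intro ennreal_leI divide_left_mono) auto
  also have "E * l ^ CARD('n) / (K (real CARD('n)) * l ^ CARD('n)) = E / K (real CARD('n))" using l by simp
  finally show ?thesis .
qed

text \<open>A negative \<open>E\<close> is truncated to 0 by \<open>ennreal\<close>, so the bound
  can be applied to a difference whose sign is unknown.\<close>

lemma le_relative_error:
  assumes l: "0 < l" "l \<le> 1" and c: "c > 0" "op_norm (integral_op (k l)) \<le> c * l ^ CARD('n)"
    and le: "ennreal (E * l ^ CARD('n)) \<le> (\<integral>\<^sup>+\<omega>. ennreal (op_norm (\<lambda>f x. T \<omega> f x - integral_op (k l) f x)) \<partial>M)"
  shows "ennreal (E / c) \<le> relative_error M T (integral_op (k l))"
proof (cases "0 \<le> E")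
  case True
  have p: "op_norm (integral_op (k l)) > 0" by (rule op_norm_pos[OF l])
  have "E / c = E * l ^ CARD('n) / (c * l ^ CARD('n))" using l by simp
  also have "\<dots> \<le> E * l ^ CARD('n) / op_norm (integral_op (k l))"
    using c p l True by (intro divide_left_mono) auto
  finally have "ennreal (E / c) \<le> ennreal (E * l ^ CARD('n) / op_norm (integral_op (k l)))" by (rule ennreal_leI)
  also have "\<dots> = ennreal (E * l ^ CARD('n)) / ennreal (op_norm (integral_op (k l)))"
    using True l p by (simp add: divide_ennreal)
  also have "\<dots> \<le> relative_error M T (integral_op (k l))"
    unfolding relative_error_def by (rule divide_right_mono_ennreal[OF le])
  finally show ?thesis .
next
  case False
  then have "E / c \<le> 0" using c by (simp add: divide_le_0_iff)
  then show ?thesis by (simp add: ennreal_neg)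
qed

text \<open>With \<sigma> = \<open>c * l^d\<close> every error bound carries the factor
  \<open>l^d\<close> of the norm. In \<open>L\<close> the trace term is of order
  \<open>l^(-d)\<close> and the constant \<open>4 * ln 3\<close> is absorbed into it, as
  \<open>l \<le> 1\<close>. The two lower bounds are joined into one maximum at the end.\<close>

lemma sample_cov_relative_error:
  "\<exists>a>0. \<exists>b>0. \<forall>l N (M :: 'w measure) u.
      0 < l \<and> l \<le> 1 \<and> 1 \<le> N \<and> gaussian_sample M N u (k l) \<longrightarrow>
      (let err = relative_error M (sample_cov N u) (integral_op (k l));
           q = l powr (- real CARD('n)) / real N
       in ennreal (a * max (sqrt q) q) \<le> err \<and> err \<le> ennreal (b * max (sqrt q) q))"
proof -
  obtain c where c: "c > 0" and
    c_le: "\<And>l. 0 < l \<Longrightarrow> l \<le> 1 \<Longrightarrow> op_norm (integral_op (k l)) \<le> c * l ^ CARD('n)"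
          "\<And>l x. 0 < l \<Longrightarrow> l \<le> 1 \<Longrightarrow> x \<in> unit_cube \<Longrightarrow> (LINT y|cube. \<bar>k l x y\<bar>) \<le> c * l ^ CARD('n)"
    using ex_row_bound by blast
  have K0: "K 0 > 0" by (rule K_pos) simp
  have Kd: "K (real CARD('n)) > 0" by (rule K_pos) simp
  define R where "R = K 0 * 3 ^ CARD('n) / (2 * c) + 4 * ln 3"
  have R: "R > 0" using K0 c by (auto simp: R_def intro!: add_pos_nonneg)
  define b where "b = 200 * c * (sqrt R + R) / K (real CARD('n))"
  define a1 where "a1 = sqrt (K (real CARD('n)) * K 0 / 2) / 160 / c"
  define a2 where "a2 = K 0 / c"
  define a where "a = min a1 (min (a2 / 2) (a1 * sqrt (a2 / 2)))"
  have a12: "a1 > 0" "a2 > 0" using K0 Kd c by (auto simp: a1_def a2_def)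
  have a: "a > 0" using a12 by (simp add: a_def)
  have b: "b > 0" using R c Kd by (simp add: b_def add_pos_pos)
  have "ennreal (a * max (sqrt q) q) \<le> relative_error M (sample_cov N u) (integral_op (k l)) \<and>
      relative_error M (sample_cov N u) (integral_op (k l)) \<le> ennreal (b * max (sqrt q) q)"
    if l: "0 < l" "l \<le> 1" and N: "1 \<le> N" and sample: "gaussian_sample M N u (k l)"
      and q_def: "q = l powr (- real CARD('n)) / real N"
    for l N and M :: "'w measure" and u q
  proof
    interpret S: gaussian_kernel_sample M N u "k l" "K 0"
      by (rule gaussian_kernel_sampleI[OF l(1) N sample])
    define \<sigma> where "\<sigma> = c * l ^ CARD('n)"
    have ld: "0 < l ^ CARD('n)" "l ^ CARD('n) \<le> 1" using l by (auto simp: power_le_one)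
    have \<sigma>: "\<sigma> > 0" using c ld by (simp add: \<sigma>_def)
    have N0: "real N > 0" using N by simp
    have q: "q = 1 / l ^ CARD('n) / real N" using l by (simp add: q_def powr_minus_card)
    have q0: "q > 0" using ld N0 by (simp add: q)
    have row: "(LINT y|cube. \<bar>k l x y\<bar>) \<le> \<sigma>" if "x \<in> unit_cube" for x
      unfolding \<sigma>_def by (rule c_le(2)[OF l that])
    have bd: "\<bar>k l x y\<bar> \<le> K 0" if "x \<in> unit_cube" "y \<in> unit_cube" for x y
      using k_le[OF l(1) that] k_pos[OF l(1) that] by simp
    define L where "L = K 0 * 3 ^ CARD('n) / (2 * \<sigma>) + 4 * ln 3"
    \<comment> \<open>Written in the shape used for splitting the root, with an empty first
      part.\<close>
    have L: "L / real N \<le> 0 * 0 + R * q"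
    proof -
      have "4 * ln 3 \<le> 4 * ln 3 / l ^ CARD('n)" using ld by (simp add: le_divide_eq)
      then have "L \<le> R / l ^ CARD('n)" by (simp add: L_def R_def \<sigma>_def add_divide_distrib mult.assoc)
      from divide_right_mono[OF this, of "real N"] show ?thesis by (simp add: q)
    qed
    have "200 * \<sigma> * (sqrt (L / real N) + L / real N) \<le> 200 * \<sigma> * ((sqrt R + R) * max (sqrt q) q)"
      using sqrt_plus_self_le[OF _ _ _ _ L] R q0 \<sigma> by (intro mult_left_mono) auto
    also have "\<dots> = (200 * c * (sqrt R + R) * max (sqrt q) q) * l ^ CARD('n)" by (simp add: \<sigma>_def)
    finally have "ennreal (200 * \<sigma> * (sqrt (L / real N) + L / real N)) \<le>
      ennreal ((200 * c * (sqrt R + R) * max (sqrt q) q) * l ^ CARD('n))" by (rule ennreal_leI)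
    with S.sample_cov_error_upper[OF row \<sigma>]
    have "(\<integral>\<^sup>+\<omega>. ennreal (op_norm (\<lambda>f x. sample_cov N u \<omega> f x - integral_op (k l) f x)) \<partial>M)
      \<le> ennreal ((200 * c * (sqrt R + R) * max (sqrt q) q) * l ^ CARD('n))"
      unfolding L_def by (rule order_trans)
    from relative_error_le[OF l _ this]
    show "relative_error M (sample_cov N u) (integral_op (k l)) \<le> ennreal (b * max (sqrt q) q)"
      using R c q0 by (simp add: b_def)
    have "ennreal (a1 * sqrt q) \<le> relative_error M (sample_cov N u) (integral_op (k l))"
    proof -
      have "ennreal (sqrt (K (real CARD('n)) * l ^ CARD('n) * K 0 / (2 * real N)) / 160) \<le>
          (\<integral>\<^sup>+\<omega>. ennreal (op_norm (\<lambda>f x. sample_cov N u \<omega> f x - integral_op (k l) f x)) \<partial>M)"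
        using ld Kd by (intro S.sample_cov_error_lower_root[OF k_diag[OF l(1)] corner_L2 _ _ corner_bil_ge[OF l]])
          (auto simp: norm_L2_def corner_integral[OF l])
      \<comment> \<open>The quantity under the root is a constant times \<open>q\<close> times the
        square of \<open>l^d\<close>, so the root itself carries the factor
        \<open>l^d\<close>.\<close>
      also have "K (real CARD('n)) * l ^ CARD('n) * K 0 / (2 * real N) = (K (real CARD('n)) * K 0 / 2) * q * (l ^ CARD('n))\<^sup>2"
        using ld by (simp add: q power2_eq_square)
      also have "sqrt \<dots> / 160 = (sqrt (K (real CARD('n)) * K 0 / 2) / 160 * sqrt q) * l ^ CARD('n)"
        using ld by (simp only: real_sqrt_mult real_sqrt_abs)
      finally have "ennreal ((sqrt (K (real CARD('n)) * K 0 / 2) / 160 * sqrt q) / c) \<le>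
          relative_error M (sample_cov N u) (integral_op (k l))"
        by (rule le_relative_error[OF l c c_le(1)[OF l]])
      then show ?thesis by (simp add: a1_def)
    qed
    moreover have "ennreal (a2 * q - 1) \<le> relative_error M (sample_cov N u) (integral_op (k l))"
    proof -
      have "K 0 / real N - \<sigma> = (K 0 * q - c) * l ^ CARD('n)" using l by (simp add: q \<sigma>_def left_diff_distrib)
      with S.sample_cov_error_lower_large[OF k_diag[OF l(1)] row bd]
      have "ennreal ((K 0 * q - c) * l ^ CARD('n)) \<le>
          (\<integral>\<^sup>+\<omega>. ennreal (op_norm (\<lambda>f x. sample_cov N u \<omega> f x - integral_op (k l) f x)) \<partial>M)" by simp
      from le_relative_error[OF l c c_le(1)[OF l] this] show ?thesis
        using c by (simp add: a2_def diff_divide_distrib)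
    qed
    ultimately have "ennreal (max (a1 * sqrt q) (a2 * q - 1)) \<le> relative_error M (sample_cov N u) (integral_op (k l))"
      by (simp add: max_def)
    then show "ennreal (a * max (sqrt q) q) \<le> relative_error M (sample_cov N u) (integral_op (k l))"
      unfolding a_def by (rule order_trans[OF ennreal_leI[OF max_sqrt_self_le[OF a12 q0]]])
  qed
  note main = this[OF _ _ _ _ refl]
  show ?thesis
    unfolding Let_def
    by (rule exI[of _ a], rule conjI[OF a], rule exI[of _ b], rule conjI[OF b], intro allI impI, elim conjE, rule main)
qed

section \<open>Tapering at the lengthscale\<close>

lemma tail_integrable:
  assumes l: "0 < l" and x: "x \<in> (unit_cube :: (real ^ 'n) set)"
  shows "integrable cube (\<lambda>y. indicator {y. r < norm (x - y)} y * \<bar>k l x y\<bar>)"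
proof -
  have "{y. r < norm (x - y)} \<in> sets borel" by measurable
  then have m: "(indicator {y. r < norm (x - y)} :: real ^ 'n \<Rightarrow> real) \<in> borel_measurable cube"
    by (intro measurable_restrict_space1 measurable_completion) simp
  show ?thesis
  proof (rule Bochner_Integration.integrable_bound[OF k_row_integrable[OF l x]])
    show "(\<lambda>y. indicator {y. r < norm (x - y)} y * \<bar>k l x y\<bar>) \<in> borel_measurable cube"
      by (intro borel_measurable_times borel_measurable_abs m k_row_measurable[OF l x])
  qed (auto simp: indicator_def)
qed

text \<open>A larger unit of length shrinks the region over which a nonnegative function is
  integrated.\<close>

lemma tail_bound_mono:
  assumes l: "0 < l" and h: "h \<le> h'" and tb: "tail_bound (k l) h \<nu> b"
  shows "tail_bound (k l) h' \<nu> b"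
  unfolding tail_bound_def
proof (intro allI impI ballI)
  fix m :: nat and x :: "real ^ 'n" assume m: "1 \<le> m" and x: "x \<in> unit_cube"
  have hm: "real m * h \<le> real m * h'" using h by (simp add: mult_left_mono)
  have "(LINT y:{y \<in> unit_cube. real m * h' < norm (x - y)}|lebesgue. \<bar>k l x y\<bar>) =
      (LINT y|cube. indicator {y. real m * h' < norm (x - y)} y * \<bar>k l x y\<bar>)" by (rule tail_integral[OF x])
  also have "\<dots> \<le> (LINT y|cube. indicator {y. real m * h < norm (x - y)} y * \<bar>k l x y\<bar>)"
    by (rule integral_mono'[OF tail_integrable[OF l x]]) (use hm in \<open>auto simp: indicator_def\<close>)
  also have "\<dots> = (LINT y:{y \<in> unit_cube. real m * h < norm (x - y)}|lebesgue. \<bar>k l x y\<bar>)"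
    by (rule tail_integral[OF x, symmetric])
  also have "\<dots> \<le> b * (op_norm (integral_op (k l)) * \<nu> m)" using tb m x by (simp add: tail_bound_def)
  finally show "(LINT y:{y \<in> unit_cube. real m * h' < norm (x - y)}|lebesgue. \<bar>k l x y\<bar>) \<le>
    b * (op_norm (integral_op (k l)) * \<nu> m)" .
qed

text \<open>The lower bound on the effective dimension gives
  \<open>r(C)^(-1/d) \<le> a^(-1/d) * l\<close>. For \<open>s\<close> at least this constant,
  \<open>s * l\<close> is the larger unit, so the tail hypothesis carries over with the same
  \<open>B\<close>.\<close>

lemma ex_tail_scale:
  "\<exists>s0>0. \<forall>s\<ge>s0. \<forall>l. 0 < l \<and> l \<le> 1 \<longrightarrow> tail_bound (k l) (s * l) \<nu> B"
proof -
  obtain a where a: "a > 0" and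
    a_le: "\<And>l. 0 < l \<Longrightarrow> l \<le> 1 \<Longrightarrow> a * l powr (- real CARD('n)) \<le> eff_dim (integral_op (k l))"
    using eff_dim_bounds by blast
  have "tail_bound (k l) (s * l) \<nu> B" if s: "a powr (- 1 / real CARD('n)) \<le> s" and l: "0 < l" "l \<le> 1" for s l
  proof (rule tail_bound_mono[OF l(1) _ tail[OF l(1)]])
    have "eff_dim (integral_op (k l)) powr (- 1 / real CARD('n)) \<le> (a * l powr (- real CARD('n))) powr (- 1 / real CARD('n))"
      using a_le[OF l] a l by (intro powr_mono2') auto
    also have "\<dots> = a powr (- 1 / real CARD('n)) * l" using a l by (simp add: powr_mult powr_powr)
    also have "\<dots> \<le> s * l" using s l by (intro mult_right_mono) auto
    finally show "eff_dim (integral_op (k l)) powr (- 1 / real CARD('n)) \<le> s * l" .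
  qed
  then show ?thesis using a by (intro exI[of _ "a powr (- 1 / real CARD('n))"]) auto
qed

text \<open>With \<kappa> = \<open>s * m_star * l\<close> the lengthscale cancels from the local
  trace term, which becomes a multiple of \<open>m_star^d\<close>; divided by \<open>N\<close> it is
  of order \<open>eps_star^2\<close>. The number of boxes is of order at most \<open>l^(-d)\<close>,
  whence the logarithm. The bias is the tail beyond \<open>m_star\<close> units of length
  \<open>s * l\<close>, a multiple of \<open>\<nu> m_star \<le> eps_star\<close>.\<close>

lemma tapered_cov_relative_error:
  assumes s: "s > 0" and tb: "\<And>l. 0 < l \<Longrightarrow> l \<le> 1 \<Longrightarrow> tail_bound (k l) (s * l) \<nu> B'"
  shows "\<exists>b>0. \<forall>l N (M :: 'w measure) u.
      0 < l \<and> l < 1 / 2 \<and> 2 \<le> N \<and> gaussian_sample M N u (k l) \<longrightarrow>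
      (let \<kappa> = s * (real (m_star \<nu> CARD('n) N) * l);
           q = ln (l powr (- real CARD('n))) / real N
       in relative_error M (tapered_cov \<kappa> N u) (integral_op (k l))
            \<le> ennreal (b * (eps_star \<nu> CARD('n) N + max (sqrt q) q)))"
proof -
  obtain c where c: "c > 0" and
    c_le: "\<And>l. 0 < l \<Longrightarrow> l \<le> 1 \<Longrightarrow> op_norm (integral_op (k l)) \<le> c * l ^ CARD('n)"
          "\<And>l x. 0 < l \<Longrightarrow> l \<le> 1 \<Longrightarrow> x \<in> unit_cube \<Longrightarrow> (LINT y|cube. \<bar>k l x y\<bar>) \<le> c * l ^ CARD('n)"
    using ex_row_bound by blast
  have K0: "K 0 > 0" by (rule K_pos) simp
  have Kd: "K (real CARD('n)) > 0" by (rule K_pos) simp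
  have \<nu>_le: "\<nu> m \<le> 1" if "1 \<le> m" for m using \<nu>_decreasing[of 1 m] \<nu>_one that by simp
  define P where "P = K 0 * (5 * s) ^ CARD('n) / (2 * c)"
  define G where "G = 3 * (1 / s + 3) ^ CARD('n)"
  \<comment> \<open>\<open>G * l^(-d)\<close> bounds the argument of the logarithm, the 3 in
    \<open>G\<close> coming from \<open>1 + 2 * X \<le> 3 * X\<close> for \<open>X \<ge> 1\<close>.
    The constant \<open>R\<close> then turns \<open>4 * (ln G + W)\<close> into a multiple of
    \<open>W\<close>, as \<open>W \<ge> ln 2\<close>.\<close>
  define R where "R = 4 * (ln G / ln 2 + 1)"
  have P: "P > 0" using K0 s c by (simp add: P_def)
  have G: "1 \<le> G"
  proof -
    have "1 \<le> (1 / s + 3) ^ CARD('n)" using s by (intro one_le_power) simp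
    then show ?thesis by (simp add: G_def)
  qed
  have R: "R > 0" using G by (simp add: R_def add_nonneg_pos)
  define Q where "Q = sqrt P * 2 ^ CARD('n) + P * 4 ^ CARD('n) + (sqrt R + R)"
  have Q: "Q > 0" using P R by (simp add: Q_def add_pos_pos)
  define H where "H = 3 ^ CARD('n) * 200 * c * Q + \<bar>B'\<bar> * c"
  have H: "H > 0" using Q c by (simp add: H_def add_pos_nonneg)
  have "relative_error M (tapered_cov \<kappa> N u) (integral_op (k l))
      \<le> ennreal (H / K (real CARD('n)) * (eps_star \<nu> CARD('n) N + max (sqrt q) q))"
    if l: "0 < l" "l < 1 / 2" and N: "2 \<le> N" and sample: "gaussian_sample M N u (k l)"
      and \<kappa>_def: "\<kappa> = s * (real (m_star \<nu> CARD('n) N) * l)" and q_def: "q = ln (l powr (- real CARD('n))) / real N"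
    for l N and M :: "'w measure" and u \<kappa> q
  proof -
    have l1: "l \<le> 1" using l by simp
    have N1: "1 \<le> N" using N by simp
    interpret S: gaussian_kernel_sample M N u "k l" "K 0"
      by (rule gaussian_kernel_sampleI[OF l(1) N1 sample])
    define m where "m = m_star \<nu> CARD('n) N"
    define \<epsilon> where "\<epsilon> = eps_star \<nu> CARD('n) N"
    define W where "W = ln (l powr (- real CARD('n)))"
    have m: "2 \<le> m" "\<nu> m \<le> \<epsilon>" "sqrt (real m ^ CARD('n) / real N) \<le> 2 ^ CARD('n) * \<epsilon>"
      unfolding m_def \<epsilon>_def using m_star_bounds[where \<nu> = \<nu> and d = "CARD('n)", OF _ N \<nu>_le \<nu>_one] by (auto simp: Suc_le_eq)
    have \<epsilon>: "0 \<le> \<epsilon>" "\<epsilon> \<le> 1" unfolding \<epsilon>_def using eps_star_bounds[where \<nu> = \<nu>, OF N1 \<nu>_le \<nu>_pos] by auto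
    have ld: "0 < l ^ CARD('n)" using l by simp
    have N0: "real N > 0" using N by simp
    have \<kappa>: "\<kappa> = real m * (s * l)" "\<kappa> > 0" using s l m by (auto simp: \<kappa>_def m_def)
    define \<sigma> where "\<sigma> = c * l ^ CARD('n)"
    have \<sigma>: "\<sigma> > 0" using c ld by (simp add: \<sigma>_def)
    \<comment> \<open>Here \<open>l < 1/2\<close> is used: the logarithm stays away from zero and
      can absorb constants.\<close>
    have W: "ln 2 \<le> W"
    proof -
      have "ln 2 \<le> ln (1 / l)" using l by (simp add: le_divide_eq)
      also have "\<dots> \<le> real CARD('n) * ln (1 / l)"
        using mult_right_mono[of 1 "real CARD('n)" "ln (1 / l)"] l1 l by (simp add: Suc_le_eq)
      also have "\<dots> = W" using l by (simp add: W_def ln_powr ln_div)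
      finally show ?thesis .
    qed
    have W0: "0 < W" using W ln_gt_zero[of "2 :: real"] by linarith
    have q: "q = W / real N" by (simp only: q_def W_def)
    have q0: "0 \<le> q" using W0 by (simp add: q)
    have row: "(LINT y|cube. \<bar>k l x y\<bar>) \<le> \<sigma>" if "x \<in> unit_cube" for x
      unfolding \<sigma>_def by (rule c_le(2)[OF l(1) l1 that])
    have bd: "\<bar>k l x y\<bar> \<le> K 0" if "x \<in> unit_cube" "y \<in> unit_cube" for x y
      using k_le[OF l(1) that] k_pos[OF l(1) that] by simp
    \<comment> \<open>\<open>B'\<close> comes without a sign, so its absolute value is used.\<close>
    define \<beta> where "\<beta> = \<bar>B'\<bar> * (\<sigma> * \<epsilon>)"
    have \<beta>: "0 \<le> \<beta>" using \<sigma> \<epsilon> by (simp add: \<beta>_def)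
    have bias: "(LINT y|cube. \<bar>k l x y * (1 - taper \<kappa> x y)\<bar>) \<le> \<beta>" if x: "x \<in> unit_cube" for x
    proof -
      \<comment> \<open>Within distance \<kappa> the taper equals one; farther out the factor
        \<open>1 - taper\<close> is between 0 and 1.\<close>
      have "(LINT y|cube. \<bar>k l x y * (1 - taper \<kappa> x y)\<bar>) \<le>
          (LINT y|cube. indicator {y. real m * (s * l) < norm (x - y)} y * \<bar>k l x y\<bar>)"
      proof (rule integral_mono'[OF tail_integrable[OF l(1) x]])
        fix y :: "real ^ 'n"
        show "\<bar>k l x y * (1 - taper \<kappa> x y)\<bar> \<le> indicator {y. real m * (s * l) < norm (x - y)} y * \<bar>k l x y\<bar>"
          using taper_near[OF \<kappa>(2), of x y] taper_bounds[OF \<kappa>(2), of x y] \<kappa>(1)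
          by (cases "norm (x - y) \<le> \<kappa>") (auto simp: abs_mult indicator_def mult_left_le)
      qed auto
      also have "\<dots> = (LINT y:{y \<in> unit_cube. real m * (s * l) < norm (x - y)}|lebesgue. \<bar>k l x y\<bar>)"
        by (rule tail_integral[OF x, symmetric])
      also have "\<dots> \<le> B' * (op_norm (integral_op (k l)) * \<nu> m)"
        using tb[OF l(1) l1] m x by (simp add: tail_bound_def)
      also have "\<dots> \<le> \<bar>B'\<bar> * (op_norm (integral_op (k l)) * \<nu> m)"
        using op_norm_pos[OF l(1) l1] \<nu>_pos[of m] m by (intro mult_right_mono) auto
      also have "\<dots> \<le> \<beta>"
        unfolding \<beta>_def \<sigma>_def using op_norm_pos[OF l(1) l1] c_le(1)[OF l(1) l1] \<nu>_pos[of m] m ld c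
        by (intro mult_left_mono mult_mono) auto
      finally show ?thesis .
    qed
    define L where "L = K 0 * (5 * \<kappa>) ^ CARD('n) / (2 * \<sigma>) + 4 * ln (1 + 2 * (1 / \<kappa> + 3) ^ CARD('n))"
    have L: "L / real N \<le> P * (real m ^ CARD('n) / real N) + R * q"
    proof -
      \<comment> \<open>Both \<open>\<kappa>^d\<close> and \<sigma> are proportional to
        \<open>l^d\<close>, so the quotient is free of the lengthscale.\<close>
      have near: "K 0 * (5 * \<kappa>) ^ CARD('n) / (2 * \<sigma>) = P * real m ^ CARD('n)"
        using ld l by (simp add: \<kappa>(1) P_def \<sigma>_def power_mult_distrib)
      have "ln (1 + 2 * (1 / \<kappa> + 3) ^ CARD('n)) \<le> ln G + W"
      proof -
        have "1 / \<kappa> \<le> (1 / s) / l"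
        proof -
          have "1 * (s * l) \<le> \<kappa>" unfolding \<kappa>(1) using m s l by (intro mult_right_mono) auto
          then show ?thesis using s l by (simp add: frac_le)
        qed
        moreover have "3 \<le> 3 / l" using l by (simp add: le_divide_eq)
        ultimately have "1 / \<kappa> + 3 \<le> (1 / s + 3) / l" by (simp add: add_divide_distrib)
        then have X: "(1 / \<kappa> + 3) ^ CARD('n) \<le> ((1 / s + 3) / l) ^ CARD('n)"
          using \<kappa>(2) by (intro power_mono) auto
        have "0 < 1 / s" using s by simp
        then have "l \<le> 1 / s + 3" using l by linarith
        then have "1 \<le> (1 / s + 3) / l" using l by (simp add: le_divide_eq)
        then have "1 \<le> ((1 / s + 3) / l) ^ CARD('n)" by (rule one_le_power)
        with X have "1 + 2 * (1 / \<kappa> + 3) ^ CARD('n) \<le> 3 * ((1 / s + 3) / l) ^ CARD('n)" by linarith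
        also have "\<dots> = G * l powr (- real CARD('n))"
          using l by (simp add: G_def powr_minus_card power_divide)
        finally have "ln (1 + 2 * (1 / \<kappa> + 3) ^ CARD('n)) \<le> ln (G * l powr (- real CARD('n)))"
          using \<kappa>(2) by (intro ln_mono add_pos_nonneg) auto
        also have "\<dots> = ln G + W" using G l by (simp add: W_def ln_mult)
        finally show ?thesis .
      qed
      then have "4 * ln (1 + 2 * (1 / \<kappa> + 3) ^ CARD('n)) \<le> 4 * (ln G + W)" by simp
      also have "4 * (ln G + W) \<le> R * W"
      proof -
        define X where "X = ln G * (W / ln 2)"
        have "ln G * 1 \<le> X" unfolding X_def using G W by (intro mult_left_mono) (auto simp: le_divide_eq)
        then have "4 * (ln G + W) \<le> 4 * (X + W)" by simp
        also have "\<dots> = R * W" by (simp add: R_def X_def distrib_right distrib_left)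
        finally show ?thesis .
      qed
      finally have "L \<le> P * real m ^ CARD('n) + R * W" unfolding L_def near by (rule add_left_mono)
      from divide_right_mono[OF this, of "real N"] show ?thesis by (simp add: q add_divide_distrib)
    qed
    define y where "y = real m ^ CARD('n) / real N"
    have y: "0 \<le> y" by (simp add: y_def)
    define z where "z = \<epsilon> + max (sqrt q) q"
    have z: "\<epsilon> \<le> z" "max (sqrt q) q \<le> z" using \<epsilon> q0 by (auto simp: z_def le_max_iff_disj)
    have "sqrt (L / real N) + L / real N \<le> (sqrt P * sqrt y + P * y) + (sqrt R + R) * max (sqrt q) q"
      using P R y q0 L by (intro sqrt_plus_self_le) (auto simp: y_def)
    also have "\<dots> \<le> (sqrt P * 2 ^ CARD('n) + P * 4 ^ CARD('n)) * z + (sqrt R + R) * z"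
    proof (rule add_mono)
      have y1: "sqrt y \<le> 2 ^ CARD('n) * \<epsilon>" using m(3) by (simp add: y_def)
      \<comment> \<open>The linear term is of order \<open>eps_star^2\<close>, and
        \<open>eps_star \<le> 1\<close> lets one factor be dropped.\<close>
      have "y = (sqrt y)\<^sup>2" using y by simp
      also have "\<dots> \<le> (2 ^ CARD('n) * \<epsilon>)\<^sup>2" using y1 y by (intro power_mono) auto
      also have "\<dots> = (2\<^sup>2) ^ CARD('n) * (\<epsilon> * \<epsilon>)"
        by (simp only: power_mult_distrib power_mult[symmetric] power2_eq_square[of \<epsilon>] mult.commute[of 2 "CARD('n)"])
      also have "\<dots> \<le> 4 ^ CARD('n) * \<epsilon>" using \<epsilon> by (auto intro!: mult_left_mono mult_left_le)
      finally have y2: "y \<le> 4 ^ CARD('n) * \<epsilon>" .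
      have "sqrt P * sqrt y + P * y \<le> sqrt P * (2 ^ CARD('n) * \<epsilon>) + P * (4 ^ CARD('n) * \<epsilon>)"
        using y1 y2 P by (intro add_mono mult_left_mono) auto
      also have "\<dots> = (sqrt P * 2 ^ CARD('n) + P * 4 ^ CARD('n)) * \<epsilon>" by (simp add: distrib_right mult.assoc)
      also have "\<dots> \<le> (sqrt P * 2 ^ CARD('n) + P * 4 ^ CARD('n)) * z" using z P by (intro mult_left_mono) auto
      finally show "sqrt P * sqrt y + P * y \<le> (sqrt P * 2 ^ CARD('n) + P * 4 ^ CARD('n)) * z" .
      show "(sqrt R + R) * max (sqrt q) q \<le> (sqrt R + R) * z" using z R by (intro mult_left_mono) auto
    qed
    finally have S: "sqrt (L / real N) + L / real N \<le> Q * z"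
      by (simp add: Q_def distrib_right)
    have "3 ^ CARD('n) * (200 * \<sigma> * (sqrt (L / real N) + L / real N)) + \<beta> \<le>
        3 ^ CARD('n) * (200 * \<sigma> * (Q * z)) + \<bar>B'\<bar> * (\<sigma> * z)"
      unfolding \<beta>_def using S \<sigma> z by (intro add_mono mult_left_mono) auto
    also have "\<dots> = (H * z) * l ^ CARD('n)" by (simp add: H_def \<sigma>_def distrib_right distrib_left mult_ac)
    finally have "ennreal (3 ^ CARD('n) * (200 * \<sigma> * (sqrt (L / real N) + L / real N)) + \<beta>) \<le> ennreal ((H * z) * l ^ CARD('n))"
      by (rule ennreal_leI)
    with S.tapered_cov_error_upper[OF row \<sigma> \<kappa>(2) bias \<beta> bd]
    have "(\<integral>\<^sup>+\<omega>. ennreal (op_norm (\<lambda>f x. tapered_cov \<kappa> N u \<omega> f x - integral_op (k l) f x)) \<partial>M) \<le> ennreal ((H * z) * l ^ CARD('n))"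
      unfolding L_def by (rule order_trans)
    from relative_error_le[OF l(1) l1 _ this] show ?thesis
      using H z \<epsilon> by (simp add: z_def \<epsilon>_def)
  qed
  note main = this[OF _ _ _ _ refl refl]
  have "H / K (real CARD('n)) > 0" using H Kd by simp
  then show ?thesis
    unfolding Let_def
    by (intro exI[of _ "H / K (real CARD('n))"] conjI allI impI) (assumption, elim conjE, rule main)
qed

end

text \<open>The tapering radius is \<open>s * m_star * l\<close> because the tail hypothesis comes
  in units of \<open>r(C)^(-1/d)\<close>, which agrees with \<open>l\<close> only up to constants,
  while \<nu> is not assumed to be doubling. All \<open>s\<close> above a threshold are covered, and
  also any \<open>s\<close> for which the tails are controlled in units of \<open>s * l\<close>; for
  \<open>s = 1\<close> the radius is \<open>m_star * l\<close> itself. The constants are chosen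
  before \<open>l\<close>, \<open>N\<close>, the probability space and the sample; in the tapering
  part they may depend on \<open>s\<close>.\<close>

theorem corollary2p12:
  fixes K :: "real \<Rightarrow> real"
    and k :: "real \<Rightarrow> real ^ 'n::finite \<Rightarrow> real ^ 'n \<Rightarrow> real"
    and \<nu> :: "nat \<Rightarrow> real" and A B :: real
  assumes trace_class: "\<And>l. l > 0 \<Longrightarrow> trace_class (integral_op (k l))"
    and sup_diag: "\<And>l x. l > 0 \<Longrightarrow> x \<in> unit_cube \<Longrightarrow> k l x x \<le> A * op_trace (integral_op (k l))"
    and \<nu>_pos: "\<And>m. 1 \<le> m \<Longrightarrow> 0 < \<nu> m"
    and \<nu>_decreasing: "\<And>m n. 1 \<le> m \<Longrightarrow> m \<le> n \<Longrightarrow> \<nu> n \<le> \<nu> m"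
    and \<nu>_one: "\<nu> 1 = 1"
    and \<nu>_tendsto_0: "\<nu> \<longlonglongrightarrow> 0"
    and tail: "\<And>l. l > 0 \<Longrightarrow>
      tail_bound (k l) (eff_dim (integral_op (k l)) powr (- 1 / real CARD('n))) \<nu> B"
    and base_kernel: "positive_semidefinite_kernel (\<lambda>x y :: real ^ 'n. K (norm (x - y)))"
    and k_eq: "\<And>l x y. l > 0 \<Longrightarrow> x \<in> unit_cube \<Longrightarrow> y \<in> unit_cube \<Longrightarrow>
      k l x y = K (norm (x - y) / l)"
    and K_pos: "\<And>r. 0 \<le> r \<Longrightarrow> 0 < K r"
    and K_diff: "K differentiable_on {0..}"
    and K_strict: "strict_antimono_on {0..} K"
    and K_lim: "(K \<longlongrightarrow> 0) at_top"
  shows "\<exists>l0>0.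
    (\<exists>a>0. \<exists>b>0. \<forall>l. 0 < l \<and> l < l0 \<longrightarrow>
      a * l powr (- real CARD('n)) \<le> eff_dim (integral_op (k l)) \<and>
      eff_dim (integral_op (k l)) \<le> b * l powr (- real CARD('n))) \<and>
    (\<exists>a>0. \<exists>b>0. \<forall>l N (M :: 'w measure) u.
      0 < l \<and> l < l0 \<and> 2 \<le> N \<and> gaussian_sample M N u (k l) \<longrightarrow>
      (let err = relative_error M (sample_cov N u) (integral_op (k l));
           q = l powr (- real CARD('n)) / real N
       in ennreal (a * max (sqrt q) q) \<le> err \<and> err \<le> ennreal (b * max (sqrt q) q))) \<and>
    (\<exists>s0>0. \<forall>s>0. s0 \<le> s \<or> (\<exists>B'. \<forall>l>0. tail_bound (k l) (s * l) \<nu> B') \<longrightarrow>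
      (\<exists>b>0. \<forall>l N (M :: 'w measure) u.
        0 < l \<and> l < l0 \<and> 2 \<le> N \<and> gaussian_sample M N u (k l) \<longrightarrow>
        (let \<kappa> = s * (real (m_star \<nu> CARD('n) N) * l);
             q = ln (l powr (- real CARD('n))) / real N
         in relative_error M (tapered_cov \<kappa> N u) (integral_op (k l))
              \<le> ennreal (b * (eps_star \<nu> CARD('n) N + max (sqrt q) q))))) \<and>
    (\<forall>\<alpha>>0. (\<forall>m\<ge>1. \<nu> m = real m powr (- \<alpha>)) \<longrightarrow>
      (\<exists>a>0. \<exists>b>0. \<forall>N\<ge>2.
        a * real N powr (- \<alpha> / (2 * \<alpha> + real CARD('n))) \<le> eps_star \<nu> CARD('n) N \<and>
        eps_star \<nu> CARD('n) N \<le> b * real N powr (- \<alpha> / (2 * \<alpha> + real CARD('n))))) \<and>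
    (\<forall>t>0. (\<exists>a>0. \<exists>b>0. \<forall>m\<ge>1.
        a * exp (- (real m powr t)) \<le> \<nu> m \<and> \<nu> m \<le> b * exp (- (real m powr t))) \<longrightarrow>
      (\<exists>a>0. \<exists>b>0. \<forall>N\<ge>2.
        a * sqrt (ln (real N) powr (real CARD('n) / t) / real N) \<le> eps_star \<nu> CARD('n) N \<and>
        eps_star \<nu> CARD('n) N \<le> b * sqrt (ln (real N) powr (real CARD('n) / t) / real N)))"
proof -
  interpret L: lengthscale_kernel K k \<nu> A B
    by (rule lengthscale_kernel.intro[OF assms])
  let ?d = "CARD('n)"
  obtain a b where ab: "a > 0" "b > 0" "\<And>l. 0 < l \<Longrightarrow> l \<le> 1 \<Longrightarrow>
      a * l powr (- real ?d) \<le> eff_dim (integral_op (k l)) \<and> eff_dim (integral_op (k l)) \<le> b * l powr (- real ?d)"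
    using L.eff_dim_bounds by blast
  obtain a' b' where sample: "a' > 0" "b' > 0" "\<And>l N (M :: 'w measure) u.
      0 < l \<Longrightarrow> l \<le> 1 \<Longrightarrow> 1 \<le> N \<Longrightarrow> gaussian_sample M N u (k l) \<Longrightarrow>
      (let err = relative_error M (sample_cov N u) (integral_op (k l));
           q = l powr (- real ?d) / real N
       in ennreal (a' * max (sqrt q) q) \<le> err \<and> err \<le> ennreal (b' * max (sqrt q) q))"
    using L.sample_cov_relative_error[where 'w = 'w] by blast
  obtain s0 where s0: "s0 > 0" "\<And>s l. s0 \<le> s \<Longrightarrow> 0 < l \<Longrightarrow> l \<le> 1 \<Longrightarrow> tail_bound (k l) (s * l) \<nu> B"
    using L.ex_tail_scale by blast
  \<comment> \<open>The threshold 1/2 serves two purposes: the norm bounds hold for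
    \<open>l \<le> 1\<close>, where the corner cube fits into the domain, and the logarithm of
    \<open>l^(-d)\<close> stays above \<open>ln 2\<close>.\<close>
  show ?thesis
  proof (rule exI[of _ "1 / 2"], intro conjI)
    show "\<exists>a>0. \<exists>b>0. \<forall>l. 0 < l \<and> l < 1 / 2 \<longrightarrow>
        a * l powr (- real ?d) \<le> eff_dim (integral_op (k l)) \<and> eff_dim (integral_op (k l)) \<le> b * l powr (- real ?d)"
      by (rule exI[of _ a], rule conjI[OF ab(1)], rule exI[of _ b], rule conjI[OF ab(2)], intro allI impI ab(3)) auto
    show "\<exists>a>0. \<exists>b>0. \<forall>l N (M :: 'w measure) u.
      0 < l \<and> l < 1 / 2 \<and> 2 \<le> N \<and> gaussian_sample M N u (k l) \<longrightarrow>
      (let err = relative_error M (sample_cov N u) (integral_op (k l));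
           q = l powr (- real CARD('n)) / real N
       in ennreal (a * max (sqrt q) q) \<le> err \<and> err \<le> ennreal (b * max (sqrt q) q))"
      by (rule exI[of _ a'], rule conjI[OF sample(1)], rule exI[of _ b'], rule conjI[OF sample(2)],
          intro allI impI sample(3)) auto
    show "\<exists>s0>0. \<forall>s>0. s0 \<le> s \<or> (\<exists>B'. \<forall>l>0. tail_bound (k l) (s * l) \<nu> B') \<longrightarrow>
      (\<exists>b>0. \<forall>l N (M :: 'w measure) u.
        0 < l \<and> l < 1 / 2 \<and> 2 \<le> N \<and> gaussian_sample M N u (k l) \<longrightarrow>
        (let \<kappa> = s * (real (m_star \<nu> CARD('n) N) * l);
             q = ln (l powr (- real CARD('n))) / real N
         in relative_error M (tapered_cov \<kappa> N u) (integral_op (k l))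
              \<le> ennreal (b * (eps_star \<nu> CARD('n) N + max (sqrt q) q))))"
    proof (rule exI[of _ s0], intro conjI allI impI)
      fix s :: real assume s: "s > 0" "s0 \<le> s \<or> (\<exists>B'. \<forall>l>0. tail_bound (k l) (s * l) \<nu> B')"
      then obtain B' where "\<And>l. 0 < l \<Longrightarrow> l \<le> 1 \<Longrightarrow> tail_bound (k l) (s * l) \<nu> B'"
        using s0(2) by blast
      from L.tapered_cov_relative_error[where 'w = 'w, OF s(1) this]
      show "\<exists>b>0. \<forall>l N (M :: 'w measure) u.
        0 < l \<and> l < 1 / 2 \<and> 2 \<le> N \<and> gaussian_sample M N u (k l) \<longrightarrow>
        (let \<kappa> = s * (real (m_star \<nu> CARD('n) N) * l);
             q = ln (l powr (- real CARD('n))) / real N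
         in relative_error M (tapered_cov \<kappa> N u) (integral_op (k l))
              \<le> ennreal (b * (eps_star \<nu> CARD('n) N + max (sqrt q) q)))" .
    qed (rule s0)
    show "\<forall>\<alpha>>0. (\<forall>m\<ge>1. \<nu> m = real m powr (- \<alpha>)) \<longrightarrow>
      (\<exists>a>0. \<exists>b>0. \<forall>N\<ge>2.
        a * real N powr (- \<alpha> / (2 * \<alpha> + real CARD('n))) \<le> eps_star \<nu> CARD('n) N \<and>
        eps_star \<nu> CARD('n) N \<le> b * real N powr (- \<alpha> / (2 * \<alpha> + real CARD('n))))"
    proof (intro allI impI)
      fix \<alpha> :: real assume \<alpha>: "\<alpha> > 0" "\<forall>m\<ge>1. \<nu> m = real m powr (- \<alpha>)"
      have "2 powr (- \<alpha>) * real N powr (- \<alpha> / (2 * \<alpha> + real ?d)) \<le> eps_star \<nu> ?d N \<and>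
          eps_star \<nu> ?d N \<le> 1 * real N powr (- \<alpha> / (2 * \<alpha> + real ?d))" if "2 \<le> N" for N
        using eps_star_polynomial[of \<alpha> \<nu> N ?d] \<alpha> that by simp
      then show "\<exists>a>0. \<exists>b>0. \<forall>N\<ge>2.
        a * real N powr (- \<alpha> / (2 * \<alpha> + real ?d)) \<le> eps_star \<nu> ?d N \<and>
        eps_star \<nu> ?d N \<le> b * real N powr (- \<alpha> / (2 * \<alpha> + real ?d))"
        by (intro exI[of _ "2 powr (- \<alpha>)"] conjI exI[of _ "1 :: real"]) auto
    qed
    show "\<forall>t>0. (\<exists>a>0. \<exists>b>0. \<forall>m\<ge>1.
        a * exp (- (real m powr t)) \<le> \<nu> m \<and> \<nu> m \<le> b * exp (- (real m powr t))) \<longrightarrow>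
      (\<exists>a>0. \<exists>b>0. \<forall>N\<ge>2.
        a * sqrt (ln (real N) powr (real CARD('n) / t) / real N) \<le> eps_star \<nu> CARD('n) N \<and>
        eps_star \<nu> CARD('n) N \<le> b * sqrt (ln (real N) powr (real CARD('n) / t) / real N))"
    proof (intro allI impI, elim exE conjE)
      fix t a b :: real
      assume "t > 0" "a > 0" "b > 0"
        "\<forall>m\<ge>1. a * exp (- (real m powr t)) \<le> \<nu> m \<and> \<nu> m \<le> b * exp (- (real m powr t))"
      then show "\<exists>a>0. \<exists>b>0. \<forall>N\<ge>2.
        a * sqrt (ln (real N) powr (real ?d / t) / real N) \<le> eps_star \<nu> ?d N \<and>
        eps_star \<nu> ?d N \<le> b * sqrt (ln (real N) powr (real ?d / t) / real N)"
        by (intro eps_star_exponential[of t ?d a b \<nu>]) (auto simp: Suc_le_eq)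
    qed
  qed simp
qed

end
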